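(* There exist universal positive constants $K_0,d_0,c_1,c_2,C,C_1,C_2$ such that the following holds. Let $\mu_\star,\nu_\star\in\mathbb{R}^d$ with $\|\mu_\star\|_2=\|\nu_\star\|_2=1$, let $\sigma\ge0$, and let $(\mu_t,\nu_t)_{t\ge0}$ be the mini-batched stochastic prox-linear iterates with batch-size $m$ and inverse step-size $\lambda$ (defined in the context) started from a deterministic initialization satisfying $$\mathrm{Err}_0\le K_0\qquad\text{and}\qquad 0.5\le\|\mu_0\|_2,\|\nu_0\|_2\le1.5 .$$ If the inverse step-size $\lambda$, batch-size $m$, dimension $d$ and number of iterations $T$ satisfy $$\lambda\ge\frac{C(1+\sigma^2)d}{m},\qquad C(1+\sigma^4)\log^{12}(d)\le m\le d,$$ $$d\ge d_0,\qquad 0\le T\le\frac{\lambda}{c_1}\log\Big(\min\Big(\frac{\lambda m}{\sigma^2d},\frac{\sqrt m}{\sigma^2\log^6(d)}\Big)\Big),$$ then, with probability at least $1-(T+1)d^{-18}$, for all $0\le t\le T$, $$\Big(1-\frac{c_2}{\lambda}\Big)\mathrm{Err}_t+\frac{C_2\sigma^2d}{\lambda^2m}-\frac{C_1\log^6(d)\,\sigma^2}{\lambda\sqrt m}\ \le\ \mathrm{Err}_{t+1}\ \le\ \Big(1-\frac{c_1}{\lambda}\Big)\mathrm{Err}_t+\frac{C_1\sigma^2d}{\lambda^2m}+\frac{C_1\log^6(d)\,\sigma^2}{\lambda\sqrt m}.$$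
   Context: Iterates: at each iteration $t=0,1,2,\dots$ a fresh batch, independent of everything before, is drawn: $x_1,\dots,x_m,z_1,\dots,z_m$ i.i.d. $N(0,I_d)$, $\epsilon_1,\dots,\epsilon_m$ i.i.d. $N(0,\sigma^2)$ independent of them, $y_i=\langle x_i,\mu_\star\rangle\langle z_i,\nu_\star\rangle+\epsilon_i$ (the dependence of the batch on $t$ is suppressed). With $G_i=\langle x_i,\mu_t\rangle$, $\tilde G_i=\langle z_i,\nu_t\rangle$, $a_i=(\tilde G_ix_i^\top,\,G_iz_i^\top)^\top\in\mathbb{R}^{2d}$, $$\begin{bmatrix}\mu_{t+1}\\ \nu_{t+1}\end{bmatrix}=\Big(\sum_{i=1}^m a_ia_i^\top+\lambda mI_{2d}\Big)^{-1}\Big(\sum_{i=1}^m(y_i+G_i\tilde G_i)a_i+\lambda m\begin{bmatrix}\mu_t\\ \nu_t\end{bmatrix}\Big).$$ Equivalently, $(\mu_{t+1},\nu_{t+1})$ minimizes $\frac1m\sum_i(y_i+G_i\tilde G_i-\tilde G_i\langle x_i,\mu\rangle-G_i\langle z_i,\nu\rangle)^2+\lambda(\|\mu-\mu_t\|_2^2+\|\nu-\nu_t\|_2^2)$. Error: $\mathrm{Err}_t=(\alpha_t\tilde\alpha_t-1)^2+\beta_t^2+\tilde\beta_t^2$ where $\alpha_t=\langle\mu_t,\mu_\star\rangle$, $\beta_t=\|P_{\mu_\star}^\perp\mu_t\|_2$, $\tilde\alpha_t=\langle\nu_t,\nu_\star\rangle$, $\tilde\beta_t=\|P_{\nu_\star}^\perp\nu_t\|_2$,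 and $P_w^\perp$ is the orthogonal projection onto $\mathrm{span}(w)^\perp$. Convention: for $\sigma=0$ the upper bound on $T$ is read as $+\infty$ (no restriction). *)

theory Defs
  imports
    "HOL-Probability.Probability"
    "Jordan_Normal_Form.Gauss_Jordan_Elimination"
    "Jordan_Normal_Form.Determinant"
begin

unbundle no vec_syntax
unbundle no inner_syntax

text \<open>
  The dimension \<open>d\<close> is quantified inside the statement, after the universal constants, so elements
  of \<open>\<real>\<^sup>d\<close> are elements of \<open>carrier_vec d\<close> rather than of a type \<open>real ^ 'n\<close>.
\<close>

section \<open>The random batches\<close>

text \<open>\<open>N(0, s\<^sup>2)\<close> for \<open>s \<ge> 0\<close>. The case \<open>s = 0\<close> is separate because \<^term>\<open>normal_density 0 0\<close> is
  identically \<open>0\<close>, so that the density formula would give the null measure.\<close>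

definition normal_law :: "real \<Rightarrow> real measure" where
  "normal_law s = (if s = 0 then return borel 0 else density lborel (normal_density 0 s))"

text \<open>
  Names of the scalar random variables: \<open>X t i j\<close> and \<open>Z t i j\<close> are the \<open>j\<close>-th coordinates of \<open>x\<^sub>i\<close>
  and \<open>z\<^sub>i\<close> in the batch drawn at iteration \<open>t\<close>, and \<open>Eps t i\<close> is the noise \<open>\<epsilon>\<^sub>i\<close> of that batch.
  A vector is \<open>N(0, I\<^sub>d)\<close>-distributed iff its coordinates are i.i.d. standard normal.
\<close>

datatype noise_index = X nat nat nat | Z nat nat nat | Eps nat nat

primrec noise_law :: "real \<Rightarrow> noise_index \<Rightarrow> real measure" where
  "noise_law \<sigma> (X t i j) = normal_law 1"
| "noise_law \<sigma> (Z t i j) = normal_law 1"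
| "noise_law \<sigma> (Eps t i) = normal_law \<sigma>"

text \<open>
  The joint law of all batches. The statement is made on this canonical product space, because a
  quantifier over arbitrary probability spaces would introduce a type variable on which the
  constants might depend; lemma \<open>prob_noise_space_transfer\<close> below carries it over to any
  probability space.
\<close>

definition noise_space :: "real \<Rightarrow> (noise_index \<Rightarrow> real) measure" where
  "noise_space \<sigma> = Pi\<^sub>M UNIV (noise_law \<sigma>)"

definition batch_x :: "nat \<Rightarrow> (noise_index \<Rightarrow> real) \<Rightarrow> nat \<Rightarrow> nat \<Rightarrow> real vec" where
  "batch_x d \<omega> t i = vec d (\<lambda>j. \<omega> (X t i j))"

definition batch_z :: "nat \<Rightarrow> (noise_index \<Rightarrow> real) \<Rightarrow> nat \<Rightarrow> nat \<Rightarrow> real vec" where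
  "batch_z d \<omega> t i = vec d (\<lambda>j. \<omega> (Z t i j))"

definition batch_y ::
  "nat \<Rightarrow> real vec \<Rightarrow> real vec \<Rightarrow> (noise_index \<Rightarrow> real) \<Rightarrow> nat \<Rightarrow> nat \<Rightarrow> real" where
  "batch_y d \<mu>s \<nu>s \<omega> t i = (batch_x d \<omega> t i \<bullet> \<mu>s) * (batch_z d \<omega> t i \<bullet> \<nu>s) + \<omega> (Eps t i)"

section \<open>The iteration\<close>

text \<open>\<open>\<Sum>\<^sub>i a\<^sub>i a\<^sub>i\<^sup>T + r I\<^sub>n\<close> for \<open>a\<^sub>0, \<dots>, a\<^bsub>m-1\<^esub> \<in> \<real>\<^sup>n\<close>. It is used with \<open>r = \<lambda> m > 0\<close>, where
  \<^const>\<open>mat_inverse\<close> is defined (lemma \<open>mat_inverse_reg_gram\<close>).\<close>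

definition reg_gram :: "nat \<Rightarrow> nat \<Rightarrow> (nat \<Rightarrow> real vec) \<Rightarrow> real \<Rightarrow> real mat" where
  "reg_gram n m a r = mat n n (\<lambda>(j, k). \<Sum>i<m. a i $ j * a i $ k) + r \<cdot>\<^sub>m 1\<^sub>m n"

definition prox_linear_step ::
  "nat \<Rightarrow> nat \<Rightarrow> real \<Rightarrow> (nat \<Rightarrow> real vec) \<Rightarrow> (nat \<Rightarrow> real vec) \<Rightarrow> (nat \<Rightarrow> real) \<Rightarrow>
    real vec \<times> real vec \<Rightarrow> real vec \<times> real vec" where
  "prox_linear_step d m lam x z y = (\<lambda>(\<mu>, \<nu>).
     let G = (\<lambda>i. x i \<bullet> \<mu>);
         G' = (\<lambda>i. z i \<bullet> \<nu>);
         a = (\<lambda>i. (G' i \<cdot>\<^sub>v x i) @\<^sub>v (G i \<cdot>\<^sub>v z i));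
         A = reg_gram (2 * d) m a (lam * real m);
         b = vec (2 * d) (\<lambda>j. \<Sum>i<m. (y i + G i * G' i) * a i $ j) + (lam * real m) \<cdot>\<^sub>v (\<mu> @\<^sub>v \<nu>);
         w = the (mat_inverse A) *\<^sub>v b
     in (vec_first w d, vec_last w d))"

primrec prox_linear_iterates ::
  "nat \<Rightarrow> nat \<Rightarrow> real \<Rightarrow> real vec \<Rightarrow> real vec \<Rightarrow> real vec \<times> real vec \<Rightarrow>
    (noise_index \<Rightarrow> real) \<Rightarrow> nat \<Rightarrow> real vec \<times> real vec" where
  "prox_linear_iterates d m lam \<mu>s \<nu>s init \<omega> 0 = init"
| "prox_linear_iterates d m lam \<mu>s \<nu>s init \<omega> (Suc t) =
     prox_linear_step d m lam (batch_x d \<omega> t) (batch_z d \<omega> t) (batch_y d \<mu>s \<nu>s \<omega> t)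
       (prox_linear_iterates d m lam \<mu>s \<nu>s init \<omega> t)"

section \<open>The error\<close>

definition l2norm :: "real vec \<Rightarrow> real" where
  "l2norm v = sqrt (v \<bullet> v)"

text \<open>The orthogonal projection of \<open>v\<close> onto \<open>span(w)\<^sup>\<bottom>\<close>, for \<open>w \<noteq> 0\<close>
  (lemma \<open>perp_proj_unique\<close>).\<close>

definition perp_proj :: "real vec \<Rightarrow> real vec \<Rightarrow> real vec" where
  "perp_proj w v = v - ((w \<bullet> v) / (w \<bullet> w)) \<cdot>\<^sub>v w"

definition Err :: "real vec \<Rightarrow> real vec \<Rightarrow> real vec \<times> real vec \<Rightarrow> real" where
  "Err \<mu>s \<nu>s = (\<lambda>(\<mu>, \<nu>).
     ((\<mu> \<bullet> \<mu>s) * (\<nu> \<bullet> \<nu>s) - 1)\<^sup>2 + (l2norm (perp_proj \<mu>s \<mu>))\<^sup>2 + (l2norm (perp_proj \<nu>s \<nu>))\<^sup>2)"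

section \<open>Adequacy of the definitions\<close>

lemma prob_space_normal_law: "s \<ge> 0 \<Longrightarrow> prob_space (normal_law s)"
  unfolding normal_law_def by (auto intro: prob_space_return prob_space_normal_density)

lemma sets_normal_law [simp, measurable_cong]: "sets (normal_law s) = sets borel"
  unfolding normal_law_def by simp

lemma sets_noise_law [simp, measurable_cong]: "sets (noise_law \<sigma> k) = sets borel"
  by (cases k) simp_all

lemma prob_space_noise_space: "\<sigma> \<ge> 0 \<Longrightarrow> prob_space (noise_space \<sigma>)"
proof -
  assume "\<sigma> \<ge> 0"
  then have "prob_space (noise_law \<sigma> k)" for k
    by (cases k) (auto intro: prob_space_normal_law)
  then show ?thesis
    unfolding noise_space_def by (intro prob_space_PiM) auto
qed

lemma prob_noise_space_transfer:
  fixes V :: "noise_index \<Rightarrow> 'a \<Rightarrow> real"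
  assumes M: "prob_space M"
    and indep: "prob_space.indep_vars M (\<lambda>_. borel) V UNIV"
    and law: "\<And>k. distr M borel (V k) = noise_law \<sigma> k"
    and E: "{\<omega> \<in> space (noise_space \<sigma>). P \<omega>} \<in> sets (noise_space \<sigma>)"
  shows "measure M {u \<in> space M. P (\<lambda>k. V k u)} =
    measure (noise_space \<sigma>) {\<omega> \<in> space (noise_space \<sigma>). P \<omega>}"
proof -
  interpret prob_space M by (rule M)
  have rv: "random_variable borel (V k)" for k
    using indep by (auto simp: indep_vars_def)
  have D: "distr M (Pi\<^sub>M UNIV (\<lambda>_. borel)) (\<lambda>u k. V k u) = noise_space \<sigma>"
    using indep indep_vars_iff_distr_eq_PiM[where I = UNIV and M' = "\<lambda>_. borel" and X = V] rv
    by (simp add: law noise_space_def restrict_def)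
  have sp: "space (noise_space \<sigma>) = UNIV"
    unfolding D[symmetric] by (simp add: space_PiM)
  have m: "(\<lambda>u k. V k u) \<in> measurable M (Pi\<^sub>M UNIV (\<lambda>_. borel))"
    using rv measurable_restrict[of UNIV V M "\<lambda>_. borel"] by (simp add: restrict_def)
  have "{\<omega>. P \<omega>} \<in> sets (Pi\<^sub>M UNIV (\<lambda>_. borel :: real measure))"
    using E unfolding sp by (simp add: D[symmetric])
  then have "measure (distr M (Pi\<^sub>M UNIV (\<lambda>_. borel)) (\<lambda>u k. V k u)) {\<omega>. P \<omega>} =
      measure M ((\<lambda>u k. V k u) -` {\<omega>. P \<omega>} \<inter> space M)"
    by (rule measure_distr[OF m])
  moreover have "(\<lambda>u k. V k u) -` {\<omega>. P \<omega>} \<inter> space M = {u \<in> space M. P (\<lambda>k. V k u)}"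
    by auto
  ultimately show ?thesis
    unfolding D sp by simp
qed

lemma reg_gram_carrier [simp]: "reg_gram n m a r \<in> carrier_mat n n"
  unfolding reg_gram_def by simp

lemma reg_gram_quadratic_form:
  assumes v: "v \<in> carrier_vec n"
  shows "v \<bullet> (reg_gram n m a r *\<^sub>v v) = (\<Sum>i<m. (\<Sum>j<n. a i $ j * v $ j)\<^sup>2) + r * (v \<bullet> v)"
proof -
  have dim: "dim_vec v = n" using v by simp
  have row: "(reg_gram n m a r *\<^sub>v v) $ j = (\<Sum>k<n. (\<Sum>i<m. a i $ j * a i $ k) * v $ k) + r * v $ j"
    if j: "j < n" for j
  proof -
    have "(reg_gram n m a r *\<^sub>v v) $ j
        = (\<Sum>k<n. ((\<Sum>i<m. a i $ j * a i $ k) + r * (if j = k then 1 else 0)) * v $ k)"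
      using j dim by (auto simp: reg_gram_def scalar_prod_def atLeast0LessThan intro!: sum.cong)
    also have "\<dots> = (\<Sum>k<n. (\<Sum>i<m. a i $ j * a i $ k) * v $ k)
        + (\<Sum>k<n. if j = k then r * v $ k else 0)"
      by (subst sum.distrib[symmetric], rule sum.cong) (auto simp: algebra_simps)
    finally show ?thesis using j by simp
  qed
  have "v \<bullet> (reg_gram n m a r *\<^sub>v v)
      = (\<Sum>j<n. v $ j * ((\<Sum>k<n. (\<Sum>i<m. a i $ j * a i $ k) * v $ k) + r * v $ j))"
    using row by (auto simp: scalar_prod_def atLeast0LessThan reg_gram_def intro!: sum.cong)
  also have "\<dots> = (\<Sum>j<n. \<Sum>k<n. \<Sum>i<m. (a i $ j * v $ j) * (a i $ k * v $ k)) + r * (v \<bullet> v)"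
    by (simp add: scalar_prod_def dim atLeast0LessThan sum_distrib_left sum_distrib_right
        sum.distrib algebra_simps)
  also have "(\<Sum>j<n. \<Sum>k<n. \<Sum>i<m. (a i $ j * v $ j) * (a i $ k * v $ k))
      = (\<Sum>j<n. \<Sum>i<m. \<Sum>k<n. (a i $ j * v $ j) * (a i $ k * v $ k))"
    by (rule sum.cong[OF refl], rule sum.swap)
  also have "\<dots> = (\<Sum>i<m. \<Sum>j<n. \<Sum>k<n. (a i $ j * v $ j) * (a i $ k * v $ k))"
    by (rule sum.swap)
  also have "\<dots> = (\<Sum>i<m. (\<Sum>j<n. a i $ j * v $ j)\<^sup>2)"
    by (simp add: power2_eq_square sum_product)
  finally show ?thesis .
qed

lemma mat_inverse_reg_gram:
  assumes r: "r > 0"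
  obtains B where "mat_inverse (reg_gram n m a r) = Some B" "B \<in> carrier_mat n n"
    "reg_gram n m a r * B = 1\<^sub>m n" "B * reg_gram n m a r = 1\<^sub>m n"
proof -
  let ?A = "reg_gram n m a r"
  have "v = 0\<^sub>v n" if v: "v \<in> carrier_vec n" and 0: "?A *\<^sub>v v = 0\<^sub>v n" for v
  proof -
    have "r * (v \<bullet> v) \<le> v \<bullet> (?A *\<^sub>v v)"
      unfolding reg_gram_quadratic_form[OF v] by (simp add: sum_nonneg)
    also have "\<dots> = 0" using v 0 by simp
    finally have "v \<bullet> v \<le> 0" using r by (simp add: mult_le_0_iff)
    moreover have "v \<bullet> v = (\<Sum>j<n. (v $ j)\<^sup>2)"
      using v by (simp add: scalar_prod_def atLeast0LessThan power2_eq_square)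
    ultimately have "(\<Sum>j<n. (v $ j)\<^sup>2) = 0"
      by (simp add: sum_nonneg order_antisym)
    then have "\<forall>j<n. v $ j = 0"
      by (simp add: sum_nonneg_eq_0_iff)
    then show ?thesis using v by (intro eq_vecI) auto
  qed
  then have "det ?A \<noteq> 0"
    using det_0_iff_vec_prod_zero[of ?A n] by auto
  then have "?A \<in> Units (ring_mat TYPE(real) n ())"
    by (intro det_non_zero_imp_unit) auto
  then obtain B where B: "mat_inverse ?A = Some B"
    using mat_inverse(1)[of ?A n "()"] by (cases "mat_inverse ?A") auto
  then show ?thesis
    using mat_inverse(2)[OF reg_gram_carrier B] that by auto
qed

lemma perp_proj_unique:
  assumes w: "w \<in> carrier_vec d" and v: "v \<in> carrier_vec d" and p: "p \<in> carrier_vec d"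
    and nz: "w \<bullet> w \<noteq> 0"
  shows "p = perp_proj w v \<longleftrightarrow> w \<bullet> p = 0 \<and> (\<exists>c. v - p = c \<cdot>\<^sub>v w)"
proof
  assume p_eq: "p = perp_proj w v"
  have "w \<bullet> p = w \<bullet> v - (w \<bullet> v) / (w \<bullet> w) * (w \<bullet> w)"
    unfolding p_eq perp_proj_def using w v
    by (simp add: scalar_prod_minus_distrib[of _ d])
  then have "w \<bullet> p = 0" using nz by simp
  moreover have "v - p = ((w \<bullet> v) / (w \<bullet> w)) \<cdot>\<^sub>v w"
    unfolding p_eq perp_proj_def using w v by (intro eq_vecI) auto
  ultimately show "w \<bullet> p = 0 \<and> (\<exists>c. v - p = c \<cdot>\<^sub>v w)" by blast
next
  assume "w \<bullet> p = 0 \<and> (\<exists>c. v - p = c \<cdot>\<^sub>v w)"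
  then obtain c where o: "w \<bullet> p = 0" and c: "v - p = c \<cdot>\<^sub>v w" by blast
  have "w \<bullet> v = w \<bullet> (v - p)"
    using w v p o by (simp add: scalar_prod_minus_distrib[of _ d])
  also have "\<dots> = c * (w \<bullet> w)" using w by (simp add: c)
  finally have "c = (w \<bullet> v) / (w \<bullet> w)" using nz by simp
  moreover have "p = v - (v - p)" using v p by (intro eq_vecI) auto
  ultimately show "p = perp_proj w v" unfolding perp_proj_def c by simp
qed

end

theory Submission
  imports Defs
begin

text \<open>
Fix a state \<open>(\<mu>, \<nu>)\<close> and one batch, and put \<open>s = \<lambda> m\<close>. The increment
\<open>\<Delta>\<close> of the prox-linear step is the ridge solution \<open>(\<Sum>\<^sub>i a\<^sub>i a\<^sub>i\<^sup>T + s I) \<Delta> = \<Sum>\<^sub>i r\<^sub>i a\<^sub>i\<close> for the data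
\<open>r\<^sub>i = y\<^sub>i - G\<^sub>i G'\<^sub>i\<close> (\<open>prox_linear_step_ridge\<close>). Let \<open>p\<^sub>0 = \<mu>\<^sub>\<star>\<close>, let \<open>p\<^sub>1\<close> be the direction of the part of \<open>\<mu>\<close>
orthogonal to \<open>\<mu>\<^sub>\<star>\<close>, and let \<open>q\<^sub>0, q\<^sub>1\<close> be the analogous directions for \<open>\<nu>\<close>. Apart from the noise, \<open>-r\<^sub>i\<close> is
then a bilinear form, with a \<open>2 \<times> 2\<close> coefficient matrix \<open>R\<close>, in the scalars \<open>\<langle>x\<^sub>i, p\<^sub>k\<rangle>\<close> and \<open>\<langle>z\<^sub>i, q\<^sub>l\<rangle>\<close>.
The change of the error is \<open>2 U + |\<Delta>|\<^sup>2\<close> up to terms quadratic in the components \<open>\<delta> = \<langle>\<mu>\<^sub>\<star>, \<Delta>\<^sub>\<mu>\<rangle>\<close> and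
\<open>\<delta>' = \<langle>\<nu>\<^sub>\<star>, \<Delta>\<^sub>\<nu>\<rangle>\<close>, where \<open>U\<close> is the inner product of \<open>\<Delta>\<close> with half the gradient of the error.

Since \<open>s \<Delta> = \<Sum>\<^sub>i \<rho>\<^sub>i a\<^sub>i\<close> for the residual \<open>\<rho>\<close> of the ridge problem, an inner product \<open>\<langle>u, \<Delta>\<rangle>\<close> equals
\<open>(1/s) \<Sum>\<^sub>i \<langle>a\<^sub>i, u\<rangle> \<rho>\<^sub>i\<close>. In the signal part of \<open>U\<close>, \<open>\<rho>\<close> may be replaced by \<open>r\<close>, because \<open>s\<close> dominates \<open>d\<close>.
What remains is \<open>-(1/s) \<Sum>\<^sub>i\<close> of a product of two bilinear forms, which concentrates around \<open>-m/s = -1/\<lambda>\<close> times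
a quadratic form comparable with the error (\<open>signal_inner\<close>, \<open>gradient_inner\<close>). The noise part of \<open>U\<close> is, given \<open>x\<close>
and \<open>z\<close>, a centred Gaussian. By the symmetry of the ridge operator and the contraction \<open>|\<rho>| \<le> |r|\<close>,
its variance is at most \<open>\<sigma>\<^sup>2 / s\<^sup>2\<close> times the squared length of the bilinear form being tested. Finally \<open>|\<Delta>|\<^sup>2\<close> is of order
\<open>\<sigma>\<^sup>2 d m / s\<^sup>2 = \<sigma>\<^sup>2 d / (\<lambda>\<^sup>2 m)\<close> from both sides, up to a small multiple of
\<open>Err / \<lambda>\<close> (\<open>step_norm\<close>, \<open>err_step\<close>). Together these give the two inequalities
for one step.

The deterministic analysis (locale \<open>batch_step\<close>) asks a batch for finitely many
properties. Sums over \<open>i\<close> of products of boundedly many Gaussian forms concentrate by truncation and Hoeffding's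
inequality (\<open>block_sum_concentration\<close>). Two quantities contain the same Gaussian matrix twice: the columns
\<open>\<Sum>\<^sub>i (\<dots>) \<langle>x\<^sub>i, p\<rangle> x\<^sub>i\<close>, and the Gram matrix applied to the noise gradient. There the component of the matrix
along the relevant direction is exchanged for fresh Gaussians by an orthogonal map that preserves the Gaussian
measure (\<open>swap_isometry\<close>), after which the old matrix enters through expressions whose coefficients are independent of it
(\<open>quadratic_row_sums_bounded\<close>, \<open>noise_gram_square_bounded\<close>).
Every failure event has probability at most \<open>5 / d\<^sup>2\<^sup>2\<close>, so that their union stays below \<open>1 / d\<^sup>1\<^sup>8\<close>.

The state before batch \<open>t\<close> depends on earlier batches only, so the one-batch estimate
applies after freezing all other coordinates (\<open>iteration_progress_probability\<close>), and a union bound gives the factor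
\<open>T + 1\<close>. The one-batch estimate needs \<open>\<alpha> = \<langle>\<mu>, \<mu>\<^sub>\<star>\<rangle>\<close> and
\<open>\<alpha>' = \<langle>\<nu>, \<nu>\<^sub>\<star>\<rangle>\<close> bounded above and away from \<open>0\<close>, which a small error alone
does not give, because the error depends on them only through \<open>\<alpha> \<alpha>'\<close>. Per step they move by at most a constant times
\<open>(\<surd>Err\<^sub>t + \<surd>\<phi>) / \<lambda>\<close>, where \<open>\<phi>\<close> is the noise level. The first part sums geometrically to a multiple of
\<open>\<surd>K\<^sub>0\<close>, and the second one accumulates to \<open>T \<surd>\<phi> / \<lambda>\<close>, which is what the upper bound on \<open>T\<close> keeps small, as
\<open>\<surd>\<phi> log (1/\<phi>)\<close> is small (\<open>stays_near\<close>, \<open>log_times_sqrt_small\<close>).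
\<close>

section \<open>Standard Gaussian product measure\<close>

abbreviation N01 :: "real measure" where
  "N01 \<equiv> density lborel (\<lambda>x. ennreal (std_normal_density x))"

definition gauss :: "('k \<Rightarrow> real) measure" where
  "gauss = Pi\<^sub>M UNIV (\<lambda>_. N01)"

interpretation N01: prob_space N01
  by (rule prob_space_normal_density) simp

interpretation N01_prod: product_prob_space "\<lambda>_. N01" UNIV
  by standard

lemma prob_space_gauss: "prob_space (gauss :: ('k \<Rightarrow> real) measure)"
  unfolding gauss_def by (intro prob_space_PiM) (rule N01.prob_space_axioms)

interpretation gauss: prob_space "gauss :: ('k \<Rightarrow> real) measure"
  by (rule prob_space_gauss)

lemma sets_gauss [measurable_cong]: "sets gauss = sets (Pi\<^sub>M UNIV (\<lambda>_. borel))"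
  unfolding gauss_def by (rule sets_PiM_cong) auto

lemma space_gauss [simp]: "space gauss = UNIV"
  by (simp add: gauss_def space_PiM)

lemma coordinate_measurable_gauss [measurable]: "(\<lambda>\<omega>. \<omega> \<kappa>) \<in> borel_measurable gauss"
  by measurable

lemma measurable_into_gauss:
  assumes "\<And>\<kappa>. (\<lambda>x. f x \<kappa>) \<in> borel_measurable M"
  shows "f \<in> measurable M gauss"
proof -
  have "f \<in> measurable M (Pi\<^sub>M UNIV (\<lambda>_. borel))"
    using assms by (intro measurable_PiM_single') auto
  then show ?thesis by (simp add: measurable_cong_sets[OF refl sets_gauss])
qed

lemma sets_gauss_coordinate [measurable]:
  assumes "A \<in> sets borel" shows "{\<omega>. \<omega> \<kappa> \<in> A} \<in> sets gauss"
  using measurable_sets[OF coordinate_measurable_gauss assms, of \<kappa>] by (simp add: vimage_def)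

lemma coordinate_measurable_lborel:
  "\<kappa> \<in> K \<Longrightarrow> (\<lambda>g. g \<kappa>) \<in> borel_measurable (Pi\<^sub>M K (\<lambda>_. lborel :: real measure))"
  using measurable_component_singleton[of \<kappa> K "\<lambda>_. lborel :: real measure"] by simp

lemma emeasure_gauss_cylinder:
  assumes "finite J" "\<And>\<kappa>. \<kappa> \<in> J \<Longrightarrow> A \<kappa> \<in> sets borel"
  shows "emeasure gauss {\<omega>. \<forall>\<kappa>\<in>J. \<omega> \<kappa> \<in> A \<kappa>} = (\<Prod>\<kappa>\<in>J. emeasure N01 (A \<kappa>))"
  using N01_prod.emeasure_PiM_Collect[of J A] assms by (simp add: gauss_def space_PiM)

lemma gauss_eqI:
  assumes "prob_space M" and sets: "sets M = sets gauss"
    and eq: "\<And>J A. finite J \<Longrightarrow> (\<And>\<kappa>. \<kappa> \<in> J \<Longrightarrow> A \<kappa> \<in> sets borel) \<Longrightarrow>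
      emeasure M {\<omega>. \<forall>\<kappa>\<in>J. \<omega> \<kappa> \<in> A \<kappa>} = (\<Prod>\<kappa>\<in>J. emeasure N01 (A \<kappa>))"
  shows "M = gauss"
proof -
  interpret prob_space M by fact
  show ?thesis
    unfolding gauss_def
  proof (rule measure_eqI_PiM_infinite)
    show "sets M = sets (Pi\<^sub>M UNIV (\<lambda>_. N01))" using sets by (simp add: gauss_def)
    show "finite_measure M" by (rule finite_measure_axioms)
    fix A :: "'a \<Rightarrow> real set" and J :: "'a set"
    assume J: "finite J" and A: "\<And>i. i \<in> J \<Longrightarrow> A i \<in> sets N01"
    have *: "prod_emb UNIV (\<lambda>_. N01) J (Pi\<^sub>E J A) = {\<omega>. \<forall>\<kappa>\<in>J. \<omega> \<kappa> \<in> A \<kappa>}"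
      by (auto simp: prod_emb_def PiE_iff)
    show "emeasure M (prod_emb UNIV (\<lambda>_. N01) J (Pi\<^sub>E J A)) =
      emeasure (Pi\<^sub>M UNIV (\<lambda>_. N01)) (prod_emb UNIV (\<lambda>_. N01) J (Pi\<^sub>E J A))"
      unfolding * using eq[OF J] emeasure_gauss_cylinder[OF J, of A] A by (simp add: gauss_def)
  qed simp
qed

text \<open>Resampling: the coordinates in \<open>A\<close> are frozen to \<open>\<omega>0\<close>, the others are taken from \<open>\<omega>\<close>. Conditioning on
some of the coordinates of a product measure is expressed by mixing two independent points.\<close>

definition mix :: "'k set \<Rightarrow> ('k \<Rightarrow> real) \<Rightarrow> ('k \<Rightarrow> real) \<Rightarrow> 'k \<Rightarrow> real" where
  "mix A \<omega>0 \<omega> = (\<lambda>\<kappa>. if \<kappa> \<in> A then \<omega>0 \<kappa> else \<omega> \<kappa>)"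

lemma mix_measurable: "(\<lambda>p. mix A (fst p) (snd p)) \<in> measurable (gauss \<Otimes>\<^sub>M gauss) gauss"
  unfolding mix_def by (rule measurable_into_gauss) measurable

lemma mix_measurable2: "mix A \<omega>0 \<in> measurable gauss gauss"
  unfolding mix_def by (rule measurable_into_gauss) measurable

lemma distr_mix: "distr (gauss \<Otimes>\<^sub>M gauss) gauss (\<lambda>p. mix A (fst p) (snd p)) = gauss"
proof (rule gauss_eqI)
  interpret P: pair_prob_space gauss gauss ..
  show "prob_space (distr (gauss \<Otimes>\<^sub>M gauss) gauss (\<lambda>p. mix A (fst p) (snd p)))"
    by (rule P.prob_space_distr[OF mix_measurable])
  fix J :: "'a set" and B :: "'a \<Rightarrow> real set"
  assume J: "finite J" and B: "\<And>\<kappa>. \<kappa> \<in> J \<Longrightarrow> B \<kappa> \<in> sets borel"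
  have meas: "{\<omega>. \<forall>\<kappa>\<in>I. \<omega> \<kappa> \<in> B \<kappa>} \<in> sets gauss" if "I \<subseteq> J" for I
  proof -
    have "{\<omega> \<in> space gauss. \<forall>\<kappa>\<in>I. \<omega> \<kappa> \<in> B \<kappa>} \<in> sets gauss"
      using that J B by (intro sets.sets_Collect_finite_All) (auto intro: finite_subset)
    then show ?thesis by simp
  qed
  have "emeasure (distr (gauss \<Otimes>\<^sub>M gauss) gauss (\<lambda>p. mix A (fst p) (snd p))) {\<omega>. \<forall>\<kappa>\<in>J. \<omega> \<kappa> \<in> B \<kappa>}
     = emeasure (gauss \<Otimes>\<^sub>M gauss) ({\<omega>. \<forall>\<kappa>\<in>J \<inter> A. \<omega> \<kappa> \<in> B \<kappa>} \<times> {\<omega>. \<forall>\<kappa>\<in>J - A. \<omega> \<kappa> \<in> B \<kappa>})"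
    by (subst emeasure_distr[OF mix_measurable meas[OF order_refl]])
      (auto intro!: arg_cong2[where f = emeasure] simp: mix_def space_pair_measure split: if_splits)
  also have "\<dots> = (\<Prod>\<kappa>\<in>J \<inter> A. emeasure N01 (B \<kappa>)) * (\<Prod>\<kappa>\<in>J - A. emeasure N01 (B \<kappa>))"
  proof -
    have 1: "emeasure gauss {\<omega>. \<forall>\<kappa>\<in>J \<inter> A. \<omega> \<kappa> \<in> B \<kappa>} = (\<Prod>\<kappa>\<in>J \<inter> A. emeasure N01 (B \<kappa>))"
      by (rule emeasure_gauss_cylinder) (use J B in auto)
    have 2: "emeasure gauss {\<omega>. \<forall>\<kappa>\<in>J - A. \<omega> \<kappa> \<in> B \<kappa>} = (\<Prod>\<kappa>\<in>J - A. emeasure N01 (B \<kappa>))"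
      by (rule emeasure_gauss_cylinder) (use J B in auto)
    show ?thesis
      using meas[of "J \<inter> A"] meas[of "J - A"]
      by (subst gauss.emeasure_pair_measure_Times) (simp_all only: 1 2, auto)
  qed
  also have "\<dots> = (\<Prod>\<kappa>\<in>J. emeasure N01 (B \<kappa>))"
    using J by (subst prod.Int_Diff[of J _ A]) auto
  finally show "emeasure (distr (gauss \<Otimes>\<^sub>M gauss) gauss (\<lambda>p. mix A (fst p) (snd p)))
      {\<omega>. \<forall>\<kappa>\<in>J. \<omega> \<kappa> \<in> B \<kappa>} = (\<Prod>\<kappa>\<in>J. emeasure N01 (B \<kappa>))" .
qed simp

lemma gauss_nn_integral_mix:
  assumes [measurable]: "f \<in> borel_measurable gauss"
  shows "(\<integral>\<^sup>+\<omega>. f \<omega> \<partial>gauss) = (\<integral>\<^sup>+\<omega>0. (\<integral>\<^sup>+\<omega>. f (mix A \<omega>0 \<omega>) \<partial>gauss) \<partial>gauss)"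
proof -
  note mix_measurable[of A, measurable]
  have "(\<integral>\<^sup>+\<omega>. f \<omega> \<partial>gauss) = (\<integral>\<^sup>+\<omega>. f \<omega> \<partial>distr (gauss \<Otimes>\<^sub>M gauss) gauss (\<lambda>p. mix A (fst p) (snd p)))"
    by (simp add: distr_mix)
  also have "\<dots> = (\<integral>\<^sup>+p. f (mix A (fst p) (snd p)) \<partial>(gauss \<Otimes>\<^sub>M gauss))"
    by (rule nn_integral_distr) measurable
  also have "\<dots> = (\<integral>\<^sup>+\<omega>0. (\<integral>\<^sup>+\<omega>. f (mix A \<omega>0 \<omega>) \<partial>gauss) \<partial>gauss)"
    by (subst gauss.nn_integral_fst[symmetric]) auto
  finally show ?thesis .
qed

text \<open>A bound that holds conditionally on the coordinates in \<open>A\<close>, uniformly in their values, holds unconditionally.\<close>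

lemma gauss_prob_le_by_resampling:
  fixes B :: "('k \<Rightarrow> real) \<Rightarrow> bool"
  assumes B: "{\<omega>. B \<omega>} \<in> sets gauss"
    and le: "\<And>\<omega>0. measure gauss {\<omega>. B (mix A \<omega>0 \<omega>)} \<le> \<delta>"
  shows "measure gauss {\<omega>. B \<omega>} \<le> \<delta>"
proof -
  have d: "0 \<le> \<delta>" using le[of undefined] measure_nonneg order_trans by blast
  have "emeasure gauss {\<omega>. B \<omega>} = (\<integral>\<^sup>+\<omega>. indicator {\<omega>. B \<omega>} \<omega> \<partial>gauss)"
    using B by simp
  also have "\<dots> = (\<integral>\<^sup>+\<omega>0. (\<integral>\<^sup>+\<omega>. indicator {\<omega>. B \<omega>} (mix A \<omega>0 \<omega>) \<partial>gauss) \<partial>gauss)"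
    using B by (intro gauss_nn_integral_mix) auto
  also have "\<dots> \<le> (\<integral>\<^sup>+\<omega>0. ennreal \<delta> \<partial>(gauss :: ('k \<Rightarrow> real) measure))"
  proof (rule nn_integral_mono)
    fix \<omega>0 :: "'k \<Rightarrow> real"
    have m: "{\<omega>. B (mix A \<omega>0 \<omega>)} \<in> sets gauss"
      using measurable_sets[OF mix_measurable2 B, of A \<omega>0] by (simp add: vimage_def)
    have "(\<integral>\<^sup>+\<omega>. indicator {\<omega>. B \<omega>} (mix A \<omega>0 \<omega>) \<partial>gauss) = (\<integral>\<^sup>+\<omega>. indicator {\<omega>. B (mix A \<omega>0 \<omega>)} \<omega> \<partial>gauss)"
      by (intro nn_integral_cong) (auto simp: indicator_def)
    also have "\<dots> = emeasure gauss {\<omega>. B (mix A \<omega>0 \<omega>)}" using m by simp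
    also have "\<dots> \<le> ennreal \<delta>"
      using le[of \<omega>0] by (simp add: gauss.emeasure_eq_measure ennreal_leI)
    finally show "(\<integral>\<^sup>+\<omega>. indicator {\<omega>. B \<omega>} (mix A \<omega>0 \<omega>) \<partial>gauss) \<le> ennreal \<delta>" .
  qed
  also have "\<dots> = ennreal \<delta>" by (simp add: gauss.emeasure_space_1[simplified])
  finally show ?thesis using d by (simp add: gauss.emeasure_eq_measure)
qed

section \<open>Exchanging a direction for fresh Gaussian coordinates\<close>

interpretation lborel_prod: product_sigma_finite "\<lambda>_. lborel :: real measure"
  by standard

lemma PiM_density_lborel:
  assumes I: "finite I"
  shows "Pi\<^sub>M I (\<lambda>_. N01) = density (Pi\<^sub>M I (\<lambda>_. lborel)) (\<lambda>g. \<Prod>\<kappa>\<in>I. ennreal (std_normal_density (g \<kappa>)))"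
proof (rule N01_prod.PiM_eqI[OF I, symmetric])
  show "sets (density (Pi\<^sub>M I (\<lambda>_. lborel)) (\<lambda>g. \<Prod>\<kappa>\<in>I. ennreal (std_normal_density (g \<kappa>)))) = sets (Pi\<^sub>M I (\<lambda>_. N01))"
    by (simp, rule sets_PiM_cong) auto
  fix A :: "'a \<Rightarrow> real set" assume A: "\<And>i. i \<in> I \<Longrightarrow> A i \<in> sets N01"
  have AE: "Pi\<^sub>E I A \<in> sets (Pi\<^sub>M I (\<lambda>_. lborel))" using I A by (intro sets_PiM_I_finite) auto
  have "emeasure (density (Pi\<^sub>M I (\<lambda>_. lborel)) (\<lambda>g. \<Prod>\<kappa>\<in>I. ennreal (std_normal_density (g \<kappa>)))) (Pi\<^sub>E I A)
    = (\<integral>\<^sup>+g. (\<Prod>\<kappa>\<in>I. ennreal (std_normal_density (g \<kappa>))) * indicator (Pi\<^sub>E I A) g \<partial>Pi\<^sub>M I (\<lambda>_. lborel))"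
    using AE by (intro emeasure_density borel_measurable_prod_ennreal measurable_compose[OF coordinate_measurable_lborel]) auto
  also have "\<dots> = (\<integral>\<^sup>+g. (\<Prod>\<kappa>\<in>I. ennreal (std_normal_density (g \<kappa>)) * indicator (A \<kappa>) (g \<kappa>)) \<partial>Pi\<^sub>M I (\<lambda>_. lborel))"
  proof (rule nn_integral_cong)
    fix g assume "g \<in> space (Pi\<^sub>M I (\<lambda>_. lborel :: real measure))"
    then have "indicator (Pi\<^sub>E I A) g = (\<Prod>\<kappa>\<in>I. indicator (A \<kappa>) (g \<kappa>) :: ennreal)"
      using I by (auto simp: indicator_def space_PiM PiE_iff prod_zero_iff split: if_splits)
    then show "(\<Prod>\<kappa>\<in>I. ennreal (std_normal_density (g \<kappa>))) * indicator (Pi\<^sub>E I A) g =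
      (\<Prod>\<kappa>\<in>I. ennreal (std_normal_density (g \<kappa>)) * indicator (A \<kappa>) (g \<kappa>))"
      by (simp add: prod.distrib)
  qed
  also have "\<dots> = (\<Prod>\<kappa>\<in>I. \<integral>\<^sup>+y. ennreal (std_normal_density y) * indicator (A \<kappa>) y \<partial>lborel)"
    using I A by (intro lborel_prod.product_nn_integral_prod) auto
  also have "\<dots> = (\<Prod>\<kappa>\<in>I. emeasure N01 (A \<kappa>))"
    using A by (intro prod.cong) (auto simp: emeasure_density)
  finally show "emeasure (density (Pi\<^sub>M I (\<lambda>_. lborel)) (\<lambda>g. \<Prod>\<kappa>\<in>I. ennreal (std_normal_density (g \<kappa>)))) (Pi\<^sub>E I A)
    = (\<Prod>\<kappa>\<in>I. emeasure N01 (A \<kappa>))" .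
qed

text \<open>Translating one coordinate by a function of the others preserves Lebesgue measure, by Fubini and translation invariance
in that coordinate.\<close>

lemma lborel_shear_one:
  fixes f :: "('k \<Rightarrow> real) \<Rightarrow> ennreal"
  assumes K: "finite K" "i \<in> K"
    and f[measurable]: "f \<in> borel_measurable (Pi\<^sub>M K (\<lambda>_. lborel))"
    and l[measurable]: "l \<in> borel_measurable (Pi\<^sub>M K (\<lambda>_. lborel))"
    and li: "\<And>g y. l (g(i := y)) = l g"
  shows "(\<integral>\<^sup>+g. f (g(i := g i + l g)) \<partial>Pi\<^sub>M K (\<lambda>_. lborel)) = (\<integral>\<^sup>+g. f g \<partial>Pi\<^sub>M K (\<lambda>_. lborel))"
proof -
  define I where "I = K - {i}"
  have K': "K = insert i I" and I: "finite I" "i \<notin> I" using K by (auto simp: I_def)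
  have m: "(\<lambda>g. g(i := g i + l g)) \<in> measurable (Pi\<^sub>M K (\<lambda>_. lborel)) (Pi\<^sub>M K (\<lambda>_. lborel))"
  proof (rule measurable_PiM_single')
    fix j assume "j \<in> K"
    then show "(\<lambda>g. (g(i := g i + l g)) j) \<in> measurable (Pi\<^sub>M K (\<lambda>_. lborel)) lborel"
      using K l by (cases "j = i") (auto intro!: coordinate_measurable_lborel borel_measurable_add)
  next
    show "(\<lambda>g. g(i := g i + l g)) \<in> space (Pi\<^sub>M K (\<lambda>_. lborel)) \<rightarrow> K \<rightarrow>\<^sub>E space lborel"
      using K by (auto simp: space_PiM PiE_iff extensional_def)
  qed
  note m2 = measurable_compose[OF m f]
  have upd: "(\<lambda>y. f (g(i := y))) \<in> borel_measurable borel" if g: "g \<in> space (Pi\<^sub>M I (\<lambda>_. lborel))" for g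
  proof -
    have "(\<lambda>y. g(i := y)) \<in> measurable lborel (Pi\<^sub>M K (\<lambda>_. lborel))"
      unfolding K' using g by (intro measurable_fun_upd[where J = I]) auto
    from measurable_compose[OF this f] show ?thesis by simp
  qed
  have "(\<integral>\<^sup>+g. f (g(i := g i + l g)) \<partial>Pi\<^sub>M K (\<lambda>_. lborel))
     = (\<integral>\<^sup>+g. (\<integral>\<^sup>+y. f (g(i := y + l g)) \<partial>lborel) \<partial>Pi\<^sub>M I (\<lambda>_. lborel))"
    using m2 unfolding K' by (subst lborel_prod.product_nn_integral_insert[OF I]) (auto simp: li)
  also have "\<dots> = (\<integral>\<^sup>+g. (\<integral>\<^sup>+y. f (g(i := y)) \<partial>lborel) \<partial>Pi\<^sub>M I (\<lambda>_. lborel))"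
  proof (rule nn_integral_cong)
    fix g assume "g \<in> space (Pi\<^sub>M I (\<lambda>_. lborel :: real measure))"
    from nn_integral_real_affine[OF upd[OF this], of 1 "l g"]
    show "(\<integral>\<^sup>+y. f (g(i := y + l g)) \<partial>lborel) = (\<integral>\<^sup>+y. f (g(i := y)) \<partial>lborel)"
      by (simp add: add.commute)
  qed
  also have "\<dots> = (\<integral>\<^sup>+g. f g \<partial>Pi\<^sub>M K (\<lambda>_. lborel))"
    using f unfolding K' by (subst lborel_prod.product_nn_integral_insert[OF I]) auto
  finally show ?thesis .
qed

definition shear :: "'k set \<Rightarrow> ('k \<Rightarrow> ('k \<Rightarrow> real) \<Rightarrow> real) \<Rightarrow> ('k \<Rightarrow> real) \<Rightarrow> 'k \<Rightarrow> real" where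
  "shear F l g = (\<lambda>\<kappa>. if \<kappa> \<in> F then g \<kappa> + l \<kappa> g else g \<kappa>)"

lemma shear_measurable:
  assumes "F \<subseteq> K" "\<And>\<kappa>. \<kappa> \<in> F \<Longrightarrow> l \<kappa> \<in> borel_measurable (Pi\<^sub>M K (\<lambda>_. lborel))"
  shows "shear F l \<in> measurable (Pi\<^sub>M K (\<lambda>_. lborel)) (Pi\<^sub>M K (\<lambda>_. lborel))"
proof (rule measurable_PiM_single')
  fix j assume "j \<in> K"
  then show "(\<lambda>g. shear F l g j) \<in> measurable (Pi\<^sub>M K (\<lambda>_. lborel)) lborel"
    using assms by (cases "j \<in> F") (auto simp: shear_def intro!: coordinate_measurable_lborel borel_measurable_add)
next
  show "shear F l \<in> space (Pi\<^sub>M K (\<lambda>_. lborel)) \<rightarrow> K \<rightarrow>\<^sub>E space lborel"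
    using assms(1) by (auto simp: space_PiM PiE_iff extensional_def shear_def)
qed

lemma lborel_shear:
  fixes f :: "('k \<Rightarrow> real) \<Rightarrow> ennreal"
  assumes K: "finite K" and "F \<subseteq> K"
    and f: "f \<in> borel_measurable (Pi\<^sub>M K (\<lambda>_. lborel))"
    and l: "\<And>\<kappa>. \<kappa> \<in> F \<Longrightarrow> l \<kappa> \<in> borel_measurable (Pi\<^sub>M K (\<lambda>_. lborel))"
    and lF: "\<And>\<kappa> g g'. \<kappa> \<in> F \<Longrightarrow> (\<And>j. j \<notin> F \<Longrightarrow> g j = g' j) \<Longrightarrow> l \<kappa> g = l \<kappa> g'"
  shows "(\<integral>\<^sup>+g. f (shear F l g) \<partial>Pi\<^sub>M K (\<lambda>_. lborel)) = (\<integral>\<^sup>+g. f g \<partial>Pi\<^sub>M K (\<lambda>_. lborel))"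
proof -
  have "finite F" using K \<open>F \<subseteq> K\<close> by (rule finite_subset[rotated])
  have "G \<subseteq> F \<Longrightarrow> (\<integral>\<^sup>+g. f (shear G l g) \<partial>Pi\<^sub>M K (\<lambda>_. lborel)) = (\<integral>\<^sup>+g. f g \<partial>Pi\<^sub>M K (\<lambda>_. lborel))" for G
  proof (induction "card G" arbitrary: G)
    case 0
    then have "G = {}" using \<open>finite F\<close> by (auto dest: finite_subset)
    then show ?case by (simp add: shear_def)
  next
    case (Suc n)
    then obtain i G' where G: "G = insert i G'" "i \<notin> G'" by (metis card_Suc_eq)
    have fG: "finite G'" using Suc.prems G \<open>finite F\<close> by (auto dest: finite_subset)
    with Suc G have n: "n = card G'" by simp
    have sub: "G' \<subseteq> F" "i \<in> F" "i \<in> K" using Suc.prems G \<open>F \<subseteq> K\<close> by auto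
    have lG: "l \<kappa> (g(i := y)) = l \<kappa> g" if "\<kappa> \<in> F" for \<kappa> g y
      using that sub by (intro lF) auto
    have sh: "shear G' l (g(i := g i + l i g)) = shear G l g" for g
    proof
      fix \<kappa>
      show "shear G' l (g(i := g i + l i g)) \<kappa> = shear G l g \<kappa>"
        using G sub lG by (cases "\<kappa> \<in> F") (auto simp: shear_def split: if_splits)
    qed
    have m: "(\<lambda>g. f (shear G' l g)) \<in> borel_measurable (Pi\<^sub>M K (\<lambda>_. lborel))"
      using sub \<open>F \<subseteq> K\<close> l by (intro measurable_compose[OF shear_measurable f]) auto
    have "(\<integral>\<^sup>+g. f (shear G l g) \<partial>Pi\<^sub>M K (\<lambda>_. lborel)) = (\<integral>\<^sup>+g. f (shear G' l g) \<partial>Pi\<^sub>M K (\<lambda>_. lborel))"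
      unfolding sh[symmetric] using sub
      by (intro lborel_shear_one[OF K \<open>i \<in> K\<close> m l] lF) auto
    also have "\<dots> = (\<integral>\<^sup>+g. f g \<partial>Pi\<^sub>M K (\<lambda>_. lborel))" using Suc.hyps(1)[OF n sub(1)] .
    finally show ?case .
  qed
  then show ?thesis by simp
qed

text \<open>The columns \<open>C \<cdot> h\<close> (\<open>h \<in> H\<close>) are orthonormal in \<open>\<real>\<^sup>F\<close>. The components of \<open>\<omega>|F\<close> along them are
moved to the coordinates in \<open>H\<close>, and in \<open>F\<close> they are replaced by the negatives of the old coordinates in \<open>H\<close>; the part of
\<open>\<omega>|F\<close> orthogonal to the columns stays. This is a rotation by a quarter turn in each of the planes spanned by
\<open>C \<cdot> h\<close> and the coordinate \<open>h\<close>.\<close>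

definition swap_isometry :: "'k set \<Rightarrow> 'k set \<Rightarrow> ('k \<Rightarrow> 'k \<Rightarrow> real) \<Rightarrow> ('k \<Rightarrow> real) \<Rightarrow> 'k \<Rightarrow> real" where
  "swap_isometry F H C \<omega> = (\<lambda>\<kappa>. if \<kappa> \<in> F then \<omega> \<kappa> - (\<Sum>h\<in>H. C \<kappa> h * (\<omega> h + (\<Sum>f\<in>F. C f h * \<omega> f)))
     else if \<kappa> \<in> H then (\<Sum>f\<in>F. C f \<kappa> * \<omega> f) else \<omega> \<kappa>)"

lemma swap_isometry_norm:
  assumes FH: "finite F" "finite H" "F \<inter> H = {}"
    and C: "\<And>h h'. h \<in> H \<Longrightarrow> h' \<in> H \<Longrightarrow> (\<Sum>f\<in>F. C f h * C f h') = (if h = h' then 1 else 0)"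
  shows "(\<Sum>\<kappa>\<in>F \<union> H. (swap_isometry F H C \<omega> \<kappa>)\<^sup>2) = (\<Sum>\<kappa>\<in>F \<union> H. (\<omega> \<kappa>)\<^sup>2)"
proof -
  define a where "a h = (\<Sum>f\<in>F. C f h * \<omega> f)" for h
  define b where "b h = \<omega> h + a h" for h
  have 1: "(\<Sum>f\<in>F. \<omega> f * (\<Sum>h\<in>H. C f h * b h)) = (\<Sum>h\<in>H. a h * b h)"
    unfolding a_def sum_distrib_left sum_distrib_right
    by (subst sum.swap) (simp add: mult_ac)
  have 2: "(\<Sum>f\<in>F. (\<Sum>h\<in>H. C f h * b h)\<^sup>2) = (\<Sum>h\<in>H. (b h)\<^sup>2)"
  proof -
    have "(\<Sum>f\<in>F. (\<Sum>h\<in>H. C f h * b h)\<^sup>2) = (\<Sum>f\<in>F. \<Sum>h\<in>H. \<Sum>h'\<in>H. C f h * C f h' * (b h * b h'))"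
      unfolding power2_eq_square sum_product by (intro sum.cong refl) (simp add: mult_ac)
    also have "\<dots> = (\<Sum>h\<in>H. \<Sum>f\<in>F. \<Sum>h'\<in>H. C f h * C f h' * (b h * b h'))"
      by (rule sum.swap)
    also have "\<dots> = (\<Sum>h\<in>H. \<Sum>h'\<in>H. \<Sum>f\<in>F. C f h * C f h' * (b h * b h'))"
      by (rule sum.cong[OF refl], rule sum.swap)
    also have "\<dots> = (\<Sum>h\<in>H. \<Sum>h'\<in>H. (if h = h' then 1 else 0) * (b h * b h'))"
      using C by (intro sum.cong refl) (simp add: sum_distrib_right[symmetric])
    also have "\<dots> = (\<Sum>h\<in>H. (b h)\<^sup>2)"
      using FH by (intro sum.cong refl) (simp add: if_distrib[of "\<lambda>x. x * _"] power2_eq_square cong: if_cong)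
    finally show ?thesis .
  qed
  have "(\<Sum>\<kappa>\<in>F \<union> H. (swap_isometry F H C \<omega> \<kappa>)\<^sup>2)
      = (\<Sum>f\<in>F. (\<omega> f - (\<Sum>h\<in>H. C f h * b h))\<^sup>2) + (\<Sum>h\<in>H. (a h)\<^sup>2)"
  proof -
    have "(\<Sum>\<kappa>\<in>H. (swap_isometry F H C \<omega> \<kappa>)\<^sup>2) = (\<Sum>h\<in>H. (a h)\<^sup>2)"
      using FH by (intro sum.cong) (auto simp: swap_isometry_def a_def)
    moreover have "(\<Sum>\<kappa>\<in>F. (swap_isometry F H C \<omega> \<kappa>)\<^sup>2) = (\<Sum>f\<in>F. (\<omega> f - (\<Sum>h\<in>H. C f h * b h))\<^sup>2)"
      by (intro sum.cong) (auto simp: swap_isometry_def a_def b_def)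
    ultimately show ?thesis using FH by (simp add: sum.union_disjoint)
  qed
  also have "(\<Sum>f\<in>F. (\<omega> f - (\<Sum>h\<in>H. C f h * b h))\<^sup>2)
     = (\<Sum>f\<in>F. (\<omega> f)\<^sup>2) - 2 * (\<Sum>h\<in>H. a h * b h) + (\<Sum>h\<in>H. (b h)\<^sup>2)"
    unfolding 1[symmetric] 2[symmetric]
    by (simp add: power2_diff sum.distrib sum_subtractf sum_distrib_left mult_ac)
  also have "\<dots> + (\<Sum>h\<in>H. (a h)\<^sup>2) = (\<Sum>f\<in>F. (\<omega> f)\<^sup>2) + (\<Sum>h\<in>H. - 2 * (a h * b h) + (b h)\<^sup>2 + (a h)\<^sup>2)"
    by (simp add: sum.distrib sum_distrib_left sum_negf sum_subtractf)
  also have "(\<Sum>h\<in>H. - 2 * (a h * b h) + (b h)\<^sup>2 + (a h)\<^sup>2) = (\<Sum>h\<in>H. (\<omega> h)\<^sup>2)"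
    by (intro sum.cong refl) (simp add: b_def power2_eq_square algebra_simps)
  also have "(\<Sum>f\<in>F. (\<omega> f)\<^sup>2) + (\<Sum>h\<in>H. (\<omega> h)\<^sup>2) = (\<Sum>\<kappa>\<in>F \<union> H. (\<omega> \<kappa>)\<^sup>2)"
    using FH by (simp add: sum.union_disjoint)
  finally show ?thesis .
qed

text \<open>A quarter turn is a product of three shears, each of which preserves Lebesgue measure.\<close>

lemma swap_isometry_shears:
  assumes FH: "finite F" "finite H" "F \<inter> H = {}"
    and C: "\<And>h h'. h \<in> H \<Longrightarrow> h' \<in> H \<Longrightarrow> (\<Sum>f\<in>F. C f h * C f h') = (if h = h' then 1 else 0)"
  defines "u \<equiv> shear F (\<lambda>\<kappa> g. - (\<Sum>h\<in>H. C \<kappa> h * g h))"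
    and "v \<equiv> shear H (\<lambda>\<kappa> g. \<Sum>f\<in>F. C f \<kappa> * g f)"
  shows "swap_isometry F H C \<omega> = u (v (u \<omega>))"
proof
  fix \<kappa>
  define a where "a h = (\<Sum>f\<in>F. C f h * \<omega> f)" for h
  have uF: "u g f = g f - (\<Sum>h\<in>H. C f h * g h)" if "f \<in> F" for f g
    using that by (simp add: u_def shear_def)
  have uN: "u g f = g f" if "f \<notin> F" for f g using that by (simp add: u_def shear_def)
  have vH: "v g h = g h + (\<Sum>f\<in>F. C f h * g f)" if "h \<in> H" for h g
    using that by (simp add: v_def shear_def)
  have vN: "v g h = g h" if "h \<notin> H" for h g using that by (simp add: v_def shear_def)
  have HF: "h \<notin> F" if "h \<in> H" for h using that FH by auto
  have FH': "f \<notin> H" if "f \<in> F" for f using that FH by auto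
  have vuH: "v (u \<omega>) h = a h" if h: "h \<in> H" for h
  proof -
    have "(\<Sum>f\<in>F. C f h * (\<Sum>h'\<in>H. C f h' * \<omega> h')) = (\<Sum>h'\<in>H. \<Sum>f\<in>F. C f h * C f h' * \<omega> h')"
      unfolding sum_distrib_left by (subst sum.swap) (simp add: mult_ac)
    also have "\<dots> = (\<Sum>h'\<in>H. (if h = h' then 1 else 0) * \<omega> h')"
      using C h by (intro sum.cong refl) (simp add: sum_distrib_right[symmetric])
    also have "\<dots> = \<omega> h" using FH h by (simp add: if_distrib[of "\<lambda>x. x * _"] cong: if_cong)
    finally show ?thesis
      using h by (simp add: vH uN HF uF right_diff_distrib sum_subtractf a_def)
  qed
  show "swap_isometry F H C \<omega> \<kappa> = u (v (u \<omega>)) \<kappa>"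
  proof (cases "\<kappa> \<in> F")
    case True
    then have "u (v (u \<omega>)) \<kappa> = \<omega> \<kappa> - (\<Sum>h\<in>H. C \<kappa> h * \<omega> h) - (\<Sum>h\<in>H. C \<kappa> h * a h)"
      using vuH by (simp add: uF vN FH')
    then show ?thesis using True
      by (simp add: swap_isometry_def a_def[symmetric] distrib_left sum.distrib)
  next
    case False
    then show ?thesis using vuH[of \<kappa>]
      by (auto simp: swap_isometry_def uN vN a_def)
  qed
qed

lemma prod_std_normal_density:
  assumes "finite K"
  shows "(\<Prod>\<kappa>\<in>K. ennreal (std_normal_density (g \<kappa>))) =
    ennreal ((1 / sqrt (2 * pi)) ^ card K * exp (- (\<Sum>\<kappa>\<in>K. (g \<kappa>)\<^sup>2) / 2))"
  using assms
  by (simp add: prod_ennreal std_normal_density_def prod_dividef exp_sum[symmetric] sum_negf sum_divide_distrib power_one_over)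

text \<open>Lebesgue measure and the Euclidean norm are preserved, hence so is the Gaussian density.\<close>

lemma distr_swap_isometry:
  assumes FH: "finite F" "finite H" "F \<inter> H = {}"
    and C: "\<And>h h'. h \<in> H \<Longrightarrow> h' \<in> H \<Longrightarrow> (\<Sum>f\<in>F. C f h * C f h') = (if h = h' then 1 else 0)"
  shows "swap_isometry F H C \<in> measurable gauss gauss"
    and "distr gauss gauss (swap_isometry F H C) = (gauss :: ('k \<Rightarrow> real) measure)"
proof -
  show m: "swap_isometry F H C \<in> measurable gauss gauss"
    unfolding swap_isometry_def by (rule measurable_into_gauss) measurable
  show "distr gauss gauss (swap_isometry F H C) = (gauss :: ('k \<Rightarrow> real) measure)"
  proof (rule gauss_eqI)
    show "prob_space (distr gauss gauss (swap_isometry F H C))"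
      by (rule gauss.prob_space_distr[OF m])
    fix J :: "'k set" and A :: "'k \<Rightarrow> real set"
    assume J: "finite J" and A: "\<And>\<kappa>. \<kappa> \<in> J \<Longrightarrow> A \<kappa> \<in> sets borel"
    define K where "K = J \<union> F \<union> H"
    have K: "finite K" "J \<subseteq> K" "F \<subseteq> K" "H \<subseteq> K" using J FH by (auto simp: K_def)
    define L where "L = Pi\<^sub>M K (\<lambda>_. lborel :: real measure)"
    define w where "w g = (\<Prod>\<kappa>\<in>K. ennreal (std_normal_density (g \<kappa>)))" for g :: "'k \<Rightarrow> real"
    define q where "q g = (\<Prod>\<kappa>\<in>J. indicator (A \<kappa>) (g \<kappa>) :: ennreal)" for g :: "'k \<Rightarrow> real"
    let ?P = "swap_isometry F H C"
    let ?u = "shear F (\<lambda>\<kappa> g. - (\<Sum>h\<in>H. C \<kappa> h * g h))"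
    let ?v = "shear H (\<lambda>\<kappa> g. \<Sum>f\<in>F. C f \<kappa> * g f)"
    have coordL: "(\<lambda>g. g \<kappa>) \<in> borel_measurable L" if "\<kappa> \<in> K" for \<kappa>
      using that unfolding L_def by (rule coordinate_measurable_lborel)
    have Psh: "?P = (\<lambda>g. ?u (?v (?u g)))"
      using swap_isometry_shears[OF FH C] by auto
    have um: "?u \<in> measurable L L" unfolding L_def
      using K by (intro shear_measurable) (auto intro!: borel_measurable_uminus borel_measurable_sum
          borel_measurable_times coordL[unfolded L_def])
    have vm: "?v \<in> measurable L L" unfolding L_def
      using K by (intro shear_measurable) (auto intro!: borel_measurable_sum borel_measurable_times
          coordL[unfolded L_def])
    have Pm: "?P \<in> measurable L L"
      unfolding Psh by (intro measurable_compose[OF um] measurable_compose[OF vm] um)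
    have qm: "q \<in> borel_measurable L"
      unfolding q_def using K A by (intro borel_measurable_prod_ennreal
          measurable_compose[OF coordL borel_measurable_indicator]) auto
    have wm: "w \<in> borel_measurable L"
      unfolding w_def by (intro borel_measurable_prod_ennreal measurable_compose[OF coordL]) auto
    have wP: "w (?P g) = w g" for g
    proof -
      have "(\<Sum>\<kappa>\<in>K. (?P g \<kappa>)\<^sup>2) = (\<Sum>\<kappa>\<in>F \<union> H. (?P g \<kappa>)\<^sup>2) + (\<Sum>\<kappa>\<in>K - (F \<union> H). (?P g \<kappa>)\<^sup>2)"
        using K by (subst sum.subset_diff[of "F \<union> H" K]) auto
      also have "(\<Sum>\<kappa>\<in>K - (F \<union> H). (?P g \<kappa>)\<^sup>2) = (\<Sum>\<kappa>\<in>K - (F \<union> H). (g \<kappa>)\<^sup>2)"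
        by (intro sum.cong) (auto simp: swap_isometry_def)
      also have "(\<Sum>\<kappa>\<in>F \<union> H. (?P g \<kappa>)\<^sup>2) = (\<Sum>\<kappa>\<in>F \<union> H. (g \<kappa>)\<^sup>2)"
        by (rule swap_isometry_norm[OF FH C])
      also have "(\<Sum>\<kappa>\<in>F \<union> H. (g \<kappa>)\<^sup>2) + (\<Sum>\<kappa>\<in>K - (F \<union> H). (g \<kappa>)\<^sup>2) = (\<Sum>\<kappa>\<in>K. (g \<kappa>)\<^sup>2)"
        using K by (subst sum.subset_diff[of "F \<union> H" K]) auto
      finally show ?thesis using K by (simp add: w_def prod_std_normal_density)
    qed
    have gaussq: "(\<integral>\<^sup>+\<omega>. f \<omega> \<partial>gauss) = (\<integral>\<^sup>+g. w g * f g \<partial>L)"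
      if f: "f \<in> borel_measurable L" and fK: "\<And>\<omega>. f (restrict \<omega> K) = f \<omega>" for f :: "('k \<Rightarrow> real) \<Rightarrow> ennreal"
    proof -
      have f': "f \<in> borel_measurable (Pi\<^sub>M K (\<lambda>_. N01))"
        using f unfolding L_def by (subst measurable_cong_sets[OF sets_PiM_cong refl]) auto
      have "(\<integral>\<^sup>+\<omega>. f \<omega> \<partial>gauss) = (\<integral>\<^sup>+\<omega>. f (restrict \<omega> K) \<partial>gauss)" by (simp add: fK)
      also have "\<dots> = (\<integral>\<^sup>+g. f g \<partial>distr gauss (Pi\<^sub>M K (\<lambda>_. N01)) (\<lambda>x. restrict x K))"
        using f' by (intro nn_integral_distr[symmetric]) (auto simp: gauss_def intro!: measurable_restrict_subset simp del: restrict_apply)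
      also have "distr gauss (Pi\<^sub>M K (\<lambda>_. N01)) (\<lambda>x. restrict x K) = Pi\<^sub>M K (\<lambda>_. N01)"
        unfolding gauss_def by (rule N01_prod.distr_PiM_restrict_finite) (use K in auto)
      also have "\<dots> = density L w" unfolding L_def w_def by (rule PiM_density_lborel[OF K(1)])
      also have "(\<integral>\<^sup>+g. f g \<partial>density L w) = (\<integral>\<^sup>+g. w g * f g \<partial>L)"
        using f wm by (intro nn_integral_density) auto
      finally show ?thesis .
    qed
    have lsh: "(\<integral>\<^sup>+g. f (?P g) \<partial>L) = (\<integral>\<^sup>+g. f g \<partial>L)" if f: "f \<in> borel_measurable L" for f :: "('k \<Rightarrow> real) \<Rightarrow> ennreal"
    proof -
      have su: "(\<integral>\<^sup>+g. f (?u g) \<partial>L) = (\<integral>\<^sup>+g. f g \<partial>L)" if f: "f \<in> borel_measurable L" for f :: "('k \<Rightarrow> real) \<Rightarrow> ennreal"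
        unfolding L_def
      proof (rule lborel_shear[OF K(1) K(3) f[unfolded L_def]])
        fix \<kappa> and g g' :: "'k \<Rightarrow> real" assume "\<And>j. j \<notin> F \<Longrightarrow> g j = g' j"
        then show "- (\<Sum>h\<in>H. C \<kappa> h * g h) = - (\<Sum>h\<in>H. C \<kappa> h * g' h)"
          using FH by (metis (no_types, lifting) disjoint_iff sum.cong)
      qed (use K in \<open>auto intro!: borel_measurable_uminus borel_measurable_sum
          borel_measurable_times coordL[unfolded L_def]\<close>)
      have sv: "(\<integral>\<^sup>+g. f (?v g) \<partial>L) = (\<integral>\<^sup>+g. f g \<partial>L)" if f: "f \<in> borel_measurable L" for f :: "('k \<Rightarrow> real) \<Rightarrow> ennreal"
        unfolding L_def
      proof (rule lborel_shear[OF K(1) K(4) f[unfolded L_def]])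
        fix \<kappa> and g g' :: "'k \<Rightarrow> real" assume "\<And>j. j \<notin> H \<Longrightarrow> g j = g' j"
        then show "(\<Sum>f\<in>F. C f \<kappa> * g f) = (\<Sum>f\<in>F. C f \<kappa> * g' f)"
          using FH by (metis (no_types, lifting) disjoint_iff sum.cong)
      qed (use K in \<open>auto intro!: borel_measurable_sum
          borel_measurable_times coordL[unfolded L_def]\<close>)
      show ?thesis
        unfolding Psh
        using su[of "\<lambda>g. f (?u (?v g))"] sv[of "\<lambda>g. f (?u g)"] su[OF f]
          measurable_compose[OF um f] measurable_compose[OF vm measurable_compose[OF um f]]
        by simp
    qed
    have setJ: "{\<omega>. \<forall>\<kappa>\<in>J. \<omega> \<kappa> \<in> A \<kappa>} \<in> sets gauss"
    proof -
      have "{\<omega> \<in> space gauss. \<forall>\<kappa>\<in>J. \<omega> \<kappa> \<in> A \<kappa>} \<in> sets gauss"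
        using J A by (intro sets.sets_Collect_finite_All)
           auto
      then show ?thesis by simp
    qed
    have ind: "indicator {\<omega>. \<forall>\<kappa>\<in>J. \<omega> \<kappa> \<in> A \<kappa>} \<omega> = q \<omega>" for \<omega>
      using J by (auto simp: q_def indicator_def prod_zero_iff split: if_splits)
    have "emeasure (distr gauss gauss ?P) {\<omega>. \<forall>\<kappa>\<in>J. \<omega> \<kappa> \<in> A \<kappa>}
        = (\<integral>\<^sup>+\<omega>. indicator {\<omega>. \<forall>\<kappa>\<in>J. \<omega> \<kappa> \<in> A \<kappa>} \<omega> \<partial>distr gauss gauss ?P)"
      using setJ by simp
    also have "\<dots> = (\<integral>\<^sup>+\<omega>. indicator {\<omega>. \<forall>\<kappa>\<in>J. \<omega> \<kappa> \<in> A \<kappa>} (?P \<omega>) \<partial>gauss)"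
      using m setJ by (intro nn_integral_distr) auto
    also have "\<dots> = (\<integral>\<^sup>+\<omega>. q (?P \<omega>) \<partial>gauss)" by (simp add: ind)
    also have "\<dots> = (\<integral>\<^sup>+g. w g * q (?P g) \<partial>L)"
    proof (rule gaussq)
      show "(\<lambda>g. q (?P g)) \<in> borel_measurable L" by (rule measurable_compose[OF Pm qm])
      fix \<omega> :: "'k \<Rightarrow> real"
      have r: "restrict \<omega> K \<kappa> = \<omega> \<kappa>" if "\<kappa> \<in> K" for \<kappa> using that by simp
      have "?P (restrict \<omega> K) \<kappa> = ?P \<omega> \<kappa>" if "\<kappa> \<in> J" for \<kappa>
        using that K unfolding swap_isometry_def
        by (auto simp: subset_eq intro!: sum.cong)
      then show "q (?P (restrict \<omega> K)) = q (?P \<omega>)" by (simp add: q_def)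
    qed
    also have "\<dots> = (\<integral>\<^sup>+g. w (?P g) * q (?P g) \<partial>L)" by (simp add: wP)
    also have "\<dots> = (\<integral>\<^sup>+g. w g * q g \<partial>L)" using wm qm by (intro lsh) auto
    also have "\<dots> = (\<integral>\<^sup>+\<omega>. q \<omega> \<partial>gauss)"
      using K by (intro gaussq[symmetric] qm) (auto simp: q_def subset_eq intro!: prod.cong)
    also have "\<dots> = emeasure gauss {\<omega>. \<forall>\<kappa>\<in>J. \<omega> \<kappa> \<in> A \<kappa>}"
      using setJ by (simp add: ind[symmetric])
    also have "\<dots> = (\<Prod>\<kappa>\<in>J. emeasure N01 (A \<kappa>))" by (rule emeasure_gauss_cylinder[OF J A])
    finally show "emeasure (distr gauss gauss ?P) {\<omega>. \<forall>\<kappa>\<in>J. \<omega> \<kappa> \<in> A \<kappa>} = (\<Prod>\<kappa>\<in>J. emeasure N01 (A \<kappa>))" .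
  qed simp
qed

section \<open>Linear forms in independent Gaussian coordinates\<close>

lemma distr_gauss_coordinate: "distr gauss borel (\<lambda>\<omega>. \<omega> \<kappa>) = N01"
proof -
  have "distr gauss N01 (\<lambda>\<omega>. \<omega> \<kappa>) = N01"
    unfolding gauss_def by (rule distr_PiM_component) (auto intro: N01.prob_space_axioms)
  moreover have "distr gauss N01 (\<lambda>\<omega>. \<omega> \<kappa>) = distr gauss borel (\<lambda>\<omega>. \<omega> \<kappa>)"
    by (rule distr_cong) auto
  ultimately show ?thesis by simp
qed

lemma indep_gauss_coordinates: "gauss.indep_vars (\<lambda>_. borel) (\<lambda>\<kappa> \<omega>. \<omega> \<kappa>) (UNIV :: 'k set)"
proof -
  have "distr gauss (Pi\<^sub>M UNIV (\<lambda>_. borel)) (\<lambda>x :: 'k \<Rightarrow> real. \<lambda>i\<in>UNIV. x i) = gauss"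
    by (simp add: distr_id2[OF sets_gauss[symmetric]] restrict_UNIV)
  also have "\<dots> = Pi\<^sub>M UNIV (\<lambda>i. distr gauss borel (\<lambda>\<omega> :: 'k \<Rightarrow> real. \<omega> i))"
    unfolding distr_gauss_coordinate by (rule gauss_def)
  finally show ?thesis
    by (subst gauss.indep_vars_iff_distr_eq_PiM) auto
qed

lemma indep_disjoint_blocks:
  assumes F: "disjoint_family_on F L"
    and m: "\<And>i. i \<in> L \<Longrightarrow> f i \<in> borel_measurable gauss"
    and dep: "\<And>i \<omega> \<omega>'. i \<in> L \<Longrightarrow> (\<And>\<kappa>. \<kappa> \<in> F i \<Longrightarrow> \<omega> \<kappa> = \<omega>' \<kappa>) \<Longrightarrow> f i \<omega> = f i \<omega>'"
  shows "gauss.indep_vars (\<lambda>_. borel) (f :: 'i \<Rightarrow> ('k \<Rightarrow> real) \<Rightarrow> real) L"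
proof -
  define e where "e i r = (\<lambda>\<kappa>. if \<kappa> \<in> F i then r \<kappa> else 0 :: real)" for i and r :: "'k \<Rightarrow> real"
  have e: "e i \<in> measurable (Pi\<^sub>M (F i) (\<lambda>_. borel)) gauss" for i
  proof (rule measurable_into_gauss)
    fix \<kappa>
    show "(\<lambda>r. e i r \<kappa>) \<in> borel_measurable (Pi\<^sub>M (F i) (\<lambda>_. borel))"
      unfolding e_def by (cases "\<kappa> \<in> F i") auto
  qed
  have "gauss.indep_vars (\<lambda>i. Pi\<^sub>M (F i) (\<lambda>_. borel)) (\<lambda>i \<omega>. restrict (\<lambda>\<kappa>. \<omega> \<kappa>) (F i)) L"
    by (rule gauss.indep_vars_restrict[OF indep_gauss_coordinates _ F]) auto
  from gauss.indep_vars_compose2[OF this, of "\<lambda>i r. f i (e i r)" "\<lambda>_. borel"]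
  have "gauss.indep_vars (\<lambda>_. borel) (\<lambda>i \<omega>. f i (e i (restrict \<omega> (F i)))) L"
    using measurable_compose[OF e m] by simp
  moreover have "f i (e i (restrict \<omega> (F i))) = f i \<omega>" if "i \<in> L" for i \<omega>
    by (rule dep[OF that]) (simp add: e_def)
  ultimately show ?thesis
    by (subst gauss.indep_vars_cong[where Y = "\<lambda>i \<omega>. f i (e i (restrict \<omega> (F i)))"]) auto
qed

lemma distributed_linear_form:
  assumes F: "finite F" and v: "(\<Sum>\<kappa>\<in>F. (c \<kappa>)\<^sup>2) > 0"
  shows "distributed gauss lborel (\<lambda>\<omega>. \<Sum>\<kappa>\<in>F. c \<kappa> * \<omega> \<kappa>) (normal_density 0 (sqrt (\<Sum>\<kappa>\<in>F. (c \<kappa>)\<^sup>2)))"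
proof -
  define F' where "F' = {\<kappa> \<in> F. c \<kappa> \<noteq> 0}"
  have "F' \<noteq> {}"
  proof
    assume "F' = {}"
    then have "\<forall>\<kappa>\<in>F. c \<kappa> = 0" by (auto simp: F'_def)
    with v show False by simp
  qed
  then have F': "finite F'" "F' \<noteq> {}" using F by (auto simp: F'_def)
  have coord: "distributed gauss lborel (\<lambda>\<omega>. \<omega> \<kappa>) (normal_density 0 1)" for \<kappa>
  proof -
    have "distr gauss lborel (\<lambda>\<omega>. \<omega> \<kappa>) = N01"
      using distr_gauss_coordinate[of \<kappa>] by (simp cong: distr_cong)
    then show ?thesis by (auto simp: distributed_def)
  qed
  have "distributed gauss lborel (\<lambda>\<omega>. \<Sum>\<kappa>\<in>F'. c \<kappa> * \<omega> \<kappa>)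
     (normal_density (\<Sum>\<kappa>\<in>F'. 0) (sqrt (\<Sum>\<kappa>\<in>F'. \<bar>c \<kappa>\<bar>\<^sup>2)))"
  proof (rule gauss.sum_indep_normal[OF F'])
    have "gauss.indep_vars (\<lambda>_. borel) (\<lambda>\<kappa> \<omega>. \<omega> \<kappa>) F'"
      using indep_gauss_coordinates by (rule gauss.indep_vars_subset) auto
    then show "gauss.indep_vars (\<lambda>_. borel) (\<lambda>\<kappa> \<omega>. c \<kappa> * \<omega> \<kappa>) F'"
      by (rule gauss.indep_vars_compose2) auto
    show "distributed gauss lborel (\<lambda>\<omega>. c \<kappa> * \<omega> \<kappa>) (normal_density 0 \<bar>c \<kappa>\<bar>)" if "\<kappa> \<in> F'" for \<kappa>
      using gauss.normal_density_affine[OF coord[of \<kappa>], of "c \<kappa>" 0] that by (simp add: F'_def)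
  qed (auto simp: F'_def)
  moreover have "(\<Sum>\<kappa>\<in>F'. c \<kappa> * \<omega> \<kappa>) = (\<Sum>\<kappa>\<in>F. c \<kappa> * \<omega> \<kappa>)" for \<omega>
    using F by (intro sum.mono_neutral_left) (auto simp: F'_def)
  moreover have "(\<Sum>\<kappa>\<in>F'. \<bar>c \<kappa>\<bar>\<^sup>2) = (\<Sum>\<kappa>\<in>F. (c \<kappa>)\<^sup>2)"
    using F by (simp, intro sum.mono_neutral_left) (auto simp: F'_def)
  ultimately show ?thesis by simp
qed

text \<open>The coefficients stay hidden: the arguments below
use only the block \<open>F\<close> on which the form depends and its Gaussian tail.\<close>

definition unit_form :: "'k set \<Rightarrow> (('k \<Rightarrow> real) \<Rightarrow> real) \<Rightarrow> bool" where
  "unit_form F g \<longleftrightarrow> finite F \<and> (\<exists>c. g = (\<lambda>\<omega>. \<Sum>\<kappa>\<in>F. c \<kappa> * \<omega> \<kappa>) \<and> (\<Sum>\<kappa>\<in>F. (c \<kappa>)\<^sup>2) \<le> 1)"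

lemma unit_form_mono:
  assumes "unit_form F g" "F \<subseteq> F'" "finite F'"
  shows "unit_form F' g"
proof -
  from assms(1) obtain c where c: "finite F" "g = (\<lambda>\<omega>. \<Sum>\<kappa>\<in>F. c \<kappa> * \<omega> \<kappa>)" "(\<Sum>\<kappa>\<in>F. (c \<kappa>)\<^sup>2) \<le> 1"
    by (auto simp: unit_form_def)
  define c' where "c' \<kappa> = (if \<kappa> \<in> F then c \<kappa> else 0)" for \<kappa>
  have "(\<Sum>\<kappa>\<in>F. c \<kappa> * \<omega> \<kappa>) = (\<Sum>\<kappa>\<in>F'. c' \<kappa> * \<omega> \<kappa>)" for \<omega>
    using assms by (intro sum.mono_neutral_cong_left) (auto simp: c'_def)
  moreover have "(\<Sum>\<kappa>\<in>F. (c \<kappa>)\<^sup>2) = (\<Sum>\<kappa>\<in>F'. (c' \<kappa>)\<^sup>2)"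
    using assms by (intro sum.mono_neutral_cong_left) (auto simp: c'_def)
  ultimately show ?thesis using c assms(3) by (auto simp: unit_form_def intro!: exI[of _ c'])
qed

lemma unit_form_reindex:
  assumes "finite J" "inj_on \<iota> J" "(\<Sum>j\<in>J. (p j)\<^sup>2) \<le> 1"
  shows "unit_form (\<iota> ` J) (\<lambda>\<omega>. \<Sum>j\<in>J. p j * \<omega> (\<iota> j))"
proof -
  define c where "c \<kappa> = p (the_inv_into J \<iota> \<kappa>)" for \<kappa>
  have c: "c (\<iota> j) = p j" if "j \<in> J" for j
    using that assms(2) by (simp add: c_def the_inv_into_f_f)
  have "(\<Sum>j\<in>J. p j * \<omega> (\<iota> j)) = (\<Sum>\<kappa>\<in>\<iota> ` J. c \<kappa> * \<omega> \<kappa>)" for \<omega>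
    using assms by (simp add: sum.reindex c)
  moreover have "(\<Sum>\<kappa>\<in>\<iota> ` J. (c \<kappa>)\<^sup>2) \<le> 1" using assms by (simp add: sum.reindex c)
  ultimately show ?thesis using assms by (auto simp: unit_form_def intro!: exI[of _ c])
qed

lemma unit_form_coordinate: "unit_form {\<kappa>} (\<lambda>\<omega>. \<omega> \<kappa>)"
  unfolding unit_form_def by (auto intro!: exI[of _ "\<lambda>_. 1"])

lemma unit_form_measurable [measurable_dest]: "unit_form F g \<Longrightarrow> g \<in> borel_measurable gauss"
  by (auto simp: unit_form_def)

lemma unit_form_cong: "unit_form F g \<Longrightarrow> (\<And>\<kappa>. \<kappa> \<in> F \<Longrightarrow> \<omega> \<kappa> = \<omega>' \<kappa>) \<Longrightarrow> g \<omega> = g \<omega>'"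
  by (auto simp: unit_form_def)

lemma unit_form_cases:
  assumes "unit_form F g"
  obtains "g = (\<lambda>_. 0)" | s where "0 < s" "s \<le> 1" "distributed gauss lborel g (normal_density 0 s)"
proof -
  from assms obtain c where c: "finite F" "g = (\<lambda>\<omega>. \<Sum>\<kappa>\<in>F. c \<kappa> * \<omega> \<kappa>)" "(\<Sum>\<kappa>\<in>F. (c \<kappa>)\<^sup>2) \<le> 1"
    by (auto simp: unit_form_def)
  show ?thesis
  proof (cases "(\<Sum>\<kappa>\<in>F. (c \<kappa>)\<^sup>2) = 0")
    case True
    then have "\<forall>\<kappa>\<in>F. c \<kappa> = 0" using c by (simp add: sum_nonneg_eq_0_iff)
    then show ?thesis using c by (intro that(1)) auto
  next
    case False
    moreover have "(\<Sum>\<kappa>\<in>F. (c \<kappa>)\<^sup>2) \<ge> 0" by (simp add: sum_nonneg)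
    ultimately have "(\<Sum>\<kappa>\<in>F. (c \<kappa>)\<^sup>2) > 0" by simp
    then show ?thesis
      using that(2)[of "sqrt (\<Sum>\<kappa>\<in>F. (c \<kappa>)\<^sup>2)"] distributed_linear_form[OF c(1)] c by simp
  qed
qed

lemma nn_integral_normal_exp:
  assumes s: "0 < s"
  shows "(\<integral>\<^sup>+x. ennreal (normal_density 0 s x) * ennreal (exp (\<theta> * x)) \<partial>lborel) = ennreal (exp (\<theta>\<^sup>2 * s\<^sup>2 / 2))"
proof -
  have *: "normal_density 0 s x * exp (\<theta> * x) = exp (\<theta>\<^sup>2 * s\<^sup>2 / 2) * normal_density (\<theta> * s\<^sup>2) s x" for x
  proof -
    have "- x\<^sup>2 / (2 * s\<^sup>2) + \<theta> * x = \<theta>\<^sup>2 * s\<^sup>2 / 2 + - (x - \<theta> * s\<^sup>2)\<^sup>2 / (2 * s\<^sup>2)"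
      using s by (simp add: field_simps power2_eq_square)
    then show ?thesis
      by (simp add: normal_density_def exp_add[symmetric] mult.assoc mult.left_commute)
  qed
  have "(\<integral>\<^sup>+x. ennreal (normal_density 0 s x) * ennreal (exp (\<theta> * x)) \<partial>lborel)
     = (\<integral>\<^sup>+x. ennreal (exp (\<theta>\<^sup>2 * s\<^sup>2 / 2)) * ennreal (normal_density (\<theta> * s\<^sup>2) s x) \<partial>lborel)"
    by (intro nn_integral_cong) (simp add: ennreal_mult[symmetric] *)
  also have "\<dots> = ennreal (exp (\<theta>\<^sup>2 * s\<^sup>2 / 2)) * (\<integral>\<^sup>+x. ennreal (normal_density (\<theta> * s\<^sup>2) s x) \<partial>lborel)"
    by (rule nn_integral_cmult) auto
  also have "(\<integral>\<^sup>+x. ennreal (normal_density (\<theta> * s\<^sup>2) s x) \<partial>lborel) = 1"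
    using s by (subst nn_integral_eq_integral) auto
  finally show ?thesis by simp
qed

lemma unit_form_upper_tail:
  assumes g: "unit_form F g" and R: "0 \<le> R"
  shows "measure gauss {\<omega>. R \<le> g \<omega>} \<le> exp (- R\<^sup>2 / 2)"
  using g
proof (cases rule: unit_form_cases)
  case 1
  show ?thesis
  proof (cases "R = 0")
    case False
    with 1 R show ?thesis by auto
  qed simp
next
  case (2 s)
  note [measurable] = unit_form_measurable[OF g]
  have m: "{\<omega>. R \<le> g \<omega>} \<in> sets gauss"
    using measurable_sets[OF unit_form_measurable[OF g], of "{R..}"] by (simp add: vimage_def)
  have "emeasure gauss {\<omega>. R \<le> g \<omega>} = (\<integral>\<^sup>+\<omega>. indicator {\<omega>. R \<le> g \<omega>} \<omega> \<partial>gauss)"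
    using m by simp
  also have "\<dots> \<le> (\<integral>\<^sup>+\<omega>. ennreal (exp (- R\<^sup>2)) * ennreal (exp (R * g \<omega>)) \<partial>gauss)"
    using R by (intro nn_integral_mono)
      (auto simp: indicator_def ennreal_mult[symmetric] exp_add[symmetric] power2_eq_square
        right_diff_distrib[symmetric])
  also have "\<dots> = ennreal (exp (- R\<^sup>2)) * (\<integral>\<^sup>+\<omega>. ennreal (exp (R * g \<omega>)) \<partial>gauss)"
    by (rule nn_integral_cmult) measurable
  also have "(\<integral>\<^sup>+\<omega>. ennreal (exp (R * g \<omega>)) \<partial>gauss) = ennreal (exp (R\<^sup>2 * s\<^sup>2 / 2))"
    using distributed_nn_integral[OF 2(3), of "\<lambda>x. ennreal (exp (R * x))"] nn_integral_normal_exp[OF 2(1), of R]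
    by simp
  also have "ennreal (exp (- R\<^sup>2)) * \<dots> \<le> ennreal (exp (- R\<^sup>2 / 2))"
  proof -
    have "R\<^sup>2 * s\<^sup>2 \<le> R\<^sup>2 * 1" using 2 by (intro mult_left_mono) (auto simp: abs_square_le_1)
    then show ?thesis by (auto simp: ennreal_mult[symmetric] exp_add[symmetric] intro!: ennreal_leI)
  qed
  finally show ?thesis by (simp add: gauss.emeasure_eq_measure)
qed

lemma unit_form_uminus: "unit_form F g \<Longrightarrow> unit_form F (\<lambda>\<omega>. - g \<omega>)"
proof -
  assume "unit_form F g"
  then obtain c where c: "finite F" "g = (\<lambda>\<omega>. \<Sum>\<kappa>\<in>F. c \<kappa> * \<omega> \<kappa>)" "(\<Sum>\<kappa>\<in>F. (c \<kappa>)\<^sup>2) \<le> 1"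
    by (auto simp: unit_form_def)
  then show ?thesis
    unfolding unit_form_def by (intro conjI exI[of _ "\<lambda>\<kappa>. - c \<kappa>"]) (auto simp: sum_negf)
qed

lemma unit_form_tail:
  assumes g: "unit_form F g" and R: "0 \<le> R"
  shows "measure gauss {\<omega>. R < \<bar>g \<omega>\<bar>} \<le> 2 * exp (- R\<^sup>2 / 2)"
proof -
  note [measurable] = unit_form_measurable[OF g]
  have m: "{\<omega>. R \<le> h \<omega>} \<in> sets gauss" if "h \<in> borel_measurable gauss" for h :: "('a \<Rightarrow> real) \<Rightarrow> real"
    using measurable_sets[OF that, of "{R..}"] by (simp add: vimage_def)
  have "measure gauss {\<omega>. R < \<bar>g \<omega>\<bar>} \<le> measure gauss ({\<omega>. R \<le> g \<omega>} \<union> {\<omega>. R \<le> - g \<omega>})"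
    using m[of g] m[of "\<lambda>\<omega>. - g \<omega>"] by (intro gauss.finite_measure_mono) auto
  also have "\<dots> \<le> measure gauss {\<omega>. R \<le> g \<omega>} + measure gauss {\<omega>. R \<le> - g \<omega>}"
    using m[of g] m[of "\<lambda>\<omega>. - g \<omega>"] by (intro measure_Un_le) auto
  also have "\<dots> \<le> 2 * exp (- R\<^sup>2 / 2)"
    using unit_form_upper_tail[OF g R] unit_form_upper_tail[OF unit_form_uminus[OF g] R] by simp
  finally show ?thesis .
qed

lemma unit_form_even_moment:
  assumes g: "unit_form F g" and k: "0 < k"
  shows "integrable gauss (\<lambda>\<omega>. g \<omega> ^ (2 * k))"
    and "(\<integral>\<omega>. g \<omega> ^ (2 * k) \<partial>gauss) \<le> fact (2 * k) / (2 ^ k * fact k)"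
proof -
  have "integrable gauss (\<lambda>\<omega>. g \<omega> ^ (2 * k)) \<and> (\<integral>\<omega>. g \<omega> ^ (2 * k) \<partial>gauss) \<le> fact (2 * k) / (2 ^ k * fact k)"
    using g
  proof (cases rule: unit_form_cases)
    case 1
    then show ?thesis using k by (simp add: zero_power)
  next
    case (2 s)
    have "integrable gauss (\<lambda>\<omega>. g \<omega> ^ (2 * k))"
      using distributed_integrable[OF 2(3), of "\<lambda>x. x ^ (2 * k)"] integrable_normal_moment[OF 2(1), of 0 "2 * k"]
      by simp
    moreover have "(\<integral>\<omega>. g \<omega> ^ (2 * k) \<partial>gauss) = fact (2 * k) / ((2 / s\<^sup>2) ^ k * fact k)"
    proof -
      have "(\<integral>\<omega>. g \<omega> ^ (2 * k) \<partial>gauss) = (\<integral>x. normal_density 0 s x * x ^ (2 * k) \<partial>lborel)"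
        using distributed_integral[OF 2(3), of "\<lambda>x. x ^ (2 * k)"] by simp
      then show ?thesis using integral_normal_moment_even[OF 2(1), of 0 k] by (simp only: diff_zero)
    qed
    moreover have "fact (2 * k) / ((2 / s\<^sup>2) ^ k * fact k) \<le> (fact (2 * k) / (2 ^ k * fact k) :: real)"
    proof -
      have "(1 :: real) \<le> 1 / s\<^sup>2" using 2 by (simp add: abs_square_le_1)
      then have "2 \<le> 2 / s\<^sup>2" by simp
      then have "2 ^ k \<le> (2 / s\<^sup>2) ^ k" by (rule power_mono) simp
      then show ?thesis using 2(1) by (intro divide_left_mono mult_right_mono mult_pos_pos) auto
    qed
    ultimately show ?thesis by simp
  qed
  then show "integrable gauss (\<lambda>\<omega>. g \<omega> ^ (2 * k))"
    and "(\<integral>\<omega>. g \<omega> ^ (2 * k) \<partial>gauss) \<le> fact (2 * k) / (2 ^ k * fact k)" by auto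
qed

section \<open>Concentration of sums over blocks\<close>

lemma prod_abs_le_power6:
  fixes g :: "nat \<Rightarrow> real" and K :: nat
  assumes "K \<le> 6" "1 \<le> R" "\<And>k. k < K \<Longrightarrow> \<bar>g k\<bar> \<le> R"
  shows "\<bar>\<Prod>k<K. g k\<bar> \<le> R ^ 6"
proof -
  have "\<bar>\<Prod>k<K. g k\<bar> = (\<Prod>k<K. \<bar>g k\<bar>)" by (rule abs_prod)
  also have "\<dots> \<le> (\<Prod>k<K. R)" using assms by (intro prod_mono) auto
  also have "\<dots> \<le> R ^ 6" using assms by (simp add: power_increasing)
  finally show ?thesis .
qed

lemma prod_square_le_sum_power12:
  fixes g :: "nat \<Rightarrow> real"
  assumes "K \<le> 6"
  shows "(\<Prod>k<K. g k)\<^sup>2 \<le> 1 + (\<Sum>k<K. g k ^ 12)"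
proof (cases "\<forall>k<K. \<bar>g k\<bar> \<le> 1")
  case True
  then have "\<bar>\<Prod>k<K. g k\<bar> \<le> 1 ^ 6" using assms by (intro prod_abs_le_power6) auto
  then have "(\<Prod>k<K. g k)\<^sup>2 \<le> 1" by (simp add: abs_square_le_1)
  moreover have "0 \<le> (\<Sum>k<K. g k ^ 12)" by (intro sum_nonneg) auto
  ultimately show ?thesis by simp
next
  case False
  then obtain k0 where k0: "k0 < K" "1 < \<bar>g k0\<bar>" by auto
  define R where "R = Max ((\<lambda>k. \<bar>g k\<bar>) ` {..<K})"
  have fin: "finite ((\<lambda>k. \<bar>g k\<bar>) ` {..<K})" "(\<lambda>k. \<bar>g k\<bar>) ` {..<K} \<noteq> {}" using k0 by auto
  from Max_in[OF fin] obtain j where j: "j < K" "R = \<bar>g j\<bar>" by (auto simp: R_def)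
  have le: "\<bar>g k\<bar> \<le> R" if "k < K" for k unfolding R_def using fin that by (intro Max_ge) auto
  have "1 \<le> R" using le[OF k0(1)] k0 by simp
  then have "\<bar>\<Prod>k<K. g k\<bar> \<le> R ^ 6" using assms le by (intro prod_abs_le_power6) auto
  then have "(\<Prod>k<K. g k)\<^sup>2 \<le> (R ^ 6)\<^sup>2" by (metis abs_ge_zero power2_abs power_mono)
  also have "\<dots> = g j ^ 12" by (simp add: j power_mult[symmetric] power_even_abs)
  also have "\<dots> \<le> (\<Sum>k<K. g k ^ 12)" using j by (intro member_le_sum) auto
  finally show ?thesis by simp
qed

text \<open>\<open>10395 = 12! / (2\<^sup>6 6!)\<close> is the twelfth moment of a standard Gaussian, and \<open>62371 = 1 + 6 \<cdot> 10395\<close>.\<close>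

lemma unit_form_product:
  fixes K :: nat
  assumes K: "K \<le> 6" and g: "\<And>k. k < K \<Longrightarrow> unit_form F (g k)"
  defines "Y \<equiv> (\<lambda>\<omega>. \<Prod>k<K. g k \<omega>)"
  shows "Y \<in> borel_measurable gauss"
    and "integrable gauss (\<lambda>\<omega>. (Y \<omega>)\<^sup>2)" and "(\<integral>\<omega>. (Y \<omega>)\<^sup>2 \<partial>gauss) \<le> 62371" and "integrable gauss Y"
proof -
  have [measurable]: "g k \<in> borel_measurable gauss" if "k < K" for k
    using unit_form_measurable[OF g[OF that]] .
  show [measurable]: "Y \<in> borel_measurable gauss" unfolding Y_def by (intro borel_measurable_prod) auto
  have i: "integrable gauss (\<lambda>\<omega>. g k \<omega> ^ 12)" "(\<integral>\<omega>. g k \<omega> ^ 12 \<partial>gauss) \<le> 10395" if "k < K" for k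
    using unit_form_even_moment[OF g[OF that], of 6] by (simp_all add: fact_numeral)
  have b: "(Y \<omega>)\<^sup>2 \<le> 1 + (\<Sum>k<K. g k \<omega> ^ 12)" for \<omega>
    unfolding Y_def using K by (rule prod_square_le_sum_power12)
  have ib: "integrable gauss (\<lambda>\<omega>. 1 + (\<Sum>k<K. g k \<omega> ^ 12))"
    using i by (intro Bochner_Integration.integrable_add Bochner_Integration.integrable_sum) auto
  show i2: "integrable gauss (\<lambda>\<omega>. (Y \<omega>)\<^sup>2)"
    by (rule Bochner_Integration.integrable_bound[OF ib]) (auto intro!: AE_I2 order_trans[OF b])
  have "(\<integral>\<omega>. (Y \<omega>)\<^sup>2 \<partial>gauss) \<le> (\<integral>\<omega>. 1 + (\<Sum>k<K. g k \<omega> ^ 12) \<partial>gauss)"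
    using i2 ib b by (intro integral_mono) auto
  also have "\<dots> = 1 + (\<Sum>k<K. (\<integral>\<omega>. g k \<omega> ^ 12 \<partial>gauss))"
  proof -
    have "(\<integral>\<omega>. (\<Sum>k<K. g k \<omega> ^ 12) \<partial>gauss) = (\<Sum>k<K. (\<integral>\<omega>. g k \<omega> ^ 12 \<partial>gauss))"
      using i(1) by (intro Bochner_Integration.integral_sum) auto
    moreover have "integrable gauss (\<lambda>\<omega>. \<Sum>k<K. g k \<omega> ^ 12)"
      using i(1) by (intro Bochner_Integration.integrable_sum) auto
    ultimately show ?thesis
      using gauss.prob_space by (simp add: Bochner_Integration.integral_add)
  qed
  also have "\<dots> \<le> 1 + (\<Sum>k<K. 10395)" using i by (intro add_mono sum_mono) auto
  also have "\<dots> \<le> 62371" using K by simp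
  finally show "(\<integral>\<omega>. (Y \<omega>)\<^sup>2 \<partial>gauss) \<le> 62371" .
  show "integrable gauss Y"
    by (rule gauss.square_integrable_imp_integrable[OF _ i2]) measurable
qed

text \<open>Products of up to six Gaussian forms have no exponential moments, so Hoeffding's inequality is applied to the
products truncated at \<open>R\<^sup>6\<close>. Truncation changes a product only if one of the forms exceeds \<open>R\<close>, and
changes its expectation by at most \<open>1 / 2000\<close>, by the bound on the second moment.\<close>

lemma block_sum_concentration:
  fixes n K :: nat
  assumes n: "0 < n" and K: "K \<le> 6"
    and g: "\<And>i k. i < n \<Longrightarrow> k < K \<Longrightarrow> unit_form (F i) (g i k)"
    and F: "disjoint_family_on F {..<n}"
    and R: "1 \<le> R" "exp (- R\<^sup>2 / 2) \<le> 1 / 10 ^ 13"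
  defines "Y \<equiv> (\<lambda>i \<omega>. \<Prod>k<K. g i k \<omega>)"
  shows "measure gauss {\<omega>. real n / 1000 \<le> \<bar>(\<Sum>i<n. Y i \<omega>) - (\<Sum>i<n. \<integral>\<omega>. Y i \<omega> \<partial>gauss)\<bar>}
    \<le> 12 * real n * exp (- R\<^sup>2 / 2) + 2 * exp (- real n / (8 * 10 ^ 6 * R ^ 12))"
proof -
  define p where "p = exp (- R\<^sup>2 / 2)"
  note Y = unit_form_product[OF K g, folded Y_def]
  have Ym[measurable]: "Y i \<in> borel_measurable gauss" if "i < n" for i
    using Y(1)[of i] that unfolding Y_def by auto
  have Y2: "integrable gauss (\<lambda>\<omega>. (Y i \<omega>)\<^sup>2)" "(\<integral>\<omega>. (Y i \<omega>)\<^sup>2 \<partial>gauss) \<le> 62371" "integrable gauss (Y i)" if "i < n" for i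
    using Y(2-4)[of i] that unfolding Y_def by auto
  have bset: "{\<omega>. R ^ 6 < \<bar>Y i \<omega>\<bar>} \<in> sets gauss" if i: "i < n" for i
    using measurable_sets[OF borel_measurable_abs[OF Ym[OF i]], of "{R ^ 6<..}"] by (simp add: vimage_def)
  have bad: "measure gauss {\<omega>. R ^ 6 < \<bar>Y i \<omega>\<bar>} \<le> 12 * p" if i: "i < n" for i
  proof -
    have ks: "{\<omega>. R < \<bar>g i k \<omega>\<bar>} \<in> sets gauss" if "k < K" for k
      using measurable_sets[OF borel_measurable_abs[OF unit_form_measurable[OF g[OF i that]]], of "{R<..}"]
      by (simp add: vimage_def)
    have "{\<omega>. R ^ 6 < \<bar>Y i \<omega>\<bar>} \<subseteq> (\<Union>k<K. {\<omega>. R < \<bar>g i k \<omega>\<bar>})"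
    proof
      fix \<omega> assume a: "\<omega> \<in> {\<omega>. R ^ 6 < \<bar>Y i \<omega>\<bar>}"
      show "\<omega> \<in> (\<Union>k<K. {\<omega>. R < \<bar>g i k \<omega>\<bar>})"
      proof (rule ccontr)
        assume "\<not> ?thesis"
        then have "\<bar>g i k \<omega>\<bar> \<le> R" if "k < K" for k using that by (auto simp: not_less)
        then have "\<bar>Y i \<omega>\<bar> \<le> R ^ 6" unfolding Y_def using K R by (intro prod_abs_le_power6) auto
        with a show False by simp
      qed
    qed
    then have "measure gauss {\<omega>. R ^ 6 < \<bar>Y i \<omega>\<bar>} \<le> measure gauss (\<Union>k<K. {\<omega>. R < \<bar>g i k \<omega>\<bar>})"
      using ks by (intro gauss.finite_measure_mono) auto
    also have "\<dots> \<le> (\<Sum>k<K. measure gauss {\<omega>. R < \<bar>g i k \<omega>\<bar>})"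
      using ks by (intro gauss.finite_measure_subadditive_finite) auto
    also have "\<dots> \<le> (\<Sum>k<K. 2 * p)"
      unfolding p_def using R by (intro sum_mono unit_form_tail[OF g[OF i]]) auto
    also have "\<dots> \<le> 12 * p" using K by (simp add: p_def)
    finally show ?thesis .
  qed
  define W where "W i \<omega> = (if \<bar>Y i \<omega>\<bar> \<le> R ^ 6 then Y i \<omega> else 0)" for i \<omega>
  have Wm[measurable]: "W i \<in> borel_measurable gauss" if "i < n" for i
    using Ym[OF that] unfolding W_def by measurable
  have indW: "gauss.indep_vars (\<lambda>_. borel) W {..<n}"
  proof (rule indep_disjoint_blocks[OF F])
    fix i and \<omega> \<omega>' :: "'a \<Rightarrow> real" assume i: "i \<in> {..<n}" and eq: "\<And>\<kappa>. \<kappa> \<in> F i \<Longrightarrow> \<omega> \<kappa> = \<omega>' \<kappa>"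
    have "Y i \<omega> = Y i \<omega>'"
      unfolding Y_def using i by (intro prod.cong refl unit_form_cong[OF g[of i] eq]) auto
    then show "W i \<omega> = W i \<omega>'" by (simp add: W_def)
  qed auto
  interpret H: Hoeffding_ineq gauss "{..<n}" W "\<lambda>_. - (R ^ 6)" "\<lambda>_. R ^ 6" "\<Sum>i<n. \<integral>\<omega>. W i \<omega> \<partial>gauss"
  proof unfold_locales
    show "AE \<omega> in gauss. W i \<omega> \<in> {- (R ^ 6)..R ^ 6}" for i
      using R by (auto simp: W_def)
  qed (use indW in auto)
  have sq: "(\<Sum>i<n. (R ^ 6 - - (R ^ 6))\<^sup>2) = 4 * real n * R ^ 12"
    by (simp add: power_mult_distrib power_mult[symmetric])
  have Hoeff: "measure gauss {\<omega>. real n / 2000 \<le> \<bar>(\<Sum>i<n. W i \<omega>) - (\<Sum>i<n. \<integral>\<omega>. W i \<omega> \<partial>gauss)\<bar>}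
      \<le> 2 * exp (- real n / (8 * 10 ^ 6 * R ^ 12))"
  proof -
    have "measure gauss {\<omega>. real n / 2000 \<le> \<bar>(\<Sum>i<n. W i \<omega>) - (\<Sum>i<n. \<integral>\<omega>. W i \<omega> \<partial>gauss)\<bar>}
      \<le> 2 * exp (- 2 * (real n / 2000)\<^sup>2 / (\<Sum>i<n. (R ^ 6 - - (R ^ 6))\<^sup>2))"
      using H.Hoeffding_ineq_abs_ge[of "real n / 2000"] n R by (simp add: sq)
    also have "- 2 * (real n / 2000)\<^sup>2 / (\<Sum>i<n. (R ^ 6 - - (R ^ 6))\<^sup>2) = - real n / (8 * 10 ^ 6 * R ^ 12)"
      unfolding sq using n R by (simp add: field_simps power2_eq_square)
    finally show ?thesis .
  qed
  \<comment> \<open>The removed part is at most \<open>|Y| \<le> Y\<^sup>2 / (2 K) + K / 2\<close> on a set of probability at most \<open>12 / 10\<^sup>1\<^sup>3\<close>. The value \<open>K = 10\<^sup>8\<close> balances the two.\<close>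
  have shift: "\<bar>(\<integral>\<omega>. Y i \<omega> \<partial>gauss) - (\<integral>\<omega>. W i \<omega> \<partial>gauss)\<bar> \<le> 1 / 2000" if i: "i < n" for i
  proof -
    let ?B = "{\<omega>. R ^ 6 < \<bar>Y i \<omega>\<bar>}"
    have iW: "integrable gauss (W i)"
      using Y2(3)[OF i] by (rule Bochner_Integration.integrable_bound) (use i in \<open>auto simp: W_def\<close>)
    have iB: "integrable gauss (indicat_real ?B)" using bset[OF i]
      by (intro integrable_real_indicator) (auto simp: gauss.emeasure_eq_measure)
    have "\<bar>(\<integral>\<omega>. Y i \<omega> \<partial>gauss) - (\<integral>\<omega>. W i \<omega> \<partial>gauss)\<bar> = \<bar>\<integral>\<omega>. Y i \<omega> - W i \<omega> \<partial>gauss\<bar>"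
      using Y2(3)[OF i] iW by simp
    also have "\<dots> \<le> (\<integral>\<omega>. \<bar>Y i \<omega> - W i \<omega>\<bar> \<partial>gauss)" by (rule integral_abs_bound)
    also have "\<dots> \<le> (\<integral>\<omega>. (1 / (2 * 10 ^ 8)) * (Y i \<omega>)\<^sup>2 + (10 ^ 8 / 2) * indicator ?B \<omega> \<partial>gauss)"
    proof (rule integral_mono)
      show "integrable gauss (\<lambda>\<omega>. \<bar>Y i \<omega> - W i \<omega>\<bar>)" using Y2(3)[OF i] iW by auto
      show "integrable gauss (\<lambda>\<omega>. (1 / (2 * 10 ^ 8)) * (Y i \<omega>)\<^sup>2 + (10 ^ 8 / 2) * indicator ?B \<omega>)"
        using Y2(1)[OF i] iB by auto
      fix \<omega>
      have "0 \<le> (\<bar>Y i \<omega>\<bar> - 10 ^ 8)\<^sup>2" by simp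
      then have "\<bar>Y i \<omega>\<bar> \<le> (1 / (2 * 10 ^ 8)) * (Y i \<omega>)\<^sup>2 + 10 ^ 8 / 2"
        by (simp add: power2_diff)
      moreover have "0 \<le> (1 / (2 * 10 ^ 8)) * (Y i \<omega>)\<^sup>2" by simp
      ultimately show "\<bar>Y i \<omega> - W i \<omega>\<bar> \<le> (1 / (2 * 10 ^ 8)) * (Y i \<omega>)\<^sup>2 + (10 ^ 8 / 2) * indicator ?B \<omega>"
        by (auto simp: W_def indicator_def)
    qed
    also have "\<dots> = (1 / (2 * 10 ^ 8)) * (\<integral>\<omega>. (Y i \<omega>)\<^sup>2 \<partial>gauss) + (10 ^ 8 / 2) * measure gauss ?B"
      using Y2(1)[OF i] iB by simp
    also have "\<dots> \<le> (1 / (2 * 10 ^ 8)) * 62371 + (10 ^ 8 / 2) * (12 * (1 / 10 ^ 13))"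
      using Y2(2)[OF i] bad[OF i] R unfolding p_def by (intro add_mono mult_left_mono) auto
    also have "\<dots> \<le> 1 / 2000" by simp
    finally show ?thesis .
  qed
  have "{\<omega>. real n / 1000 \<le> \<bar>(\<Sum>i<n. Y i \<omega>) - (\<Sum>i<n. \<integral>\<omega>. Y i \<omega> \<partial>gauss)\<bar>}
    \<subseteq> (\<Union>i<n. {\<omega>. R ^ 6 < \<bar>Y i \<omega>\<bar>}) \<union> {\<omega>. real n / 2000 \<le> \<bar>(\<Sum>i<n. W i \<omega>) - (\<Sum>i<n. \<integral>\<omega>. W i \<omega> \<partial>gauss)\<bar>}"
  proof
    fix \<omega> assume a: "\<omega> \<in> {\<omega>. real n / 1000 \<le> \<bar>(\<Sum>i<n. Y i \<omega>) - (\<Sum>i<n. \<integral>\<omega>. Y i \<omega> \<partial>gauss)\<bar>}"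
    show "\<omega> \<in> (\<Union>i<n. {\<omega>. R ^ 6 < \<bar>Y i \<omega>\<bar>}) \<union> {\<omega>. real n / 2000 \<le> \<bar>(\<Sum>i<n. W i \<omega>) - (\<Sum>i<n. \<integral>\<omega>. W i \<omega> \<partial>gauss)\<bar>}"
    proof (cases "\<exists>i<n. R ^ 6 < \<bar>Y i \<omega>\<bar>")
      case False
      then have "W i \<omega> = Y i \<omega>" if "i < n" for i using that by (auto simp: W_def)
      then have s: "(\<Sum>i<n. W i \<omega>) = (\<Sum>i<n. Y i \<omega>)" by (intro sum.cong) auto
      have "\<bar>(\<Sum>i<n. \<integral>\<omega>. Y i \<omega> \<partial>gauss) - (\<Sum>i<n. \<integral>\<omega>. W i \<omega> \<partial>gauss)\<bar>
          \<le> (\<Sum>i<n. \<bar>(\<integral>\<omega>. Y i \<omega> \<partial>gauss) - (\<integral>\<omega>. W i \<omega> \<partial>gauss)\<bar>)"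
        by (simp add: sum_subtractf[symmetric] del: sum_subtractf)
      also have "\<dots> \<le> (\<Sum>i<n. 1 / 2000)" using shift by (intro sum_mono) auto
      finally have "\<bar>(\<Sum>i<n. \<integral>\<omega>. Y i \<omega> \<partial>gauss) - (\<Sum>i<n. \<integral>\<omega>. W i \<omega> \<partial>gauss)\<bar> \<le> real n / 2000" by simp
      moreover have "real n / 1000 \<le> \<bar>(\<Sum>i<n. Y i \<omega>) - (\<Sum>i<n. \<integral>\<omega>. Y i \<omega> \<partial>gauss)\<bar>" using a by simp
      ultimately have "real n / 2000 \<le> \<bar>(\<Sum>i<n. Y i \<omega>) - (\<Sum>i<n. \<integral>\<omega>. W i \<omega> \<partial>gauss)\<bar>" by linarith
      then show ?thesis using s by simp
    qed auto
  qed
  moreover have ms: "{\<omega>. real n / 2000 \<le> \<bar>(\<Sum>i<n. W i \<omega>) - (\<Sum>i<n. \<integral>\<omega>. W i \<omega> \<partial>gauss)\<bar>} \<in> sets gauss"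
  proof -
    have "(\<lambda>\<omega>. \<bar>(\<Sum>i<n. W i \<omega>) - (\<Sum>i<n. \<integral>\<omega>. W i \<omega> \<partial>gauss)\<bar>) \<in> borel_measurable gauss"
      using Wm by (intro borel_measurable_abs borel_measurable_diff borel_measurable_sum) auto
    from measurable_sets[OF this, of "{real n / 2000..}"] show ?thesis by (simp add: vimage_def)
  qed
  ultimately have "measure gauss {\<omega>. real n / 1000 \<le> \<bar>(\<Sum>i<n. Y i \<omega>) - (\<Sum>i<n. \<integral>\<omega>. Y i \<omega> \<partial>gauss)\<bar>}
    \<le> measure gauss ((\<Union>i<n. {\<omega>. R ^ 6 < \<bar>Y i \<omega>\<bar>}) \<union> {\<omega>. real n / 2000 \<le> \<bar>(\<Sum>i<n. W i \<omega>) - (\<Sum>i<n. \<integral>\<omega>. W i \<omega> \<partial>gauss)\<bar>})"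
    using bset by (intro gauss.finite_measure_mono) auto
  also have "\<dots> \<le> measure gauss (\<Union>i<n. {\<omega>. R ^ 6 < \<bar>Y i \<omega>\<bar>}) + measure gauss {\<omega>. real n / 2000 \<le> \<bar>(\<Sum>i<n. W i \<omega>) - (\<Sum>i<n. \<integral>\<omega>. W i \<omega> \<partial>gauss)\<bar>}"
    using bset ms by (intro measure_Un_le) auto
  also have "measure gauss (\<Union>i<n. {\<omega>. R ^ 6 < \<bar>Y i \<omega>\<bar>}) \<le> (\<Sum>i<n. measure gauss {\<omega>. R ^ 6 < \<bar>Y i \<omega>\<bar>})"
    using bset by (intro gauss.finite_measure_subadditive_finite) auto
  also have "\<dots> \<le> (\<Sum>i<n. 12 * p)" using bad by (intro sum_mono) auto
  finally show ?thesis using Hoeff by (simp add: p_def)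
qed

lemma gauss_setI: "Measurable.pred gauss P \<Longrightarrow> {\<omega>. P \<omega>} \<in> sets gauss"
  using measurable_sets[of P gauss "count_space UNIV" "{True}"] by (simp add: vimage_def)

text \<open>The range in which a sum of \<open>n\<close> products deviates by \<open>n / 1000\<close> with probability at most \<open>d\<^sup>-\<^sup>2\<^sup>2\<close>. With
truncation of the forms at \<open>R = \<surd>(50 log d)\<close> the Hoeffding exponent is a multiple of \<open>n / R\<^sup>1\<^sup>2\<close>, and \<open>10\<^sup>2\<^sup>0 (log d)\<^sup>1\<^sup>2 \<le> n\<close> makes
it larger than \<open>25 log d\<close>.\<close>

definition regime :: "nat \<Rightarrow> nat \<Rightarrow> bool" where
  "regime n d \<longleftrightarrow> 1000 \<le> d \<and> n \<le> d \<and> 10 ^ 20 * ln (real d) ^ 12 \<le> real n"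

lemma regime_refl: "regime n d \<Longrightarrow> regime d d"
  by (auto simp: regime_def)

lemma ln_ge_1: "1000 \<le> d \<Longrightarrow> 1 \<le> ln (real d)"
proof -
  assume d: "1000 \<le> d"
  have "exp 1 < (3 :: real)" by (rule e_less_272[THEN less_trans]) simp
  then have "exp 1 \<le> real d" using d by simp
  then show ?thesis using d by (simp add: ln_ge_iff)
qed

lemma exp_ln_multiple: "0 < d \<Longrightarrow> exp (- (real k * ln (real d))) = 1 / real d ^ k"
  by (simp add: exp_minus exp_of_nat_mult divide_inverse)

lemma block_sum_concentration_regime:
  fixes n K d :: nat
  assumes reg: "regime n d" and K: "K \<le> 6"
    and g: "\<And>i k. i < n \<Longrightarrow> k < K \<Longrightarrow> unit_form (F i) (g i k)"
    and F: "disjoint_family_on F {..<n}"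
  shows "measure gauss {\<omega>. real n / 1000 \<le> \<bar>(\<Sum>i<n. \<Prod>k<K. g i k \<omega>) - (\<Sum>i<n. \<integral>\<omega>. (\<Prod>k<K. g i k \<omega>) \<partial>gauss)\<bar>}
    \<le> 1 / real d ^ 22"
proof -
  define L where "L = ln (real d)"
  have d: "1000 \<le> d" "0 < d" and nd: "n \<le> d" and nL: "10 ^ 20 * L ^ 12 \<le> real n"
    using reg by (auto simp: regime_def L_def)
  have L: "1 \<le> L" using ln_ge_1[OF d(1)] by (simp add: L_def)
  have n: "0 < n" using nL L by (cases "n = 0") (auto simp: power_le_zero_eq)
  define R where "R = sqrt (50 * L)"
  have R2: "R\<^sup>2 = 50 * L" using L by (simp add: R_def)
  have e25: "exp (- R\<^sup>2 / 2) = 1 / real d ^ 25"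
    using exp_ln_multiple[OF d(2), of 25] by (simp add: R2 L_def)
  have pd: "(1000 :: real) ^ k \<le> real d ^ k" for k using d by (intro power_mono) auto
  have "1 / real d ^ 25 \<le> 1 / 1000 ^ 25" by (intro divide_left_mono pd) (use d in auto)
  also have "\<dots> \<le> 1 / 10 ^ 13" by simp
  finally have small: "exp (- R\<^sup>2 / 2) \<le> 1 / 10 ^ 13" unfolding e25 .
  have "measure gauss {\<omega>. real n / 1000 \<le> \<bar>(\<Sum>i<n. \<Prod>k<K. g i k \<omega>) - (\<Sum>i<n. \<integral>\<omega>. (\<Prod>k<K. g i k \<omega>) \<partial>gauss)\<bar>}
     \<le> 12 * real n * exp (- R\<^sup>2 / 2) + 2 * exp (- real n / (8 * 10 ^ 6 * R ^ 12))"
    using L by (intro block_sum_concentration[OF n K g F _ small]) (auto simp: R_def)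
  also have "12 * real n * exp (- R\<^sup>2 / 2) \<le> 12 / real d ^ 24"
  proof -
    have "12 * real n * exp (- R\<^sup>2 / 2) \<le> 12 * real d * (1 / real d ^ 25)"
      unfolding e25 using nd by (intro mult_right_mono) auto
    also have "\<dots> = 12 / real d ^ 24" using d by (simp add: field_simps power_numeral_reduce)
    finally show ?thesis .
  qed
  also have "2 * exp (- real n / (8 * 10 ^ 6 * R ^ 12)) \<le> 2 / real d ^ 25"
  proof -
    have R12: "R ^ 12 = (50 * L) ^ 6" unfolding R2[symmetric] by (simp add: power_mult[symmetric])
    have "25 * L * (8 * 10 ^ 6 * R ^ 12) = 3125 * 10 ^ 15 * L ^ 7"
      unfolding R12 by (simp add: power_mult_distrib power_numeral_reduce)
    also have "\<dots> \<le> 3125 * 10 ^ 15 * L ^ 12"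
      using L by (intro mult_left_mono power_increasing) auto
    also have "\<dots> \<le> 10 ^ 20 * L ^ 12" using L by (intro mult_right_mono) auto
    also have "\<dots> \<le> real n" by (rule nL)
    finally have "25 * L * (8 * 10 ^ 6 * R ^ 12) \<le> real n" .
    moreover have "0 < 8 * 10 ^ 6 * R ^ 12" using L by (simp add: R_def)
    ultimately have "25 * L \<le> real n / (8 * 10 ^ 6 * R ^ 12)" by (simp only: pos_le_divide_eq)
    then have "exp (- real n / (8 * 10 ^ 6 * R ^ 12)) \<le> exp (- (25 * L))" by simp
    also have "\<dots> = 1 / real d ^ 25" using exp_ln_multiple[OF d(2), of 25] by (simp add: L_def)
    finally show ?thesis by simp
  qed
  also have "12 / real d ^ 24 + 2 / real d ^ 25 \<le> 1 / real d ^ 22"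
  proof -
    have "2 / real d ^ 25 \<le> 2 / real d ^ 24"
      using d by (intro divide_left_mono power_increasing) auto
    moreover have "14 / real d ^ 24 \<le> 1 / real d ^ 22"
    proof -
      have "14 \<le> real d ^ 2" using pd[of 2] by simp
      then have "14 * real d ^ 22 \<le> real d ^ 2 * real d ^ 22" by (intro mult_right_mono) auto
      also have "\<dots> = real d ^ 24" by (simp add: power_add[symmetric])
      finally show ?thesis using d by (simp add: field_simps)
    qed
    moreover have "12 / real d ^ 24 + 2 / real d ^ 24 = 14 / real d ^ 24" by simp
    ultimately show ?thesis by linarith
  qed
  finally show ?thesis by simp
qed

lemma block_sum_upper:
  fixes n K d :: nat
  assumes reg: "regime n d" and K: "K \<le> 6"
    and g: "\<And>i k. i < n \<Longrightarrow> k < K \<Longrightarrow> unit_form (F i) (g i k)"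
    and F: "disjoint_family_on F {..<n}"
  shows "measure gauss {\<omega>. 10 ^ 5 * real n < (\<Sum>i<n. \<Prod>k<K. g i k \<omega>)} \<le> 1 / real d ^ 22"
proof -
  have Ym: "(\<lambda>\<omega>. \<Prod>k<K. g i k \<omega>) \<in> borel_measurable gauss" if "i < n" for i
    using unit_form_product(1)[OF K, of "F i" "g i"] g that by auto
  have E: "(\<integral>\<omega>. (\<Prod>k<K. g i k \<omega>) \<partial>gauss) \<le> 62372" if i: "i < n" for i
  proof -
    note P = unit_form_product[OF K, of "F i" "g i", OF g[OF i]]
    have "(\<integral>\<omega>. (\<Prod>k<K. g i k \<omega>) \<partial>gauss) \<le> (\<integral>\<omega>. 1 + (\<Prod>k<K. g i k \<omega>)\<^sup>2 \<partial>gauss)"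
    proof (rule integral_mono)
      fix \<omega>
      have "0 \<le> ((\<Prod>k<K. g i k \<omega>) - 1 / 2)\<^sup>2" by simp
      then show "(\<Prod>k<K. g i k \<omega>) \<le> 1 + (\<Prod>k<K. g i k \<omega>)\<^sup>2" by (simp add: power2_diff power_divide)
    qed (use P in auto)
    also have "\<dots> = 1 + (\<integral>\<omega>. (\<Prod>k<K. g i k \<omega>)\<^sup>2 \<partial>gauss)" using P gauss.prob_space by simp
    also have "\<dots> \<le> 62372" using P by simp
    finally show ?thesis .
  qed
  have "{\<omega>. 10 ^ 5 * real n < (\<Sum>i<n. \<Prod>k<K. g i k \<omega>)}
    \<subseteq> {\<omega>. real n / 1000 \<le> \<bar>(\<Sum>i<n. \<Prod>k<K. g i k \<omega>) - (\<Sum>i<n. \<integral>\<omega>. (\<Prod>k<K. g i k \<omega>) \<partial>gauss)\<bar>}"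
  proof
    fix \<omega> assume a: "\<omega> \<in> {\<omega>. 10 ^ 5 * real n < (\<Sum>i<n. \<Prod>k<K. g i k \<omega>)}"
    have "(\<Sum>i<n. \<integral>\<omega>. (\<Prod>k<K. g i k \<omega>) \<partial>gauss) \<le> (\<Sum>i<n. 62372)" using E by (intro sum_mono) auto
    then show "\<omega> \<in> {\<omega>. real n / 1000 \<le> \<bar>(\<Sum>i<n. \<Prod>k<K. g i k \<omega>) - (\<Sum>i<n. \<integral>\<omega>. (\<Prod>k<K. g i k \<omega>) \<partial>gauss)\<bar>}"
      using a by simp
  qed
  moreover have "{\<omega>. real n / 1000 \<le> \<bar>(\<Sum>i<n. \<Prod>k<K. g i k \<omega>) - (\<Sum>i<n. \<integral>\<omega>. (\<Prod>k<K. g i k \<omega>) \<partial>gauss)\<bar>} \<in> sets gauss"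
  proof (rule gauss_setI)
    have [measurable]: "(\<lambda>\<omega>. \<Sum>i<n. \<Prod>k<K. g i k \<omega>) \<in> borel_measurable gauss"
      using Ym by (intro borel_measurable_sum) auto
    show "Measurable.pred gauss (\<lambda>\<omega>. real n / 1000 \<le> \<bar>(\<Sum>i<n. \<Prod>k<K. g i k \<omega>) - (\<Sum>i<n. \<integral>\<omega>. (\<Prod>k<K. g i k \<omega>) \<partial>gauss)\<bar>)"
      by measurable
  qed
  ultimately have "measure gauss {\<omega>. 10 ^ 5 * real n < (\<Sum>i<n. \<Prod>k<K. g i k \<omega>)}
    \<le> measure gauss {\<omega>. real n / 1000 \<le> \<bar>(\<Sum>i<n. \<Prod>k<K. g i k \<omega>) - (\<Sum>i<n. \<integral>\<omega>. (\<Prod>k<K. g i k \<omega>) \<partial>gauss)\<bar>}"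
    by (intro gauss.finite_measure_mono) auto
  also have "\<dots> \<le> 1 / real d ^ 22" by (rule block_sum_concentration_regime[OF reg K g F])
  finally show ?thesis .
qed

lemma expectation_linear_forms:
  assumes F: "finite F"
  shows "integrable gauss (\<lambda>\<omega>. (\<Sum>\<kappa>\<in>F. c \<kappa> * \<omega> \<kappa>) * (\<Sum>\<kappa>\<in>F. c' \<kappa> * \<omega> \<kappa>))"
    and "(\<integral>\<omega>. (\<Sum>\<kappa>\<in>F. c \<kappa> * \<omega> \<kappa>) * (\<Sum>\<kappa>\<in>F. c' \<kappa> * \<omega> \<kappa>) \<partial>gauss) = (\<Sum>\<kappa>\<in>F. c \<kappa> * c' \<kappa>)"
proof -
  have sq: "integrable gauss (\<lambda>\<omega>. (\<Sum>\<kappa>\<in>F. b \<kappa> * \<omega> \<kappa>)\<^sup>2) \<and> (\<integral>\<omega>. (\<Sum>\<kappa>\<in>F. b \<kappa> * \<omega> \<kappa>)\<^sup>2 \<partial>gauss) = (\<Sum>\<kappa>\<in>F. (b \<kappa>)\<^sup>2)" for b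
  proof (cases "(\<Sum>\<kappa>\<in>F. (b \<kappa>)\<^sup>2) = 0")
    case True
    then have "\<forall>\<kappa>\<in>F. b \<kappa> = 0" using F by (simp add: sum_nonneg_eq_0_iff)
    then show ?thesis by simp
  next
    case False
    moreover have "(\<Sum>\<kappa>\<in>F. (b \<kappa>)\<^sup>2) \<ge> 0" by (simp add: sum_nonneg)
    ultimately have pos: "(\<Sum>\<kappa>\<in>F. (b \<kappa>)\<^sup>2) > 0" by simp
    define s where "s = sqrt (\<Sum>\<kappa>\<in>F. (b \<kappa>)\<^sup>2)"
    have s: "0 < s" "s\<^sup>2 = (\<Sum>\<kappa>\<in>F. (b \<kappa>)\<^sup>2)" using pos by (auto simp: s_def)
    note D = distributed_linear_form[OF F pos, folded s_def]
    have "integrable gauss (\<lambda>\<omega>. (\<Sum>\<kappa>\<in>F. b \<kappa> * \<omega> \<kappa>)\<^sup>2)"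
      using distributed_integrable[OF D, of "\<lambda>x. x\<^sup>2"] integrable_normal_moment[OF s(1), of 0 2] by simp
    moreover have "(\<integral>\<omega>. (\<Sum>\<kappa>\<in>F. b \<kappa> * \<omega> \<kappa>)\<^sup>2 \<partial>gauss) = s\<^sup>2"
    proof -
      have "(\<integral>\<omega>. (\<Sum>\<kappa>\<in>F. b \<kappa> * \<omega> \<kappa>)\<^sup>2 \<partial>gauss) = (\<integral>x. normal_density 0 s x * x\<^sup>2 \<partial>lborel)"
        using distributed_integral[OF D, of "\<lambda>x. x\<^sup>2"] by simp
      also have "\<dots> = fact (2 * 1) / ((2 / s\<^sup>2) ^ 1 * fact 1)"
        using integral_normal_moment_even[OF s(1), of 0 1] by (simp only: diff_zero mult_1_right)
      finally show ?thesis using s(1) by (simp add: fact_numeral)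
    qed
    ultimately show ?thesis using s by simp
  qed
  have pol: "(\<Sum>\<kappa>\<in>F. c \<kappa> * \<omega> \<kappa>) * (\<Sum>\<kappa>\<in>F. c' \<kappa> * \<omega> \<kappa>)
     = (1 / 4) * (\<Sum>\<kappa>\<in>F. (c \<kappa> + c' \<kappa>) * \<omega> \<kappa>)\<^sup>2 - (1 / 4) * (\<Sum>\<kappa>\<in>F. (c \<kappa> - c' \<kappa>) * \<omega> \<kappa>)\<^sup>2" for \<omega>
  proof -
    have "(\<Sum>\<kappa>\<in>F. (c \<kappa> + c' \<kappa>) * \<omega> \<kappa>) = (\<Sum>\<kappa>\<in>F. c \<kappa> * \<omega> \<kappa>) + (\<Sum>\<kappa>\<in>F. c' \<kappa> * \<omega> \<kappa>)"
      and "(\<Sum>\<kappa>\<in>F. (c \<kappa> - c' \<kappa>) * \<omega> \<kappa>) = (\<Sum>\<kappa>\<in>F. c \<kappa> * \<omega> \<kappa>) - (\<Sum>\<kappa>\<in>F. c' \<kappa> * \<omega> \<kappa>)"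
      by (simp_all add: distrib_right left_diff_distrib sum.distrib sum_subtractf)
    then show ?thesis by (simp add: power2_sum power2_diff diff_divide_distrib[symmetric])
  qed
  note sq1 = sq[of "\<lambda>\<kappa>. c \<kappa> + c' \<kappa>"] and sq2 = sq[of "\<lambda>\<kappa>. c \<kappa> - c' \<kappa>"]
  show "integrable gauss (\<lambda>\<omega>. (\<Sum>\<kappa>\<in>F. c \<kappa> * \<omega> \<kappa>) * (\<Sum>\<kappa>\<in>F. c' \<kappa> * \<omega> \<kappa>))"
    unfolding pol using sq1 sq2 by (intro Bochner_Integration.integrable_diff integrable_mult_right) auto
  have "(\<integral>\<omega>. (\<Sum>\<kappa>\<in>F. c \<kappa> * \<omega> \<kappa>) * (\<Sum>\<kappa>\<in>F. c' \<kappa> * \<omega> \<kappa>) \<partial>gauss)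
     = (1 / 4) * (\<Sum>\<kappa>\<in>F. (c \<kappa> + c' \<kappa>)\<^sup>2) - (1 / 4) * (\<Sum>\<kappa>\<in>F. (c \<kappa> - c' \<kappa>)\<^sup>2)"
    unfolding pol using sq1 sq2 by simp
  also have "\<dots> = (\<Sum>\<kappa>\<in>F. (1 / 4) * (c \<kappa> + c' \<kappa>)\<^sup>2 - (1 / 4) * (c \<kappa> - c' \<kappa>)\<^sup>2)"
    by (simp add: sum_subtractf sum_distrib_left)
  also have "\<dots> = (\<Sum>\<kappa>\<in>F. c \<kappa> * c' \<kappa>)"
    by (intro sum.cong refl) (simp add: power2_sum power2_diff diff_divide_distrib[symmetric])
  finally show "(\<integral>\<omega>. (\<Sum>\<kappa>\<in>F. c \<kappa> * \<omega> \<kappa>) * (\<Sum>\<kappa>\<in>F. c' \<kappa> * \<omega> \<kappa>) \<partial>gauss) = (\<Sum>\<kappa>\<in>F. c \<kappa> * c' \<kappa>)" .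
qed

lemma expectation_reindexed_forms:
  assumes J: "finite J" "inj_on \<iota> J"
  shows "integrable gauss (\<lambda>\<omega>. (\<Sum>j\<in>J. p j * \<omega> (\<iota> j)) * (\<Sum>j\<in>J. p' j * \<omega> (\<iota> j)))"
    and "(\<integral>\<omega>. (\<Sum>j\<in>J. p j * \<omega> (\<iota> j)) * (\<Sum>j\<in>J. p' j * \<omega> (\<iota> j)) \<partial>gauss) = (\<Sum>j\<in>J. p j * p' j)"
proof -
  define c where "c p \<kappa> = (p (the_inv_into J \<iota> \<kappa>) :: real)" for p \<kappa>
  have c: "c p (\<iota> j) = p j" if "j \<in> J" for p j
    using that J by (simp add: c_def the_inv_into_f_f)
  have s: "(\<Sum>j\<in>J. p j * \<omega> (\<iota> j)) = (\<Sum>\<kappa>\<in>\<iota> ` J. c p \<kappa> * \<omega> \<kappa>)" for \<omega> p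
    using J by (simp add: sum.reindex c)
  have s2: "(\<Sum>j\<in>J. p j * p' j) = (\<Sum>\<kappa>\<in>\<iota> ` J. c p \<kappa> * c p' \<kappa>)"
    using J by (simp add: sum.reindex c)
  show "integrable gauss (\<lambda>\<omega>. (\<Sum>j\<in>J. p j * \<omega> (\<iota> j)) * (\<Sum>j\<in>J. p' j * \<omega> (\<iota> j)))"
    unfolding s using J by (intro expectation_linear_forms) auto
  show "(\<integral>\<omega>. (\<Sum>j\<in>J. p j * \<omega> (\<iota> j)) * (\<Sum>j\<in>J. p' j * \<omega> (\<iota> j)) \<partial>gauss) = (\<Sum>j\<in>J. p j * p' j)"
    unfolding s s2 using J by (intro expectation_linear_forms) auto
qed

lemma expectation_product_of_disjoint_blocks:
  assumes F: "F1 \<inter> F2 = {}"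
    and f: "integrable gauss f1" "integrable gauss f2"
    and dep: "\<And>\<omega> \<omega>'. (\<And>\<kappa>. \<kappa> \<in> F1 \<Longrightarrow> \<omega> \<kappa> = \<omega>' \<kappa>) \<Longrightarrow> f1 \<omega> = f1 \<omega>'"
      "\<And>\<omega> \<omega>'. (\<And>\<kappa>. \<kappa> \<in> F2 \<Longrightarrow> \<omega> \<kappa> = \<omega>' \<kappa>) \<Longrightarrow> f2 \<omega> = f2 \<omega>'"
  shows "(\<integral>\<omega>. f1 \<omega> * f2 \<omega> \<partial>gauss) = (\<integral>\<omega>. f1 \<omega> \<partial>gauss) * (\<integral>\<omega>. f2 \<omega> \<partial>gauss :: real)"
proof -
  have "gauss.indep_vars (\<lambda>_. borel) (case_bool f1 f2) (UNIV :: bool set)"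
  proof (rule indep_disjoint_blocks[where F = "case_bool F1 F2"])
    show "disjoint_family_on (case_bool F1 F2) UNIV"
      using F by (auto simp: disjoint_family_on_def split: bool.splits)
    show "case_bool f1 f2 i \<in> borel_measurable gauss" for i
      using f by (cases i) auto
    fix i and \<omega> \<omega>' :: "'a \<Rightarrow> real" assume "\<And>\<kappa>. \<kappa> \<in> case_bool F1 F2 i \<Longrightarrow> \<omega> \<kappa> = \<omega>' \<kappa>"
    then show "case_bool f1 f2 i \<omega> = case_bool f1 f2 i \<omega>'"
      using dep(1)[of \<omega> \<omega>'] dep(2)[of \<omega> \<omega>'] by (cases i) auto
  qed
  moreover have "(\<lambda>_ :: bool. borel :: real measure) = case_bool borel borel" by (auto split: bool.split)
  ultimately have "gauss.indep_var borel f1 borel f2"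
    unfolding gauss.indep_var_def by simp
  then show ?thesis using f by (rule gauss.indep_var_lebesgue_integral)
qed

lemma gauss_prob_list:
  assumes B: "\<And>\<omega>. B \<omega> \<Longrightarrow> \<exists>E\<in>set Es. E \<omega>"
    and m: "\<And>E. E \<in> set Es \<Longrightarrow> {\<omega>. E \<omega>} \<in> sets gauss"
    and \<delta>: "\<And>E. E \<in> set Es \<Longrightarrow> measure gauss {\<omega>. E \<omega>} \<le> \<delta>"
  shows "measure gauss {\<omega>. B \<omega>} \<le> real (length Es) * \<delta>"
  using assms
proof (induction Es arbitrary: B)
  case Nil
  then have "{\<omega>. B \<omega>} = {}" by auto
  then show ?case by simp
next
  case (Cons E Es)
  define B' where "B' \<omega> \<longleftrightarrow> (\<exists>E\<in>set Es. E \<omega>)" for \<omega>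
  have B'm: "{\<omega>. B' \<omega>} \<in> sets gauss"
  proof -
    have "{\<omega>. B' \<omega>} = (\<Union>E\<in>set Es. {\<omega>. E \<omega>})" by (auto simp: B'_def)
    then show ?thesis using Cons.prems(2) by auto
  qed
  have "measure gauss {\<omega>. B \<omega>} \<le> measure gauss ({\<omega>. E \<omega>} \<union> {\<omega>. B' \<omega>})"
    using Cons.prems(1,2) B'm by (intro gauss.finite_measure_mono) (auto simp: B'_def)
  also have "\<dots> \<le> measure gauss {\<omega>. E \<omega>} + measure gauss {\<omega>. B' \<omega>}"
    using Cons.prems(2) B'm by (intro measure_Un_le) auto
  also have "measure gauss {\<omega>. B' \<omega>} \<le> real (length Es) * \<delta>"
    using Cons.prems by (intro Cons.IH) (auto simp: B'_def)
  also have "measure gauss {\<omega>. E \<omega>} \<le> \<delta>" using Cons.prems(3) by auto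
  finally show ?case by (simp add: algebra_simps)
qed

lemma concentration_of_products4:
  fixes n d :: nat
  assumes reg: "regime n d" and F: "disjoint_family_on F {..<n}"
    and g: "\<And>i. i < n \<Longrightarrow> unit_form (F i) (g1 i)" "\<And>i. i < n \<Longrightarrow> unit_form (F i) (g2 i)"
      "\<And>i. i < n \<Longrightarrow> unit_form (F i) (g3 i)" "\<And>i. i < n \<Longrightarrow> unit_form (F i) (g4 i)"
    and E: "\<And>i. i < n \<Longrightarrow> (\<integral>\<omega>. g1 i \<omega> * g2 i \<omega> * g3 i \<omega> * g4 i \<omega> \<partial>gauss) = e"
  shows "measure gauss {\<omega>. real n / 1000 \<le> \<bar>(\<Sum>i<n. g1 i \<omega> * g2 i \<omega> * g3 i \<omega> * g4 i \<omega>) - real n * e\<bar>} \<le> 1 / real d ^ 22"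
proof -
  define g where "g i k = [g1 i, g2 i, g3 i, g4 i] ! k" for i k
  have p: "(\<Prod>k<4. g i k \<omega>) = g1 i \<omega> * g2 i \<omega> * g3 i \<omega> * g4 i \<omega>" for i \<omega>
    by (simp add: g_def numeral_eq_Suc mult_ac)
  have u: "unit_form (F i) (g i k)" if "i < n" "k < 4" for i k
  proof -
    from that have "k = 0 \<or> k = 1 \<or> k = 2 \<or> k = 3" by auto
    then show ?thesis using g that by (auto simp: g_def)
  qed
  show ?thesis
  proof -
    have e: "(\<Sum>i<n. \<integral>\<omega>. g1 i \<omega> * g2 i \<omega> * g3 i \<omega> * g4 i \<omega> \<partial>gauss) = real n * e"
      using E by simp
    show ?thesis
      using block_sum_concentration_regime[OF reg, of 4 F g] u F unfolding p e by auto
  qed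
qed

lemma concentration_of_products2:
  fixes n d :: nat
  assumes reg: "regime n d" and F: "disjoint_family_on F {..<n}"
    and g: "\<And>i. i < n \<Longrightarrow> unit_form (F i) (g1 i)" "\<And>i. i < n \<Longrightarrow> unit_form (F i) (g2 i)"
    and E: "\<And>i. i < n \<Longrightarrow> (\<integral>\<omega>. g1 i \<omega> * g2 i \<omega> \<partial>gauss) = e"
  shows "measure gauss {\<omega>. real n / 1000 \<le> \<bar>(\<Sum>i<n. g1 i \<omega> * g2 i \<omega>) - real n * e\<bar>} \<le> 1 / real d ^ 22"
proof -
  define g where "g i k = [g1 i, g2 i] ! k" for i k
  have p: "(\<Prod>k<2. g i k \<omega>) = g1 i \<omega> * g2 i \<omega>" for i \<omega>
    by (simp add: g_def numeral_eq_Suc mult_ac)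
  have u: "unit_form (F i) (g i k)" if "i < n" "k < 2" for i k
  proof -
    from that have "k = 0 \<or> k = 1" by auto
    then show ?thesis using g that by (auto simp: g_def)
  qed
  show ?thesis
  proof -
    have e: "(\<Sum>i<n. \<integral>\<omega>. g1 i \<omega> * g2 i \<omega> \<partial>gauss) = real n * e"
      using E by simp
    show ?thesis
      using block_sum_concentration_regime[OF reg, of 2 F g] u F unfolding p e by auto
  qed
qed

lemma upper_bound_of_products6:
  fixes n d :: nat
  assumes reg: "regime n d" and F: "disjoint_family_on F {..<n}"
    and g: "\<And>i. i < n \<Longrightarrow> unit_form (F i) (g1 i)" "\<And>i. i < n \<Longrightarrow> unit_form (F i) (g2 i)"
      "\<And>i. i < n \<Longrightarrow> unit_form (F i) (g3 i)"
  shows "measure gauss {\<omega>. 10 ^ 5 * real n < (\<Sum>i<n. (g1 i \<omega>)\<^sup>2 * (g2 i \<omega>)\<^sup>2 * (g3 i \<omega>)\<^sup>2)} \<le> 1 / real d ^ 22"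
proof -
  define g where "g i k = [g1 i, g1 i, g2 i, g2 i, g3 i, g3 i] ! k" for i k
  have p: "(\<Prod>k<6. g i k \<omega>) = (g1 i \<omega>)\<^sup>2 * (g2 i \<omega>)\<^sup>2 * (g3 i \<omega>)\<^sup>2" for i \<omega>
    by (simp add: g_def numeral_eq_Suc mult_ac power2_eq_square)
  have u: "unit_form (F i) (g i k)" if "i < n" "k < 6" for i k
  proof -
    from that have "k = 0 \<or> k = 1 \<or> k = 2 \<or> k = 3 \<or> k = 4 \<or> k = 5" by auto
    then show ?thesis using g that by (auto simp: g_def)
  qed
  show ?thesis
    using block_sum_upper[OF reg, of 6 F g] u F unfolding p by auto
qed

lemma upper_bound_of_products4:
  fixes n d :: nat
  assumes reg: "regime n d" and F: "disjoint_family_on F {..<n}"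
    and g: "\<And>i. i < n \<Longrightarrow> unit_form (F i) (g1 i)" "\<And>i. i < n \<Longrightarrow> unit_form (F i) (g2 i)"
  shows "measure gauss {\<omega>. 10 ^ 5 * real n < (\<Sum>i<n. (g1 i \<omega>)\<^sup>2 * (g2 i \<omega>)\<^sup>2)} \<le> 1 / real d ^ 22"
proof -
  define g where "g i k = [g1 i, g1 i, g2 i, g2 i] ! k" for i k
  have p: "(\<Prod>k<4. g i k \<omega>) = (g1 i \<omega>)\<^sup>2 * (g2 i \<omega>)\<^sup>2" for i \<omega>
    by (simp add: g_def numeral_eq_Suc mult_ac power2_eq_square)
  have u: "unit_form (F i) (g i k)" if "i < n" "k < 4" for i k
  proof -
    from that have "k = 0 \<or> k = 1 \<or> k = 2 \<or> k = 3" by auto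
    then show ?thesis using g that by (auto simp: g_def)
  qed
  show ?thesis
    using block_sum_upper[OF reg, of 4 F g] u F unfolding p by auto
qed

lemma upper_bound_of_products2:
  fixes n d :: nat
  assumes reg: "regime n d" and F: "disjoint_family_on F {..<n}"
    and g: "\<And>i. i < n \<Longrightarrow> unit_form (F i) (g1 i)"
  shows "measure gauss {\<omega>. 10 ^ 5 * real n < (\<Sum>i<n. (g1 i \<omega>)\<^sup>2)} \<le> 1 / real d ^ 22"
proof -
  have u: "unit_form (F i) (g1 i)" if "i < n" "k < (2 :: nat)" for i k
    using g that by auto
  have p: "(\<Prod>k<(2::nat). g1 i \<omega>) = (g1 i \<omega>)\<^sup>2" for i \<omega>
    by simp
  show ?thesis
    using block_sum_upper[OF reg, of 2 F "\<lambda>i k. g1 i"] u F unfolding p by auto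
qed

text \<open>The direction along which coordinates are exchanged may itself be random, as long as it depends only on coordinates
that the exchange leaves alone: freeze those and use the invariance for the resulting fixed direction.\<close>

lemma gauss_prob_random_swap:
  fixes B :: "('k \<Rightarrow> real) \<Rightarrow> bool" and C :: "('k \<Rightarrow> real) \<Rightarrow> 'k \<Rightarrow> 'k \<Rightarrow> real"
  assumes FH: "finite F" "finite H" "F \<inter> H = {}"
    and C: "\<And>\<omega> h h'. h \<in> H \<Longrightarrow> h' \<in> H \<Longrightarrow> (\<Sum>f\<in>F. C \<omega> f h * C \<omega> f h') = (if h = h' then 1 else 0)"
    and dep: "\<And>\<omega> \<omega>'. (\<And>\<kappa>. \<kappa> \<notin> F \<union> H \<Longrightarrow> \<omega> \<kappa> = \<omega>' \<kappa>) \<Longrightarrow> C \<omega> = C \<omega>'"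
    and Cm: "\<And>f h. (\<lambda>\<omega>. C \<omega> f h) \<in> borel_measurable gauss"
    and B: "{\<omega>. B \<omega>} \<in> sets gauss"
  shows "measure gauss {\<omega>. B \<omega>} = measure gauss {\<omega>. B (swap_isometry F H (C \<omega>) \<omega>)}"
proof -
  let ?\<Psi> = "\<lambda>\<omega>. swap_isometry F H (C \<omega>) \<omega>"
  let ?A = "- (F \<union> H)"
  have \<Psi>m: "?\<Psi> \<in> measurable gauss gauss"
  proof (rule measurable_into_gauss)
    fix \<kappa>
    note [measurable] = Cm
    show "(\<lambda>\<omega>. ?\<Psi> \<omega> \<kappa>) \<in> borel_measurable gauss"
      unfolding swap_isometry_def by measurable
  qed
  define f where "f \<omega> = (indicator {\<omega>. B \<omega>} \<omega> :: ennreal)" for \<omega>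
  have fm: "f \<in> borel_measurable gauss" unfolding f_def using B by simp
  have "emeasure gauss {\<omega>. B \<omega>} = (\<integral>\<^sup>+\<omega>. f \<omega> \<partial>gauss)" using B by (simp add: f_def)
  also have "\<dots> = (\<integral>\<^sup>+\<omega>0. (\<integral>\<^sup>+\<omega>. f (mix ?A \<omega>0 \<omega>) \<partial>gauss) \<partial>gauss)"
    by (rule gauss_nn_integral_mix[OF fm])
  also have "\<dots> = (\<integral>\<^sup>+\<omega>0. (\<integral>\<^sup>+\<omega>. f (?\<Psi> (mix ?A \<omega>0 \<omega>)) \<partial>gauss) \<partial>gauss)"
  proof (rule nn_integral_cong)
    fix \<omega>0 :: "'k \<Rightarrow> real"
    let ?s = "swap_isometry F H (C \<omega>0)"
    have S: "?s \<in> measurable gauss gauss" "distr gauss gauss ?s = gauss"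
      by (rule distr_swap_isometry[OF FH], rule C, assumption+)+
    have hm: "(\<lambda>\<omega>. f (mix ?A \<omega>0 \<omega>)) \<in> borel_measurable gauss"
      by (rule measurable_compose[OF mix_measurable2 fm])
    have com: "mix ?A \<omega>0 (?s \<omega>) = ?\<Psi> (mix ?A \<omega>0 \<omega>)" for \<omega>
    proof -
      have "C (mix ?A \<omega>0 \<omega>) = C \<omega>0" by (rule dep) (simp add: mix_def)
      moreover have "mix ?A \<omega>0 (?s \<omega>) = ?s (mix ?A \<omega>0 \<omega>)"
      proof
        fix \<kappa>
        have 1: "mix ?A \<omega>0 \<omega> f = \<omega> f" if "f \<in> F \<union> H" for f using that by (auto simp: mix_def)
        then show "mix ?A \<omega>0 (?s \<omega>) \<kappa> = ?s (mix ?A \<omega>0 \<omega>) \<kappa>"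
          by (cases "\<kappa> \<in> F \<union> H") (auto simp: swap_isometry_def mix_def)
      qed
      ultimately show ?thesis by simp
    qed
    have "(\<integral>\<^sup>+\<omega>. f (mix ?A \<omega>0 \<omega>) \<partial>gauss) = (\<integral>\<^sup>+\<omega>. f (mix ?A \<omega>0 \<omega>) \<partial>distr gauss gauss ?s)"
      by (simp add: S(2))
    also have "\<dots> = (\<integral>\<^sup>+\<omega>. f (mix ?A \<omega>0 (?s \<omega>)) \<partial>gauss)"
      using hm by (intro nn_integral_distr[OF S(1)]) (simp add: S(2))
    finally show "(\<integral>\<^sup>+\<omega>. f (mix ?A \<omega>0 \<omega>) \<partial>gauss) = (\<integral>\<^sup>+\<omega>. f (?\<Psi> (mix ?A \<omega>0 \<omega>)) \<partial>gauss)"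
      unfolding com .
  qed
  also have "\<dots> = (\<integral>\<^sup>+\<omega>. f (?\<Psi> \<omega>) \<partial>gauss)"
    by (rule gauss_nn_integral_mix[symmetric]) (rule measurable_compose[OF \<Psi>m fm])
  also have "\<dots> = (\<integral>\<^sup>+\<omega>. indicator {\<omega>. B (?\<Psi> \<omega>)} \<omega> \<partial>gauss)"
    by (intro nn_integral_cong) (simp add: f_def indicator_def)
  also have "\<dots> = emeasure gauss {\<omega>. B (?\<Psi> \<omega>)}"
    using measurable_sets[OF \<Psi>m B] by (simp add: vimage_def)
  finally show ?thesis by (simp add: gauss.emeasure_eq_measure)
qed

section \<open>Linear forms of the rows and columns of a Gaussian matrix\<close>

text \<open>Squared Euclidean norm of \<open>(p\<^sub>0, \<dots>, p\<^bsub>n-1\<^esub>)\<close>. Vectors are functions on \<open>nat\<close> of which an initial segment counts.\<close>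

definition nsq :: "nat \<Rightarrow> (nat \<Rightarrow> real) \<Rightarrow> real" where
  "nsq n p = (\<Sum>j<n. (p j)\<^sup>2)"

text \<open>For the random matrix with entries \<open>\<omega> (\<iota> i j)\<close>, \<open>rowf\<close> is the matrix applied to \<open>p\<close> and \<open>colf\<close> its transpose applied
to \<open>c\<close>.\<close>

definition rowf :: "nat \<Rightarrow> (nat \<Rightarrow> nat \<Rightarrow> 'k) \<Rightarrow> (nat \<Rightarrow> real) \<Rightarrow> ('k \<Rightarrow> real) \<Rightarrow> nat \<Rightarrow> real" where
  "rowf d \<iota> p \<omega> i = (\<Sum>j<d. p j * \<omega> (\<iota> i j))"

definition colf :: "nat \<Rightarrow> (nat \<Rightarrow> nat \<Rightarrow> 'k) \<Rightarrow> (nat \<Rightarrow> real) \<Rightarrow> ('k \<Rightarrow> real) \<Rightarrow> nat \<Rightarrow> real" where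
  "colf m \<iota> c \<omega> j = (\<Sum>i<m. c i * \<omega> (\<iota> i j))"

lemma rowf_measurable [measurable]: "(\<lambda>\<omega>. rowf d \<iota> p \<omega> i) \<in> borel_measurable gauss"
  unfolding rowf_def by measurable

lemma nsq_nonneg [simp]: "0 \<le> nsq n p"
  unfolding nsq_def by (simp add: sum_nonneg)

lemma Cauchy_Schwarz_nsq: "(\<Sum>j<n. a j * b j)\<^sup>2 \<le> nsq n a * nsq n b"
  unfolding nsq_def by (rule Cauchy_Schwarz_ineq_sum)

lemma square_sum_le: "(a + b)\<^sup>2 \<le> 2 * a\<^sup>2 + 2 * (b :: real)\<^sup>2"
  using zero_le_power2[of "a - b"] by (simp add: power2_sum power2_diff)

lemma nsq_add_le: "nsq n (\<lambda>j. a j + b j) \<le> 2 * nsq n a + 2 * nsq n b"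
proof -
  have "nsq n (\<lambda>j. a j + b j) \<le> (\<Sum>j<n. 2 * (a j)\<^sup>2 + 2 * (b j)\<^sup>2)"
    unfolding nsq_def by (intro sum_mono square_sum_le)
  also have "\<dots> = 2 * nsq n a + 2 * nsq n b"
    by (simp add: nsq_def sum.distrib sum_distrib_left)
  finally show ?thesis .
qed

lemma nsq_scale: "nsq n (\<lambda>j. c * a j) = c\<^sup>2 * nsq n a"
  by (simp add: nsq_def power_mult_distrib sum_distrib_left)

lemma nsq_eq_0: "nsq n a = 0 \<Longrightarrow> j < n \<Longrightarrow> a j = 0"
  by (auto simp: nsq_def sum_nonneg_eq_0_iff)

text \<open>The Gaussian coordinates used by one batch: the matrices \<open>x\<close> and \<open>z\<close> (\<open>m\<close> rows of length \<open>d\<close>), the noise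
\<open>e\<close>, and a further independent sequence \<open>a\<close> which the algorithm does not see and which supplies the fresh Gaussians
for the exchange of a direction.\<close>

locale arrays =
  fixes ix iz :: "nat \<Rightarrow> nat \<Rightarrow> 'k" and ie ia :: "nat \<Rightarrow> 'k" and d m :: nat
  assumes reg: "regime m d"
    and inj_x: "ix i j = ix i' j' \<longleftrightarrow> i = i' \<and> j = j'"
    and inj_z: "iz i j = iz i' j' \<longleftrightarrow> i = i' \<and> j = j'"
    and inj_e: "ie i = ie i' \<longleftrightarrow> i = i'"
    and inj_a: "ia i = ia i' \<longleftrightarrow> i = i'"
    and disj: "ix i j \<noteq> iz i' j'" "ix i j \<noteq> ie k" "ix i j \<noteq> ia k"
      "iz i j \<noteq> ie k" "iz i j \<noteq> ia k" "ie k \<noteq> ia k'"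
begin

lemma reg_d: "regime d d" using reg by (rule regime_refl)

lemma d_pos: "0 < d" and m_le_d: "m \<le> d"
  using reg by (auto simp: regime_def)

text \<open>All coordinates with row number \<open>i\<close>. Blocks with different row numbers are disjoint, which makes the rows independent.\<close>

definition blk :: "nat \<Rightarrow> 'k set" where
  "blk i = ix i ` {..<d} \<union> iz i ` {..<d} \<union> {ie i, ia i}"

lemma disjoint_blk: "disjoint_family_on blk S"
  unfolding disjoint_family_on_def blk_def
  using inj_x inj_z inj_e inj_a disj disj[symmetric] by auto

lemma unit_x: "nsq d p \<le> 1 \<Longrightarrow> unit_form (blk i) (\<lambda>\<omega>. rowf d ix p \<omega> i)"
  unfolding rowf_def nsq_def
  by (rule unit_form_mono[OF unit_form_reindex]) (auto simp: blk_def inj_on_def inj_x)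

lemma unit_z: "nsq d p \<le> 1 \<Longrightarrow> unit_form (blk i) (\<lambda>\<omega>. rowf d iz p \<omega> i)"
  unfolding rowf_def nsq_def
  by (rule unit_form_mono[OF unit_form_reindex]) (auto simp: blk_def inj_on_def inj_z)

lemma unit_e: "unit_form (blk i) (\<lambda>\<omega>. \<omega> (ie i))"
  by (rule unit_form_mono[OF unit_form_coordinate]) (auto simp: blk_def)

lemma unit_a: "unit_form (blk i) (\<lambda>\<omega>. \<omega> (ia i))"
  by (rule unit_form_mono[OF unit_form_coordinate]) (auto simp: blk_def)

lemma expectation_xxzz:
  "(\<integral>\<omega>. rowf d ix p \<omega> i * rowf d ix p' \<omega> i * rowf d iz q \<omega> i * rowf d iz q' \<omega> i \<partial>gauss)
     = (\<Sum>j<d. p j * p' j) * (\<Sum>j<d. q j * q' j)"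
proof -
  have inj: "inj_on (ix i) {..<d}" "inj_on (iz i) {..<d}"
    by (auto simp: inj_on_def inj_x inj_z)
  note X = expectation_reindexed_forms[OF finite_lessThan inj(1)]
  note Z = expectation_reindexed_forms[OF finite_lessThan inj(2)]
  have "(\<integral>\<omega>. rowf d ix p \<omega> i * rowf d ix p' \<omega> i * rowf d iz q \<omega> i * rowf d iz q' \<omega> i \<partial>gauss)
      = (\<integral>\<omega>. (rowf d ix p \<omega> i * rowf d ix p' \<omega> i) * (rowf d iz q \<omega> i * rowf d iz q' \<omega> i) \<partial>gauss)"
    by (simp add: mult.assoc)
  also have "\<dots> = (\<integral>\<omega>. rowf d ix p \<omega> i * rowf d ix p' \<omega> i \<partial>gauss) * (\<integral>\<omega>. rowf d iz q \<omega> i * rowf d iz q' \<omega> i \<partial>gauss)"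
  proof (rule expectation_product_of_disjoint_blocks[where ?F1.0 = "ix i ` {..<d}" and ?F2.0 = "iz i ` {..<d}"])
    show "ix i ` {..<d} \<inter> iz i ` {..<d} = {}" using disj by auto
  qed (auto simp: rowf_def X(1) Z(1) intro!: arg_cong2[where f = "(*)"] sum.cong)
  also have "\<dots> = (\<Sum>j<d. p j * p' j) * (\<Sum>j<d. q j * q' j)"
    by (simp add: rowf_def X(2) Z(2))
  finally show ?thesis .
qed

lemma moments_concentrate:
  assumes "nsq d p \<le> 1" "nsq d p' \<le> 1" "nsq d q \<le> 1" "nsq d q' \<le> 1"
  shows "measure gauss {\<omega>. real m / 1000 \<le>
      \<bar>(\<Sum>i<m. rowf d ix p \<omega> i * rowf d ix p' \<omega> i * rowf d iz q \<omega> i * rowf d iz q' \<omega> i)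
        - real m * ((\<Sum>j<d. p j * p' j) * (\<Sum>j<d. q j * q' j))\<bar>} \<le> 1 / real d ^ 22"
  using assms
  by (intro concentration_of_products4[OF reg disjoint_blk] unit_x unit_z expectation_xxzz)

lemma noise_weights_concentrate:
  assumes q: "nsq d q \<le> 1"
  shows "measure gauss {\<omega>. real m / 1000 \<le>
      \<bar>nsq m (\<lambda>i. rowf d iz q \<omega> i * \<omega> (ie i)) - real m * nsq d q\<bar>} \<le> 1 / real d ^ 22"
proof -
  have E: "(\<integral>\<omega>. rowf d iz q \<omega> i * rowf d iz q \<omega> i * \<omega> (ie i) * \<omega> (ie i) \<partial>gauss) = nsq d q" for i
  proof -
    have inj: "inj_on (iz i) {..<d}" by (auto simp: inj_on_def inj_z)
    note Z = expectation_reindexed_forms[OF finite_lessThan inj, of q q]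
    have e: "integrable gauss (\<lambda>\<omega>. \<omega> (ie i) * \<omega> (ie i)) \<and> (\<integral>\<omega>. \<omega> (ie i) * \<omega> (ie i) \<partial>gauss) = 1"
      using expectation_linear_forms[of "{ie i}" "\<lambda>_. 1" "\<lambda>_. 1"] by simp
    have "(\<integral>\<omega>. rowf d iz q \<omega> i * rowf d iz q \<omega> i * \<omega> (ie i) * \<omega> (ie i) \<partial>gauss)
       = (\<integral>\<omega>. (rowf d iz q \<omega> i * rowf d iz q \<omega> i) * (\<omega> (ie i) * \<omega> (ie i)) \<partial>gauss)"
      by (simp add: mult.assoc)
    also have "\<dots> = (\<integral>\<omega>. rowf d iz q \<omega> i * rowf d iz q \<omega> i \<partial>gauss) * (\<integral>\<omega>. \<omega> (ie i) * \<omega> (ie i) \<partial>gauss)"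
    proof (rule expectation_product_of_disjoint_blocks[where ?F1.0 = "iz i ` {..<d}" and ?F2.0 = "{ie i}"])
      show "iz i ` {..<d} \<inter> {ie i} = {}" using disj disj[symmetric] by auto
    qed (use e in \<open>auto simp: rowf_def Z(1) intro!: arg_cong2[where f = "(*)"] sum.cong\<close>)
    also have "\<dots> = nsq d q" using e by (simp add: rowf_def Z(2) nsq_def power2_eq_square)
    finally show ?thesis .
  qed
  have eq: "nsq m (\<lambda>i. rowf d iz q \<omega> i * \<omega> (ie i))
    = (\<Sum>i<m. rowf d iz q \<omega> i * rowf d iz q \<omega> i * \<omega> (ie i) * \<omega> (ie i))" for \<omega>
    unfolding nsq_def by (intro sum.cong refl) (simp add: power2_eq_square mult_ac)
  show ?thesis
    unfolding eq
    by (rule concentration_of_products4[OF reg disjoint_blk unit_z[OF q] unit_z[OF q] unit_e unit_e E])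
qed

text \<open>Given the coefficients, the \<open>d\<close> columns are independent and each form has variance \<open>nsq m (c \<omega>)\<close>.\<close>

lemma column_forms_concentrate:
  assumes cm[measurable]: "\<And>i. (\<lambda>\<omega>. c \<omega> i) \<in> borel_measurable gauss"
    and dep: "\<And>\<omega> \<omega>'. (\<And>\<kappa>. (\<forall>i j. \<kappa> \<noteq> ix i j) \<Longrightarrow> \<omega> \<kappa> = \<omega>' \<kappa>) \<Longrightarrow> c \<omega> = c \<omega>'"
  shows "measure gauss {\<omega>. real d * nsq m (c \<omega>) / 1000 <
      \<bar>nsq d (colf m ix (c \<omega>) \<omega>) - real d * nsq m (c \<omega>)\<bar>} \<le> 1 / real d ^ 22"
proof (rule gauss_prob_le_by_resampling[where A = "- range (case_prod ix)"])
  show "{\<omega>. real d * nsq m (c \<omega>) / 1000 < \<bar>nsq d (colf m ix (c \<omega>) \<omega>) - real d * nsq m (c \<omega>)\<bar>} \<in> sets gauss"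
    unfolding nsq_def colf_def by (rule gauss_setI) measurable
  fix \<omega>0 :: "'k \<Rightarrow> real"
  let ?A = "- range (case_prod ix)"
  define b where "b = c \<omega>0"
  have c: "c (mix ?A \<omega>0 \<omega>) = b" for \<omega>
    unfolding b_def by (rule dep) (auto simp: mix_def)
  have col: "colf m ix b (mix ?A \<omega>0 \<omega>) = colf m ix b \<omega>" for \<omega>
  proof -
    have "ix i j \<in> range (case_prod ix)" for i j by (rule range_eqI[of _ _ "(i, j)"]) simp
    then show ?thesis by (simp add: colf_def mix_def fun_eq_iff)
  qed
  show "measure gauss {\<omega>. real d * nsq m (c (mix ?A \<omega>0 \<omega>)) / 1000 <
      \<bar>nsq d (colf m ix (c (mix ?A \<omega>0 \<omega>)) (mix ?A \<omega>0 \<omega>)) - real d * nsq m (c (mix ?A \<omega>0 \<omega>))\<bar>} \<le> 1 / real d ^ 22"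
    unfolding c col
  proof (cases "nsq m b = 0")
    case True
    then have "b i = 0" if "i < m" for i using nsq_eq_0 that by blast
    then have "colf m ix b \<omega> j = 0" for \<omega> j by (simp add: colf_def)
    then show "measure gauss {\<omega>. real d * nsq m b / 1000 < \<bar>nsq d (colf m ix b \<omega>) - real d * nsq m b\<bar>} \<le> 1 / real d ^ 22"
      using True by (simp add: nsq_def)
  next
    case False
    then have pos: "0 < nsq m b" using nsq_nonneg[of m b] by linarith
    define s where "s = sqrt (nsq m b)"
    have s: "0 < s" "s\<^sup>2 = nsq m b" using pos by (auto simp: s_def)
    define u where "u i = b i / s" for i
    have "nsq m u = nsq m b / s\<^sup>2"
      by (simp add: nsq_def u_def power_divide sum_divide_distrib)
    then have u1: "nsq m u = 1" using s pos by simp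
    have bu: "colf m ix b \<omega> j = s * colf m ix u \<omega> j" for \<omega> j
      using s by (simp add: colf_def u_def sum_distrib_left)
    have inj: "inj_on (\<lambda>i. ix i j) {..<m}" for j by (auto simp: inj_on_def inj_x)
    have uf: "unit_form ((\<lambda>i. ix i j) ` {..<m}) (\<lambda>\<omega>. colf m ix u \<omega> j)" for j
      unfolding colf_def using u1 by (intro unit_form_reindex inj) (auto simp: nsq_def)
    have E: "(\<integral>\<omega>. colf m ix u \<omega> j * colf m ix u \<omega> j \<partial>gauss) = 1" for j
      using expectation_reindexed_forms(2)[OF finite_lessThan inj, where p = u and p' = u] u1
      by (simp add: colf_def nsq_def power2_eq_square)
    have dj: "disjoint_family_on (\<lambda>j. (\<lambda>i. ix i j) ` {..<m}) {..<d}"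
      by (auto simp: disjoint_family_on_def inj_x)
    have "measure gauss {\<omega>. real d / 1000 \<le> \<bar>(\<Sum>j<d. colf m ix u \<omega> j * colf m ix u \<omega> j) - real d * 1\<bar>} \<le> 1 / real d ^ 22"
      by (rule concentration_of_products2[OF reg_d dj uf uf E])
    moreover have "measure gauss {\<omega>. real d * nsq m b / 1000 < \<bar>nsq d (colf m ix b \<omega>) - real d * nsq m b\<bar>}
      \<le> measure gauss {\<omega>. real d / 1000 \<le> \<bar>(\<Sum>j<d. colf m ix u \<omega> j * colf m ix u \<omega> j) - real d * 1\<bar>}"
    proof (rule gauss.finite_measure_mono)
      show "{\<omega>. real d / 1000 \<le> \<bar>(\<Sum>j<d. colf m ix u \<omega> j * colf m ix u \<omega> j) - real d * 1\<bar>} \<in> sets gauss"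
        unfolding colf_def by (rule gauss_setI) measurable
      have "nsq d (colf m ix b \<omega>) - real d * nsq m b = nsq m b * ((\<Sum>j<d. colf m ix u \<omega> j * colf m ix u \<omega> j) - real d * 1)" for \<omega>
        unfolding nsq_def[of d] bu
        by (simp add: s(2)[symmetric] power_mult_distrib sum_distrib_left[symmetric] power2_eq_square algebra_simps)
      then have "\<bar>nsq d (colf m ix b \<omega>) - real d * nsq m b\<bar> = nsq m b * \<bar>(\<Sum>j<d. colf m ix u \<omega> j * colf m ix u \<omega> j) - real d * 1\<bar>" for \<omega>
        using pos by (simp add: abs_mult)
      then show "{\<omega>. real d * nsq m b / 1000 < \<bar>nsq d (colf m ix b \<omega>) - real d * nsq m b\<bar>}
        \<subseteq> {\<omega>. real d / 1000 \<le> \<bar>(\<Sum>j<d. colf m ix u \<omega> j * colf m ix u \<omega> j) - real d * 1\<bar>}"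
        using pos by (auto simp: mult.commute[of _ "nsq m b"] mult_less_cancel_left_pos times_divide_eq_right[symmetric]
            simp del: times_divide_eq_right)
    qed
    ultimately show "measure gauss {\<omega>. real d * nsq m b / 1000 < \<bar>nsq d (colf m ix b \<omega>) - real d * nsq m b\<bar>} \<le> 1 / real d ^ 22"
      by linarith
  qed
qed

text \<open>Given the coefficients, the form is a centred Gaussian with variance \<open>nsq m (h \<omega>)\<close>.\<close>

lemma noise_forms_bounded:
  assumes hm[measurable]: "\<And>i. (\<lambda>\<omega>. h \<omega> i) \<in> borel_measurable gauss"
    and dep: "\<And>\<omega> \<omega>'. (\<And>\<kappa>. (\<forall>i. \<kappa> \<noteq> ie i) \<Longrightarrow> \<omega> \<kappa> = \<omega>' \<kappa>) \<Longrightarrow> h \<omega> = h \<omega>'"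
  shows "measure gauss {\<omega>. 50 * ln (real d) * nsq m (h \<omega>) < (\<Sum>i<m. h \<omega> i * \<omega> (ie i))\<^sup>2} \<le> 1 / real d ^ 22"
proof (rule gauss_prob_le_by_resampling[where A = "- range ie"])
  show "{\<omega>. 50 * ln (real d) * nsq m (h \<omega>) < (\<Sum>i<m. h \<omega> i * \<omega> (ie i))\<^sup>2} \<in> sets gauss"
    unfolding nsq_def by (rule gauss_setI) measurable
  fix \<omega>0 :: "'k \<Rightarrow> real"
  let ?A = "- range ie"
  define b where "b = h \<omega>0"
  have h: "h (mix ?A \<omega>0 \<omega>) = b" for \<omega>
    unfolding b_def by (rule dep) (auto simp: mix_def)
  have e: "mix ?A \<omega>0 \<omega> (ie i) = \<omega> (ie i)" for \<omega> i by (simp add: mix_def)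
  have d: "1000 \<le> d" using reg by (simp add: regime_def)
  have L: "1 \<le> ln (real d)" using ln_ge_1[OF d] .
  show "measure gauss {\<omega>. 50 * ln (real d) * nsq m (h (mix ?A \<omega>0 \<omega>))
      < (\<Sum>i<m. h (mix ?A \<omega>0 \<omega>) i * mix ?A \<omega>0 \<omega> (ie i))\<^sup>2} \<le> 1 / real d ^ 22"
    unfolding h e
  proof (cases "nsq m b = 0")
    case True
    then have "b i = 0" if "i < m" for i using nsq_eq_0 that by blast
    then show "measure gauss {\<omega>. 50 * ln (real d) * nsq m b < (\<Sum>i<m. b i * \<omega> (ie i))\<^sup>2} \<le> 1 / real d ^ 22"
      using True by simp
  next
    case False
    then have pos: "0 < nsq m b" using nsq_nonneg[of m b] by linarith
    define s where "s = sqrt (nsq m b)"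
    have s: "0 < s" "s\<^sup>2 = nsq m b" using pos by (auto simp: s_def)
    define R where "R = sqrt (50 * ln (real d))"
    have R: "0 \<le> R" "R\<^sup>2 = 50 * ln (real d)" using L by (auto simp: R_def)
    let ?g = "\<lambda>\<omega>. \<Sum>i<m. (b i / s) * \<omega> (ie i)"
    have uf: "unit_form (ie ` {..<m}) ?g"
    proof (intro unit_form_reindex)
      have "(\<Sum>i<m. (b i / s)\<^sup>2) = nsq m b / s\<^sup>2"
        by (simp add: nsq_def power_divide sum_divide_distrib)
      then show "(\<Sum>i<m. (b i / s)\<^sup>2) \<le> 1" using s pos by simp
    qed (auto simp: inj_on_def inj_e)
    have sg: "(\<Sum>i<m. b i * \<omega> (ie i)) = s * ?g \<omega>" for \<omega>
      using s by (simp add: sum_distrib_left)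
    have "measure gauss {\<omega>. 50 * ln (real d) * nsq m b < (\<Sum>i<m. b i * \<omega> (ie i))\<^sup>2} \<le> measure gauss {\<omega>. R < \<bar>?g \<omega>\<bar>}"
    proof (rule gauss.finite_measure_mono)
      show "{\<omega>. R < \<bar>?g \<omega>\<bar>} \<in> sets gauss" by (rule gauss_setI) measurable
      show "{\<omega>. 50 * ln (real d) * nsq m b < (\<Sum>i<m. b i * \<omega> (ie i))\<^sup>2} \<subseteq> {\<omega>. R < \<bar>?g \<omega>\<bar>}"
      proof
        fix \<omega> assume "\<omega> \<in> {\<omega>. 50 * ln (real d) * nsq m b < (\<Sum>i<m. b i * \<omega> (ie i))\<^sup>2}"
        then have "R\<^sup>2 * s\<^sup>2 < (s * ?g \<omega>)\<^sup>2" unfolding sg R s by simp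
        then have "R\<^sup>2 * s\<^sup>2 < (?g \<omega>)\<^sup>2 * s\<^sup>2" by (simp only: power_mult_distrib mult.commute)
        then have "R\<^sup>2 < (?g \<omega>)\<^sup>2" using s(1) mult_less_cancel_right_pos[of "s\<^sup>2"] by (simp del: sum_divide_distrib)
        then have "R < \<bar>?g \<omega>\<bar>" using R(1) by (metis abs_of_nonneg real_sqrt_abs real_sqrt_less_iff)
        then show "\<omega> \<in> {\<omega>. R < \<bar>?g \<omega>\<bar>}" by simp
      qed
    qed
    also have "\<dots> \<le> 2 * exp (- R\<^sup>2 / 2)" by (rule unit_form_tail[OF uf R(1)])
    also have "\<dots> = 2 / real d ^ 25"
      using exp_ln_multiple[of d 25] d_pos by (simp add: R)
    also have "\<dots> \<le> 1 / real d ^ 22"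
    proof -
      have "2 \<le> real d ^ 3" using d power_mono[of 1000 "real d" 3] by simp
      then have "2 * real d ^ 22 \<le> real d ^ 3 * real d ^ 22" by (intro mult_right_mono) auto
      also have "\<dots> = real d ^ 25" by (simp add: power_add[symmetric])
      finally show ?thesis using d_pos by (simp add: field_simps)
    qed
    finally show "measure gauss {\<omega>. 50 * ln (real d) * nsq m b < (\<Sum>i<m. b i * \<omega> (ie i))\<^sup>2} \<le> 1 / real d ^ 22" .
  qed
qed

section \<open>Quadratic expressions in one Gaussian matrix\<close>

text \<open>\<open>M i j k\<close> is the entry at position \<open>(i, j)\<close> of the \<open>k\<close>-th direction in the space of \<open>m \<times> d\<close> matrices. \<open>coef\<close> translates
these indices to coordinates of the Gaussian space.\<close>

definition coef :: "(nat \<Rightarrow> nat \<Rightarrow> nat \<Rightarrow> real) \<Rightarrow> 'k \<Rightarrow> 'k \<Rightarrow> real" where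
  "coef M \<kappa> h = M (fst (inv_into UNIV (case_prod ix) \<kappa>)) (snd (inv_into UNIV (case_prod ix) \<kappa>)) (inv_into UNIV ia h)"

text \<open>The matrix \<open>x\<close> with its components along the directions \<open>M \<cdot> \<cdot> k\<close>, for \<open>k < N\<close>, replaced by \<open>-a\<^sub>k\<close>.\<close>

definition regress :: "nat \<Rightarrow> (nat \<Rightarrow> nat \<Rightarrow> nat \<Rightarrow> real) \<Rightarrow> ('k \<Rightarrow> real) \<Rightarrow> 'k \<Rightarrow> real" where
  "regress N M = swap_isometry (case_prod ix ` ({..<m} \<times> {..<d})) (ia ` {..<N}) (coef M)"

lemma inj_case_x: "inj (case_prod ix)"
  by (auto simp: inj_on_def inj_x)

lemma inj_ia: "inj ia"
  by (auto simp: inj_on_def inj_a)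

lemma coef_eq: "coef M (ix i j) (ia k) = M i j k"
  using inv_f_f[OF inj_case_x, of "(i, j)"] inv_f_f[OF inj_ia] by (simp add: coef_def)

lemma sum_x: "(\<Sum>f\<in>case_prod ix ` ({..<m} \<times> {..<d}). g f) = (\<Sum>i<m. \<Sum>j<d. g (ix i j))"
  by (subst sum.reindex[OF inj_on_subset[OF inj_case_x]])
    (auto simp: sum.cartesian_product split_def comp_def)

lemma sum_a: "(\<Sum>h\<in>ia ` {..<N}. g h) = (\<Sum>k<N. g (ia k))"
  by (subst sum.reindex) (auto intro: inj_on_subset[OF inj_ia])

lemma regress_eqs:
  "i < m \<Longrightarrow> j < d \<Longrightarrow> regress N M \<omega> (ix i j) =
     \<omega> (ix i j) - (\<Sum>k<N. M i j k * (\<omega> (ia k) + (\<Sum>i'<m. \<Sum>j'<d. M i' j' k * \<omega> (ix i' j'))))"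
  "regress N M \<omega> (iz i j) = \<omega> (iz i j)"
  "regress N M \<omega> (ie i) = \<omega> (ie i)"
  using disj disj[symmetric]
  by (auto simp: regress_def swap_isometry_def sum_x sum_a coef_eq)

lemma prob_regress:
  assumes iso: "\<And>\<omega> k k'. k < N \<Longrightarrow> k' < N \<Longrightarrow>
      (\<Sum>i<m. \<Sum>j<d. M \<omega> i j k * M \<omega> i j k') = (if k = k' then 1 else 0)"
    and Mm: "\<And>i j k. (\<lambda>\<omega>. M \<omega> i j k) \<in> borel_measurable gauss"
    and dep: "\<And>\<omega> \<omega>'. (\<And>\<kappa>. (\<forall>i j. \<kappa> \<noteq> ix i j) \<Longrightarrow> (\<forall>k. \<kappa> \<noteq> ia k) \<Longrightarrow> \<omega> \<kappa> = \<omega>' \<kappa>) \<Longrightarrow> M \<omega> = M \<omega>'"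
    and B: "{\<omega>. B \<omega>} \<in> sets gauss"
  shows "measure gauss {\<omega>. B \<omega>} = measure gauss {\<omega>. B (regress N (M \<omega>) \<omega>)}"
  unfolding regress_def
proof (rule gauss_prob_random_swap[OF _ _ _ _ _ _ B])
  fix \<omega> h h' assume "h \<in> ia ` {..<N}" "h' \<in> ia ` {..<N}"
  then show "(\<Sum>f\<in>case_prod ix ` ({..<m} \<times> {..<d}). coef (M \<omega>) f h * coef (M \<omega>) f h') = (if h = h' then 1 else 0)"
    using iso by (auto simp: sum_x coef_eq inj_a)
next
  fix \<omega> \<omega>' :: "'k \<Rightarrow> real"
  assume "\<And>\<kappa>. \<kappa> \<notin> case_prod ix ` ({..<m} \<times> {..<d}) \<union> ia ` {..<N} \<Longrightarrow> \<omega> \<kappa> = \<omega>' \<kappa>"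
  then have "M \<omega> = M \<omega>'" by (intro dep) (metis (no_types, lifting) UnE image_iff old.prod.case surj_pair)
  then show "coef (M \<omega>) = coef (M \<omega>')" by simp
qed (use disj in \<open>auto simp: coef_def intro: Mm\<close>)

text \<open>The directions \<open>e\<^sub>k p\<^sup>T\<close>: in every row the component along \<open>p\<close> is replaced.\<close>

lemma prob_regress_rows:
  assumes p: "nsq d p = 1" and B: "{\<omega>. B \<omega>} \<in> sets gauss"
  defines "\<Phi> \<equiv> regress m (\<lambda>i j k. if i = k then p j else 0)"
  shows "measure gauss {\<omega>. B \<omega>} = measure gauss {\<omega>. B (\<Phi> \<omega>)}"
    and "i < m \<Longrightarrow> j < d \<Longrightarrow> \<Phi> \<omega> (ix i j) = \<omega> (ix i j) - p j * (\<omega> (ia i) + rowf d ix p \<omega> i)"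
    and "\<Phi> \<omega> (iz i j) = \<omega> (iz i j)"
proof -
  have d1: "(\<Sum>i<m. \<Sum>j<d. (if i = k then p j else 0) * b i j) = (\<Sum>j<d. p j * b k j)" if "k < m" for k b
  proof -
    have "(\<Sum>i<m. \<Sum>j<d. (if i = k then p j else 0) * b i j) = (\<Sum>i<m. if i = k then (\<Sum>j<d. p j * b i j) else 0)"
      by (intro sum.cong refl) auto
    then show ?thesis using that by simp
  qed
  show "measure gauss {\<omega>. B \<omega>} = measure gauss {\<omega>. B (\<Phi> \<omega>)}"
    unfolding \<Phi>_def
  proof (rule prob_regress[OF _ _ _ B])
    fix k k' assume k: "k < m" "k' < m"
    show "(\<Sum>i<m. \<Sum>j<d. (if i = k then p j else 0) * (if i = k' then p j else 0)) = (if k = k' then 1 else 0)"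
      unfolding d1[OF k(1)] using p by (auto simp: nsq_def power2_eq_square)
  qed auto
  show "\<Phi> \<omega> (ix i j) = \<omega> (ix i j) - p j * (\<omega> (ia i) + rowf d ix p \<omega> i)" if "i < m" "j < d"
  proof -
    have "(\<Sum>k<m. (if i = k then p j else 0) * (\<omega> (ia k) + (\<Sum>i'<m. \<Sum>j'<d. (if i' = k then p j' else 0) * \<omega> (ix i' j'))))
       = (\<Sum>k<m. if i = k then p j * (\<omega> (ia k) + (\<Sum>j'<d. p j' * \<omega> (ix k j'))) else 0)"
      by (intro sum.cong refl) (auto simp: d1)
    then show ?thesis
      unfolding \<Phi>_def regress_eqs(1)[OF that] using that by (simp add: rowf_def)
  qed
  show "\<Phi> \<omega> (iz i j) = \<omega> (iz i j)" by (simp add: \<Phi>_def regress_eqs)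
qed

text \<open>The directions \<open>u e\<^sub>k\<^sup>T\<close>: in every column the component along \<open>u\<close> is replaced.\<close>

lemma prob_regress_columns:
  assumes u: "\<And>\<omega>. nsq m (u \<omega>) = 1" and um: "\<And>i. (\<lambda>\<omega>. u \<omega> i) \<in> borel_measurable gauss"
    and dep: "\<And>\<omega> \<omega>'. (\<And>\<kappa>. (\<forall>i j. \<kappa> \<noteq> ix i j) \<Longrightarrow> (\<forall>k. \<kappa> \<noteq> ia k) \<Longrightarrow> \<omega> \<kappa> = \<omega>' \<kappa>) \<Longrightarrow> u \<omega> = u \<omega>'"
    and B: "{\<omega>. B \<omega>} \<in> sets gauss"
  defines "\<Phi> \<equiv> (\<lambda>\<omega>. regress d (\<lambda>i j k. if j = k then u \<omega> i else 0) \<omega>)"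
  shows "measure gauss {\<omega>. B \<omega>} = measure gauss {\<omega>. B (\<Phi> \<omega>)}"
    and "i < m \<Longrightarrow> j < d \<Longrightarrow> \<Phi> \<omega> (ix i j) = \<omega> (ix i j) - u \<omega> i * (\<omega> (ia j) + colf m ix (u \<omega>) \<omega> j)"
    and "\<Phi> \<omega> (iz i j) = \<omega> (iz i j)" and "\<Phi> \<omega> (ie i) = \<omega> (ie i)"
proof -
  have d1: "(\<Sum>i<m. \<Sum>j<d. (if j = k then u \<omega> i else 0) * b i j) = (\<Sum>i<m. u \<omega> i * b i k)" if "k < d" for k b \<omega>
  proof -
    have "(\<Sum>j<d. (if j = k then u \<omega> i else 0) * b i j) = (\<Sum>j<d. if j = k then u \<omega> i * b i j else 0)" for i
      by (intro sum.cong refl) auto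
    then show ?thesis using that by simp
  qed
  show "measure gauss {\<omega>. B \<omega>} = measure gauss {\<omega>. B (\<Phi> \<omega>)}"
    unfolding \<Phi>_def
  proof (rule prob_regress[OF _ _ _ B])
    fix k k' \<omega> assume k: "k < d" "k' < d"
    show "(\<Sum>i<m. \<Sum>j<d. (if j = k then u \<omega> i else 0) * (if j = k' then u \<omega> i else 0)) = (if k = k' then 1 else 0)"
      unfolding d1[OF k(1)] using u[of \<omega>] by (auto simp: nsq_def power2_eq_square)
  next
    fix \<omega> \<omega>' :: "'k \<Rightarrow> real"
    assume "\<And>\<kappa>. (\<forall>i j. \<kappa> \<noteq> ix i j) \<Longrightarrow> (\<forall>k. \<kappa> \<noteq> ia k) \<Longrightarrow> \<omega> \<kappa> = \<omega>' \<kappa>"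
    then have eq: "u \<omega> = u \<omega>'" by (rule dep)
    show "(\<lambda>i j k. if j = k then u \<omega> i else 0) = (\<lambda>i j k. if j = k then u \<omega>' i else 0)"
      unfolding eq by (rule refl)
  next
    fix i j k :: nat
    show "(\<lambda>\<omega>. if j = k then u \<omega> i else 0) \<in> borel_measurable gauss" using um by (cases "j = k") auto
  qed
  show "\<Phi> \<omega> (ix i j) = \<omega> (ix i j) - u \<omega> i * (\<omega> (ia j) + colf m ix (u \<omega>) \<omega> j)" if "i < m" "j < d"
  proof -
    have "(\<Sum>k<d. (if j = k then u \<omega> i else 0) * (\<omega> (ia k) + (\<Sum>i'<m. \<Sum>j'<d. (if j' = k then u \<omega> i' else 0) * \<omega> (ix i' j'))))
       = (\<Sum>k<d. if j = k then u \<omega> i * (\<omega> (ia k) + (\<Sum>i'<m. u \<omega> i' * \<omega> (ix i' k))) else 0)"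
      by (intro sum.cong refl) (auto simp: d1)
    then show ?thesis
      unfolding \<Phi>_def regress_eqs(1)[OF that] using that by (simp add: colf_def)
  qed
  show "\<Phi> \<omega> (iz i j) = \<omega> (iz i j)" "\<Phi> \<omega> (ie i) = \<omega> (ie i)" by (simp_all add: \<Phi>_def regress_eqs)
qed

text \<open>In \<open>\<Sum>\<^sub>i D\<^sub>i \<langle>x\<^sub>i, p\<rangle> x\<^sub>i\<close> the coefficients depend on \<open>x\<close>. After the component of \<open>x\<^sub>i\<close> along \<open>p\<close> has been exchanged
for \<open>-a\<^sub>i\<close>, the sum equals \<open>-\<Sum>\<^sub>i D\<^sub>i a\<^sub>i x\<^sub>i\<close>, whose coefficients are independent of \<open>x\<close>, plus a multiple of \<open>p\<close>. The first
term has squared norm of order \<open>m d\<close>, the second one of order \<open>m\<^sup>2 \<le> m d\<close>.\<close>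

lemma quadratic_row_sums_bounded:
  assumes p: "nsq d p = 1" and q: "nsq d q \<le> 1" "nsq d q' \<le> 1"
  shows "measure gauss {\<omega>. 10 ^ 12 * real m * real d <
      nsq d (colf m ix (\<lambda>i. rowf d iz q \<omega> i * rowf d iz q' \<omega> i * rowf d ix p \<omega> i) \<omega>)} \<le> 4 / real d ^ 22"
proof -
  define D where "D \<omega> i = rowf d iz q \<omega> i * rowf d iz q' \<omega> i" for \<omega> i
  have Dm[measurable]: "(\<lambda>\<omega>. D \<omega> i) \<in> borel_measurable gauss" for i unfolding D_def by measurable
  define B where "B \<omega> \<longleftrightarrow> 10 ^ 12 * real m * real d < nsq d (colf m ix (\<lambda>i. D \<omega> i * rowf d ix p \<omega> i) \<omega>)" for \<omega>
  have Bm: "{\<omega>. B \<omega>} \<in> sets gauss"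
    unfolding B_def nsq_def colf_def by (rule gauss_setI) measurable
  let ?\<Phi> = "regress m (\<lambda>i j k. if i = k then p j else 0)"
  note R = prob_regress_rows[OF p Bm]
  define c where "c \<omega> i = D \<omega> i * \<omega> (ia i)" for \<omega> i
  have cm[measurable]: "(\<lambda>\<omega>. c \<omega> i) \<in> borel_measurable gauss" for i unfolding c_def by measurable
  have xp: "rowf d ix p (?\<Phi> \<omega>) i = - \<omega> (ia i)" if "i < m" for \<omega> i
  proof -
    have "rowf d ix p (?\<Phi> \<omega>) i = (\<Sum>j<d. p j * (\<omega> (ix i j) - p j * (\<omega> (ia i) + rowf d ix p \<omega> i)))"
      unfolding rowf_def[of d ix p "?\<Phi> \<omega>"] using that R(2) by (intro sum.cong) auto
    also have "\<dots> = rowf d ix p \<omega> i - nsq d p * (\<omega> (ia i) + rowf d ix p \<omega> i)"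
      by (simp add: right_diff_distrib sum_subtractf rowf_def nsq_def power2_eq_square sum_distrib_right mult.assoc)
    finally show ?thesis using p by simp
  qed
  have D\<Phi>: "D (?\<Phi> \<omega>) i = D \<omega> i" for \<omega> i by (simp add: D_def rowf_def R(3))
  have col: "colf m ix (\<lambda>i. D (?\<Phi> \<omega>) i * rowf d ix p (?\<Phi> \<omega>) i) (?\<Phi> \<omega>) j
      = - colf m ix (c \<omega>) \<omega> j + p j * (\<Sum>i<m. c \<omega> i * (\<omega> (ia i) + rowf d ix p \<omega> i))" if "j < d" for \<omega> j
  proof -
    have "colf m ix (\<lambda>i. D (?\<Phi> \<omega>) i * rowf d ix p (?\<Phi> \<omega>) i) (?\<Phi> \<omega>) j
        = (\<Sum>i<m. - c \<omega> i * (\<omega> (ix i j) - p j * (\<omega> (ia i) + rowf d ix p \<omega> i)))"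
      unfolding colf_def by (intro sum.cong refl) (use that in \<open>simp add: xp D\<Phi> c_def R(2)\<close>)
    also have "\<dots> = - colf m ix (c \<omega>) \<omega> j + p j * (\<Sum>i<m. c \<omega> i * (\<omega> (ia i) + rowf d ix p \<omega> i))"
      by (simp add: colf_def right_diff_distrib sum_subtractf sum_negf sum_distrib_left mult_ac)
    finally show ?thesis .
  qed
  define E1 where "E1 \<omega> \<longleftrightarrow> real d * nsq m (c \<omega>) / 1000 < \<bar>nsq d (colf m ix (c \<omega>) \<omega>) - real d * nsq m (c \<omega>)\<bar>" for \<omega>
  define E2 where "E2 \<omega> \<longleftrightarrow> 10 ^ 5 * real m < (\<Sum>i<m. (rowf d iz q \<omega> i)\<^sup>2 * (rowf d iz q' \<omega> i)\<^sup>2 * (\<omega> (ia i))\<^sup>2)" for \<omega>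
  define E3 where "E3 \<omega> \<longleftrightarrow> 10 ^ 5 * real m < (\<Sum>i<m. (\<omega> (ia i))\<^sup>2)" for \<omega>
  define E4 where "E4 \<omega> \<longleftrightarrow> 10 ^ 5 * real m < (\<Sum>i<m. (rowf d ix p \<omega> i)\<^sup>2)" for \<omega>
  have P1: "measure gauss {\<omega>. E1 \<omega>} \<le> 1 / real d ^ 22"
    unfolding E1_def
  proof (rule column_forms_concentrate[OF cm])
    fix \<omega> \<omega>' :: "'k \<Rightarrow> real" assume a: "\<And>\<kappa>. \<forall>i j. \<kappa> \<noteq> ix i j \<Longrightarrow> \<omega> \<kappa> = \<omega>' \<kappa>"
    have "\<omega> (iz i j) = \<omega>' (iz i j)" "\<omega> (ia i) = \<omega>' (ia i)" for i j
      using disj disj[symmetric] by (auto intro!: a)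
    then show "c \<omega> = c \<omega>'" by (simp add: c_def D_def rowf_def fun_eq_iff)
  qed
  have P2: "measure gauss {\<omega>. E2 \<omega>} \<le> 1 / real d ^ 22"
    unfolding E2_def using q by (intro upper_bound_of_products6[OF reg disjoint_blk] unit_z unit_a)
  have P3: "measure gauss {\<omega>. E3 \<omega>} \<le> 1 / real d ^ 22"
    unfolding E3_def by (intro upper_bound_of_products2[OF reg disjoint_blk] unit_a)
  have P4: "measure gauss {\<omega>. E4 \<omega>} \<le> 1 / real d ^ 22"
    unfolding E4_def using p by (intro upper_bound_of_products2[OF reg disjoint_blk] unit_x) simp
  have impl: "E1 \<omega> \<or> E2 \<omega> \<or> E3 \<omega> \<or> E4 \<omega>" if B: "B (?\<Phi> \<omega>)" for \<omega>
  proof (rule ccontr)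
    assume "\<not> ?thesis"
    then have n: "\<not> E1 \<omega>" "\<not> E2 \<omega>" "\<not> E3 \<omega>" "\<not> E4 \<omega>" by auto
    have c2: "nsq m (c \<omega>) \<le> 10 ^ 5 * real m"
      using n(2) by (simp add: E2_def nsq_def c_def D_def power_mult_distrib)
    have cc: "nsq d (colf m ix (c \<omega>) \<omega>) \<le> 2 * real d * nsq m (c \<omega>)"
    proof -
      have "nsq d (colf m ix (c \<omega>) \<omega>) - real d * nsq m (c \<omega>) \<le> real d * nsq m (c \<omega>) / 1000"
        using n(1) unfolding E1_def by linarith
      moreover have "0 \<le> real d * nsq m (c \<omega>)" by simp
      ultimately show ?thesis by linarith
    qed
    define s where "s = (\<Sum>i<m. c \<omega> i * (\<omega> (ia i) + rowf d ix p \<omega> i))"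
    have s2: "s\<^sup>2 \<le> 10 ^ 5 * real m * (4 * 10 ^ 5 * real m)"
    proof -
      have "nsq m (\<lambda>i. \<omega> (ia i) + rowf d ix p \<omega> i) \<le> 2 * nsq m (\<lambda>i. \<omega> (ia i)) + 2 * nsq m (rowf d ix p \<omega>)"
        by (rule nsq_add_le)
      also have "\<dots> \<le> 2 * (10 ^ 5 * real m) + 2 * (10 ^ 5 * real m)"
        using n(3,4) by (intro add_mono mult_left_mono) (auto simp: E3_def E4_def nsq_def)
      finally have "nsq m (\<lambda>i. \<omega> (ia i) + rowf d ix p \<omega> i) \<le> 4 * 10 ^ 5 * real m" by simp
      moreover have "s\<^sup>2 \<le> nsq m (c \<omega>) * nsq m (\<lambda>i. \<omega> (ia i) + rowf d ix p \<omega> i)"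
        unfolding s_def by (rule Cauchy_Schwarz_nsq)
      moreover have "nsq m (c \<omega>) * nsq m (\<lambda>i. \<omega> (ia i) + rowf d ix p \<omega> i) \<le> 10 ^ 5 * real m * (4 * 10 ^ 5 * real m)"
        by (rule mult_mono) (use c2 calculation(1) in auto)
      ultimately show ?thesis by linarith
    qed
    have "nsq d (colf m ix (\<lambda>i. D (?\<Phi> \<omega>) i * rowf d ix p (?\<Phi> \<omega>) i) (?\<Phi> \<omega>))
        = nsq d (\<lambda>j. - colf m ix (c \<omega>) \<omega> j + s * p j)"
      unfolding nsq_def by (intro sum.cong refl) (simp add: col s_def mult.commute)
    also have "\<dots> \<le> 2 * nsq d (\<lambda>j. - colf m ix (c \<omega>) \<omega> j) + 2 * nsq d (\<lambda>j. s * p j)"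
      by (rule nsq_add_le)
    also have "\<dots> = 2 * nsq d (colf m ix (c \<omega>) \<omega>) + 2 * s\<^sup>2"
      using p by (simp add: nsq_scale) (simp add: nsq_def)
    also have "\<dots> \<le> 2 * (2 * real d * (10 ^ 5 * real m)) + 2 * (10 ^ 5 * real m * (4 * 10 ^ 5 * real m))"
    proof -
      have "2 * real d * nsq m (c \<omega>) \<le> 2 * real d * (10 ^ 5 * real m)" using c2 by (intro mult_left_mono) auto
      then show ?thesis using cc s2 by linarith
    qed
    also have "\<dots> \<le> 10 ^ 12 * real m * real d"
    proof -
      have "real m * real m \<le> real m * real d" using m_le_d by (intro mult_left_mono) auto
      moreover have "0 \<le> real m * real d" by simp
      moreover have "4 * 10 ^ 5 * B + 8 * 10 ^ 10 * A \<le> 10 ^ 12 * B" if "A \<le> B" "0 \<le> B" for A B :: real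
        using that by simp
      ultimately have "4 * 10 ^ 5 * (real m * real d) + 8 * 10 ^ 10 * (real m * real m) \<le> 10 ^ 12 * (real m * real d)"
        by blast
      moreover have "2 * (2 * real d * (10 ^ 5 * real m)) + 2 * (10 ^ 5 * real m * (4 * 10 ^ 5 * real m))
          = 4 * 10 ^ 5 * (real m * real d) + 8 * 10 ^ 10 * (real m * real m)" by simp
      moreover have "10 ^ 12 * real m * real d = 10 ^ 12 * (real m * real d)" by simp
      ultimately show ?thesis by (simp only:)
    qed
    finally show False using B by (simp add: B_def)
  qed
  have M1: "{\<omega>. E1 \<omega>} \<in> sets gauss" unfolding E1_def nsq_def colf_def by (rule gauss_setI) measurable
  have M2: "{\<omega>. E2 \<omega>} \<in> sets gauss" unfolding E2_def nsq_def colf_def by (rule gauss_setI) measurable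
  have M3: "{\<omega>. E3 \<omega>} \<in> sets gauss" unfolding E3_def nsq_def colf_def by (rule gauss_setI) measurable
  have M4: "{\<omega>. E4 \<omega>} \<in> sets gauss" unfolding E4_def nsq_def colf_def by (rule gauss_setI) measurable
  have "measure gauss {\<omega>. B \<omega>} = measure gauss {\<omega>. B (?\<Phi> \<omega>)}" by (rule R(1))
  also have "\<dots> \<le> real (length [E1, E2, E3, E4]) * (1 / real d ^ 22)"
  proof (rule gauss_prob_list)
    fix E assume "E \<in> set [E1, E2, E3, E4]"
    then show "{\<omega>. E \<omega>} \<in> sets gauss" using M1 M2 M3 M4 by auto
    show "measure gauss {\<omega>. E \<omega>} \<le> 1 / real d ^ 22"
      using \<open>E \<in> set [E1, E2, E3, E4]\<close> P1 P2 P3 P4 by auto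
  qed (use impl in auto)
  finally show ?thesis by (simp add: B_def D_def)
qed

text \<open>Here \<open>x\<close> is applied to \<open>P = x\<^sup>T w\<close>, with \<open>w\<close> independent of \<open>x\<close>. Exchanging the component of the columns of \<open>x\<close> along \<open>w\<close>
turns \<open>P\<close> into \<open>-|w| \<tau>\<close> with fresh Gaussians \<open>\<tau>\<close>, so that \<open>\<langle>x\<^sub>i, P\<rangle>\<close> becomes \<open>-|w| \<langle>x\<^sub>i, \<tau>\<rangle> + t w\<^sub>i\<close> for a
scalar \<open>t\<close> of order \<open>d\<close>; here \<open>|w|\<^sup>2\<close> is of order \<open>m\<close> and \<open>\<tau>\<close> is independent of \<open>x\<close>.\<close>

lemma noise_gram_square_bounded:
  assumes q: "nsq d q \<le> 1"
  defines "w \<equiv> (\<lambda>\<omega> i. rowf d iz q \<omega> i * \<omega> (ie i))"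
  shows "measure gauss {\<omega>. 10 ^ 16 * real m * (real d)\<^sup>2 <
      nsq m (\<lambda>i. rowf d iz q \<omega> i * rowf d ix (colf m ix (w \<omega>) \<omega>) \<omega> i)} \<le> 5 / real d ^ 22"
proof -
  have m: "0 < m"
  proof (rule ccontr)
    assume "\<not> 0 < m"
    moreover have "1 \<le> ln (real d)" using reg by (intro ln_ge_1) (simp add: regime_def)
    moreover have "10 ^ 20 * ln (real d) ^ 12 \<le> real m" using reg by (simp add: regime_def)
    ultimately show False by (simp add: power_le_zero_eq)
  qed
  have wm[measurable]: "(\<lambda>\<omega>. w \<omega> i) \<in> borel_measurable gauss" for i unfolding w_def by measurable
  have wdep: "w \<omega> = w \<omega>'" if a: "\<And>\<kappa>. (\<forall>i j. \<kappa> \<noteq> ix i j) \<Longrightarrow> (\<forall>k. \<kappa> \<noteq> ia k) \<Longrightarrow> \<omega> \<kappa> = \<omega>' \<kappa>" for \<omega> \<omega>'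
  proof -
    have "\<omega> (iz i j) = \<omega>' (iz i j)" "\<omega> (ie i) = \<omega>' (ie i)" for i j
      using disj disj[symmetric] by (auto intro!: a)
    then show ?thesis by (simp add: w_def rowf_def fun_eq_iff)
  qed
  define s where "s \<omega> = sqrt (nsq m (w \<omega>))" for \<omega>
  have sm[measurable]: "s \<in> borel_measurable gauss" unfolding s_def nsq_def by measurable
  \<comment> \<open>The direction of \<open>w\<close>, with the first unit vector as a default where \<open>w\<close> vanishes, so that it is a unit vector everywhere.\<close>
  define u where "u \<omega> i = (if s \<omega> = 0 then (if i = 0 then 1 else 0) else w \<omega> i / s \<omega>)" for \<omega> i
  have um[measurable]: "(\<lambda>\<omega>. u \<omega> i) \<in> borel_measurable gauss" for i unfolding u_def by measurable
  have s2: "(s \<omega>)\<^sup>2 = nsq m (w \<omega>)" for \<omega> by (simp add: s_def)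
  have u1: "nsq m (u \<omega>) = 1" for \<omega>
  proof (cases "s \<omega> = 0")
    case True
    then have "nsq m (u \<omega>) = (\<Sum>i<m. if i = 0 then 1 else 0)"
      unfolding nsq_def by (intro sum.cong) (auto simp: u_def)
    then show ?thesis using m by simp
  next
    case False
    then have "nsq m (u \<omega>) = nsq m (w \<omega>) / (s \<omega>)\<^sup>2"
      by (simp add: nsq_def u_def power_divide sum_divide_distrib)
    then show ?thesis unfolding s2[symmetric] using False by simp
  qed
  have wu: "w \<omega> i = s \<omega> * u \<omega> i" if "i < m" for \<omega> i
  proof (cases "s \<omega> = 0")
    case True
    then have "nsq m (w \<omega>) = 0" using s2[of \<omega>] by simp
    then have "w \<omega> i = 0" using nsq_eq_0 that by blast
    then show ?thesis using True by simp
  qed (simp add: u_def)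
  have udep: "u \<omega> = u \<omega>'" if "\<And>\<kappa>. (\<forall>i j. \<kappa> \<noteq> ix i j) \<Longrightarrow> (\<forall>k. \<kappa> \<noteq> ia k) \<Longrightarrow> \<omega> \<kappa> = \<omega>' \<kappa>" for \<omega> \<omega>'
  proof -
    have "w \<omega> = w \<omega>'" by (rule wdep) (rule that)
    then show ?thesis by (intro ext) (simp only: u_def s_def)
  qed
  define B where "B \<omega> \<longleftrightarrow> 10 ^ 16 * real m * (real d)\<^sup>2 <
      nsq m (\<lambda>i. rowf d iz q \<omega> i * rowf d ix (colf m ix (w \<omega>) \<omega>) \<omega> i)" for \<omega>
  have Bm: "{\<omega>. B \<omega>} \<in> sets gauss"
    unfolding B_def nsq_def colf_def rowf_def[of d ix] by (rule gauss_setI) measurable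
  define \<Phi> where "\<Phi> \<omega> = regress d (\<lambda>i j k. if j = k then u \<omega> i else 0) \<omega>" for \<omega>
  note R = prob_regress_columns[OF u1 um udep Bm, folded \<Phi>_def]
  define tau where "tau \<omega> j = \<omega> (ia j)" for \<omega> :: "'k \<Rightarrow> real" and j
  have taum[measurable]: "(\<lambda>\<omega>. tau \<omega> j) \<in> borel_measurable gauss" for j unfolding tau_def by measurable
  define y where "y \<omega> i = rowf d ix (tau \<omega>) \<omega> i" for \<omega> i
  have ym[measurable]: "(\<lambda>\<omega>. y \<omega> i) \<in> borel_measurable gauss" for i unfolding y_def rowf_def by measurable
  define G where "G \<omega> i = rowf d iz q \<omega> i" for \<omega> i
  have Gm[measurable]: "(\<lambda>\<omega>. G \<omega> i) \<in> borel_measurable gauss" for i unfolding G_def by measurable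
  have G\<Phi>: "G (\<Phi> \<omega>) = G \<omega>" for \<omega> by (simp add: G_def rowf_def R(3) fun_eq_iff)
  have w\<Phi>: "w (\<Phi> \<omega>) = w \<omega>" for \<omega> by (simp add: w_def rowf_def R(3,4) fun_eq_iff)
  have P\<Phi>: "colf m ix (w \<omega>) (\<Phi> \<omega>) j = - s \<omega> * tau \<omega> j" if "j < d" for \<omega> j
  proof -
    have "colf m ix (w \<omega>) (\<Phi> \<omega>) j = (\<Sum>i<m. s \<omega> * u \<omega> i * (\<omega> (ix i j) - u \<omega> i * (\<omega> (ia j) + colf m ix (u \<omega>) \<omega> j)))"
      unfolding colf_def[of m ix "w \<omega>"] by (intro sum.cong refl) (use that wu R(2) in auto)
    also have "\<dots> = s \<omega> * (colf m ix (u \<omega>) \<omega> j - nsq m (u \<omega>) * (\<omega> (ia j) + colf m ix (u \<omega>) \<omega> j))"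
      by (simp add: right_diff_distrib sum_subtractf colf_def nsq_def power2_eq_square sum_distrib_right
          sum_distrib_left mult_ac)
    finally show ?thesis by (simp add: u1 tau_def)
  qed
  have uy: "(\<Sum>j<d. tau \<omega> j * colf m ix (u \<omega>) \<omega> j) = (\<Sum>k<m. u \<omega> k * y \<omega> k)" for \<omega>
    unfolding colf_def y_def rowf_def sum_distrib_left
    by (subst sum.swap) (simp add: mult_ac)
  \<comment> \<open>After the exchange, \<open>\<langle>x\<^sub>i, P\<rangle> = -|w| \<langle>x\<^sub>i, \<tau>\<rangle> + t w\<^sub>i\<close>.\<close>
  define t where "t \<omega> = nsq d (tau \<omega>) + (\<Sum>k<m. u \<omega> k * y \<omega> k)" for \<omega>
  have Q\<Phi>: "rowf d ix (colf m ix (w (\<Phi> \<omega>)) (\<Phi> \<omega>)) (\<Phi> \<omega>) i = - s \<omega> * y \<omega> i + w \<omega> i * t \<omega>" if "i < m" for \<omega> i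
  proof -
    have "rowf d ix (colf m ix (w (\<Phi> \<omega>)) (\<Phi> \<omega>)) (\<Phi> \<omega>) i
      = (\<Sum>j<d. (- s \<omega> * tau \<omega> j) * (\<omega> (ix i j) - u \<omega> i * (tau \<omega> j + colf m ix (u \<omega>) \<omega> j)))"
      unfolding rowf_def w\<Phi> by (intro sum.cong refl) (use that R(2) in \<open>simp add: P\<Phi> tau_def\<close>)
    also have "\<dots> = - s \<omega> * (\<Sum>j<d. tau \<omega> j * \<omega> (ix i j)) + s \<omega> * u \<omega> i *
        ((\<Sum>j<d. (tau \<omega> j)\<^sup>2) + (\<Sum>j<d. tau \<omega> j * colf m ix (u \<omega>) \<omega> j))"
      by (simp add: algebra_simps power2_eq_square sum.distrib sum_subtractf sum_distrib_left sum_negf)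
    also have "\<dots> = - s \<omega> * y \<omega> i + w \<omega> i * t \<omega>"
      unfolding uy by (simp add: y_def rowf_def t_def nsq_def wu[OF that])
    finally show ?thesis .
  qed
  define E1 where "E1 \<omega> \<longleftrightarrow> 10 ^ 5 * real m < (\<Sum>i<m. (G \<omega> i)\<^sup>2 * (\<omega> (ie i))\<^sup>2)" for \<omega>
  define E2 where "E2 \<omega> \<longleftrightarrow> 10 ^ 5 * real m < (\<Sum>i<m. (G \<omega> i)\<^sup>2 * (G \<omega> i)\<^sup>2 * (\<omega> (ie i))\<^sup>2)" for \<omega>
  define E3 where "E3 \<omega> \<longleftrightarrow> 10 ^ 5 * real d < (\<Sum>j<d. (\<omega> (ia j))\<^sup>2)" for \<omega>
  define E4 where "E4 \<omega> \<longleftrightarrow> 10 ^ 5 * real m * nsq d (tau \<omega>) < (\<Sum>i<m. (G \<omega> i)\<^sup>2 * (y \<omega> i)\<^sup>2)" for \<omega>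
  define E5 where "E5 \<omega> \<longleftrightarrow> 10 ^ 5 * real m * nsq d (tau \<omega>) < (\<Sum>i<m. (y \<omega> i)\<^sup>2)" for \<omega>
  have P1: "measure gauss {\<omega>. E1 \<omega>} \<le> 1 / real d ^ 22"
    unfolding E1_def G_def by (intro upper_bound_of_products4[OF reg disjoint_blk] unit_z[OF q] unit_e)
  have P2: "measure gauss {\<omega>. E2 \<omega>} \<le> 1 / real d ^ 22"
    unfolding E2_def G_def by (intro upper_bound_of_products6[OF reg disjoint_blk] unit_z[OF q] unit_e)
  have P3: "measure gauss {\<omega>. E3 \<omega>} \<le> 1 / real d ^ 22"
    unfolding E3_def by (intro upper_bound_of_products2[OF reg_d disjoint_blk] unit_a)
  let ?A = "range ia"
  have mix: "mix ?A \<omega>0 \<omega> (ia j) = \<omega>0 (ia j)" "mix ?A \<omega>0 \<omega> (ix i j) = \<omega> (ix i j)"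
    "mix ?A \<omega>0 \<omega> (iz i j) = \<omega> (iz i j)" for \<omega>0 \<omega> i j
    using disj by (auto simp: mix_def)
  have tmix: "tau (mix ?A \<omega>0 \<omega>) = tau \<omega>0" for \<omega>0 \<omega> by (simp add: tau_def mix fun_eq_iff)
  have Gmix: "G (mix ?A \<omega>0 \<omega>) i = G \<omega> i" for \<omega>0 \<omega> i by (simp add: G_def rowf_def mix)
  have ymix: "y (mix ?A \<omega>0 \<omega>) i = rowf d ix (tau \<omega>0) \<omega> i" for \<omega>0 \<omega> i by (simp add: y_def rowf_def mix tmix)
  have E4m: "{\<omega>. E4 \<omega>} \<in> sets gauss" unfolding E4_def nsq_def by (rule gauss_setI) measurable
  have E5m: "{\<omega>. E5 \<omega>} \<in> sets gauss" unfolding E5_def nsq_def by (rule gauss_setI) measurable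
  \<comment> \<open>Normalises a fixed vector, the zero vector included, to apply bounds on unit forms.\<close>
  have norm: "\<exists>p. nsq d p \<le> 1 \<and> (\<forall>\<omega> i. (rowf d ix b \<omega> i)\<^sup>2 = nsq d b * (rowf d ix p \<omega> i)\<^sup>2)" for b
  proof (cases "nsq d b = 0")
    case True
    then have "b j = 0" if "j < d" for j using nsq_eq_0 that by blast
    then have "rowf d ix b \<omega> i = 0" for \<omega> i by (simp add: rowf_def)
    then show ?thesis using True by (intro exI[of _ "\<lambda>_. 0"]) (simp add: nsq_def)
  next
    case False
    then have pos: "0 < nsq d b" using nsq_nonneg[of d b] by linarith
    define p where "p j = (1 / sqrt (nsq d b)) * b j" for j
    have "nsq d p = 1" unfolding p_def nsq_scale using pos by (simp add: power_divide)
    moreover have "(rowf d ix b \<omega> i)\<^sup>2 = nsq d b * (rowf d ix p \<omega> i)\<^sup>2" for \<omega> i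
    proof -
      have "rowf d ix p \<omega> i = (1 / sqrt (nsq d b)) * rowf d ix b \<omega> i"
        by (simp add: rowf_def p_def sum_distrib_left sum_divide_distrib)
      then show ?thesis using pos by (simp add: power_divide)
    qed
    ultimately show ?thesis by (intro exI[of _ p]) auto
  qed
  have mono: "measure gauss {\<omega>. K * N < S \<omega> * N} \<le> \<delta>"
    if "0 \<le> N" "measure gauss {\<omega>. K < S \<omega>} \<le> \<delta>" for K N \<delta> and S :: "('k \<Rightarrow> real) \<Rightarrow> real"
  proof (cases "N = 0")
    case True
    then show ?thesis using order_trans[OF measure_nonneg that(2)] by simp
  next
    case False
    then have "{\<omega>. K * N < S \<omega> * N} = {\<omega>. K < S \<omega>}" using that(1) by (auto simp: mult_less_cancel_right)
    then show ?thesis using that by simp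
  qed
  have P4: "measure gauss {\<omega>. E4 \<omega>} \<le> 1 / real d ^ 22"
  proof (rule gauss_prob_le_by_resampling[OF E4m, of ?A])
    fix \<omega>0 :: "'k \<Rightarrow> real"
    obtain p where p: "nsq d p \<le> 1" "\<And>\<omega> i. (rowf d ix (tau \<omega>0) \<omega> i)\<^sup>2 = nsq d (tau \<omega>0) * (rowf d ix p \<omega> i)\<^sup>2"
      using norm by blast
    have "measure gauss {\<omega>. 10 ^ 5 * real m < (\<Sum>i<m. (G \<omega> i)\<^sup>2 * (rowf d ix p \<omega> i)\<^sup>2)} \<le> 1 / real d ^ 22"
      unfolding G_def by (intro upper_bound_of_products4[OF reg disjoint_blk] unit_z[OF q] unit_x p)
    from mono[OF nsq_nonneg[of d "tau \<omega>0"] this]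
    show "measure gauss {\<omega>. E4 (mix ?A \<omega>0 \<omega>)} \<le> 1 / real d ^ 22"
      unfolding E4_def tmix Gmix ymix p(2) by (simp add: sum_distrib_left mult_ac)
  qed
  have P5: "measure gauss {\<omega>. E5 \<omega>} \<le> 1 / real d ^ 22"
  proof (rule gauss_prob_le_by_resampling[OF E5m, of ?A])
    fix \<omega>0 :: "'k \<Rightarrow> real"
    obtain p where p: "nsq d p \<le> 1" "\<And>\<omega> i. (rowf d ix (tau \<omega>0) \<omega> i)\<^sup>2 = nsq d (tau \<omega>0) * (rowf d ix p \<omega> i)\<^sup>2"
      using norm by blast
    have "measure gauss {\<omega>. 10 ^ 5 * real m < (\<Sum>i<m. (rowf d ix p \<omega> i)\<^sup>2)} \<le> 1 / real d ^ 22"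
      by (intro upper_bound_of_products2[OF reg disjoint_blk] unit_x p)
    from mono[OF nsq_nonneg[of d "tau \<omega>0"] this]
    show "measure gauss {\<omega>. E5 (mix ?A \<omega>0 \<omega>)} \<le> 1 / real d ^ 22"
      unfolding E5_def tmix ymix p(2) by (simp add: sum_distrib_left mult_ac)
  qed
  have impl: "E1 \<omega> \<or> E2 \<omega> \<or> E3 \<omega> \<or> E4 \<omega> \<or> E5 \<omega>" if B: "B (\<Phi> \<omega>)" for \<omega>
  proof (rule ccontr)
    assume "\<not> ?thesis"
    then have n: "\<not> E1 \<omega>" "\<not> E2 \<omega>" "\<not> E3 \<omega>" "\<not> E4 \<omega>" "\<not> E5 \<omega>" by auto
    define T where "T = nsq d (tau \<omega>)"
    have T: "0 \<le> T" "T \<le> 10 ^ 5 * real d" using n(3) by (auto simp: T_def E3_def nsq_def tau_def sum_nonneg)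
    have S: "nsq m (w \<omega>) \<le> 10 ^ 5 * real m"
      using n(1) by (simp add: E1_def nsq_def w_def G_def power_mult_distrib)
    have W: "nsq m (\<lambda>i. G \<omega> i * w \<omega> i) \<le> 10 ^ 5 * real m"
      using n(2) by (simp add: E2_def nsq_def w_def G_def power_mult_distrib mult.assoc)
    have Y: "nsq m (\<lambda>i. G \<omega> i * y \<omega> i) \<le> 10 ^ 5 * real m * T"
      using n(4) by (simp add: E4_def nsq_def T_def power_mult_distrib)
    have Y2: "nsq m (y \<omega>) \<le> 10 ^ 5 * real m * T"
      using n(5) by (simp add: E5_def nsq_def T_def)
    have md: "real m \<le> real d" using m_le_d by simp
    have t2: "(t \<omega>)\<^sup>2 \<le> 4 * 10 ^ 10 * (real d)\<^sup>2"
    proof -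
      have "(\<Sum>k<m. u \<omega> k * y \<omega> k)\<^sup>2 \<le> nsq m (u \<omega>) * nsq m (y \<omega>)" by (rule Cauchy_Schwarz_nsq)
      also have "\<dots> \<le> 10 ^ 5 * real m * T" using Y2 by (simp add: u1)
      also have "\<dots> \<le> 10 ^ 5 * real d * (10 ^ 5 * real d)" using T md by (intro mult_mono) auto
      finally have 1: "(\<Sum>k<m. u \<omega> k * y \<omega> k)\<^sup>2 \<le> 10 ^ 10 * (real d)\<^sup>2" by (simp add: power2_eq_square)
      have "T * T \<le> (10 ^ 5 * real d) * (10 ^ 5 * real d)" using T by (intro mult_mono) auto
      then have 2: "T\<^sup>2 \<le> 10 ^ 10 * (real d)\<^sup>2" by (simp add: power2_eq_square)
      have "(t \<omega>)\<^sup>2 \<le> 2 * T\<^sup>2 + 2 * (\<Sum>k<m. u \<omega> k * y \<omega> k)\<^sup>2"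
        unfolding t_def T_def by (rule square_sum_le)
      also have "\<dots> \<le> 2 * (10 ^ 10 * (real d)\<^sup>2) + 2 * (10 ^ 10 * (real d)\<^sup>2)"
        using 1 2 by linarith
      finally show ?thesis by simp
    qed
    have "nsq m (\<lambda>i. rowf d iz q (\<Phi> \<omega>) i * rowf d ix (colf m ix (w (\<Phi> \<omega>)) (\<Phi> \<omega>)) (\<Phi> \<omega>) i)
      = nsq m (\<lambda>i. (- s \<omega>) * (G \<omega> i * y \<omega> i) + t \<omega> * (G \<omega> i * w \<omega> i))"
      unfolding nsq_def
    proof (intro sum.cong refl)
      fix i assume "i \<in> {..<m}"
      then have "rowf d iz q (\<Phi> \<omega>) i * rowf d ix (colf m ix (w (\<Phi> \<omega>)) (\<Phi> \<omega>)) (\<Phi> \<omega>) i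
          = (- s \<omega>) * (G \<omega> i * y \<omega> i) + t \<omega> * (G \<omega> i * w \<omega> i)"
        using G\<Phi>[of \<omega>] by (simp add: Q\<Phi> G_def fun_eq_iff algebra_simps)
      then show "(rowf d iz q (\<Phi> \<omega>) i * rowf d ix (colf m ix (w (\<Phi> \<omega>)) (\<Phi> \<omega>)) (\<Phi> \<omega>) i)\<^sup>2
          = ((- s \<omega>) * (G \<omega> i * y \<omega> i) + t \<omega> * (G \<omega> i * w \<omega> i))\<^sup>2" by simp
    qed
    also have "\<dots> \<le> 2 * nsq m (\<lambda>i. (- s \<omega>) * (G \<omega> i * y \<omega> i)) + 2 * nsq m (\<lambda>i. t \<omega> * (G \<omega> i * w \<omega> i))"
      by (rule nsq_add_le)
    also have "\<dots> = 2 * (nsq m (w \<omega>) * nsq m (\<lambda>i. G \<omega> i * y \<omega> i)) + 2 * ((t \<omega>)\<^sup>2 * nsq m (\<lambda>i. G \<omega> i * w \<omega> i))"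
      unfolding nsq_scale by (simp add: s2)
    also have "\<dots> \<le> 2 * ((10 ^ 5 * real d) * (10 ^ 5 * real m * (10 ^ 5 * real d)))
       + 2 * ((4 * 10 ^ 10 * (real d)\<^sup>2) * (10 ^ 5 * real m))"
    proof -
      have "nsq m (\<lambda>i. G \<omega> i * y \<omega> i) \<le> 10 ^ 5 * real m * (10 ^ 5 * real d)"
        by (rule order_trans[OF Y mult_left_mono[OF T(2)]]) simp
      moreover have "nsq m (w \<omega>) \<le> 10 ^ 5 * real d" using S md by simp
      ultimately have "nsq m (w \<omega>) * nsq m (\<lambda>i. G \<omega> i * y \<omega> i) \<le> (10 ^ 5 * real d) * (10 ^ 5 * real m * (10 ^ 5 * real d))"
        by (intro mult_mono) auto
      moreover have "(t \<omega>)\<^sup>2 * nsq m (\<lambda>i. G \<omega> i * w \<omega> i) \<le> (4 * 10 ^ 10 * (real d)\<^sup>2) * (10 ^ 5 * real m)"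
        using t2 W by (intro mult_mono) auto
      ultimately show ?thesis by linarith
    qed
    also have "\<dots> = 10 ^ 16 * real m * (real d)\<^sup>2"
      by (simp add: power2_eq_square)
    finally show False using B by (simp add: B_def)
  qed
  have M1: "{\<omega>. E1 \<omega>} \<in> sets gauss" unfolding E1_def by (rule gauss_setI) measurable
  have M2: "{\<omega>. E2 \<omega>} \<in> sets gauss" unfolding E2_def by (rule gauss_setI) measurable
  have M3: "{\<omega>. E3 \<omega>} \<in> sets gauss" unfolding E3_def by (rule gauss_setI) measurable
  have "measure gauss {\<omega>. B \<omega>} = measure gauss {\<omega>. B (\<Phi> \<omega>)}" by (rule R(1))
  also have "\<dots> \<le> real (length [E1, E2, E3, E4, E5]) * (1 / real d ^ 22)"
  proof (rule gauss_prob_list)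
    fix E assume "E \<in> set [E1, E2, E3, E4, E5]"
    then show "{\<omega>. E \<omega>} \<in> sets gauss" using M1 M2 M3 E4m E5m by auto
    show "measure gauss {\<omega>. E \<omega>} \<le> 1 / real d ^ 22"
      using \<open>E \<in> set [E1, E2, E3, E4, E5]\<close> P1 P2 P3 P4 P5 by auto
  qed (use impl in auto)
  finally show ?thesis by (simp add: B_def)
qed

end

section \<open>The regularised least-squares step\<close>

text \<open>The normal equations in coordinates: \<open>lin\<close> is \<open>\<Sum>\<^sub>i r\<^sub>i a\<^sub>i\<close>, the transpose of the map \<open>app : \<Delta> \<mapsto> (\<langle>a\<^sub>i, \<Delta>\<rangle>)\<^sub>i\<close>.\<close>

definition lin :: "nat \<Rightarrow> (nat \<Rightarrow> nat \<Rightarrow> real) \<Rightarrow> (nat \<Rightarrow> real) \<Rightarrow> nat \<Rightarrow> real" where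
  "lin m a r j = (\<Sum>i<m. r i * a i j)"

definition app :: "nat \<Rightarrow> (nat \<Rightarrow> nat \<Rightarrow> real) \<Rightarrow> (nat \<Rightarrow> real) \<Rightarrow> nat \<Rightarrow> real" where
  "app N a \<Delta> i = (\<Sum>j<N. a i j * \<Delta> j)"

text \<open>\<open>\<Delta>\<close> is the regularised least-squares solution for the data \<open>r\<close>, characterised by its residual \<open>\<rho>\<close>: eliminating \<open>\<rho>\<close>
gives \<open>(\<Sum>\<^sub>i a\<^sub>i a\<^sub>i\<^sup>T + s I) \<Delta> = \<Sum>\<^sub>i r\<^sub>i a\<^sub>i\<close>. Carrying the residual along avoids inverse matrices in all the estimates.\<close>

definition ridge :: "nat \<Rightarrow> nat \<Rightarrow> (nat \<Rightarrow> nat \<Rightarrow> real) \<Rightarrow> real \<Rightarrow> (nat \<Rightarrow> real) \<Rightarrow> (nat \<Rightarrow> real) \<Rightarrow> (nat \<Rightarrow> real) \<Rightarrow> bool" where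
  "ridge N m a s r \<Delta> \<rho> \<longleftrightarrow> (\<forall>j<N. s * \<Delta> j = lin m a \<rho> j) \<and> (\<forall>i<m. \<rho> i = r i - app N a \<Delta> i)"

lemma lin_app_adjoint: "(\<Sum>j<N. \<Delta> j * lin m a r j) = (\<Sum>i<m. r i * app N a \<Delta> i)"
  unfolding lin_def app_def sum_distrib_left by (subst sum.swap) (simp add: mult_ac)

lemma lin_add: "lin m a (\<lambda>i. r i + r' i) j = lin m a r j + lin m a r' j"
  by (simp add: lin_def distrib_right sum.distrib)

lemma lin_diff: "lin m a (\<lambda>i. r i - r' i) j = lin m a r j - lin m a r' j"
  by (simp add: lin_def left_diff_distrib sum_subtractf)

lemma lin_scale: "lin m a (\<lambda>i. c * r i) j = c * lin m a r j"
  by (simp add: lin_def sum_distrib_left mult_ac)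

lemma app_add: "app N a (\<lambda>j. r j + r' j) i = app N a r i + app N a r' i"
  by (simp add: app_def distrib_left sum.distrib)

lemma app_scale: "app N a (\<lambda>j. c * r j) i = c * app N a r i"
  by (simp add: app_def sum_distrib_left mult_ac)

lemma ridge_data: "ridge N m a s r \<Delta> \<rho> \<Longrightarrow> i < m \<Longrightarrow> r i = \<rho> i + app N a \<Delta> i"
  by (simp add: ridge_def)

lemma ridge_add:
  assumes "ridge N m a s r \<Delta> \<rho>" "ridge N m a s r' \<Delta>' \<rho>'"
  shows "ridge N m a s (\<lambda>i. r i + r' i) (\<lambda>j. \<Delta> j + \<Delta>' j) (\<lambda>i. \<rho> i + \<rho>' i)"
  using assms by (auto simp: ridge_def lin_add app_add distrib_left)

lemma ridge_scale:
  assumes "ridge N m a s r \<Delta> \<rho>"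
  shows "ridge N m a s (\<lambda>i. c * r i) (\<lambda>j. c * \<Delta> j) (\<lambda>i. c * \<rho> i)"
  using assms by (auto simp: ridge_def lin_scale app_scale right_diff_distrib)

lemma ridge_inner:
  assumes r: "ridge N m a s r \<Delta> \<rho>"
  shows "s * (\<Sum>j<N. u j * \<Delta> j) = (\<Sum>i<m. app N a u i * \<rho> i)"
proof -
  have "s * (\<Sum>j<N. u j * \<Delta> j) = (\<Sum>j<N. u j * lin m a \<rho> j)"
    using r by (auto simp: ridge_def sum_distrib_left mult_ac intro!: sum.cong)
  also have "\<dots> = (\<Sum>i<m. app N a u i * \<rho> i)" by (simp add: lin_app_adjoint mult.commute)
  finally show ?thesis .
qed

lemma ridge_lin_inner:
  assumes r: "ridge N m a s r \<Delta> \<rho>"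
  shows "(\<Sum>j<N. \<Delta> j * lin m a r j) = s * nsq N \<Delta> + nsq m (app N a \<Delta>)"
proof -
  have "(\<Sum>j<N. \<Delta> j * lin m a r j) = (\<Sum>i<m. r i * app N a \<Delta> i)" by (rule lin_app_adjoint)
  also have "\<dots> = (\<Sum>i<m. \<rho> i * app N a \<Delta> i + (app N a \<Delta> i)\<^sup>2)"
    by (intro sum.cong refl) (simp add: ridge_data[OF r] power2_eq_square algebra_simps)
  also have "\<dots> = (\<Sum>j<N. \<Delta> j * lin m a \<rho> j) + nsq m (app N a \<Delta>)"
    by (simp add: sum.distrib lin_app_adjoint nsq_def)
  also have "(\<Sum>j<N. \<Delta> j * lin m a \<rho> j) = s * nsq N \<Delta>"
    using r by (auto simp: ridge_def nsq_def sum_distrib_left power2_eq_square mult_ac intro!: sum.cong)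
  finally show ?thesis .
qed

lemma ridge_residual_inner:
  assumes r: "ridge N m a s r \<Delta> \<rho>" and v: "ridge N m a s v \<Delta>' \<rho>'"
  shows "(\<Sum>i<m. v i * \<rho> i) = (\<Sum>i<m. \<rho>' i * \<rho> i) + s * (\<Sum>j<N. \<Delta>' j * \<Delta> j)"
proof -
  have "(\<Sum>i<m. v i * \<rho> i) = (\<Sum>i<m. \<rho>' i * \<rho> i + app N a \<Delta>' i * \<rho> i)"
    by (intro sum.cong refl) (simp add: ridge_data[OF v] algebra_simps)
  also have "\<dots> = (\<Sum>i<m. \<rho>' i * \<rho> i) + s * (\<Sum>j<N. \<Delta>' j * \<Delta> j)"
    by (simp add: sum.distrib ridge_inner[OF r])
  finally show ?thesis .
qed

text \<open>The map \<open>r \<mapsto> \<rho>\<close> is the symmetric matrix \<open>s (A A\<^sup>T + s I)\<^sup>-\<^sup>1\<close>, where the \<open>a\<^sub>i\<close> are the rows of \<open>A\<close>. This lets the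
noise be tested against a residual that does not depend on it.\<close>

lemma ridge_symmetric:
  assumes r: "ridge N m a s r \<Delta> \<rho>" and v: "ridge N m a s v \<Delta>' \<rho>'"
  shows "(\<Sum>i<m. v i * \<rho> i) = (\<Sum>i<m. \<rho>' i * r i)"
  using ridge_residual_inner[OF r v] ridge_residual_inner[OF v r] by (simp add: mult.commute)

lemma ridge_residual_le:
  assumes r: "ridge N m a s r \<Delta> \<rho>" and s: "0 < s"
  shows "nsq m \<rho> \<le> nsq m r"
proof -
  have "(\<Sum>i<m. r i * \<rho> i) = nsq m \<rho> + s * nsq N \<Delta>"
    using ridge_residual_inner[OF r r] by (simp add: nsq_def power2_eq_square)
  moreover have "0 \<le> s * nsq N \<Delta>" using s by simp
  ultimately have le: "nsq m \<rho> \<le> (\<Sum>i<m. r i * \<rho> i)" by linarith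
  have "nsq m \<rho> * nsq m \<rho> \<le> (\<Sum>i<m. r i * \<rho> i)\<^sup>2"
    unfolding power2_eq_square using le order_trans[OF nsq_nonneg le] by (intro mult_mono) auto
  also have "\<dots> \<le> nsq m r * nsq m \<rho>" by (rule Cauchy_Schwarz_nsq)
  finally have "nsq m \<rho> * nsq m \<rho> \<le> nsq m r * nsq m \<rho>" .
  then show ?thesis
    using nsq_nonneg[of m \<rho>] nsq_nonneg[of m r] by (cases "nsq m \<rho> = 0") (auto simp: mult_le_cancel_right)
qed

lemma ridge_step_le:
  assumes r: "ridge N m a s r \<Delta> \<rho>" and s: "0 < s"
  shows "s\<^sup>2 * nsq N \<Delta> \<le> nsq N (lin m a r)"
proof -
  have le: "s * nsq N \<Delta> \<le> (\<Sum>j<N. \<Delta> j * lin m a r j)"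
    using ridge_lin_inner[OF r] nsq_nonneg[of m "app N a \<Delta>"] by linarith
  have "(s * nsq N \<Delta>)\<^sup>2 \<le> (\<Sum>j<N. \<Delta> j * lin m a r j)\<^sup>2"
    using le s by (intro power_mono) auto
  also have "\<dots> \<le> nsq N \<Delta> * nsq N (lin m a r)" by (rule Cauchy_Schwarz_nsq)
  finally have "nsq N \<Delta> * (s\<^sup>2 * nsq N \<Delta>) \<le> nsq N \<Delta> * nsq N (lin m a r)"
    by (simp add: power2_eq_square mult_ac)
  then show ?thesis
    using nsq_nonneg[of N \<Delta>] nsq_nonneg[of N "lin m a r"] by (cases "nsq N \<Delta> = 0") (auto simp: mult_le_cancel_left)
qed

lemma ridge_unique:
  assumes r: "ridge N m a s r \<Delta> \<rho>" "ridge N m a s r \<Delta>' \<rho>'" and s: "0 < s" and j: "j < N"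
  shows "\<Delta> j = \<Delta>' j"
proof -
  have "ridge N m a s (\<lambda>i. r i + (-1) * r i) (\<lambda>j. \<Delta> j + (-1) * \<Delta>' j) (\<lambda>i. \<rho> i + (-1) * \<rho>' i)"
    by (intro ridge_add ridge_scale r)
  from ridge_step_le[OF this s] have "s\<^sup>2 * nsq N (\<lambda>j. \<Delta> j + (-1) * \<Delta>' j) \<le> 0"
    by (simp add: lin_def nsq_def)
  moreover have "0 \<le> s\<^sup>2 * nsq N (\<lambda>j. \<Delta> j + (-1) * \<Delta>' j)" by simp
  ultimately have "s\<^sup>2 * nsq N (\<lambda>j. \<Delta> j + (-1) * \<Delta>' j) = 0" by linarith
  then have "nsq N (\<lambda>j. \<Delta> j + (-1) * \<Delta>' j) = 0" using s by simp
  from nsq_eq_0[OF this j] show ?thesis by simp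
qed

text \<open>Replacing the residual by the data costs \<open>\<langle>A\<^sup>T v, \<Delta>\<rangle>\<close>, and \<open>s |\<Delta>| \<le> |A\<^sup>T r|\<close>. So only the two gradients
\<open>A\<^sup>T v\<close> and \<open>A\<^sup>T r\<close> have to be small compared with \<open>s\<close>.\<close>

lemma ridge_bilinear_perturbation:
  assumes r: "ridge N m a s r \<Delta> \<rho>" and s: "0 < s"
  shows "((\<Sum>i<m. v i * r i) - (\<Sum>i<m. v i * \<rho> i))\<^sup>2 \<le> nsq N (lin m a v) * nsq N (lin m a r) / s\<^sup>2"
proof -
  have "(\<Sum>i<m. v i * r i) - (\<Sum>i<m. v i * \<rho> i) = (\<Sum>i<m. v i * app N a \<Delta> i)"
    unfolding sum_subtractf[symmetric]
    by (intro sum.cong refl) (simp add: ridge_data[OF r] algebra_simps)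
  also have "\<dots> = (\<Sum>j<N. lin m a v j * \<Delta> j)" by (simp add: lin_app_adjoint[symmetric] mult.commute)
  finally have "((\<Sum>i<m. v i * r i) - (\<Sum>i<m. v i * \<rho> i))\<^sup>2 \<le> nsq N (lin m a v) * nsq N \<Delta>"
    by (simp add: Cauchy_Schwarz_nsq)
  also have "nsq N \<Delta> \<le> nsq N (lin m a r) / s\<^sup>2"
    using ridge_step_le[OF r s] s by (simp add: field_simps)
  finally show ?thesis by (simp add: mult_left_mono)
qed

text \<open>To first order \<open>s \<Delta>\<close> is the gradient \<open>g = A\<^sup>T r\<close>. The assumption says that \<open>|A g|\<^sup>2\<close> is small compared with \<open>s |g|\<^sup>2\<close>,
that is, that regularisation dominates in the single direction \<open>g\<close>.\<close>

lemma ridge_step_ge: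
  assumes r: "ridge N m a s r \<Delta> \<rho>" and s: "0 < s"
    and K: "4 * nsq m (app N a (lin m a r)) \<le> s * nsq N (lin m a r)"
  shows "nsq N (lin m a r) \<le> 4 * s\<^sup>2 * nsq N \<Delta>"
proof (cases "nsq N (lin m a r) = 0")
  case False
  define A where "A = nsq N (lin m a r)"
  have A: "0 < A" using False nsq_nonneg[of N "lin m a r"] unfolding A_def by linarith
  \<comment> \<open>With \<open>\<theta> = \<langle>\<Delta>, g\<rangle> = s |\<Delta>|\<^sup>2 + |A \<Delta>|\<^sup>2\<close>, Cauchy-Schwarz gives \<open>s \<theta> \<le> |g|\<^sup>2\<close>. Conversely \<open>s \<theta> = |g|\<^sup>2 - \<langle>A g, A \<Delta>\<rangle>\<close>, where the assumption bounds the last term by \<open>|g|\<^sup>2 / 2\<close>.\<close>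
  define \<theta> where "\<theta> = (\<Sum>j<N. \<Delta> j * lin m a r j)"
  have \<theta>: "\<theta> = s * nsq N \<Delta> + nsq m (app N a \<Delta>)" unfolding \<theta>_def by (rule ridge_lin_inner[OF r])
  have \<theta>0: "0 \<le> \<theta>" unfolding \<theta> using s by simp
  have CS: "\<theta>\<^sup>2 \<le> nsq N \<Delta> * A" unfolding \<theta>_def A_def by (rule Cauchy_Schwarz_nsq)
  have "s * \<theta>\<^sup>2 \<le> (s * nsq N \<Delta>) * A" using mult_left_mono[OF CS, of s] s by (simp only: mult.assoc less_imp_le)
  also have "\<dots> \<le> \<theta> * A" using \<theta> A by (intro mult_right_mono) auto
  finally have "\<theta> * (s * \<theta>) \<le> \<theta> * A" by (simp add: power2_eq_square mult_ac)
  then have s\<theta>: "s * \<theta> \<le> A" using \<theta>0 A by (cases "\<theta> = 0") (auto simp: mult_le_cancel_left)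
  have "s * \<theta> = (\<Sum>i<m. app N a (lin m a r) i * \<rho> i)"
    unfolding \<theta>_def ridge_inner[OF r, of "lin m a r", symmetric] by (simp only: mult.commute)
  also have "\<dots> = (\<Sum>i<m. app N a (lin m a r) i * r i - app N a (lin m a r) i * app N a \<Delta> i)"
  proof (rule sum.cong[OF refl])
    fix i assume "i \<in> {..<m}"
    then have \<rho>: "\<rho> i = r i - app N a \<Delta> i" using r by (auto simp: ridge_def)
    show "app N a (lin m a r) i * \<rho> i = app N a (lin m a r) i * r i - app N a (lin m a r) i * app N a \<Delta> i"
      unfolding \<rho> by (rule right_diff_distrib)
  qed
  also have "\<dots> = (\<Sum>i<m. r i * app N a (lin m a r) i) - (\<Sum>i<m. app N a (lin m a r) i * app N a \<Delta> i)"
    by (simp only: sum_subtractf mult.commute[of "r _"])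
  also have "(\<Sum>i<m. r i * app N a (lin m a r) i) = A"
    by (simp only: lin_app_adjoint[symmetric] A_def nsq_def power2_eq_square)
  finally have eq: "s * \<theta> = A - (\<Sum>i<m. app N a (lin m a r) i * app N a \<Delta> i)" .
  have "(\<Sum>i<m. app N a (lin m a r) i * app N a \<Delta> i)\<^sup>2 \<le> nsq m (app N a (lin m a r)) * nsq m (app N a \<Delta>)"
    by (rule Cauchy_Schwarz_nsq)
  also have "\<dots> \<le> (s * A / 4) * \<theta>"
    using K \<theta> s by (intro mult_mono) (auto simp: A_def)
  also have "\<dots> = A / 4 * (s * \<theta>)" by simp
  also have "\<dots> \<le> A / 4 * A" using s\<theta> A by (intro mult_left_mono) auto
  also have "\<dots> = (A / 2)\<^sup>2" by (simp add: power2_eq_square)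
  finally have "(\<Sum>i<m. app N a (lin m a r) i * app N a \<Delta> i) \<le> A / 2"
    by (rule power2_le_imp_le) (use A in auto)
  then have "A / 2 \<le> s * \<theta>" using eq by simp
  then have "(A / 2)\<^sup>2 \<le> (s * \<theta>)\<^sup>2" using A by (intro power_mono) auto
  also have "\<dots> \<le> s\<^sup>2 * (nsq N \<Delta> * A)"
    unfolding power_mult_distrib by (intro mult_left_mono CS) simp
  finally have "A * A \<le> (4 * s\<^sup>2 * nsq N \<Delta>) * A" by (simp add: power2_eq_square mult_ac)
  then show ?thesis using A by (simp add: A_def mult_le_cancel_right)
qed (use s in auto)

section \<open>Deterministic analysis of one step\<close>

text \<open>The data of the \<open>i\<close>-th observation enter through four scalars, \<open>xs k i = \<langle>x\<^sub>i, p\<^sub>k\<rangle>\<close> and \<open>zs l i = \<langle>z\<^sub>i, q\<^sub>l\<rangle>\<close> for \<open>k, l < 2\<close>.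
\<open>frob\<close> is the squared Frobenius norm of the coefficient matrix.\<close>

definition bil :: "(nat \<Rightarrow> nat \<Rightarrow> real) \<Rightarrow> (nat \<Rightarrow> nat \<Rightarrow> real) \<Rightarrow> (nat \<Rightarrow> nat \<Rightarrow> real) \<Rightarrow> nat \<Rightarrow> real" where
  "bil R xs zs i = (\<Sum>k<2. \<Sum>l<2. R k l * (xs k i * zs l i))"

definition frob :: "(nat \<Rightarrow> nat \<Rightarrow> real) \<Rightarrow> real" where
  "frob R = (\<Sum>k<2. \<Sum>l<2. (R k l)\<^sup>2)"

lemma nsq_sum_le:
  "nsq n (\<lambda>j. \<Sum>k\<in>S. c k * f k j) \<le> real (card S) * (\<Sum>k\<in>S. (c k)\<^sup>2 * nsq n (f k))"
proof -
  have "nsq n (\<lambda>j. \<Sum>k\<in>S. c k * f k j) \<le> (\<Sum>j<n. real (card S) * (\<Sum>k\<in>S. (c k * f k j)\<^sup>2))"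
    unfolding nsq_def
  proof (rule sum_mono)
    fix j
    have "(\<Sum>k\<in>S. 1 * (c k * f k j))\<^sup>2 \<le> (\<Sum>k\<in>S. 1\<^sup>2) * (\<Sum>k\<in>S. (c k * f k j)\<^sup>2)"
      by (rule Cauchy_Schwarz_ineq_sum)
    then show "(\<Sum>k\<in>S. c k * f k j)\<^sup>2 \<le> real (card S) * (\<Sum>k\<in>S. (c k * f k j)\<^sup>2)" by simp
  qed
  also have "\<dots> = real (card S) * (\<Sum>k\<in>S. (c k)\<^sup>2 * nsq n (f k))"
  proof -
    have "(\<Sum>j<n. \<Sum>k\<in>S. (c k * f k j)\<^sup>2) = (\<Sum>k\<in>S. \<Sum>j<n. (c k * f k j)\<^sup>2)" by (rule sum.swap)
    also have "\<dots> = (\<Sum>k\<in>S. (c k)\<^sup>2 * nsq n (f k))"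
      by (simp only: power_mult_distrib sum_distrib_left nsq_def)
    finally show ?thesis by (simp only: sum_distrib_left[symmetric])
  qed
  finally show ?thesis .
qed

lemma bil_eq: "bil R xs zs i = (\<Sum>p\<in>{..<2} \<times> {..<2}. R (fst p) (snd p) * (xs (fst p) i * zs (snd p) i))"
  unfolding bil_def by (simp add: sum.cartesian_product split_def)

lemma frob_eq: "frob R = (\<Sum>p\<in>{..<2} \<times> {..<2}. (R (fst p) (snd p))\<^sup>2)"
  unfolding frob_def by (simp add: sum.cartesian_product split_def)

lemma nsq_bil_le:
  assumes "\<And>k l. k < 2 \<Longrightarrow> l < 2 \<Longrightarrow> nsq m (\<lambda>i. xs k i * zs l i) \<le> B"
  shows "nsq m (bil R xs zs) \<le> 4 * B * frob R"
proof -
  have "nsq m (bil R xs zs) \<le> real (card ({..<2::nat} \<times> {..<2::nat})) *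
     (\<Sum>p\<in>{..<2} \<times> {..<2}. (R (fst p) (snd p))\<^sup>2 * nsq m (\<lambda>i. xs (fst p) i * zs (snd p) i))"
    unfolding bil_eq[abs_def] by (rule nsq_sum_le)
  also have "\<dots> \<le> 4 * (\<Sum>p\<in>{..<2} \<times> {..<2}. (R (fst p) (snd p))\<^sup>2 * B)"
  proof -
    have "(\<Sum>p\<in>{..<2} \<times> {..<2}. (R (fst p) (snd p))\<^sup>2 * nsq m (\<lambda>i. xs (fst p) i * zs (snd p) i))
      \<le> (\<Sum>p\<in>{..<2} \<times> {..<2}. (R (fst p) (snd p))\<^sup>2 * B)"
      by (intro sum_mono mult_left_mono assms) auto
    moreover have "card ({..<2::nat} \<times> {..<2::nat}) = 4" by (simp only: card_cartesian_product card_lessThan)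
    ultimately show ?thesis by simp
  qed
  also have "(\<Sum>p\<in>{..<2} \<times> {..<2}. (R (fst p) (snd p))\<^sup>2 * B) = frob R * B"
    by (simp only: frob_eq sum_distrib_right)
  also have "4 * (frob R * B) = 4 * B * frob R" by simp
  finally show ?thesis .
qed

lemma nsq_bil_column_le:
  assumes B: "\<And>k l l'. k < 2 \<Longrightarrow> l < 2 \<Longrightarrow> l' < 2 \<Longrightarrow>
      nsq d (\<lambda>j. \<Sum>i<m. zs l i * zs l' i * xs k i * x i j) \<le> B"
  shows "nsq d (\<lambda>j. \<Sum>i<m. bil R xs zs i * (g 0 * zs 0 i + g 1 * zs 1 i) * x i j) \<le>
    8 * B * frob R * ((g 0)\<^sup>2 + (g (1 :: nat))\<^sup>2)"
proof -
  let ?S = "({..<2::nat} \<times> {..<2::nat}) \<times> {..<2::nat}"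
  let ?c = "\<lambda>p. R (fst (fst p)) (snd (fst p)) * g (snd p)"
  let ?f = "\<lambda>p j. \<Sum>i<m. zs (snd (fst p)) i * zs (snd p) i * xs (fst (fst p)) i * x i j"
  have g: "g 0 * zs 0 i + g 1 * zs 1 i = (\<Sum>l<2. g l * zs l i)" for i
    by (simp add: numeral_2_eq_2)
  have eq: "(\<Sum>i<m. bil R xs zs i * (g 0 * zs 0 i + g 1 * zs 1 i) * x i j) = (\<Sum>p\<in>?S. ?c p * ?f p j)" for j
  proof -
    have "(\<Sum>i<m. bil R xs zs i * (g 0 * zs 0 i + g 1 * zs 1 i) * x i j)
      = (\<Sum>i<m. \<Sum>p\<in>?S. ?c p * (zs (snd (fst p)) i * zs (snd p) i * xs (fst (fst p)) i * x i j))"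
    proof (intro sum.cong refl)
      fix i
      show "bil R xs zs i * (g 0 * zs 0 i + g 1 * zs 1 i) * x i j =
        (\<Sum>p\<in>?S. ?c p * (zs (snd (fst p)) i * zs (snd p) i * xs (fst (fst p)) i * x i j))"
      proof -
        have "(\<Sum>p\<in>?S. ?c p * (zs (snd (fst p)) i * zs (snd p) i * xs (fst (fst p)) i * x i j))
          = (\<Sum>p\<in>{..<2} \<times> {..<2}. \<Sum>l<2. R (fst p) (snd p) * g l * (zs (snd p) i * zs l i * xs (fst p) i * x i j))"
          unfolding sum.cartesian_product split_def ..
        moreover have "bil R xs zs i * (\<Sum>l<2. g l * zs l i) * x i j
          = (\<Sum>p\<in>{..<2} \<times> {..<2}. \<Sum>l<2. R (fst p) (snd p) * g l * (zs (snd p) i * zs l i * xs (fst p) i * x i j))"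
          unfolding bil_eq sum_distrib_right
          by (simp only: sum_distrib_left sum_distrib_right, intro sum.cong refl, simp only: mult_ac)
        ultimately show ?thesis unfolding g by (simp only:)
      qed
    qed
    also have "\<dots> = (\<Sum>p\<in>?S. ?c p * ?f p j)"
      unfolding sum_distrib_left by (rule sum.swap)
    finally show ?thesis .
  qed
  have "nsq d (\<lambda>j. \<Sum>i<m. bil R xs zs i * (g 0 * zs 0 i + g 1 * zs 1 i) * x i j)
     \<le> real (card ?S) * (\<Sum>p\<in>?S. (?c p)\<^sup>2 * nsq d (?f p))"
    unfolding eq by (rule nsq_sum_le)
  also have "\<dots> \<le> 8 * (\<Sum>p\<in>?S. (?c p)\<^sup>2 * B)"
  proof -
    have "(\<Sum>p\<in>?S. (?c p)\<^sup>2 * nsq d (?f p)) \<le> (\<Sum>p\<in>?S. (?c p)\<^sup>2 * B)"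
    proof (rule sum_mono, rule mult_left_mono)
      fix p assume "p \<in> ?S"
      then show "nsq d (?f p) \<le> B" by (intro B) auto
    qed simp
    moreover have "card ?S = 8" by (simp only: card_cartesian_product card_lessThan)
    ultimately show ?thesis by simp
  qed
  also have "(\<Sum>p\<in>?S. (?c p)\<^sup>2 * B) = B * (frob R * (\<Sum>l<2. (g l)\<^sup>2))"
  proof -
    have "(\<Sum>p\<in>?S. (?c p)\<^sup>2 * B) = (\<Sum>p\<in>{..<2} \<times> {..<2}. \<Sum>l<2. (R (fst p) (snd p) * g l)\<^sup>2 * B)"
      unfolding sum.cartesian_product split_def ..
    also have "\<dots> = (\<Sum>p\<in>{..<2} \<times> {..<2}. B * ((R (fst p) (snd p))\<^sup>2 * (\<Sum>l<2. (g l)\<^sup>2)))"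
      by (simp only: sum_distrib_left, intro sum.cong refl, simp only: power_mult_distrib mult_ac)
    also have "\<dots> = B * (frob R * (\<Sum>l<2. (g l)\<^sup>2))"
      unfolding frob_eq sum_distrib_right sum_distrib_left[symmetric] ..
    finally show ?thesis .
  qed
  also have "(\<Sum>l<2. (g l)\<^sup>2) = (g 0)\<^sup>2 + (g 1)\<^sup>2" by (simp add: numeral_2_eq_2)
  finally show ?thesis by (simp only: mult_ac)
qed

text \<open>If the fourth-order empirical moments are close to those of independent variables with covariance matrices \<open>P\<close> and \<open>Q\<close>,
then so are the inner products of bilinear forms, entry by entry.\<close>

lemma bil_inner_close:
  fixes P Q :: "nat \<Rightarrow> nat \<Rightarrow> real"
  assumes H: "\<And>k k' l l'. k < 2 \<Longrightarrow> k' < 2 \<Longrightarrow> l < 2 \<Longrightarrow> l' < 2 \<Longrightarrow>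
      \<bar>(\<Sum>i<m. xs k i * xs k' i * zs l i * zs l' i) - M * (P k k' * Q l l')\<bar> \<le> \<epsilon>"
  defines "S \<equiv> {..<2::nat} \<times> {..<2::nat}"
  shows "\<bar>(\<Sum>i<m. bil V xs zs i * bil R xs zs i)
      - M * (\<Sum>p\<in>S. \<Sum>q\<in>S. V (fst p) (snd p) * R (fst q) (snd q) * (P (fst p) (fst q) * Q (snd p) (snd q)))\<bar>
    \<le> \<epsilon> * ((\<Sum>p\<in>S. \<bar>V (fst p) (snd p)\<bar>) * (\<Sum>p\<in>S. \<bar>R (fst p) (snd p)\<bar>))"
proof -
  define W where "W p q = (\<Sum>i<m. xs (fst p) i * xs (fst q) i * zs (snd p) i * zs (snd q) i)"
    for p q :: "nat \<times> nat"
  define E where "E p q = W p q - M * (P (fst p) (fst q) * Q (snd p) (snd q))" for p q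
  have E: "\<bar>E p q\<bar> \<le> \<epsilon>" if "p \<in> S" "q \<in> S" for p q
    unfolding E_def W_def using that by (intro H) (auto simp: S_def)
  have "(\<Sum>i<m. bil V xs zs i * bil R xs zs i) =
     (\<Sum>i<m. \<Sum>p\<in>S. \<Sum>q\<in>S. V (fst p) (snd p) * R (fst q) (snd q) *
       (xs (fst p) i * xs (fst q) i * zs (snd p) i * zs (snd q) i))"
    unfolding bil_eq sum_product S_def by (intro sum.cong refl) (simp only: mult_ac)
  also have "\<dots> = (\<Sum>p\<in>S. \<Sum>i<m. \<Sum>q\<in>S. V (fst p) (snd p) * R (fst q) (snd q) *
       (xs (fst p) i * xs (fst q) i * zs (snd p) i * zs (snd q) i))" by (rule sum.swap)
  also have "\<dots> = (\<Sum>p\<in>S. \<Sum>q\<in>S. V (fst p) (snd p) * R (fst q) (snd q) * W p q)"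
    unfolding W_def sum_distrib_left by (rule sum.cong[OF refl], rule sum.swap)
  finally have 0: "(\<Sum>i<m. bil V xs zs i * bil R xs zs i)
    = (\<Sum>p\<in>S. \<Sum>q\<in>S. V (fst p) (snd p) * R (fst q) (snd q) * W p q)" .
  have 1: "(\<Sum>i<m. bil V xs zs i * bil R xs zs i)
      - M * (\<Sum>p\<in>S. \<Sum>q\<in>S. V (fst p) (snd p) * R (fst q) (snd q) * (P (fst p) (fst q) * Q (snd p) (snd q)))
    = (\<Sum>p\<in>S. \<Sum>q\<in>S. V (fst p) (snd p) * R (fst q) (snd q) * E p q)"
  proof -
    have "(\<Sum>p\<in>S. \<Sum>q\<in>S. V (fst p) (snd p) * R (fst q) (snd q) * E p q)
      = (\<Sum>p\<in>S. \<Sum>q\<in>S. V (fst p) (snd p) * R (fst q) (snd q) * W p q)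
        - (\<Sum>p\<in>S. \<Sum>q\<in>S. M * (V (fst p) (snd p) * R (fst q) (snd q) * (P (fst p) (fst q) * Q (snd p) (snd q))))"
      unfolding sum_subtractf[symmetric] E_def
      by (intro sum.cong refl) (simp only: right_diff_distrib mult_ac)
    then show ?thesis
      by (simp only: 0 sum_distrib_left)
  qed
  have "\<bar>\<Sum>p\<in>S. \<Sum>q\<in>S. V (fst p) (snd p) * R (fst q) (snd q) * E p q\<bar>
      \<le> (\<Sum>p\<in>S. \<bar>\<Sum>q\<in>S. V (fst p) (snd p) * R (fst q) (snd q) * E p q\<bar>)" by (rule sum_abs)
  also have "\<dots> \<le> (\<Sum>p\<in>S. \<Sum>q\<in>S. \<bar>V (fst p) (snd p) * R (fst q) (snd q) * E p q\<bar>)"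
    by (intro sum_mono sum_abs)
  also have "\<dots> \<le> (\<Sum>p\<in>S. \<Sum>q\<in>S. \<bar>V (fst p) (snd p)\<bar> * \<bar>R (fst q) (snd q)\<bar> * \<epsilon>)"
    unfolding abs_mult by (intro sum_mono mult_left_mono E) auto
  also have "\<dots> = \<epsilon> * ((\<Sum>p\<in>S. \<bar>V (fst p) (snd p)\<bar>) * (\<Sum>p\<in>S. \<bar>R (fst p) (snd p)\<bar>))"
    unfolding sum_product by (simp only: sum_distrib_left, intro sum.cong refl, simp only: mult_ac)
  finally show ?thesis unfolding 1 .
qed

definition mat2 :: "real \<Rightarrow> real \<Rightarrow> real \<Rightarrow> real \<Rightarrow> nat \<Rightarrow> nat \<Rightarrow> real" where
  "mat2 a b c e k l = (if k = 0 then (if l = 0 then a else b) else (if l = 0 then c else e))"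

lemma pairs_2: "{..<2::nat} \<times> {..<2::nat} = {(0, 0), (0, 1), (1, 0), (1, 1)}"
  by (auto simp: numeral_2_eq_2 less_Suc_eq)

lemma frob_mat2: "frob (mat2 a b c e) = a\<^sup>2 + b\<^sup>2 + c\<^sup>2 + e\<^sup>2"
  unfolding frob_eq pairs_2 by (simp add: mat2_def)

lemma bil_mat2: "bil (mat2 a b c e) xs zs i =
    a * (xs 0 i * zs 0 i) + b * (xs 0 i * zs 1 i) + c * (xs 1 i * zs 0 i) + e * (xs 1 i * zs 1 i)"
  unfolding bil_eq pairs_2 by (simp add: mat2_def)

lemma bil_transpose: "bil R xs zs i = bil (\<lambda>k l. R l k) zs xs i"
  unfolding bil_eq pairs_2 by simp

lemma frob_transpose: "frob (\<lambda>k l. R l k) = frob R"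
  unfolding frob_eq pairs_2 by simp

lemma sum_split_2d: "(\<Sum>j<2 * (d::nat). f j) = (\<Sum>j<d. f j) + (\<Sum>j<d. f (d + j))"
proof -
  have "(\<Sum>j<2 * d. f j) = (\<Sum>j<d. f j) + (\<Sum>j=d..<2 * d. f j)"
    using sum.atLeastLessThan_concat[of 0 d "2 * d" f] by (simp add: atLeast0LessThan)
  also have "(\<Sum>j=d..<2 * d. f j) = (\<Sum>j<d. f (d + j))"
    using sum.shift_bounds_nat_ivl[of f 0 d d] by (simp add: atLeast0LessThan add.commute mult_2)
  finally show ?thesis .
qed

lemma nsq_split_2d: "nsq (2 * d) f = nsq d f + nsq d (\<lambda>j. f (d + j))"
  unfolding nsq_def by (rule sum_split_2d)

lemma abs_sum4_le:
  fixes a b c e :: real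
  assumes "a\<^sup>2 + b\<^sup>2 + c\<^sup>2 + e\<^sup>2 \<le> K\<^sup>2" "0 \<le> K"
  shows "\<bar>a\<bar> + \<bar>b\<bar> + \<bar>c\<bar> + \<bar>e\<bar> \<le> 2 * K"
proof -
  have "(\<bar>a\<bar> + \<bar>b\<bar> + \<bar>c\<bar> + \<bar>e\<bar>)\<^sup>2 \<le> 4 * (a\<^sup>2 + b\<^sup>2 + c\<^sup>2 + e\<^sup>2)"
  proof -
    have "(\<bar>a\<bar> + \<bar>b\<bar> + \<bar>c\<bar> + \<bar>e\<bar>)\<^sup>2 + (\<bar>a\<bar> - \<bar>b\<bar>)\<^sup>2 + (\<bar>a\<bar> - \<bar>c\<bar>)\<^sup>2 + (\<bar>a\<bar> - \<bar>e\<bar>)\<^sup>2 + (\<bar>b\<bar> - \<bar>c\<bar>)\<^sup>2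
        + (\<bar>b\<bar> - \<bar>e\<bar>)\<^sup>2 + (\<bar>c\<bar> - \<bar>e\<bar>)\<^sup>2 = 4 * (\<bar>a\<bar>\<^sup>2 + \<bar>b\<bar>\<^sup>2 + \<bar>c\<bar>\<^sup>2 + \<bar>e\<bar>\<^sup>2)"
      by (simp add: power2_eq_square algebra_simps)
    then show ?thesis
      using zero_le_power2[of "\<bar>a\<bar> - \<bar>b\<bar>"] zero_le_power2[of "\<bar>a\<bar> - \<bar>c\<bar>"] zero_le_power2[of "\<bar>a\<bar> - \<bar>e\<bar>"]
        zero_le_power2[of "\<bar>b\<bar> - \<bar>c\<bar>"] zero_le_power2[of "\<bar>b\<bar> - \<bar>e\<bar>"] zero_le_power2[of "\<bar>c\<bar> - \<bar>e\<bar>"]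
      by (simp only: power2_abs)
  qed
  also have "\<dots> \<le> (2 * K)\<^sup>2" using assms by (simp add: power_mult_distrib)
  finally show ?thesis by (rule power2_le_imp_le) (use assms in auto)
qed

text \<open>The weighted form of the inequality of arithmetic and geometric means that trades a small multiple of the error for noise.\<close>

lemma young: "0 < t \<Longrightarrow> 2 * (a * b) \<le> t * a\<^sup>2 + b\<^sup>2 / (t :: real)"
proof -
  assume t: "0 < t"
  have "0 \<le> (t * a - b)\<^sup>2 / t" using t by simp
  also have "\<dots> = t * a\<^sup>2 - 2 * (a * b) + b\<^sup>2 / t"
    using t by (simp add: power2_eq_square field_simps)
  finally show ?thesis by linarith
qed

lemma abs_le_of_square_le: "a\<^sup>2 \<le> b\<^sup>2 \<Longrightarrow> 0 \<le> b \<Longrightarrow> \<bar>a\<bar> \<le> (b :: real)"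
  by (metis abs_le_square_iff abs_of_nonneg)

text \<open>One step, with everything known about the batch stated as inequalities. The state is \<open>\<mu> = \<alpha> p\<^sub>0 + \<beta> p\<^sub>1\<close> and
\<open>\<nu> = \<alpha>' q\<^sub>0 + \<beta>' q\<^sub>1\<close>, written \<open>al\<close>, \<open>be\<close>, \<open>al'\<close>, \<open>be'\<close>, with \<open>p\<^sub>0 = \<mu>\<^sub>\<star>\<close> and \<open>q\<^sub>0 = \<nu>\<^sub>\<star>\<close>. The numbers \<open>ka\<close> and \<open>ka'\<close> are
the squared norms of \<open>p\<^sub>1\<close> and \<open>q\<^sub>1\<close>: they are \<open>1\<close> unless the orthogonal part vanishes, in which case the direction is
taken to be \<open>0\<close>. \<open>R\<close> is the coefficient matrix of the negative noiseless residual, \<open>V\<close> that of \<open>i \<mapsto> \<langle>a\<^sub>i, u\<rangle>\<close> for \<open>u\<close> half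
the gradient of the error, and \<open>H\<close>, \<open>H'\<close> those for \<open>u = (\<mu>\<^sub>\<star>, 0)\<close> and \<open>u = (0, \<nu>\<^sub>\<star>)\<close>.

\<open>H1\<close> is the concentration of fourth-order moments, \<open>H2x\<close> and \<open>H2z\<close> bound the gradients of bilinear data, \<open>H3\<close> is the size of
the noise gradient from both sides, \<open>H4\<close> says that the Gram matrix does not amplify that gradient, and \<open>H5\<close> bounds the
noise tested against the ridge residuals of the three bilinear forms. The step is split into the response \<open>\<Delta>0\<close> to the
noiseless data and the response \<open>\<Delta>e\<close> to the normalised noise.\<close>

locale batch_step =
  fixes d m :: nat and lam \<sigma> L :: real
    and x z :: "nat \<Rightarrow> nat \<Rightarrow> real" and e :: "nat \<Rightarrow> real"
    and p q :: "nat \<Rightarrow> nat \<Rightarrow> real"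
    and al al' be be' ka ka' :: real
    and \<Delta>0 \<rho>0 \<Delta>e \<rho>e :: "nat \<Rightarrow> real"
  fixes xs zs a s0 s E
  defines "xs \<equiv> (\<lambda>k i. \<Sum>j<d. p k j * x i j)" and "zs \<equiv> (\<lambda>l i. \<Sum>j<d. q l j * z i j)"
    and "a \<equiv> (\<lambda>i j. if j < d then (al' * zs 0 i + be' * zs 1 i) * x i j
        else (al * xs 0 i + be * xs 1 i) * z i (j - d))"
    and "s0 \<equiv> al * al' - 1" and "s \<equiv> lam * real m" and "E \<equiv> s0\<^sup>2 + be\<^sup>2 + be'\<^sup>2"
  fixes V R H H'
  defines "V \<equiv> mat2 (s0 * (al\<^sup>2 + al'\<^sup>2)) (be' * (al + s0 * al')) (be * (al' + s0 * al)) (2 * be * be')"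
    and "R \<equiv> mat2 s0 (al * be') (al' * be) (be * be')"
    and "H \<equiv> mat2 al' be' 0 0" and "H' \<equiv> mat2 al 0 be 0"
  assumes m: "0 < m" and \<sigma>: "0 \<le> \<sigma>" and L: "0 \<le> L"
    and sd: "10 ^ 30 * real d \<le> s" and d: "0 < d" and md: "m \<le> d"
    and noise_le: "\<sigma>\<^sup>2 * L \<le> lam * real m"
    and al: "(2 / 5) \<le> \<bar>al\<bar>" "\<bar>al\<bar> \<le> (17 / 10)" and al': "(2 / 5) \<le> \<bar>al'\<bar>" "\<bar>al'\<bar> \<le> (17 / 10)"
    and E_le: "E \<le> 1 / 10 ^ 4"
    and ka: "0 \<le> ka" "ka \<le> 1" "be = 0 \<or> ka = 1" and ka': "0 \<le> ka'" "ka' \<le> 1" "be' = 0 \<or> ka' = 1"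
    and H1: "\<And>k k' l l'. k < 2 \<Longrightarrow> k' < 2 \<Longrightarrow> l < 2 \<Longrightarrow> l' < 2 \<Longrightarrow>
      \<bar>(\<Sum>i<m. xs k i * xs k' i * zs l i * zs l' i) - real m * (mat2 1 0 0 ka k k' * mat2 1 0 0 ka' l l')\<bar> \<le> real m / 1000"
    and H2x: "\<And>k l l'. k < 2 \<Longrightarrow> l < 2 \<Longrightarrow> l' < 2 \<Longrightarrow>
      nsq d (\<lambda>j. \<Sum>i<m. zs l i * zs l' i * xs k i * x i j) \<le> 10 ^ 12 * real m * real d"
    and H2z: "\<And>l k k'. l < 2 \<Longrightarrow> k < 2 \<Longrightarrow> k' < 2 \<Longrightarrow>
      nsq d (\<lambda>j. \<Sum>i<m. xs k i * xs k' i * zs l i * z i j) \<le> 10 ^ 12 * real m * real d"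
    and H3: "(1 / 10) * real m * real d \<le> nsq (2 * d) (lin m a e)" "nsq (2 * d) (lin m a e) \<le> 10 * real m * real d"
    and H4: "nsq m (app (2 * d) a (lin m a e)) \<le> 10 ^ 18 * real m * (real d)\<^sup>2"
    and H5: "\<And>W. W \<in> {V, H, H'} \<Longrightarrow> \<exists>\<Delta>w \<rho>w. ridge (2 * d) m a s (bil W xs zs) \<Delta>w \<rho>w \<and>
        (\<Sum>i<m. \<rho>w i * e i)\<^sup>2 \<le> 50 * L * nsq m (bil W xs zs)"
    and r0: "ridge (2 * d) m a s (\<lambda>i. - bil R xs zs i) \<Delta>0 \<rho>0"
    and re: "ridge (2 * d) m a s e \<Delta>e \<rho>e"
begin

definition "\<Delta> j = \<Delta>0 j + \<sigma> * \<Delta>e j"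
definition "\<rho> i = \<rho>0 i + \<sigma> * \<rho>e i"
definition "\<eta> = \<sigma>\<^sup>2 * L / real m"

lemma \<eta>_nonneg: "0 \<le> \<eta>"
  using L by (simp add: \<eta>_def)

lemma ridge_total: "ridge (2 * d) m a s (\<lambda>i. - bil R xs zs i + \<sigma> * e i) \<Delta> \<rho>"
  unfolding \<Delta>_def \<rho>_def by (intro ridge_add ridge_scale r0 re)

lemma s_pos: "0 < s"
proof -
  have "0 < 10 ^ 30 * real d" using d by simp
  then show ?thesis using sd by linarith
qed

lemma E_bounds: "s0\<^sup>2 \<le> E" "be\<^sup>2 \<le> E" "be'\<^sup>2 \<le> E" "0 \<le> E"
  by (simp_all add: E_def)

text \<open>Multiples of the error expanded into its three parts, for linear arithmetic.\<close>

lemma E_mult: "c * E = c * s0\<^sup>2 + c * be\<^sup>2 + c * be'\<^sup>2"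
  by (simp add: E_def distrib_left)

lemma small: "\<bar>s0\<bar> \<le> (1 / 100)" "\<bar>be\<bar> \<le> (1 / 100)" "\<bar>be'\<bar> \<le> (1 / 100)"
proof -
  have "y\<^sup>2 \<le> (1 / 100)\<^sup>2" if "y\<^sup>2 \<le> E" for y :: real
    using that E_le by (simp add: power2_eq_square)
  then show "\<bar>s0\<bar> \<le> (1 / 100)" "\<bar>be\<bar> \<le> (1 / 100)" "\<bar>be'\<bar> \<le> (1 / 100)"
    using E_bounds abs_le_of_square_le[of _ "(1 / 100)"] by auto
qed

lemma al_sq: "(4 / 25) \<le> al\<^sup>2" "al\<^sup>2 \<le> (289 / 100)" "(4 / 25) \<le> al'\<^sup>2" "al'\<^sup>2 \<le> (289 / 100)"
proof -
  have "(4 / 25) \<le> y\<^sup>2 \<and> y\<^sup>2 \<le> (289 / 100)" if "(2 / 5) \<le> \<bar>y\<bar>" "\<bar>y\<bar> \<le> (17 / 10)" for y :: real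
    using power_mono[OF that(1), of 2] power_mono[OF that(2), of 2] by (simp add: power2_eq_square)
  then show "(4 / 25) \<le> al\<^sup>2" "al\<^sup>2 \<le> (289 / 100)" "(4 / 25) \<le> al'\<^sup>2" "al'\<^sup>2 \<le> (289 / 100)"
    using al al' by auto
qed

lemma cross_bound: "\<bar>s0 * (al * al')\<bar> \<le> (3 / 100)"
proof -
  have "\<bar>al * al'\<bar> \<le> (17 / 10) * (17 / 10)" unfolding abs_mult using al al' by (intro mult_mono) auto
  then have "\<bar>s0\<bar> * \<bar>al * al'\<bar> \<le> (1 / 100) * ((17 / 10) * (17 / 10))" using small by (intro mult_mono) auto
  then show ?thesis by (simp add: abs_mult)
qed

lemma frob_R: "frob R \<le> 4 * E"
proof -
  have "frob R = s0\<^sup>2 + al\<^sup>2 * be'\<^sup>2 + al'\<^sup>2 * be\<^sup>2 + be\<^sup>2 * be'\<^sup>2"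
    unfolding R_def frob_mat2 by (simp add: power_mult_distrib)
  also have "\<dots> \<le> s0\<^sup>2 + (289 / 100) * be'\<^sup>2 + (289 / 100) * be\<^sup>2 + 1 * be'\<^sup>2"
    using al_sq E_bounds E_le by (intro add_mono mult_right_mono) auto
  also have "\<dots> \<le> 4 * E"
    unfolding E_mult using zero_le_power2[of s0] zero_le_power2[of be] zero_le_power2[of be'] by linarith
  finally show ?thesis .
qed

lemma frob_V: "frob V \<le> 36 * E"
proof -
  have b: "(y + s0 * y')\<^sup>2 \<le> 4" if "\<bar>y\<bar> \<le> (17 / 10)" "\<bar>y'\<bar> \<le> (17 / 10)" for y y'
  proof -
    have "\<bar>s0 * y'\<bar> \<le> (1 / 100) * (17 / 10)" unfolding abs_mult using small that by (intro mult_mono) auto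
    then have "\<bar>y + s0 * y'\<bar> \<le> 2" using that by linarith
    then have "\<bar>y + s0 * y'\<bar>\<^sup>2 \<le> 2\<^sup>2" by (intro power_mono) auto
    then show ?thesis by simp
  qed
  have v0: "(al\<^sup>2 + al'\<^sup>2)\<^sup>2 \<le> 34"
  proof -
    have "(al\<^sup>2 + al'\<^sup>2)\<^sup>2 \<le> (289 / 50)\<^sup>2" using al_sq by (intro power_mono) auto
    then show ?thesis by (simp add: power2_eq_square)
  qed
  have "frob V = s0\<^sup>2 * (al\<^sup>2 + al'\<^sup>2)\<^sup>2 + be'\<^sup>2 * (al + s0 * al')\<^sup>2 + be\<^sup>2 * (al' + s0 * al)\<^sup>2 + 4 * (be\<^sup>2 * be'\<^sup>2)"
    unfolding V_def frob_mat2 by (simp add: power_mult_distrib)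
  also have "\<dots> \<le> s0\<^sup>2 * 34 + be'\<^sup>2 * 4 + be\<^sup>2 * 4 + 4 * (be\<^sup>2 * 1)"
    using v0 b al al' E_bounds E_le by (intro add_mono mult_left_mono) auto
  also have "\<dots> \<le> 36 * E"
    unfolding E_mult using zero_le_power2[of s0] zero_le_power2[of be] zero_le_power2[of be'] by linarith
  finally show ?thesis .
qed

lemma frob_H: "frob H \<le> 3" "frob H' \<le> 3"
  unfolding H_def H'_def frob_mat2 using al_sq E_bounds E_le by auto

lemma ka_1: "mat2 1 0 0 ka k k' \<le> 1" "0 \<le> mat2 1 0 0 ka k k'" "mat2 1 0 0 ka' k k' \<le> 1" "0 \<le> mat2 1 0 0 ka' k k'"
  using ka ka' by (auto simp: mat2_def)

lemma nsq_bil: "nsq m (bil W xs zs) \<le> 8 * real m * frob W"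
proof -
  have "nsq m (\<lambda>i. xs k i * zs l i) \<le> 2 * real m" if "k < 2" "l < 2" for k l
  proof -
    have eq: "nsq m (\<lambda>i. xs k i * zs l i) = (\<Sum>i<m. xs k i * xs k i * zs l i * zs l i)"
      unfolding nsq_def by (intro sum.cong refl) (simp add: power2_eq_square)
    have "mat2 1 0 0 ka k k * mat2 1 0 0 ka' l l \<le> 1 * 1" using ka_1 by (intro mult_mono) auto
    then have "real m * (mat2 1 0 0 ka k k * mat2 1 0 0 ka' l l) \<le> real m * 1" by (intro mult_left_mono) auto
    then show ?thesis using H1[OF that(1,1) that(2,2)] unfolding eq by linarith
  qed
  then have "nsq m (bil W xs zs) \<le> 4 * (2 * real m) * frob W" by (rule nsq_bil_le)
  then show ?thesis by simp
qed

lemma nsq_lin_bil: "nsq (2 * d) (lin m a (bil W xs zs)) \<le> 5 * 10 ^ 13 * real m * real d * frob W"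
proof -
  let ?B = "10 ^ 12 * real m * real d"
  have f: "0 \<le> frob W" by (simp add: frob_def sum_nonneg)
  have g: "al'\<^sup>2 + be'\<^sup>2 \<le> 3" "al\<^sup>2 + be\<^sup>2 \<le> 3" using al_sq E_bounds E_le by auto
  have 1: "lin m a (bil W xs zs) j = (\<Sum>i<m. bil W xs zs i * (mat2 al' be' 0 0 0 0 * zs 0 i + mat2 al' be' 0 0 0 1 * zs 1 i) * x i j)"
    if "j < d" for j
    unfolding lin_def using that by (simp add: a_def mat2_def mult.assoc)
  have 2: "lin m a (bil W xs zs) (d + j) = (\<Sum>i<m. bil (\<lambda>k l. W l k) zs xs i * (mat2 al be 0 0 0 0 * xs 0 i + mat2 al be 0 0 0 1 * xs 1 i) * z i j)"
    for j
    unfolding lin_def bil_transpose[of W] by (simp add: a_def mat2_def mult.assoc)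
  have "nsq d (lin m a (bil W xs zs)) = nsq d (\<lambda>j. \<Sum>i<m. bil W xs zs i * (mat2 al' be' 0 0 0 0 * zs 0 i + mat2 al' be' 0 0 0 1 * zs 1 i) * x i j)"
    unfolding nsq_def[of d] by (intro sum.cong refl) (simp add: 1)
  also have "\<dots> \<le> 8 * ?B * frob W * ((mat2 al' be' 0 0 0 0)\<^sup>2 + (mat2 al' be' 0 0 0 1)\<^sup>2)"
    by (rule nsq_bil_column_le) (rule H2x)
  also have "\<dots> \<le> 8 * ?B * frob W * 3" using f g by (intro mult_left_mono) (auto simp: mat2_def)
  finally have A: "nsq d (lin m a (bil W xs zs)) \<le> 24 * (?B * frob W)" by simp
  have "nsq d (\<lambda>j. lin m a (bil W xs zs) (d + j)) \<le> 8 * ?B * frob (\<lambda>k l. W l k) * ((mat2 al be 0 0 0 0)\<^sup>2 + (mat2 al be 0 0 0 1)\<^sup>2)"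
    unfolding 2 by (rule nsq_bil_column_le) (rule H2z)
  also have "\<dots> \<le> 8 * ?B * frob W * 3" unfolding frob_transpose[of W] using f g by (intro mult_left_mono) (auto simp: mat2_def)
  finally have B: "nsq d (\<lambda>j. lin m a (bil W xs zs) (d + j)) \<le> 24 * (?B * frob W)" by simp
  have "0 \<le> ?B * frob W" using f by simp
  then have "nsq (2 * d) (lin m a (bil W xs zs)) \<le> 50 * (?B * frob W)"
    using A B unfolding nsq_split_2d by linarith
  then show ?thesis by simp
qed

text \<open>In expectation the sum is \<open>m\<close> times \<open>(\<alpha>\<^sup>2 + \<alpha>'\<^sup>2) s0\<^sup>2 + \<alpha>'\<^sup>2 \<beta>\<^sup>2 + \<alpha>\<^sup>2 \<beta>'\<^sup>2\<close> up to terms of higher order: the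
quadratic form of the squared residual around the truth, which is comparable with the error as long as \<open>\<alpha>\<close> and \<open>\<alpha>'\<close> are bounded
above and away from \<open>0\<close>. The entries of \<open>V\<close> and \<open>R\<close> are of order \<open>\<surd>E\<close>, so the deviation of the moments costs a small multiple of
\<open>m E\<close>.\<close>

lemma signal_inner: "(2 / 25) * real m * E \<le> (\<Sum>i<m. bil V xs zs i * bil R xs zs i)"
    "(\<Sum>i<m. bil V xs zs i * bil R xs zs i) \<le> (121 / 20) * real m * E"
proof -
  define main where "main = s0\<^sup>2 * (al\<^sup>2 + al'\<^sup>2) + be'\<^sup>2 * (al\<^sup>2 + s0 * (al * al'))
     + be\<^sup>2 * (al'\<^sup>2 + s0 * (al * al')) + 2 * (be\<^sup>2 * be'\<^sup>2)"
  have kk: "be * ka = be" "be' * ka' = be'" using ka(3) ka'(3) by auto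
  let ?S = "{..<2::nat} \<times> {..<2::nat}"
  have "(\<Sum>u\<in>?S. \<Sum>v\<in>?S. V (fst u) (snd u) * R (fst v) (snd v) *
      (mat2 1 0 0 ka (fst u) (fst v) * mat2 1 0 0 ka' (snd u) (snd v)))
    = s0 * (al\<^sup>2 + al'\<^sup>2) * s0 + be' * (al + s0 * al') * (al * be') * ka' + be * (al' + s0 * al) * (al' * be) * ka
      + 2 * be * be' * (be * be') * (ka * ka')"
    unfolding pairs_2 V_def R_def by (simp add: mat2_def)
  also have "\<dots> = s0 * (al\<^sup>2 + al'\<^sup>2) * s0 + be' * (al + s0 * al') * al * (be' * ka') + be * (al' + s0 * al) * al' * (be * ka)
      + 2 * be * be' * ((be * ka) * (be' * ka'))" by (simp add: mult_ac)
  also have "\<dots> = main" unfolding kk main_def by (simp add: power2_eq_square algebra_simps)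
  finally have mainS: "(\<Sum>u\<in>?S. \<Sum>v\<in>?S. V (fst u) (snd u) * R (fst v) (snd v) *
      (mat2 1 0 0 ka (fst u) (fst v) * mat2 1 0 0 ka' (snd u) (snd v))) = main" .
  have absV: "(\<Sum>u\<in>?S. \<bar>V (fst u) (snd u)\<bar>) \<le> 2 * (6 * sqrt E)"
  proof -
    have "frob V = (V 0 0)\<^sup>2 + (V 0 1)\<^sup>2 + (V 1 0)\<^sup>2 + (V 1 1)\<^sup>2" unfolding frob_eq pairs_2 by simp
    moreover have "(6 * sqrt E)\<^sup>2 = 36 * E" using E_bounds by (simp add: power_mult_distrib)
    ultimately have "\<bar>V 0 0\<bar> + \<bar>V 0 1\<bar> + \<bar>V 1 0\<bar> + \<bar>V 1 1\<bar> \<le> 2 * (6 * sqrt E)"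
      using frob_V E_bounds by (intro abs_sum4_le) auto
    then show ?thesis unfolding pairs_2 by simp
  qed
  have absR: "(\<Sum>u\<in>?S. \<bar>R (fst u) (snd u)\<bar>) \<le> 2 * (2 * sqrt E)"
  proof -
    have "frob R = (R 0 0)\<^sup>2 + (R 0 1)\<^sup>2 + (R 1 0)\<^sup>2 + (R 1 1)\<^sup>2" unfolding frob_eq pairs_2 by simp
    moreover have "(2 * sqrt E)\<^sup>2 = 4 * E" using E_bounds by (simp add: power_mult_distrib)
    ultimately have "\<bar>R 0 0\<bar> + \<bar>R 0 1\<bar> + \<bar>R 1 0\<bar> + \<bar>R 1 1\<bar> \<le> 2 * (2 * sqrt E)"
      using frob_R E_bounds by (intro abs_sum4_le) auto
    then show ?thesis unfolding pairs_2 by simp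
  qed
  have "(\<Sum>u\<in>?S. \<bar>V (fst u) (snd u)\<bar>) * (\<Sum>u\<in>?S. \<bar>R (fst u) (snd u)\<bar>) \<le> (2 * (6 * sqrt E)) * (2 * (2 * sqrt E))"
    by (intro mult_mono absV absR) (auto intro!: sum_nonneg E_bounds)
  also have "\<dots> = 48 * E" using E_bounds by simp
  finally have "real m / 1000 * ((\<Sum>u\<in>?S. \<bar>V (fst u) (snd u)\<bar>) * (\<Sum>u\<in>?S. \<bar>R (fst u) (snd u)\<bar>)) \<le> real m / 1000 * (48 * E)"
    by (intro mult_left_mono) auto
  then have close: "\<bar>(\<Sum>i<m. bil V xs zs i * bil R xs zs i) - real m * main\<bar> \<le> real m / 1000 * (48 * E)"
    using bil_inner_close[where xs = xs and zs = zs and m = m and M = "real m" and P = "mat2 1 0 0 ka"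
        and Q = "mat2 1 0 0 ka'" and \<epsilon> = "real m / 1000" and V = V and R = R, OF H1]
    unfolding mainS by linarith
  have lo: "(13 / 100) * E \<le> main"
  proof -
    have "(13 / 100) * s0\<^sup>2 \<le> s0\<^sup>2 * (al\<^sup>2 + al'\<^sup>2)" using al_sq by (subst mult.commute) (intro mult_left_mono, auto)
    moreover have "be'\<^sup>2 * (13 / 100) \<le> be'\<^sup>2 * (al\<^sup>2 + s0 * (al * al'))"
      using al_sq cross_bound by (intro mult_left_mono) auto
    moreover have "be\<^sup>2 * (13 / 100) \<le> be\<^sup>2 * (al'\<^sup>2 + s0 * (al * al'))"
      using al_sq cross_bound by (intro mult_left_mono) auto
    moreover have "0 \<le> 2 * (be\<^sup>2 * be'\<^sup>2)" by simp
    ultimately show ?thesis unfolding main_def E_mult by linarith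
  qed
  have hi: "main \<le> 6 * E"
  proof -
    have "s0\<^sup>2 * (al\<^sup>2 + al'\<^sup>2) \<le> s0\<^sup>2 * 6" using al_sq by (intro mult_left_mono) auto
    moreover have "be'\<^sup>2 * (al\<^sup>2 + s0 * (al * al')) \<le> be'\<^sup>2 * 3"
      using al_sq cross_bound by (intro mult_left_mono) auto
    moreover have "be\<^sup>2 * (al'\<^sup>2 + s0 * (al * al')) \<le> be\<^sup>2 * 3"
      using al_sq cross_bound by (intro mult_left_mono) auto
    moreover have "be\<^sup>2 * be'\<^sup>2 \<le> be\<^sup>2 * 1" using E_bounds E_le by (intro mult_left_mono) auto
    ultimately show ?thesis unfolding main_def E_mult using zero_le_power2[of be] zero_le_power2[of be'] by linarith
  qed
  have lo': "13 / 100 * (real m * E) \<le> real m * main" using mult_left_mono[OF lo, of "real m"] by simp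
  have hi': "real m * main \<le> 6 * (real m * E)" using mult_left_mono[OF hi, of "real m"] by simp
  have close': "\<bar>(\<Sum>i<m. bil V xs zs i * bil R xs zs i) - real m * main\<bar> \<le> 48 / 1000 * (real m * E)"
    using close by (simp add: mult.commute)
  have mE: "0 \<le> real m * E" using E_bounds by simp
  show "(2 / 25) * real m * E \<le> (\<Sum>i<m. bil V xs zs i * bil R xs zs i)"
    "(\<Sum>i<m. bil V xs zs i * bil R xs zs i) \<le> (121 / 20) * real m * E"
    unfolding mult.assoc using lo' hi' close' mE by - linarith+
qed

lemma app_pair:
  "app (2 * d) a (\<lambda>j. if j < d then c0 * p 0 j + c1 * p 1 j else c0' * q 0 (j - d) + c1' * q 1 (j - d)) i
   = (al' * zs 0 i + be' * zs 1 i) * (c0 * xs 0 i + c1 * xs 1 i)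
     + (al * xs 0 i + be * xs 1 i) * (c0' * zs 0 i + c1' * zs 1 i)"
proof -
  have "(\<Sum>j<d. (al' * zs 0 i + be' * zs 1 i) * x i j * (c0 * p 0 j + c1 * p 1 j))
     = (al' * zs 0 i + be' * zs 1 i) * (c0 * xs 0 i + c1 * xs 1 i)"
    unfolding xs_def by (simp add: sum_distrib_left distrib_left sum.distrib mult_ac)
  moreover have "(\<Sum>j<d. (al * xs 0 i + be * xs 1 i) * z i j * (c0' * q 0 j + c1' * q 1 j))
     = (al * xs 0 i + be * xs 1 i) * (c0' * zs 0 i + c1' * zs 1 i)"
    unfolding zs_def by (simp add: sum_distrib_left distrib_left sum.distrib mult_ac)
  ultimately show ?thesis unfolding app_def sum_split_2d by (simp add: a_def)
qed

definition "dx k = (\<Sum>j<d. p k j * \<Delta> j)"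
definition "dz l = (\<Sum>j<d. q l j * \<Delta> (d + j))"

text \<open>Tests the step with the direction of coefficients \<open>c0\<close>, \<open>c1\<close>, \<open>c0'\<close>, \<open>c1'\<close> in \<open>p\<^sub>0, p\<^sub>1, q\<^sub>0, q\<^sub>1\<close>; on the data side this is a bilinear form.\<close>

lemma ridge_pair:
  assumes W: "\<And>i. bil W xs zs i = (al' * zs 0 i + be' * zs 1 i) * (c0 * xs 0 i + c1 * xs 1 i)
     + (al * xs 0 i + be * xs 1 i) * (c0' * zs 0 i + c1' * zs 1 i)"
  shows "s * (c0 * dx 0 + c1 * dx 1 + c0' * dz 0 + c1' * dz 1)
    = (\<Sum>i<m. bil W xs zs i * \<rho>0 i) + \<sigma> * (\<Sum>i<m. bil W xs zs i * \<rho>e i)"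
proof -
  let ?u = "\<lambda>j. if j < d then c0 * p 0 j + c1 * p 1 j else c0' * q 0 (j - d) + c1' * q 1 (j - d)"
  have "(\<Sum>j<2 * d. ?u j * \<Delta> j) = c0 * dx 0 + c1 * dx 1 + c0' * dz 0 + c1' * dz 1"
    unfolding sum_split_2d dx_def dz_def
    by (simp add: sum_distrib_left algebra_simps sum.distrib)
  then have "s * (c0 * dx 0 + c1 * dx 1 + c0' * dz 0 + c1' * dz 1) = (\<Sum>i<m. app (2 * d) a ?u i * \<rho> i)"
    using ridge_inner[OF ridge_total, of ?u] by simp
  also have "\<dots> = (\<Sum>i<m. bil W xs zs i * \<rho>0 i + \<sigma> * (bil W xs zs i * \<rho>e i))"
    unfolding app_pair W[symmetric] \<rho>_def by (intro sum.cong refl) (simp add: algebra_simps)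
  also have "\<dots> = (\<Sum>i<m. bil W xs zs i * \<rho>0 i) + \<sigma> * (\<Sum>i<m. bil W xs zs i * \<rho>e i)"
    by (simp add: sum.distrib sum_distrib_left)
  finally show ?thesis .
qed

text \<open>By symmetry of the ridge operator, the bilinear form against the residual of the noise is the noise against the residual
of the bilinear form, and the latter residual is a function of \<open>x\<close> and \<open>z\<close> only.\<close>

lemma noise_inner:
  assumes "W \<in> {V, H, H'}"
  shows "(\<Sum>i<m. bil W xs zs i * \<rho>e i)\<^sup>2 \<le> 400 * (L * real m) * frob W"
proof -
  obtain \<Delta>w \<rho>w where w: "ridge (2 * d) m a s (bil W xs zs) \<Delta>w \<rho>w"
    "(\<Sum>i<m. \<rho>w i * e i)\<^sup>2 \<le> 50 * L * nsq m (bil W xs zs)"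
    using H5[OF assms] by blast
  have "(\<Sum>i<m. bil W xs zs i * \<rho>e i)\<^sup>2 \<le> 50 * L * nsq m (bil W xs zs)"
    using w(2) unfolding ridge_symmetric[OF re w(1)] .
  also have "\<dots> \<le> 50 * L * (8 * real m * frob W)" using L by (intro mult_left_mono nsq_bil) auto
  finally show ?thesis by simp
qed

lemma nsq_r0: "nsq m (\<lambda>i. - bil R xs zs i) \<le> 32 * (real m * E)"
proof -
  have "nsq m (\<lambda>i. - bil R xs zs i) = nsq m (bil R xs zs)" by (simp add: nsq_def)
  also have "\<dots> \<le> 8 * real m * frob R" by (rule nsq_bil)
  also have "\<dots> \<le> 8 * real m * (4 * E)" using frob_R by (intro mult_left_mono) auto
  finally show ?thesis by simp
qed

lemma nsq_lin_r0: "nsq (2 * d) (lin m a (\<lambda>i. - bil R xs zs i)) \<le> 2 * 10 ^ 14 * (real m * real d * E)"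
proof -
  have "lin m a (\<lambda>i. - bil R xs zs i) j = - lin m a (bil R xs zs) j" for j
    by (simp add: lin_def sum_negf)
  then have "nsq (2 * d) (lin m a (\<lambda>i. - bil R xs zs i)) = nsq (2 * d) (lin m a (bil R xs zs))"
    by (simp add: nsq_def)
  also have "\<dots> \<le> 5 * 10 ^ 13 * real m * real d * frob R" by (rule nsq_lin_bil)
  also have "\<dots> \<le> 5 * 10 ^ 13 * real m * real d * (4 * E)" using frob_R by (intro mult_left_mono) auto
  finally show ?thesis by simp
qed

lemma \<sigma>L: "\<sigma>\<^sup>2 * L = real m * \<eta>"
  using m by (simp add: \<eta>_def)

text \<open>The first-order change \<open>2 U\<close> of the error. Its signal part is \<open>-2 / s\<close> times the sum of \<open>signal_inner\<close> up to the ridge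
perturbation, which is small because \<open>s\<close> dominates \<open>d\<close>. Its noise part is at most a multiple of
\<open>\<surd>(m E) \<sigma> \<surd>L / s\<close>, which Young's inequality splits into a small multiple of \<open>m E / s\<close> and a multiple of \<open>m \<eta> / s\<close>.\<close>

lemma gradient_inner:
  defines "U \<equiv> s0 * al' * dx 0 + be * dx 1 + s0 * al * dz 0 + be' * dz 1"
  shows "- (real m * (13 * E + 10 ^ 6 * \<eta>)) \<le> 2 * (s * U)" "2 * (s * U) \<le> real m * (- (13 / 100) * E + 10 ^ 6 * \<eta>)"
proof -
  have V: "bil V xs zs i = (al' * zs 0 i + be' * zs 1 i) * (s0 * al' * xs 0 i + be * xs 1 i)
     + (al * xs 0 i + be * xs 1 i) * (s0 * al * zs 0 i + be' * zs 1 i)" for i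
    unfolding V_def bil_mat2 by (simp add: algebra_simps power2_eq_square)
  define S where "S = (\<Sum>i<m. bil V xs zs i * \<rho>0 i)"
  define N where "N = (\<Sum>i<m. bil V xs zs i * \<rho>e i)"
  have sU: "s * U = S + \<sigma> * N"
    unfolding U_def S_def N_def using ridge_pair[OF V] by simp
  have mE: "0 \<le> real m * E" using E_bounds by simp
  have S: "\<bar>S + (\<Sum>i<m. bil V xs zs i * bil R xs zs i)\<bar> \<le> 1 / 1000 * (real m * E)"
  proof (rule abs_le_of_square_le)
    have "(S + (\<Sum>i<m. bil V xs zs i * bil R xs zs i))\<^sup>2
       = ((\<Sum>i<m. bil V xs zs i * - bil R xs zs i) - (\<Sum>i<m. bil V xs zs i * \<rho>0 i))\<^sup>2"
      unfolding S_def by (simp add: sum_negf power2_commute)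
    also have "\<dots> \<le> nsq (2 * d) (lin m a (bil V xs zs)) * nsq (2 * d) (lin m a (\<lambda>i. - bil R xs zs i)) / s\<^sup>2"
      by (rule ridge_bilinear_perturbation[OF r0 s_pos])
    also have "\<dots> \<le> (2 * 10 ^ 15 * (real m * real d * E)) * (2 * 10 ^ 15 * (real m * real d * E)) / s\<^sup>2"
    proof (intro divide_right_mono mult_mono)
      have "nsq (2 * d) (lin m a (bil V xs zs)) \<le> 5 * 10 ^ 13 * real m * real d * frob V" by (rule nsq_lin_bil)
      also have "\<dots> \<le> 5 * 10 ^ 13 * real m * real d * (36 * E)" using frob_V by (intro mult_left_mono) auto
      also have "\<dots> = 18 * 10 ^ 14 * (real m * real d * E)" by simp
      also have "\<dots> \<le> 2 * 10 ^ 15 * (real m * real d * E)" using E_bounds by (intro mult_right_mono) auto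
      finally show "nsq (2 * d) (lin m a (bil V xs zs)) \<le> 2 * 10 ^ 15 * (real m * real d * E)" .
      have "2 * 10 ^ 14 * (real m * real d * E) \<le> 2 * 10 ^ 15 * (real m * real d * E)"
        using E_bounds by (intro mult_right_mono) auto
      then show "nsq (2 * d) (lin m a (\<lambda>i. - bil R xs zs i)) \<le> 2 * 10 ^ 15 * (real m * real d * E)"
        using nsq_lin_r0 by linarith
    qed (use E_bounds in auto)
    also have "\<dots> = (2 * 10 ^ 15 * real d / s)\<^sup>2 * (real m * E)\<^sup>2"
      by (simp add: power2_eq_square)
    also have "\<dots> \<le> (1 / 1000)\<^sup>2 * (real m * E)\<^sup>2"
    proof (intro mult_right_mono power_mono)
      have "2 * 10 ^ 15 * real d * 1000 \<le> 10 ^ 30 * real d" by (simp add: mult_right_mono)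
      then have "2 * 10 ^ 15 * real d * 1000 \<le> s" using sd by linarith
      then show "2 * 10 ^ 15 * real d / s \<le> 1 / 1000" using s_pos by (simp add: field_simps)
    qed (use s_pos in auto)
    finally show "(S + (\<Sum>i<m. bil V xs zs i * bil R xs zs i))\<^sup>2 \<le> (1 / 1000 * (real m * E))\<^sup>2"
      by (simp only: power_mult_distrib)
  qed (use mE in simp)
  have N: "2 * \<bar>\<sigma> * N\<bar> \<le> 2 / 100 * (real m * E) + 10 ^ 6 * (real m * \<eta>)"
  proof -
    have "N\<^sup>2 \<le> 400 * (L * real m) * (36 * E)"
    proof -
      have "N\<^sup>2 \<le> 400 * (L * real m) * frob V" unfolding N_def by (rule noise_inner) simp
      also have "\<dots> \<le> 400 * (L * real m) * (36 * E)" using frob_V L by (intro mult_left_mono) auto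
      finally show ?thesis .
    qed
    also have "\<dots> = (sqrt (real m * E) * (120 * sqrt L))\<^sup>2"
      using mE L by (simp add: power_mult_distrib)
    finally have "\<bar>N\<bar> \<le> sqrt (real m * E) * (120 * sqrt L)"
      using mE L by (intro abs_le_of_square_le) auto
    then have "\<sigma> * \<bar>N\<bar> \<le> \<sigma> * (sqrt (real m * E) * (120 * sqrt L))" using \<sigma> by (intro mult_left_mono) auto
    then have "2 * \<bar>\<sigma> * N\<bar> \<le> 2 * (sqrt (real m * E) * (\<sigma> * 120 * sqrt L))"
      using \<sigma> by (simp add: abs_mult mult_ac)
    also have "\<dots> \<le> 2 / 100 * (sqrt (real m * E))\<^sup>2 + (\<sigma> * 120 * sqrt L)\<^sup>2 / (2 / 100)"
      by (rule young) simp
    also have "\<dots> = 2 / 100 * (real m * E) + 720000 * (\<sigma>\<^sup>2 * L)"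
      using mE L by (simp add: power_mult_distrib)
    also have "720000 * (\<sigma>\<^sup>2 * L) \<le> 10 ^ 6 * (real m * \<eta>)"
      unfolding \<sigma>L using \<eta>_nonneg by (intro mult_right_mono) auto
    finally show ?thesis by simp
  qed
  have sig: "8 / 100 * (real m * E) \<le> (\<Sum>i<m. bil V xs zs i * bil R xs zs i)"
    "(\<Sum>i<m. bil V xs zs i * bil R xs zs i) \<le> 121 / 20 * (real m * E)"
    using signal_inner by (simp_all add: mult.assoc)
  have sU2: "2 * (s * U) = 2 * S + 2 * (\<sigma> * N)" by (simp add: sU)
  define T where "T = 10 ^ 6 * (real m * \<eta>)"
  have "- (13 * (real m * E)) - T \<le> 2 * (s * U)" "2 * (s * U) \<le> - (13 / 100 * (real m * E)) + T"
    unfolding sU2 using S N[folded T_def] sig mE by - linarith+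
  then show "- (real m * (13 * E + 10 ^ 6 * \<eta>)) \<le> 2 * (s * U)" "2 * (s * U) \<le> real m * (- (13 / 100) * E + 10 ^ 6 * \<eta>)"
    by (simp_all add: algebra_simps T_def)
qed

text \<open>The movement of \<open>\<alpha>\<close> and \<open>\<alpha>'\<close>. Unlike the first-order change of the error, its leading term has no sign, so only its size
is bounded.\<close>

lemma parallel_step:
  shows "(s * dx 0)\<^sup>2 \<le> (real m)\<^sup>2 * (1536 * E + 2400 * \<eta>)" "(s * dz 0)\<^sup>2 \<le> (real m)\<^sup>2 * (1536 * E + 2400 * \<eta>)"
proof -
  have gen: "((\<Sum>i<m. bil W xs zs i * \<rho>0 i) + \<sigma> * (\<Sum>i<m. bil W xs zs i * \<rho>e i))\<^sup>2 \<le> (real m)\<^sup>2 * (1536 * E + 2400 * \<eta>)"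
    if W: "W \<in> {V, H, H'}" "frob W \<le> 3" for W
  proof -
    have n: "nsq m (bil W xs zs) \<le> 24 * real m"
    proof -
      have "8 * real m * frob W \<le> 8 * real m * 3" using W by (intro mult_left_mono) auto
      then show ?thesis using nsq_bil[of W] by linarith
    qed
    have "(\<Sum>i<m. bil W xs zs i * \<rho>0 i)\<^sup>2 \<le> nsq m (bil W xs zs) * nsq m \<rho>0" by (rule Cauchy_Schwarz_nsq)
    also have "\<dots> \<le> (24 * real m) * (32 * (real m * E))"
    proof (intro mult_mono n)
      show "nsq m \<rho>0 \<le> 32 * (real m * E)"
        using ridge_residual_le[OF r0 s_pos] nsq_r0 by linarith
    qed auto
    finally have 1: "(\<Sum>i<m. bil W xs zs i * \<rho>0 i)\<^sup>2 \<le> 768 * ((real m)\<^sup>2 * E)" by (simp add: power2_eq_square)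
    have "(\<Sum>i<m. bil W xs zs i * \<rho>e i)\<^sup>2 \<le> 400 * (L * real m) * frob W" by (rule noise_inner[OF W(1)])
    also have "\<dots> \<le> 400 * (L * real m) * 3" using W L by (intro mult_left_mono) auto
    finally have "\<sigma>\<^sup>2 * (\<Sum>i<m. bil W xs zs i * \<rho>e i)\<^sup>2 \<le> \<sigma>\<^sup>2 * (1200 * (L * real m))"
      by (intro mult_left_mono) auto
    also have "\<dots> = 1200 * ((\<sigma>\<^sup>2 * L) * real m)" by simp
    also have "\<dots> = 1200 * ((real m)\<^sup>2 * \<eta>)" unfolding \<sigma>L by (simp add: power2_eq_square)
    finally have 2: "(\<sigma> * (\<Sum>i<m. bil W xs zs i * \<rho>e i))\<^sup>2 \<le> 1200 * ((real m)\<^sup>2 * \<eta>)" by (simp add: power_mult_distrib)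
    have "((\<Sum>i<m. bil W xs zs i * \<rho>0 i) + \<sigma> * (\<Sum>i<m. bil W xs zs i * \<rho>e i))\<^sup>2
       \<le> 2 * (\<Sum>i<m. bil W xs zs i * \<rho>0 i)\<^sup>2 + 2 * (\<sigma> * (\<Sum>i<m. bil W xs zs i * \<rho>e i))\<^sup>2" by (rule square_sum_le)
    also have "\<dots> \<le> 1536 * ((real m)\<^sup>2 * E) + 2400 * ((real m)\<^sup>2 * \<eta>)" using 1 2 by linarith
    also have "\<dots> = (real m)\<^sup>2 * (1536 * E + 2400 * \<eta>)" by (simp add: algebra_simps)
    finally show ?thesis .
  qed
  have H: "bil H xs zs i = (al' * zs 0 i + be' * zs 1 i) * (1 * xs 0 i + 0 * xs 1 i)
     + (al * xs 0 i + be * xs 1 i) * (0 * zs 0 i + 0 * zs 1 i)" for i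
    unfolding H_def bil_mat2 by (simp add: algebra_simps)
  have H': "bil H' xs zs i = (al' * zs 0 i + be' * zs 1 i) * (0 * xs 0 i + 0 * xs 1 i)
     + (al * xs 0 i + be * xs 1 i) * (1 * zs 0 i + 0 * zs 1 i)" for i
    unfolding H'_def bil_mat2 by (simp add: algebra_simps)
  have "s * dx 0 = (\<Sum>i<m. bil H xs zs i * \<rho>0 i) + \<sigma> * (\<Sum>i<m. bil H xs zs i * \<rho>e i)"
    using ridge_pair[OF H] by simp
  then show "(s * dx 0)\<^sup>2 \<le> (real m)\<^sup>2 * (1536 * E + 2400 * \<eta>)" using gen[of H] frob_H by simp
  have "s * dz 0 = (\<Sum>i<m. bil H' xs zs i * \<rho>0 i) + \<sigma> * (\<Sum>i<m. bil H' xs zs i * \<rho>e i)"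
    using ridge_pair[OF H'] by simp
  then show "(s * dz 0)\<^sup>2 \<le> (real m)\<^sup>2 * (1536 * E + 2400 * \<eta>)" using gen[of H'] frob_H by simp
qed

text \<open>The noise contributes \<open>\<sigma>\<^sup>2 |\<Delta>e|\<^sup>2\<close>, of order \<open>\<sigma>\<^sup>2 m d / s\<^sup>2\<close> from both sides; the signal contributes a further multiple
of \<open>m d E / s\<^sup>2\<close>. As \<open>s\<close> is at least \<open>10\<^sup>3\<^sup>0 d\<close>, the latter is absorbed into \<open>E / \<lambda>\<close>.\<close>

lemma step_norm:
  shows "s\<^sup>2 * nsq (2 * d) \<Delta> \<le> real m * real d * (4 * 10 ^ 14 * E + 20 * \<sigma>\<^sup>2)"
    and "real m * real d * (1 / 80 * \<sigma>\<^sup>2 - 2 * 10 ^ 14 * E) \<le> s\<^sup>2 * nsq (2 * d) \<Delta>"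
proof -
  define P where "P = real m * real d"
  have P0: "0 \<le> P" by (simp add: P_def)
  have n0: "s\<^sup>2 * nsq (2 * d) \<Delta>0 \<le> 2 * 10 ^ 14 * (P * E)"
    using ridge_step_le[OF r0 s_pos] nsq_lin_r0 unfolding P_def by linarith
  have ne: "s\<^sup>2 * nsq (2 * d) \<Delta>e \<le> 10 * P"
    using ridge_step_le[OF re s_pos] H3(2) unfolding P_def by linarith
  have sc: "nsq (2 * d) (\<lambda>j. \<sigma> * \<Delta>e j) = \<sigma>\<^sup>2 * nsq (2 * d) \<Delta>e" by (rule nsq_scale)
  have "nsq (2 * d) \<Delta> \<le> 2 * nsq (2 * d) \<Delta>0 + 2 * (\<sigma>\<^sup>2 * nsq (2 * d) \<Delta>e)"
    unfolding sc[symmetric] \<Delta>_def[abs_def] by (rule nsq_add_le)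
  then have "s\<^sup>2 * nsq (2 * d) \<Delta> \<le> s\<^sup>2 * (2 * nsq (2 * d) \<Delta>0 + 2 * (\<sigma>\<^sup>2 * nsq (2 * d) \<Delta>e))"
    by (intro mult_left_mono) auto
  also have "\<dots> = 2 * (s\<^sup>2 * nsq (2 * d) \<Delta>0) + 2 * (\<sigma>\<^sup>2 * (s\<^sup>2 * nsq (2 * d) \<Delta>e))" by (simp add: algebra_simps)
  also have "\<sigma>\<^sup>2 * (s\<^sup>2 * nsq (2 * d) \<Delta>e) \<le> \<sigma>\<^sup>2 * (10 * P)" using ne by (intro mult_left_mono) auto
  finally have "s\<^sup>2 * nsq (2 * d) \<Delta> \<le> 4 * 10 ^ 14 * (P * E) + 20 * (\<sigma>\<^sup>2 * P)" using n0 by simp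
  then show "s\<^sup>2 * nsq (2 * d) \<Delta> \<le> real m * real d * (4 * 10 ^ 14 * E + 20 * \<sigma>\<^sup>2)"
    unfolding P_def[symmetric] by (simp add: algebra_simps)
  have "nsq (2 * d) (lin m a e) \<le> 4 * s\<^sup>2 * nsq (2 * d) \<Delta>e"
  proof (rule ridge_step_ge[OF re s_pos])
    have "4 * nsq m (app (2 * d) a (lin m a e)) \<le> 4 * (10 ^ 18 * real m * (real d)\<^sup>2)" using H4 by linarith
    also have "\<dots> = 4 * 10 ^ 18 * (real d * P)" by (simp add: P_def power2_eq_square)
    also have "\<dots> \<le> 10 ^ 29 * (real d * P)" using P0 by (intro mult_right_mono) auto
    also have "\<dots> = (10 ^ 30 * real d) * (1 / 10 * P)" by simp
    also have "\<dots> \<le> s * (1 / 10 * P)" using sd P0 by (intro mult_right_mono) auto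
    also have "\<dots> \<le> s * nsq (2 * d) (lin m a e)"
      using H3(1) s_pos by (intro mult_left_mono) (auto simp: P_def)
    finally show "4 * nsq m (app (2 * d) a (lin m a e)) \<le> s * nsq (2 * d) (lin m a e)" .
  qed
  then have ge: "1 / 10 * P \<le> 4 * (s\<^sup>2 * nsq (2 * d) \<Delta>e)" using H3(1) by (simp add: P_def)
  have "\<sigma>\<^sup>2 * nsq (2 * d) \<Delta>e = nsq (2 * d) (\<lambda>j. \<Delta> j + (- 1) * \<Delta>0 j)"
    unfolding sc[symmetric] by (simp add: \<Delta>_def)
  also have "\<dots> \<le> 2 * nsq (2 * d) \<Delta> + 2 * nsq (2 * d) (\<lambda>j. (- 1) * \<Delta>0 j)" by (rule nsq_add_le)
  also have "nsq (2 * d) (\<lambda>j. (- 1) * \<Delta>0 j) = nsq (2 * d) \<Delta>0" unfolding nsq_scale by simp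
  finally have "s\<^sup>2 * (\<sigma>\<^sup>2 * nsq (2 * d) \<Delta>e) \<le> s\<^sup>2 * (2 * nsq (2 * d) \<Delta> + 2 * nsq (2 * d) \<Delta>0)"
    by (intro mult_left_mono) auto
  also have "\<dots> = 2 * (s\<^sup>2 * nsq (2 * d) \<Delta>) + 2 * (s\<^sup>2 * nsq (2 * d) \<Delta>0)" by (simp add: algebra_simps)
  finally have 1: "\<sigma>\<^sup>2 * (s\<^sup>2 * nsq (2 * d) \<Delta>e) \<le> 2 * (s\<^sup>2 * nsq (2 * d) \<Delta>) + 4 * 10 ^ 14 * (P * E)"
    using n0 by (simp add: mult.left_commute)
  have "\<sigma>\<^sup>2 * (1 / 10 * P) \<le> \<sigma>\<^sup>2 * (4 * (s\<^sup>2 * nsq (2 * d) \<Delta>e))" using ge by (intro mult_left_mono) auto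
  then have "1 / 40 * (\<sigma>\<^sup>2 * P) \<le> \<sigma>\<^sup>2 * (s\<^sup>2 * nsq (2 * d) \<Delta>e)" by simp
  then have "1 / 80 * (\<sigma>\<^sup>2 * P) - 2 * 10 ^ 14 * (P * E) \<le> s\<^sup>2 * nsq (2 * d) \<Delta>" using 1 by linarith
  then show "real m * real d * (1 / 80 * \<sigma>\<^sup>2 - 2 * 10 ^ 14 * E) \<le> s\<^sup>2 * nsq (2 * d) \<Delta>"
    unfolding P_def[symmetric] by (simp add: algebra_simps)
qed

lemma lam_ge: "10 ^ 30 \<le> lam"
proof -
  have "10 ^ 30 * real m \<le> 10 ^ 30 * real d" using md by simp
  then have "10 ^ 30 * real m \<le> lam * real m" using sd unfolding s_def by linarith
  then show ?thesis using m by (simp add: mult_le_cancel_right)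
qed

lemma \<eta>_le: "\<eta> \<le> lam"
proof -
  have "real m * \<eta> \<le> real m * lam" using noise_le unfolding \<sigma>L by (simp add: mult.commute)
  then show ?thesis using m by (simp add: mult_le_cancel_left)
qed

lemma shift_small:
  "lam\<^sup>2 * (dx 0)\<^sup>2 \<le> 1536 * E + 2400 * \<eta>" "lam\<^sup>2 * (dz 0)\<^sup>2 \<le> 1536 * E + 2400 * \<eta>"
proof -
  have m2: "0 < (real m)\<^sup>2" using m by simp
  have "(real m)\<^sup>2 * (lam\<^sup>2 * (dx 0)\<^sup>2) \<le> (real m)\<^sup>2 * (1536 * E + 2400 * \<eta>)"
    using parallel_step(1) unfolding s_def by (simp add: power_mult_distrib mult_ac)
  then show "lam\<^sup>2 * (dx 0)\<^sup>2 \<le> 1536 * E + 2400 * \<eta>" using m2 by (simp only: mult_le_cancel_left_pos)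
  have "(real m)\<^sup>2 * (lam\<^sup>2 * (dz 0)\<^sup>2) \<le> (real m)\<^sup>2 * (1536 * E + 2400 * \<eta>)"
    using parallel_step(2) unfolding s_def by (simp add: power_mult_distrib mult_ac)
  then show "lam\<^sup>2 * (dz 0)\<^sup>2 \<le> 1536 * E + 2400 * \<eta>" using m2 by (simp only: mult_le_cancel_left_pos)
qed

text \<open>\<open>E'\<close> is the error after the step, expanded in the components of the increment. Exactly,
\<open>E' - E = 2 U + 2 s0 \<delta> \<delta>' + X\<^sup>2 + |\<Delta>|\<^sup>2 - \<delta>\<^sup>2 - \<delta>'\<^sup>2\<close>, where \<open>\<delta> = dx 0\<close>, \<open>\<delta>' = dz 0\<close> and \<open>X\<close> is the change
of \<open>\<alpha> \<alpha>'\<close>. The terms other than \<open>2 U\<close> and \<open>|\<Delta>|\<^sup>2\<close> are of order \<open>(E + \<eta>) / \<lambda>\<^sup>2\<close>.\<close>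

lemma err_step:
  defines "E' \<equiv> ((al + dx 0) * (al' + dz 0) - 1)\<^sup>2 + (be\<^sup>2 + 2 * be * dx 1 + nsq d \<Delta> - (dx 0)\<^sup>2)
      + (be'\<^sup>2 + 2 * be' * dz 1 + nsq d (\<lambda>j. \<Delta> (d + j)) - (dz 0)\<^sup>2)"
  shows "E' \<le> (1 - (1 / 10) / lam) * E + 20 * \<sigma>\<^sup>2 * real d / (lam\<^sup>2 * real m) + 2 * 10 ^ 6 * \<eta> / lam"
    and "(1 - 14 / lam) * E + (1 / 80) * \<sigma>\<^sup>2 * real d / (lam\<^sup>2 * real m) - 2 * 10 ^ 6 * \<eta> / lam \<le> E'"
proof -
  define U where "U = s0 * al' * dx 0 + be * dx 1 + s0 * al * dz 0 + be' * dz 1"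
  define X where "X = al' * dx 0 + al * dz 0 + dx 0 * dz 0"
  define N where "N = nsq (2 * d) \<Delta>"
  define D where "D = (dx 0)\<^sup>2 + (dz 0)\<^sup>2"
  define w where "w = \<sigma>\<^sup>2 * real d / (lam * real m)"
  have lam: "0 < lam" using lam_ge by simp
  have N0: "0 \<le> N" by (simp add: N_def)
  have w0: "0 \<le> w" using lam by (simp add: w_def)
  have D0: "0 \<le> D" by (simp add: D_def)
  have eq: "E' = E + 2 * U + 2 * s0 * (dx 0 * dz 0) + X\<^sup>2 + N - D"
    unfolding E'_def E_def U_def X_def N_def D_def nsq_split_2d s0_def
    by (simp add: power2_eq_square algebra_simps)
  have U: "- (13 * E + 10 ^ 6 * \<eta>) \<le> lam * (2 * U)" "lam * (2 * U) \<le> - (13 / 100) * E + 10 ^ 6 * \<eta>"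
  proof -
    have sU: "2 * (s * U) = real m * (lam * (2 * U))" by (simp add: s_def)
    have "real m * - (13 * E + 10 ^ 6 * \<eta>) \<le> real m * (lam * (2 * U))"
      "real m * (lam * (2 * U)) \<le> real m * (- (13 / 100) * E + 10 ^ 6 * \<eta>)"
      using gradient_inner[folded U_def] unfolding sU by (simp_all only: minus_mult_right)
    then show "- (13 * E + 10 ^ 6 * \<eta>) \<le> lam * (2 * U)" "lam * (2 * U) \<le> - (13 / 100) * E + 10 ^ 6 * \<eta>"
      using m by (simp_all only: mult_le_cancel_left_pos of_nat_0_less_iff)
  qed
  have DD: "lam\<^sup>2 * D \<le> 3072 * E + 4800 * \<eta>" unfolding D_def using shift_small by (simp add: distrib_left)
  have lamD: "lam * D \<le> 1 / 10 ^ 4 * (E + \<eta>)"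
  proof -
    have "lam * (lam * D) \<le> 10 ^ 4 * (E + \<eta>)"
      using DD E_bounds \<eta>_nonneg by (simp add: power2_eq_square mult.assoc)
    also have "\<dots> = 10 ^ 8 * (1 / 10 ^ 4 * (E + \<eta>))" by simp
    also have "\<dots> \<le> lam * (1 / 10 ^ 4 * (E + \<eta>))"
      using lam_ge E_bounds \<eta>_nonneg by (intro mult_right_mono) auto
    finally show ?thesis using lam by (simp only: mult_le_cancel_left_pos)
  qed
  have one: "\<bar>y\<bar> \<le> 1" if "lam\<^sup>2 * y\<^sup>2 \<le> 1536 * E + 2400 * \<eta>" for y
  proof -
    have "1536 * E + 2400 * \<eta> \<le> 1 + 2400 * lam" using E_le \<eta>_le by simp
    also have "\<dots> \<le> lam * lam"
    proof -
      have "10 ^ 4 * lam \<le> lam * lam" using lam_ge lam by (intro mult_right_mono) auto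
      moreover have "1 + 2400 * lam \<le> 10 ^ 4 * lam" using lam_ge by simp
      ultimately show ?thesis by (rule order_trans[rotated])
    qed
    finally have "lam\<^sup>2 * y\<^sup>2 \<le> lam\<^sup>2 * 1" using that by (simp add: power2_eq_square)
    then have "y\<^sup>2 \<le> 1" using lam by (simp add: mult_le_cancel_left)
    then show ?thesis by (simp add: abs_square_le_1)
  qed
  have X2: "X\<^sup>2 \<le> 16 * D"
  proof -
    have "\<bar>al + dx 0\<bar> \<le> 27 / 10" using al one[OF shift_small(1)] by linarith
    then have a1: "(al + dx 0)\<^sup>2 \<le> (27 / 10)\<^sup>2" by (metis abs_ge_zero power2_abs power_mono)
    have "X\<^sup>2 = (al' * dx 0 + (al + dx 0) * dz 0)\<^sup>2" by (simp add: X_def algebra_simps)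
    also have "\<dots> \<le> 2 * (al' * dx 0)\<^sup>2 + 2 * ((al + dx 0) * dz 0)\<^sup>2" by (rule square_sum_le)
    also have "\<dots> = 2 * (al'\<^sup>2 * (dx 0)\<^sup>2) + 2 * ((al + dx 0)\<^sup>2 * (dz 0)\<^sup>2)" by (simp add: power_mult_distrib)
    also have "\<dots> \<le> 2 * (8 * (dx 0)\<^sup>2) + 2 * (8 * (dz 0)\<^sup>2)"
      using al_sq a1 by (intro add_mono mult_left_mono mult_right_mono) (auto simp: power2_eq_square)
    finally show ?thesis by (simp add: D_def)
  qed
  have cr: "\<bar>2 * s0 * (dx 0 * dz 0)\<bar> \<le> D"
  proof -
    have "2 * \<bar>dx 0 * dz 0\<bar> \<le> D"
      using zero_le_power2[of "\<bar>dx 0\<bar> - \<bar>dz 0\<bar>"] by (simp add: D_def power2_diff abs_mult)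
    moreover have "\<bar>s0\<bar> * (2 * \<bar>dx 0 * dz 0\<bar>) \<le> 1 * (2 * \<bar>dx 0 * dz 0\<bar>)" using small by (intro mult_right_mono) auto
    ultimately show ?thesis by (simp add: abs_mult mult_ac)
  qed
  have s2: "s\<^sup>2 * N = lam * real m * (real m * (lam * N))" by (simp add: s_def power2_eq_square)
  have frac: "real d * E \<le> 1 / 10 ^ 30 * (E * (lam * real m))"
    using mult_right_mono[OF sd, of E] E_bounds by (simp add: s_def mult_ac)
  have N_hi: "lam * N \<le> 1 / 100 * E + 20 * w"
  proof -
    have "real m * (lam * real m * (lam * N)) \<le> real m * (real d * (4 * 10 ^ 14 * E + 20 * \<sigma>\<^sup>2))"
      using step_norm(1) unfolding N_def[symmetric] s2 by (simp add: mult_ac)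
    then have "lam * real m * (lam * N) \<le> real d * (4 * 10 ^ 14 * E + 20 * \<sigma>\<^sup>2)"
      using m by (simp only: mult_le_cancel_left_pos of_nat_0_less_iff)
    also have "\<dots> = 4 * 10 ^ 14 * (real d * E) + 20 * (\<sigma>\<^sup>2 * real d)" by (simp add: algebra_simps)
    also have "\<dots> \<le> 1 / 100 * (E * (lam * real m)) + 20 * (\<sigma>\<^sup>2 * real d)"
    proof -
      have "0 \<le> E * (lam * real m)" using E_bounds lam by simp
      then show ?thesis using frac by simp
    qed
    also have "\<dots> = lam * real m * (1 / 100 * E + 20 * w)" using lam m by (simp add: w_def field_simps)
    finally show ?thesis using lam m by (simp only: mult_le_cancel_left_pos mult_pos_pos of_nat_0_less_iff)
  qed
  have N_lo: "1 / 80 * w - 1 / 100 * E \<le> lam * N"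
  proof -
    have "real m * (real d * (1 / 80 * \<sigma>\<^sup>2 - 2 * 10 ^ 14 * E)) \<le> real m * (lam * real m * (lam * N))"
      using step_norm(2) unfolding N_def[symmetric] s2 by (simp add: mult_ac)
    then have 1: "real d * (1 / 80 * \<sigma>\<^sup>2 - 2 * 10 ^ 14 * E) \<le> lam * real m * (lam * N)"
      using m by (simp only: mult_le_cancel_left_pos of_nat_0_less_iff)
    have "lam * real m * (1 / 80 * w - 1 / 100 * E) = 1 / 80 * (\<sigma>\<^sup>2 * real d) - 1 / 100 * (E * (lam * real m))"
      using lam m by (simp add: w_def field_simps)
    also have "\<dots> \<le> 1 / 80 * (\<sigma>\<^sup>2 * real d) - 2 * 10 ^ 14 * (real d * E)"
    proof -
      have "0 \<le> E * (lam * real m)" using E_bounds lam by simp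
      then show ?thesis using frac by simp
    qed
    also have "\<dots> = real d * (1 / 80 * \<sigma>\<^sup>2 - 2 * 10 ^ 14 * E)" by (simp add: algebra_simps)
    also note 1
    finally show ?thesis using lam m by (simp only: mult_le_cancel_left_pos mult_pos_pos of_nat_0_less_iff)
  qed
  define T where "T = 10 ^ 6 * \<eta>"
  have T0: "\<eta> \<le> T" "0 \<le> T" using \<eta>_nonneg by (simp_all add: T_def)
  have E0: "0 \<le> E" by (rule E_bounds)
  have "E' - E \<le> 2 * U + N + 17 * D" using X2 cr D0 unfolding eq by linarith
  then have "lam * (E' - E) \<le> lam * (2 * U + N + 17 * D)" using lam by (intro mult_left_mono) auto
  also have "\<dots> = lam * (2 * U) + lam * N + 17 * (lam * D)" by (simp add: algebra_simps)
  also have "\<dots> \<le> - (1 / 10) * E + 20 * w + 2 * T"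
  proof -
    have "17 * (lam * D) \<le> 17 / 10 ^ 4 * E + 17 / 10 ^ 4 * \<eta>" using lamD by simp
    then have "17 * (lam * D) \<le> 1 / 100 * E + \<eta>" using E0 \<eta>_nonneg by simp
    then show ?thesis using U(2)[folded T_def] N_hi T0 E0 by linarith
  qed
  finally have "E' - E \<le> (- (1 / 10) * E + 20 * w + 2 * T) / lam" using lam by (simp add: field_simps)
  also have "\<dots> = - (1 / 10) / lam * E + 20 * \<sigma>\<^sup>2 * real d / (lam\<^sup>2 * real m) + 2 * 10 ^ 6 * \<eta> / lam"
    using lam m by (simp add: w_def T_def add_divide_distrib diff_divide_distrib power2_eq_square mult_ac)
  finally show "E' \<le> (1 - (1 / 10) / lam) * E + 20 * \<sigma>\<^sup>2 * real d / (lam\<^sup>2 * real m) + 2 * 10 ^ 6 * \<eta> / lam"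
    by (simp add: left_diff_distrib)
  have "2 * U + N - 2 * D \<le> E' - E" using zero_le_power2[of X] cr D0 unfolding eq by linarith
  then have "lam * (2 * U + N - 2 * D) \<le> lam * (E' - E)" using lam by (intro mult_left_mono) auto
  moreover have "lam * (2 * U + N - 2 * D) = lam * (2 * U) + lam * N - 2 * (lam * D)" by (simp add: algebra_simps)
  moreover have "- 14 * E + 1 / 80 * w - 2 * T \<le> lam * (2 * U) + lam * N - 2 * (lam * D)"
  proof -
    have "2 * (lam * D) \<le> 2 / 10 ^ 4 * E + 2 / 10 ^ 4 * \<eta>" using lamD by simp
    then have "2 * (lam * D) \<le> 1 / 100 * E + \<eta>" using E0 \<eta>_nonneg by simp
    then show ?thesis using U(1)[folded T_def] N_lo T0 E0 by linarith
  qed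
  ultimately have "(- 14 * E + 1 / 80 * w - 2 * T) / lam \<le> E' - E" using lam by (simp add: field_simps)
  moreover have "(- 14 * E + 1 / 80 * w - 2 * T) / lam
      = - 14 / lam * E + (1 / 80) * \<sigma>\<^sup>2 * real d / (lam\<^sup>2 * real m) - 2 * 10 ^ 6 * \<eta> / lam"
    using lam m by (simp add: w_def T_def add_divide_distrib diff_divide_distrib power2_eq_square mult_ac)
  ultimately show "(1 - 14 / lam) * E + (1 / 80) * \<sigma>\<^sup>2 * real d / (lam\<^sup>2 * real m) - 2 * 10 ^ 6 * \<eta> / lam \<le> E'"
    by (simp add: left_diff_distrib)
qed

end

section \<open>The prox-linear step as a ridge regression\<close>

lemma reg_gram_mult_vec:
  assumes v: "v \<in> carrier_vec n" and j: "j < n"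
  shows "(reg_gram n m a r *\<^sub>v v) $ j = (\<Sum>i<m. a i $ j * (\<Sum>k<n. a i $ k * v $ k)) + r * v $ j"
proof -
  have dim: "dim_vec v = n" using v by simp
  have "(reg_gram n m a r *\<^sub>v v) $ j
      = (\<Sum>k<n. ((\<Sum>i<m. a i $ j * a i $ k) + r * (if j = k then 1 else 0)) * v $ k)"
    using j dim by (auto simp: reg_gram_def scalar_prod_def atLeast0LessThan intro!: sum.cong)
  also have "\<dots> = (\<Sum>k<n. (\<Sum>i<m. a i $ j * a i $ k) * v $ k) + (\<Sum>k<n. if j = k then r * v $ k else 0)"
    by (subst sum.distrib[symmetric], rule sum.cong) (auto simp: algebra_simps)
  also have "(\<Sum>k<n. (\<Sum>i<m. a i $ j * a i $ k) * v $ k) = (\<Sum>i<m. a i $ j * (\<Sum>k<n. a i $ k * v $ k))"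
  proof -
    have "(\<Sum>k<n. (\<Sum>i<m. a i $ j * a i $ k) * v $ k) = (\<Sum>k<n. \<Sum>i<m. a i $ j * (a i $ k * v $ k))"
      by (simp only: sum_distrib_right mult.assoc)
    also have "\<dots> = (\<Sum>i<m. \<Sum>k<n. a i $ j * (a i $ k * v $ k))" by (rule sum.swap)
    finally show ?thesis by (simp only: sum_distrib_left)
  qed
  finally show ?thesis using j by simp
qed

lemma ridge_by_inverse:
  fixes r :: "nat \<Rightarrow> real" and a :: "nat \<Rightarrow> nat \<Rightarrow> real"
  assumes s: "0 < s" and a: "\<And>i j. i < m \<Longrightarrow> j < n \<Longrightarrow> av i $ j = a i j"
  defines "B \<equiv> the (mat_inverse (reg_gram n m av s))"
  defines "\<Delta> \<equiv> (\<lambda>j. (B *\<^sub>v vec n (lin m a r)) $ j)"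
  shows "ridge n m a s r \<Delta> (\<lambda>i. r i - app n a \<Delta> i)"
proof -
  obtain B' where B': "mat_inverse (reg_gram n m av s) = Some B'" "B' \<in> carrier_mat n n"
    "reg_gram n m av s * B' = 1\<^sub>m n" "B' * reg_gram n m av s = 1\<^sub>m n"
    using mat_inverse_reg_gram[OF s] .
  have B: "B = B'" by (simp add: B_def B')
  let ?v = "B *\<^sub>v vec n (lin m a r)"
  have v: "?v \<in> carrier_vec n" using B' B by simp
  have Av: "reg_gram n m av s *\<^sub>v ?v = vec n (lin m a r)"
  proof -
    have "reg_gram n m av s *\<^sub>v ?v = (reg_gram n m av s * B) *\<^sub>v vec n (lin m a r)"
      unfolding B by (rule assoc_mult_mat_vec[OF reg_gram_carrier B'(2), symmetric]) simp
    also have "\<dots> = vec n (lin m a r)" unfolding B B'(3) by (intro one_mult_mat_vec) simp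
    finally show ?thesis .
  qed
  have "s * \<Delta> j = lin m a (\<lambda>i. r i - app n a \<Delta> i) j" if j: "j < n" for j
  proof -
    have "lin m a r j = (reg_gram n m av s *\<^sub>v ?v) $ j" using j by (simp add: Av)
    also have "\<dots> = (\<Sum>i<m. av i $ j * (\<Sum>k<n. av i $ k * ?v $ k)) + s * ?v $ j"
      by (rule reg_gram_mult_vec[OF v j])
    also have "(\<Sum>i<m. av i $ j * (\<Sum>k<n. av i $ k * ?v $ k)) = lin m a (app n a \<Delta>) j"
      unfolding lin_def app_def \<Delta>_def using j by (intro sum.cong refl) (simp add: a mult.commute)
    finally have "lin m a r j = lin m a (app n a \<Delta>) j + s * \<Delta> j" by (simp add: \<Delta>_def)
    then show ?thesis using lin_diff[of m a r "app n a \<Delta>" j] by simp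
  qed
  then show ?thesis by (simp add: ridge_def)
qed

text \<open>The row \<open>a\<^sub>i\<close> of the linearised model, the \<open>x\<close>-part in the first \<open>d\<close> coordinates and the \<open>z\<close>-part in the last \<open>d\<close>.\<close>

definition design :: "nat \<Rightarrow> (nat \<Rightarrow> real) \<Rightarrow> (nat \<Rightarrow> real) \<Rightarrow> (nat \<Rightarrow> nat \<Rightarrow> real) \<Rightarrow> (nat \<Rightarrow> nat \<Rightarrow> real) \<Rightarrow> nat \<Rightarrow> nat \<Rightarrow> real" where
  "design d gz gx x z i j = (if j < d then gz i * x i j else gx i * z i (j - d))"

lemma scalar_prod_sum: "v \<in> carrier_vec d \<Longrightarrow> w \<in> carrier_vec d \<Longrightarrow> v \<bullet> w = (\<Sum>j<d. v $ j * w $ j)"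
  by (simp add: scalar_prod_def atLeast0LessThan)

text \<open>The linearised prediction \<open>\<langle>a\<^sub>i, (\<mu>, \<nu>)\<rangle>\<close> at the current state is \<open>2 G\<^sub>i G'\<^sub>i\<close>. Subtracting the current state from the normal
equations turns their data \<open>y\<^sub>i + G\<^sub>i G'\<^sub>i\<close> into \<open>y\<^sub>i - G\<^sub>i G'\<^sub>i\<close>.\<close>

lemma prox_linear_step_ridge:
  fixes x z :: "nat \<Rightarrow> real vec"
  assumes x: "\<And>i. x i \<in> carrier_vec d" and z: "\<And>i. z i \<in> carrier_vec d"
    and \<mu>: "\<mu> \<in> carrier_vec d" and \<nu>: "\<nu> \<in> carrier_vec d" and s: "0 < lam * real m"
  defines "a \<equiv> design d (\<lambda>i. z i \<bullet> \<nu>) (\<lambda>i. x i \<bullet> \<mu>) (\<lambda>i j. x i $ j) (\<lambda>i j. z i $ j)"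
  assumes r: "ridge (2 * d) m a (lam * real m) (\<lambda>i. y i - (x i \<bullet> \<mu>) * (z i \<bullet> \<nu>)) \<Delta> \<rho>"
  obtains \<mu>' \<nu>' where "prox_linear_step d m lam x z y (\<mu>, \<nu>) = (\<mu>', \<nu>')"
    "\<mu>' \<in> carrier_vec d" "\<nu>' \<in> carrier_vec d"
    "\<And>j. j < d \<Longrightarrow> \<mu>' $ j = \<mu> $ j + \<Delta> j" "\<And>j. j < d \<Longrightarrow> \<nu>' $ j = \<nu> $ j + \<Delta> (d + j)"
proof -
  let ?n = "2 * d" and ?s = "lam * real m"
  define G where "G = (\<lambda>i. x i \<bullet> \<mu>)"
  define G' where "G' = (\<lambda>i. z i \<bullet> \<nu>)"
  define av where "av = (\<lambda>i. (G' i \<cdot>\<^sub>v x i) @\<^sub>v (G i \<cdot>\<^sub>v z i))"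
  define A where "A = reg_gram ?n m av ?s"
  define b where "b = vec ?n (\<lambda>j. \<Sum>i<m. (y i + G i * G' i) * av i $ j) + ?s \<cdot>\<^sub>v (\<mu> @\<^sub>v \<nu>)"
  define B where "B = the (mat_inverse A)"
  define w where "w = B *\<^sub>v b"
  have step: "prox_linear_step d m lam x z y (\<mu>, \<nu>) = (vec_first w d, vec_last w d)"
    by (simp add: prox_linear_step_def w_def B_def A_def b_def av_def G_def G'_def Let_def)
  have dims: "dim_vec (x i) = d" "dim_vec (z i) = d" "dim_vec \<mu> = d" "dim_vec \<nu> = d" for i
    using x z \<mu> \<nu> by auto
  have av: "av i $ j = a i j" if "j < ?n" for i j
    using that by (simp add: av_def a_def design_def G_def G'_def dims)
  have c0: "\<mu> @\<^sub>v \<nu> \<in> carrier_vec ?n" by (rule carrier_vecI) (simp add: dims(3,4))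
  have m0: "(\<mu> @\<^sub>v \<nu>) $ j = (if j < d then \<mu> $ j else \<nu> $ (j - d))" if "j < ?n" for j
    using that by (simp add: dims)
  define c where "c = vec ?n (lin m a (\<lambda>i. y i - G i * G' i))"
  obtain B' where B': "mat_inverse A = Some B'" "B' \<in> carrier_mat ?n ?n" "A * B' = 1\<^sub>m ?n" "B' * A = 1\<^sub>m ?n"
    using mat_inverse_reg_gram[OF s] unfolding A_def .
  have BB: "B = B'" by (simp add: B_def B')
  have Ac: "A \<in> carrier_mat ?n ?n" by (simp add: A_def)
  have bc: "b = A *\<^sub>v (\<mu> @\<^sub>v \<nu>) + c"
  proof (rule eq_vecI)
    show "dim_vec b = dim_vec (A *\<^sub>v (\<mu> @\<^sub>v \<nu>) + c)" by (simp add: b_def c_def dims(3,4))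
    fix j assume "j < dim_vec (A *\<^sub>v (\<mu> @\<^sub>v \<nu>) + c)"
    then have j: "j < ?n" by (simp add: c_def)
    have in2: "(\<Sum>k<?n. av i $ k * (\<mu> @\<^sub>v \<nu>) $ k) = 2 * (G i * G' i)" for i
    proof -
      have "(\<Sum>k<?n. av i $ k * (\<mu> @\<^sub>v \<nu>) $ k) = (\<Sum>k<?n. a i k * (if k < d then \<mu> $ k else \<nu> $ (k - d)))"
        by (intro sum.cong refl) (simp add: av m0 del: index_append_vec)
      also have "\<dots> = (\<Sum>k<d. G' i * (x i $ k * \<mu> $ k)) + (\<Sum>k<d. G i * (z i $ k * \<nu> $ k))"
        unfolding sum_split_2d by (simp add: a_def design_def G_def G'_def mult.assoc)
      also have "\<dots> = G' i * G i + G i * G' i"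
        unfolding sum_distrib_left[symmetric] G_def G'_def
        using scalar_prod_sum[OF x \<mu>] scalar_prod_sum[OF z \<nu>] by simp
      finally show ?thesis by simp
    qed
    have "(A *\<^sub>v (\<mu> @\<^sub>v \<nu>)) $ j = (\<Sum>i<m. av i $ j * (2 * (G i * G' i))) + ?s * (\<mu> @\<^sub>v \<nu>) $ j"
      unfolding A_def reg_gram_mult_vec[OF c0 j] in2 ..
    moreover have "c $ j = (\<Sum>i<m. (y i - G i * G' i) * av i $ j)"
      unfolding c_def lin_def using j by (simp add: av)
    moreover have "b $ j = (\<Sum>i<m. (y i + G i * G' i) * av i $ j) + ?s * (\<mu> @\<^sub>v \<nu>) $ j"
      unfolding b_def using j by (simp add: dims)
    moreover have "(\<Sum>i<m. (y i + G i * G' i) * av i $ j)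
       = (\<Sum>i<m. av i $ j * (2 * (G i * G' i))) + (\<Sum>i<m. (y i - G i * G' i) * av i $ j)"
      unfolding sum.distrib[symmetric] by (intro sum.cong refl) (simp add: algebra_simps)
    ultimately show "b $ j = (A *\<^sub>v (\<mu> @\<^sub>v \<nu>) + c) $ j" using j by (simp add: c_def)
  qed
  have cc: "c \<in> carrier_vec ?n" by (simp add: c_def)
  have w: "w = (\<mu> @\<^sub>v \<nu>) + B *\<^sub>v c"
  proof -
    have "w = B *\<^sub>v (A *\<^sub>v (\<mu> @\<^sub>v \<nu>)) + B *\<^sub>v c"
      unfolding w_def bc BB using B'(2) Ac c0 cc by (intro mult_add_distrib_mat_vec) auto
    also have "B *\<^sub>v (A *\<^sub>v (\<mu> @\<^sub>v \<nu>)) = (B * A) *\<^sub>v (\<mu> @\<^sub>v \<nu>)"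
      unfolding BB by (rule assoc_mult_mat_vec[OF B'(2) Ac c0, symmetric])
    also have "\<dots> = \<mu> @\<^sub>v \<nu>" unfolding BB B'(4) by (rule one_mult_mat_vec[OF c0])
    finally show ?thesis .
  qed
  have "ridge ?n m a ?s (\<lambda>i. y i - G i * G' i) (\<lambda>j. (B *\<^sub>v c) $ j) (\<lambda>i. (y i - G i * G' i) - app ?n a (\<lambda>j. (B *\<^sub>v c) $ j) i)"
    unfolding B_def A_def c_def by (rule ridge_by_inverse[OF s]) (rule av)
  moreover have "ridge ?n m a ?s (\<lambda>i. y i - G i * G' i) \<Delta> \<rho>" using r by (simp add: G_def G'_def)
  ultimately have \<Delta>: "(B *\<^sub>v c) $ j = \<Delta> j" if "j < ?n" for j
    using ridge_unique[OF _ _ s that] by blast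
  have dimB: "dim_row B = ?n" using B'(2) BB by simp
  have wc: "dim_vec w = d + d" unfolding w using dimB by (simp add: dims)
  have wj: "w $ j = (if j < d then \<mu> $ j else \<nu> $ (j - d)) + \<Delta> j" if "j < ?n" for j
    unfolding w using that dimB \<Delta>[OF that] by (simp add: dims)
  show ?thesis
  proof (rule that[OF step])
    show "vec_first w d \<in> carrier_vec d" "vec_last w d \<in> carrier_vec d" by simp_all
    show "vec_first w d $ j = \<mu> $ j + \<Delta> j" if "j < d" for j
      using that wj[of j] by (simp add: vec_first_def)
    show "vec_last w d $ j = \<nu> $ j + \<Delta> (d + j)" if "j < d" for j
      using that wj[of "d + j"] wc by (simp add: vec_last_def)
  qed
qed

section \<open>Measurability\<close>

lemma det_measurable:
  assumes A: "\<And>\<omega>. A \<omega> \<in> carrier_mat n n"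
    and m: "\<And>j k. j < n \<Longrightarrow> k < n \<Longrightarrow> (\<lambda>\<omega>. A \<omega> $$ (j, k)) \<in> borel_measurable M"
  shows "(\<lambda>\<omega>. det (A \<omega>) :: real) \<in> borel_measurable M"
proof -
  have "det (A \<omega>) = (\<Sum>p\<in>{p. p permutes {0..<n}}. signof p * (\<Prod>i = 0..<n. A \<omega> $$ (i, p i)))" for \<omega>
    using det_def'[OF A] .
  moreover have "(\<lambda>\<omega>. \<Sum>p\<in>{p. p permutes {0..<n}}. signof p * (\<Prod>i = 0..<n. A \<omega> $$ (i, p i))) \<in> borel_measurable M"
    by (intro borel_measurable_sum borel_measurable_times borel_measurable_const borel_measurable_prod m)
      (auto dest: permutes_in_image)
  ultimately show ?thesis by simp
qed

lemma inverse_entry_adjugate: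
  assumes A: "A \<in> carrier_mat n n" and B: "B \<in> carrier_mat n n" "B * A = 1\<^sub>m n"
    and jk: "j < n" "k < n"
  shows "B $$ (j, k) = adj_mat A $$ (j, k) / det (A :: real mat)"
proof -
  note adj = adj_mat[OF A]
  have "det B * det A = 1" using B A det_mult[OF B(1) A] by simp
  then have nz: "det A \<noteq> 0" by auto
  have "adj_mat A = (B * A) * adj_mat A" using adj B by simp
  also have "\<dots> = B * (A * adj_mat A)" by (rule assoc_mult_mat[OF B(1) A adj(1)])
  also have "\<dots> = det A \<cdot>\<^sub>m B" unfolding adj(2)
    using mult_smult_distrib[OF B(1) one_carrier_mat, of "det A"] B(1) by simp
  finally have "adj_mat A $$ (j, k) = det A * B $$ (j, k)" using B jk by simp
  then show ?thesis using nz by simp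
qed

text \<open>By Cramer's rule the entries of the inverse are rational functions of the entries of the design.\<close>

lemma reg_gram_inverse_measurable:
  assumes s: "0 < s" and jk: "j < n" "k < n"
    and m: "\<And>i j. i < m \<Longrightarrow> j < n \<Longrightarrow> (\<lambda>\<omega>. a \<omega> i $ j) \<in> borel_measurable M"
  shows "(\<lambda>\<omega>. the (mat_inverse (reg_gram n m (a \<omega>) s)) $$ (j, k)) \<in> borel_measurable M"
proof -
  let ?A = "\<lambda>\<omega>. reg_gram n m (a \<omega>) s"
  have Am: "(\<lambda>\<omega>. ?A \<omega> $$ (j, k)) \<in> borel_measurable M" if "j < n" "k < n" for j k
  proof -
    have "?A \<omega> $$ (j, k) = (\<Sum>i<m. a \<omega> i $ j * a \<omega> i $ k) + s * (if j = k then 1 else 0)" for \<omega>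
      using that by (simp add: reg_gram_def)
    then show ?thesis using that m by (auto intro!: borel_measurable_add borel_measurable_sum borel_measurable_times)
  qed
  have detm: "(\<lambda>\<omega>. det (?A \<omega>)) \<in> borel_measurable M" by (rule det_measurable[where n = n]) (auto intro: Am)
  have adj: "adj_mat (?A \<omega>) $$ (j, k) = (- 1) ^ (k + j) * det (mat_delete (?A \<omega>) k j)" for \<omega>
    using jk by (simp add: adj_mat_def cofactor_def reg_gram_def)
  have "(\<lambda>\<omega>. det (mat_delete (?A \<omega>) k j)) \<in> borel_measurable M"
  proof (rule det_measurable[where n = "n - 1"])
    show "mat_delete (?A \<omega>) k j \<in> carrier_mat (n - 1) (n - 1)" for \<omega>
      by (simp add: mat_delete_def reg_gram_def)
    fix j' k' assume jk': "j' < n - 1" "k' < n - 1"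
    then have "mat_delete (?A \<omega>) k j $$ (j', k') = ?A \<omega> $$ (if j' < k then j' else Suc j', if k' < j then k' else Suc k')" for \<omega>
      by (simp add: mat_delete_def reg_gram_def)
    then show "(\<lambda>\<omega>. mat_delete (?A \<omega>) k j $$ (j', k')) \<in> borel_measurable M"
      using jk' by (simp only:) (intro Am, auto)
  qed
  then have adjm: "(\<lambda>\<omega>. adj_mat (?A \<omega>) $$ (j, k)) \<in> borel_measurable M"
    unfolding adj by (intro borel_measurable_times) auto
  have "the (mat_inverse (?A \<omega>)) $$ (j, k) = adj_mat (?A \<omega>) $$ (j, k) / det (?A \<omega>)" for \<omega>
  proof -
    obtain B where "mat_inverse (?A \<omega>) = Some B" "B \<in> carrier_mat n n" "B * ?A \<omega> = 1\<^sub>m n"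
      using mat_inverse_reg_gram[OF s] by blast
    then show ?thesis using inverse_entry_adjugate[OF reg_gram_carrier, of B n m "a \<omega>" s j k] jk by simp
  qed
  then show ?thesis using adjm detm by simp
qed

lemma scalar_prod_measurable:
  assumes "\<And>\<omega>. v \<omega> \<in> carrier_vec d" "\<And>\<omega>. w \<omega> \<in> carrier_vec d"
    and "\<And>j. j < d \<Longrightarrow> (\<lambda>\<omega>. v \<omega> $ j) \<in> borel_measurable M"
    and "\<And>j. j < d \<Longrightarrow> (\<lambda>\<omega>. w \<omega> $ j :: real) \<in> borel_measurable M"
  shows "(\<lambda>\<omega>. v \<omega> \<bullet> w \<omega>) \<in> borel_measurable M"
  using assms by (simp add: scalar_prod_sum[OF assms(1,2)])

lemma prox_linear_step_measurable:
  assumes s: "0 < lam * real m" and j: "j < d"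
    and x: "\<And>\<omega> i. x \<omega> i \<in> carrier_vec d" and z: "\<And>\<omega> i. z \<omega> i \<in> carrier_vec d"
    and \<mu>: "\<And>\<omega>. \<mu> \<omega> \<in> carrier_vec d" and \<nu>: "\<And>\<omega>. \<nu> \<omega> \<in> carrier_vec d"
    and xm: "\<And>i j. j < d \<Longrightarrow> (\<lambda>\<omega>. x \<omega> i $ j) \<in> borel_measurable M"
    and zm: "\<And>i j. j < d \<Longrightarrow> (\<lambda>\<omega>. z \<omega> i $ j) \<in> borel_measurable M"
    and ym: "\<And>i. (\<lambda>\<omega>. y \<omega> i) \<in> borel_measurable M"
    and \<mu>m: "\<And>j. j < d \<Longrightarrow> (\<lambda>\<omega>. \<mu> \<omega> $ j) \<in> borel_measurable M"
    and \<nu>m: "\<And>j. j < d \<Longrightarrow> (\<lambda>\<omega>. \<nu> \<omega> $ j) \<in> borel_measurable M"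
  shows "(\<lambda>\<omega>. fst (prox_linear_step d m lam (x \<omega>) (z \<omega>) (y \<omega>) (\<mu> \<omega>, \<nu> \<omega>)) $ j) \<in> borel_measurable M"
    and "(\<lambda>\<omega>. snd (prox_linear_step d m lam (x \<omega>) (z \<omega>) (y \<omega>) (\<mu> \<omega>, \<nu> \<omega>)) $ j) \<in> borel_measurable M"
proof -
  let ?n = "2 * d" and ?s = "lam * real m"
  define G where "G \<omega> i = x \<omega> i \<bullet> \<mu> \<omega>" for \<omega> i
  define G' where "G' \<omega> i = z \<omega> i \<bullet> \<nu> \<omega>" for \<omega> i
  define av where "av \<omega> i = (G' \<omega> i \<cdot>\<^sub>v x \<omega> i) @\<^sub>v (G \<omega> i \<cdot>\<^sub>v z \<omega> i)" for \<omega> i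
  define B where "B \<omega> = the (mat_inverse (reg_gram ?n m (av \<omega>) ?s))" for \<omega>
  define b where "b \<omega> = vec ?n (\<lambda>j. \<Sum>i<m. (y \<omega> i + G \<omega> i * G' \<omega> i) * av \<omega> i $ j) + ?s \<cdot>\<^sub>v (\<mu> \<omega> @\<^sub>v \<nu> \<omega>)" for \<omega>
  have step: "prox_linear_step d m lam (x \<omega>) (z \<omega>) (y \<omega>) (\<mu> \<omega>, \<nu> \<omega>)
      = (vec_first (B \<omega> *\<^sub>v b \<omega>) d, vec_last (B \<omega> *\<^sub>v b \<omega>) d)" for \<omega>
    by (simp add: prox_linear_step_def B_def b_def av_def[abs_def] G_def[abs_def] G'_def[abs_def] Let_def)
  have dims: "dim_vec (x \<omega> i) = d" "dim_vec (z \<omega> i) = d" "dim_vec (\<mu> \<omega>) = d" "dim_vec (\<nu> \<omega>) = d" for \<omega> i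
    using x z \<mu> \<nu> by auto
  have Gm[measurable]: "(\<lambda>\<omega>. G \<omega> i) \<in> borel_measurable M" "(\<lambda>\<omega>. G' \<omega> i) \<in> borel_measurable M" for i
    unfolding G_def G'_def by (rule scalar_prod_measurable; fact assms)+
  have avj: "av \<omega> i $ k = (if k < d then G' \<omega> i * x \<omega> i $ k else G \<omega> i * z \<omega> i $ (k - d))" if "k < ?n" for \<omega> i k
    using that by (simp add: av_def dims)
  have avm: "(\<lambda>\<omega>. av \<omega> i $ k) \<in> borel_measurable M" if "k < ?n" for i k
    unfolding avj[OF that]
  proof (cases "k < d")
    case True
    then show "(\<lambda>\<omega>. if k < d then G' \<omega> i * x \<omega> i $ k else G \<omega> i * z \<omega> i $ (k - d)) \<in> borel_measurable M"
      using xm[of k i] by simp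
  next
    case False
    then show "(\<lambda>\<omega>. if k < d then G' \<omega> i * x \<omega> i $ k else G \<omega> i * z \<omega> i $ (k - d)) \<in> borel_measurable M"
      using zm[of "k - d" i] that by simp
  qed
  have bj: "b \<omega> $ k = (\<Sum>i<m. (y \<omega> i + G \<omega> i * G' \<omega> i) * av \<omega> i $ k)
      + ?s * (if k < d then \<mu> \<omega> $ k else \<nu> \<omega> $ (k - d))" if "k < ?n" for \<omega> k
    using that by (simp add: b_def dims)
  have bm: "(\<lambda>\<omega>. b \<omega> $ k) \<in> borel_measurable M" if k: "k < ?n" for k
  proof -
    have [measurable]: "(\<lambda>\<omega>. if k < d then \<mu> \<omega> $ k else \<nu> \<omega> $ (k - d)) \<in> borel_measurable M"
      using \<mu>m[of k] \<nu>m[of "k - d"] k by (cases "k < d") simp_all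
    note [measurable] = avm[OF k] ym
    show ?thesis unfolding bj[OF k] by measurable
  qed
  have dimb: "dim_vec (b \<omega>) = ?n" for \<omega> by (simp add: b_def dims)
  have Bc: "B \<omega> \<in> carrier_mat ?n ?n" for \<omega>
    using mat_inverse_reg_gram[OF s, of ?n m "av \<omega>"] unfolding B_def by (metis option.sel)
  have Bd: "dim_row (B \<omega>) = ?n" "dim_col (B \<omega>) = ?n" for \<omega> using Bc[of \<omega>] by auto
  have Bb: "(B \<omega> *\<^sub>v b \<omega>) $ k = (\<Sum>l<?n. B \<omega> $$ (k, l) * b \<omega> $ l)" if "k < ?n" for \<omega> k
    using that by (simp add: Bd dimb scalar_prod_def atLeast0LessThan)
  have Bbm: "(\<lambda>\<omega>. (B \<omega> *\<^sub>v b \<omega>) $ k) \<in> borel_measurable M" if k: "k < ?n" for k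
    unfolding Bb[OF k] unfolding B_def
    by (intro borel_measurable_sum borel_measurable_times bm reg_gram_inverse_measurable[OF s k] avm) auto
  have "fst (prox_linear_step d m lam (x \<omega>) (z \<omega>) (y \<omega>) (\<mu> \<omega>, \<nu> \<omega>)) $ j = (B \<omega> *\<^sub>v b \<omega>) $ j"
    "snd (prox_linear_step d m lam (x \<omega>) (z \<omega>) (y \<omega>) (\<mu> \<omega>, \<nu> \<omega>)) $ j = (B \<omega> *\<^sub>v b \<omega>) $ (d + j)" for \<omega>
    unfolding step using j by (simp_all add: vec_first_def vec_last_def Bd)
  then show "(\<lambda>\<omega>. fst (prox_linear_step d m lam (x \<omega>) (z \<omega>) (y \<omega>) (\<mu> \<omega>, \<nu> \<omega>)) $ j) \<in> borel_measurable M"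
    "(\<lambda>\<omega>. snd (prox_linear_step d m lam (x \<omega>) (z \<omega>) (y \<omega>) (\<mu> \<omega>, \<nu> \<omega>)) $ j) \<in> borel_measurable M"
    using Bbm[of j] Bbm[of "d + j"] j by simp_all
qed

lemma prox_linear_step_carrier:
  "fst (prox_linear_step d m lam x z y w) \<in> carrier_vec d" "snd (prox_linear_step d m lam x z y w) \<in> carrier_vec d"
  by (simp_all add: prox_linear_step_def Let_def split_beta)

lemma prox_linear_iterates_carrier:
  assumes "fst w \<in> carrier_vec d" "snd w \<in> carrier_vec d"
  shows "fst (prox_linear_iterates d m lam \<mu>s \<nu>s w \<omega> t) \<in> carrier_vec d"
    "snd (prox_linear_iterates d m lam \<mu>s \<nu>s w \<omega> t) \<in> carrier_vec d"
  using assms by (cases t; simp add: prox_linear_step_carrier)+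

text \<open>The iteration at which a coordinate of the noise is drawn.\<close>

primrec batch_number :: "noise_index \<Rightarrow> nat" where
  "batch_number (X t i j) = t"
| "batch_number (Z t i j) = t"
| "batch_number (Eps t i) = t"

lemma prox_linear_iterates_cong:
  assumes "\<And>\<kappa>. batch_number \<kappa> < t \<Longrightarrow> \<omega> \<kappa> = \<omega>' \<kappa>"
  shows "prox_linear_iterates d m lam \<mu>s \<nu>s w \<omega> t = prox_linear_iterates d m lam \<mu>s \<nu>s w \<omega>' t"
  using assms
proof (induction t)
  case (Suc t)
  have "batch_x d \<omega> t = batch_x d \<omega>' t" "batch_z d \<omega> t = batch_z d \<omega>' t"
    using Suc.prems by (auto simp: batch_x_def batch_z_def fun_eq_iff)
  moreover from this have "batch_y d \<mu>s \<nu>s \<omega> t = batch_y d \<mu>s \<nu>s \<omega>' t"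
    using Suc.prems by (auto simp: batch_y_def fun_eq_iff)
  ultimately show ?case using Suc by simp
qed simp

lemma batch_carrier: "batch_x d \<omega> t i \<in> carrier_vec d" "batch_z d \<omega> t i \<in> carrier_vec d"
  by (simp_all add: batch_x_def batch_z_def)

lemma prox_linear_iterates_measurable:
  fixes \<Phi> :: "'w \<Rightarrow> noise_index \<Rightarrow> real"
  assumes s: "0 < lam * real m" and \<Phi>: "\<And>\<kappa>. (\<lambda>u. \<Phi> u \<kappa>) \<in> borel_measurable M"
    and w: "fst w \<in> carrier_vec d" "snd w \<in> carrier_vec d"
    and \<mu>s: "\<mu>s \<in> carrier_vec d" "\<nu>s \<in> carrier_vec d" and j: "j < d"
  shows "(\<lambda>u. fst (prox_linear_iterates d m lam \<mu>s \<nu>s w (\<Phi> u) t) $ j) \<in> borel_measurable M \<and>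
    (\<lambda>u. snd (prox_linear_iterates d m lam \<mu>s \<nu>s w (\<Phi> u) t) $ j) \<in> borel_measurable M"
  using j
proof (induction t arbitrary: j)
  case (Suc t)
  have x: "(\<lambda>u. batch_x d (\<Phi> u) t i $ j) \<in> borel_measurable M" if "j < d" for i j
    using that \<Phi> by (simp add: batch_x_def)
  have z: "(\<lambda>u. batch_z d (\<Phi> u) t i $ j) \<in> borel_measurable M" if "j < d" for i j
    using that \<Phi> by (simp add: batch_z_def)
  have "(\<lambda>u. batch_x d (\<Phi> u) t i \<bullet> \<mu>s) \<in> borel_measurable M" for i
    by (rule scalar_prod_measurable[OF batch_carrier(1) \<mu>s(1) x]) auto
  moreover have "(\<lambda>u. batch_z d (\<Phi> u) t i \<bullet> \<nu>s) \<in> borel_measurable M" for i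
    by (rule scalar_prod_measurable[OF batch_carrier(2) \<mu>s(2) z]) auto
  ultimately have y: "(\<lambda>u. batch_y d \<mu>s \<nu>s (\<Phi> u) t i) \<in> borel_measurable M" for i
    unfolding batch_y_def using \<Phi> by (intro borel_measurable_add borel_measurable_times) auto
  note IH = Suc.IH[THEN conjunct1] Suc.IH[THEN conjunct2]
  note step = prox_linear_step_measurable[OF s \<open>j < d\<close> batch_carrier prox_linear_iterates_carrier[OF w] x z y IH]
  show ?case using step by simp
qed simp

lemma Err_formula:
  assumes "\<mu> \<in> carrier_vec d" "\<nu> \<in> carrier_vec d" "\<mu>s \<in> carrier_vec d" "\<nu>s \<in> carrier_vec d"
    and "l2norm \<mu>s = 1" "l2norm \<nu>s = 1"
  shows "Err \<mu>s \<nu>s (\<mu>, \<nu>) = ((\<mu> \<bullet> \<mu>s) * (\<nu> \<bullet> \<nu>s) - 1)\<^sup>2 + (\<mu> \<bullet> \<mu> - (\<mu> \<bullet> \<mu>s)\<^sup>2) + (\<nu> \<bullet> \<nu> - (\<nu> \<bullet> \<nu>s)\<^sup>2)"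
proof -
  have P: "(l2norm (perp_proj u v))\<^sup>2 = v \<bullet> v - (v \<bullet> u)\<^sup>2" if c: "v \<in> carrier_vec d" "u \<in> carrier_vec d" and u: "l2norm u = 1" for u v
  proof -
    have uu: "u \<bullet> u = 1" using u by (simp add: l2norm_def)
    have uv: "u \<bullet> v = v \<bullet> u" by (rule comm_scalar_prod[OF c(2,1)])
    define k where "k = v \<bullet> u"
    have p: "perp_proj u v = v - k \<cdot>\<^sub>v u" by (simp add: perp_proj_def uu uv k_def)
    have "perp_proj u v \<bullet> perp_proj u v = v \<bullet> v - k * (v \<bullet> u) - (k * (u \<bullet> v) - k * (k * (u \<bullet> u)))"
      unfolding p using c by (simp add: scalar_prod_minus_distrib[of _ d] minus_scalar_prod_distrib[of _ d] algebra_simps)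
    also have "\<dots> = v \<bullet> v - (v \<bullet> u)\<^sup>2" by (simp add: uu uv k_def power2_eq_square)
    finally have e: "perp_proj u v \<bullet> perp_proj u v = v \<bullet> v - (v \<bullet> u)\<^sup>2" .
    have "0 \<le> perp_proj u v \<bullet> perp_proj u v" by (auto simp: scalar_prod_def intro: sum_nonneg)
    then show ?thesis by (simp add: l2norm_def e)
  qed
  show ?thesis using P[OF assms(1,3,5)] P[OF assms(2,4,6)] by (simp add: Err_def)
qed

lemma Err_measurable:
  assumes s: "0 < lam * real m" and \<Phi>: "\<And>\<kappa>. (\<lambda>u. \<Phi> u \<kappa>) \<in> borel_measurable M"
    and w: "fst w \<in> carrier_vec d" "snd w \<in> carrier_vec d"
    and \<mu>s: "\<mu>s \<in> carrier_vec d" "\<nu>s \<in> carrier_vec d" "l2norm \<mu>s = 1" "l2norm \<nu>s = 1"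
  shows "(\<lambda>u. Err \<mu>s \<nu>s (prox_linear_iterates d m lam \<mu>s \<nu>s w (\<Phi> u) t)) \<in> borel_measurable M"
    and "(\<lambda>u. fst (prox_linear_iterates d m lam \<mu>s \<nu>s w (\<Phi> u) t) \<bullet> \<mu>s) \<in> borel_measurable M"
    and "(\<lambda>u. snd (prox_linear_iterates d m lam \<mu>s \<nu>s w (\<Phi> u) t) \<bullet> \<nu>s) \<in> borel_measurable M"
proof -
  let ?W = "\<lambda>u. prox_linear_iterates d m lam \<mu>s \<nu>s w (\<Phi> u) t"
  note c = prox_linear_iterates_carrier[OF w]
  have m: "(\<lambda>u. fst (?W u) $ j) \<in> borel_measurable M" "(\<lambda>u. snd (?W u) $ j) \<in> borel_measurable M" if "j < d" for j
    using prox_linear_iterates_measurable[OF s \<Phi> w \<mu>s(1,2) that] by auto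
  have k: "(\<lambda>u. \<mu>s $ j) \<in> borel_measurable M" "(\<lambda>u. \<nu>s $ j) \<in> borel_measurable M" for j by auto
  show a[measurable]: "(\<lambda>u. fst (?W u) \<bullet> \<mu>s) \<in> borel_measurable M" by (rule scalar_prod_measurable[OF c(1) \<mu>s(1) m(1) k(1)])
  show b[measurable]: "(\<lambda>u. snd (?W u) \<bullet> \<nu>s) \<in> borel_measurable M" by (rule scalar_prod_measurable[OF c(2) \<mu>s(2) m(2) k(2)])
  have [measurable]: "(\<lambda>u. fst (?W u) \<bullet> fst (?W u)) \<in> borel_measurable M"
    by (rule scalar_prod_measurable[OF c(1) c(1) m(1) m(1)])
  have [measurable]: "(\<lambda>u. snd (?W u) \<bullet> snd (?W u)) \<in> borel_measurable M"
    by (rule scalar_prod_measurable[OF c(2) c(2) m(2) m(2)])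
  have "Err \<mu>s \<nu>s (?W u) = ((fst (?W u) \<bullet> \<mu>s) * (snd (?W u) \<bullet> \<nu>s) - 1)\<^sup>2
     + (fst (?W u) \<bullet> fst (?W u) - (fst (?W u) \<bullet> \<mu>s)\<^sup>2) + (snd (?W u) \<bullet> snd (?W u) - (snd (?W u) \<bullet> \<nu>s)\<^sup>2)" for u
    using Err_formula[OF c \<mu>s, of m lam \<mu>s \<nu>s "\<Phi> u" t m lam \<mu>s \<nu>s "\<Phi> u" t] by simp
  then show "(\<lambda>u. Err \<mu>s \<nu>s (?W u)) \<in> borel_measurable M" by simp
qed

section \<open>A batch has the required properties with high probability\<close>

lemma rowf_combination: "rowf d \<iota> (\<lambda>j. a * p j + b * p' j) \<omega> i = a * rowf d \<iota> p \<omega> i + b * rowf d \<iota> p' \<omega> i"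
  unfolding rowf_def sum_distrib_left sum.distrib[symmetric] by (intro sum.cong refl) (simp add: algebra_simps)

lemma nsq_orthogonal_combination:
  assumes "(\<Sum>j<d. p j * p' j) = 0"
  shows "nsq d (\<lambda>j. a * p j + b * p' j) = a\<^sup>2 * nsq d p + b\<^sup>2 * nsq d p'"
proof -
  have "nsq d (\<lambda>j. a * p j + b * p' j) = (\<Sum>j<d. a\<^sup>2 * (p j)\<^sup>2 + b\<^sup>2 * (p' j)\<^sup>2 + (2 * a * b) * (p j * p' j))"
    unfolding nsq_def by (intro sum.cong refl) (simp add: power2_eq_square algebra_simps)
  also have "\<dots> = a\<^sup>2 * nsq d p + b\<^sup>2 * nsq d p' + (2 * a * b) * (\<Sum>j<d. p j * p' j)"
    by (simp add: sum.distrib nsq_def sum_distrib_left)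
  finally show ?thesis using assms by simp
qed

text \<open>An orthonormal pair, or a unit vector followed by \<open>0\<close> when the state has no orthogonal part.\<close>

definition direction_pair :: "nat \<Rightarrow> (nat \<Rightarrow> nat \<Rightarrow> real) \<Rightarrow> real \<Rightarrow> bool" where
  "direction_pair d p ka \<longleftrightarrow> nsq d (p 0) = 1 \<and> (\<Sum>j<d. p 0 j * p 1 j) = 0 \<and> nsq d (p 1) = ka \<and> (ka = 0 \<or> ka = 1)"

lemma direction_pair_inner:
  assumes "direction_pair d p ka" "k < 2" "k' < 2"
  shows "(\<Sum>j<d. p k j * p k' j) = mat2 1 0 0 ka k k'"
proof -
  have "k = 0 \<or> k = 1" "k' = 0 \<or> k' = 1" using assms by auto
  moreover have "(\<Sum>j<d. p 1 j * p 0 j) = 0" using assms(1) by (simp add: direction_pair_def mult.commute)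
  moreover have "(\<Sum>j<d. p 1 j * p 1 j) = ka" "(\<Sum>j<d. p 0 j * p 0 j) = 1"
    using assms(1) by (simp_all add: direction_pair_def nsq_def power2_eq_square)
  ultimately show ?thesis using assms(1) by (auto simp: mat2_def direction_pair_def)
qed

lemma direction_pair_nsq: "direction_pair d p ka \<Longrightarrow> k < 2 \<Longrightarrow> nsq d (p k) \<le> 1"
  using direction_pair_inner[of d p ka k k] unfolding nsq_def power2_eq_square
  by (auto simp: mat2_def direction_pair_def split: if_splits)

context arrays
begin

text \<open>The algorithm treats \<open>x\<close> and \<open>z\<close> symmetrically, so every event for \<open>x\<close> has a mirror image.\<close>

lemma swapped: "arrays iz ix ie ia d m"
  using reg inj_x inj_z inj_e inj_a disj by unfold_locales (auto, metis+)

lemma row_sums_bounded_direction: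
  assumes p: "direction_pair d p ka" "k < 2" and q: "nsq d q \<le> 1" "nsq d q' \<le> 1"
  shows "measure gauss {\<omega>. 10 ^ 12 * real m * real d <
      nsq d (colf m ix (\<lambda>i. rowf d iz q \<omega> i * rowf d iz q' \<omega> i * rowf d ix (p k) \<omega> i) \<omega>)} \<le> 4 / real d ^ 22"
proof (cases "nsq d (p k) = 1")
  case True
  then show ?thesis using quadratic_row_sums_bounded q by blast
next
  case False
  have "k = 0 \<or> k = 1" using p(2) by auto
  then have "nsq d (p k) = 0" using p(1) False by (auto simp: direction_pair_def)
  then have "rowf d ix (p k) \<omega> i = 0" for \<omega> i unfolding rowf_def by (simp add: nsq_eq_0)
  then have "nsq d (colf m ix (\<lambda>i. rowf d iz q \<omega> i * rowf d iz q' \<omega> i * rowf d ix (p k) \<omega> i) \<omega>) = 0" for \<omega>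
    by (simp add: colf_def nsq_def)
  moreover have "\<not> 10 ^ 12 * real m * real d < 0" by (simp add: not_less)
  ultimately show ?thesis by (simp del: zero_less_mult_iff mult_less_0_iff)
qed

text \<open>The coefficients \<open>\<langle>z\<^sub>i, q\<rangle> e\<^sub>i\<close> do not depend on \<open>x\<close>, and their squared norm concentrates around \<open>m |q|\<^sup>2\<close>.\<close>

lemma gradient_noise_bounds:
  assumes q: "1 / 25 \<le> nsq d q" "nsq d q \<le> 3 / 4"
  shows "measure gauss {\<omega>. \<not> (real m * real d / 30 \<le> nsq d (colf m ix (\<lambda>i. rowf d iz q \<omega> i * \<omega> (ie i)) \<omega>)
      \<and> nsq d (colf m ix (\<lambda>i. rowf d iz q \<omega> i * \<omega> (ie i)) \<omega>) \<le> real m * real d)} \<le> 2 / real d ^ 22"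
proof -
  define c where "c \<omega> i = rowf d iz q \<omega> i * \<omega> (ie i)" for \<omega> :: "'k \<Rightarrow> real" and i
  have cm[measurable]: "(\<lambda>\<omega>. c \<omega> i) \<in> borel_measurable gauss" for i unfolding c_def by measurable
  define E1 where "E1 \<omega> \<longleftrightarrow> real d * nsq m (c \<omega>) / 1000 < \<bar>nsq d (colf m ix (c \<omega>) \<omega>) - real d * nsq m (c \<omega>)\<bar>" for \<omega>
  define E2 where "E2 \<omega> \<longleftrightarrow> real m / 1000 \<le> \<bar>nsq m (c \<omega>) - real m * nsq d q\<bar>" for \<omega>
  have dep: "c \<omega> = c \<omega>'" if "\<And>\<kappa>. (\<forall>i j. \<kappa> \<noteq> ix i j) \<Longrightarrow> \<omega> \<kappa> = \<omega>' \<kappa>" for \<omega> \<omega>'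
  proof -
    have "\<omega> (iz i j) = \<omega>' (iz i j)" "\<omega> (ie i) = \<omega>' (ie i)" for i j
      by (rule that, use disj in metis)+
    then show ?thesis by (simp add: c_def rowf_def fun_eq_iff)
  qed
  have e1: "{\<omega>. E1 \<omega>} \<in> sets gauss" unfolding E1_def nsq_def colf_def by (rule gauss_setI) measurable
  have e2: "{\<omega>. E2 \<omega>} \<in> sets gauss" unfolding E2_def nsq_def by (rule gauss_setI) measurable
  have p1: "measure gauss {\<omega>. E1 \<omega>} \<le> 1 / real d ^ 22"
    unfolding E1_def by (rule column_forms_concentrate[OF cm dep])
  have p2: "measure gauss {\<omega>. E2 \<omega>} \<le> 1 / real d ^ 22"
    unfolding E2_def c_def using q by (intro noise_weights_concentrate) simp
  have "measure gauss {\<omega>. \<not> (real m * real d / 30 \<le> nsq d (colf m ix (c \<omega>) \<omega>)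
      \<and> nsq d (colf m ix (c \<omega>) \<omega>) \<le> real m * real d)} \<le> real (length [E1, E2]) * (1 / real d ^ 22)"
  proof (rule gauss_prob_list)
    fix E assume "E \<in> set [E1, E2]"
    then show "{\<omega>. E \<omega>} \<in> sets gauss" "measure gauss {\<omega>. E \<omega>} \<le> 1 / real d ^ 22" using e1 e2 p1 p2 by auto
  next
    fix \<omega> assume B: "\<not> (real m * real d / 30 \<le> nsq d (colf m ix (c \<omega>) \<omega>) \<and> nsq d (colf m ix (c \<omega>) \<omega>) \<le> real m * real d)"
    show "\<exists>E\<in>set [E1, E2]. E \<omega>"
    proof (rule ccontr)
      assume "\<not> (\<exists>E\<in>set [E1, E2]. E \<omega>)"
      then have n: "\<bar>nsq d (colf m ix (c \<omega>) \<omega>) - real d * nsq m (c \<omega>)\<bar> \<le> real d * nsq m (c \<omega>) / 1000"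
        "\<bar>nsq m (c \<omega>) - real m * nsq d q\<bar> < real m / 1000" by (auto simp: E1_def E2_def)
      have "real m * (1 / 25) \<le> real m * nsq d q" "real m * nsq d q \<le> real m * (3 / 4)"
        using q by (intro mult_left_mono; simp)+
      then have "(39 / 1000) * real m \<le> nsq m (c \<omega>)" "nsq m (c \<omega>) \<le> (751 / 1000) * real m"
        using n(2) by linarith+
      then have "real d * ((39 / 1000) * real m) \<le> real d * nsq m (c \<omega>)" "real d * nsq m (c \<omega>) \<le> real d * ((751 / 1000) * real m)"
        by (intro mult_left_mono; simp)+
      then have "(39 / 1000) * (real m * real d) \<le> real d * nsq m (c \<omega>)" "real d * nsq m (c \<omega>) \<le> (751 / 1000) * (real m * real d)"
        by (simp_all add: mult_ac)
      moreover have "0 \<le> real m * real d" by simp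
      ultimately have "real m * real d / 30 \<le> nsq d (colf m ix (c \<omega>) \<omega>)" "nsq d (colf m ix (c \<omega>) \<omega>) \<le> real m * real d"
        using n(1) by linarith+
      then show False using B by simp
    qed
  qed
  then show ?thesis unfolding c_def by simp
qed

text \<open>The residual is a measurable function of the design and the data, hence independent of the noise when those are, and it is no
longer than the data. The event is existentially quantified because it refers to the inverse matrix, which later arguments
need not see.\<close>

lemma ridge_noise_inner_bounded:
  assumes s: "0 < s"
    and am: "\<And>i j. (\<lambda>\<omega>. a \<omega> i j) \<in> borel_measurable gauss" and bm: "\<And>i. (\<lambda>\<omega>. b \<omega> i) \<in> borel_measurable gauss"
    and dep: "\<And>\<omega> \<omega>'. (\<And>\<kappa>. (\<forall>i. \<kappa> \<noteq> ie i) \<Longrightarrow> \<omega> \<kappa> = \<omega>' \<kappa>) \<Longrightarrow> a \<omega> = a \<omega>' \<and> b \<omega> = b \<omega>'"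
  obtains E where "{\<omega>. E \<omega>} \<in> sets gauss" "measure gauss {\<omega>. E \<omega>} \<le> 1 / real d ^ 22"
    "\<And>\<omega>. \<not> E \<omega> \<Longrightarrow> \<exists>\<Delta>w \<rho>w. ridge N m (a \<omega>) s (b \<omega>) \<Delta>w \<rho>w \<and>
      (\<Sum>i<m. \<rho>w i * \<omega> (ie i))\<^sup>2 \<le> 50 * ln (real d) * nsq m (b \<omega>)"
proof -
  define av where "av \<omega> i = vec N (a \<omega> i)" for \<omega> i
  define B where "B \<omega> = the (mat_inverse (reg_gram N m (av \<omega>) s))" for \<omega>
  define \<Delta> where "\<Delta> \<omega> = (\<lambda>j. (B \<omega> *\<^sub>v vec N (lin m (a \<omega>) (b \<omega>))) $ j)" for \<omega>
  define \<rho> where "\<rho> \<omega> = (\<lambda>i. b \<omega> i - app N (a \<omega>) (\<Delta> \<omega>) i)" for \<omega>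
  have R: "ridge N m (a \<omega>) s (b \<omega>) (\<Delta> \<omega>) (\<rho> \<omega>)" for \<omega>
    unfolding \<rho>_def \<Delta>_def B_def by (rule ridge_by_inverse[OF s]) (simp add: av_def)
  have Bc: "B \<omega> \<in> carrier_mat N N" for \<omega>
    using mat_inverse_reg_gram[OF s, of N m "av \<omega>"] unfolding B_def by (metis option.sel)
  have Bd: "dim_row (B \<omega>) = N" "dim_col (B \<omega>) = N" for \<omega> using Bc[of \<omega>] by auto
  have \<Delta>j: "\<Delta> \<omega> j = (\<Sum>k<N. B \<omega> $$ (j, k) * lin m (a \<omega>) (b \<omega>) k)" if "j < N" for \<omega> j
    using that by (simp add: \<Delta>_def Bd scalar_prod_def atLeast0LessThan)
  have linm: "(\<lambda>\<omega>. lin m (a \<omega>) (b \<omega>) k) \<in> borel_measurable gauss" for k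
    unfolding lin_def by (intro borel_measurable_sum borel_measurable_times am bm)
  have Bm: "(\<lambda>\<omega>. B \<omega> $$ (j, k)) \<in> borel_measurable gauss" if "j < N" "k < N" for j k
    unfolding B_def by (rule reg_gram_inverse_measurable[OF s that]) (simp add: av_def am)
  have \<Delta>m: "(\<lambda>\<omega>. \<Delta> \<omega> j) \<in> borel_measurable gauss" if "j < N" for j
    unfolding \<Delta>j[OF that] using that by (intro borel_measurable_sum borel_measurable_times Bm linm) auto
  have \<rho>m[measurable]: "(\<lambda>\<omega>. \<rho> \<omega> i) \<in> borel_measurable gauss" for i
    unfolding \<rho>_def app_def by (intro borel_measurable_diff borel_measurable_sum borel_measurable_times am bm \<Delta>m) auto
  have \<rho>dep: "\<rho> \<omega> = \<rho> \<omega>'" if "\<And>\<kappa>. (\<forall>i. \<kappa> \<noteq> ie i) \<Longrightarrow> \<omega> \<kappa> = \<omega>' \<kappa>" for \<omega> \<omega>'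
    using dep[OF that] by (simp add: \<rho>_def \<Delta>_def B_def av_def[abs_def])
  show ?thesis
  proof (rule that)
    show "{\<omega>. 50 * ln (real d) * nsq m (\<rho> \<omega>) < (\<Sum>i<m. \<rho> \<omega> i * \<omega> (ie i))\<^sup>2} \<in> sets gauss"
      unfolding nsq_def by (rule gauss_setI) measurable
    show "measure gauss {\<omega>. 50 * ln (real d) * nsq m (\<rho> \<omega>) < (\<Sum>i<m. \<rho> \<omega> i * \<omega> (ie i))\<^sup>2} \<le> 1 / real d ^ 22"
      by (rule noise_forms_bounded[OF \<rho>m \<rho>dep])
    fix \<omega> assume "\<not> 50 * ln (real d) * nsq m (\<rho> \<omega>) < (\<Sum>i<m. \<rho> \<omega> i * \<omega> (ie i))\<^sup>2"
    then have "(\<Sum>i<m. \<rho> \<omega> i * \<omega> (ie i))\<^sup>2 \<le> 50 * ln (real d) * nsq m (\<rho> \<omega>)" by simp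
    also have "\<dots> \<le> 50 * ln (real d) * nsq m (b \<omega>)"
    proof (rule mult_left_mono[OF ridge_residual_le[OF R s]])
      have "1 \<le> ln (real d)" using reg by (intro ln_ge_1) (simp add: regime_def)
      then show "0 \<le> 50 * ln (real d)" by simp
    qed
    finally show "\<exists>\<Delta>w \<rho>w. ridge N m (a \<omega>) s (b \<omega>) \<Delta>w \<rho>w \<and> (\<Sum>i<m. \<rho>w i * \<omega> (ie i))\<^sup>2 \<le> 50 * ln (real d) * nsq m (b \<omega>)"
      using R by blast
  qed
qed

text \<open>A union bound over 39 events. The bounds for linear forms ask for squared norm at most one, and the states can have
squared norm close to three, so they are applied to \<open>\<mu> / 2\<close> and \<open>\<nu> / 2\<close>. The set \<open>Bad\<close> is arbitrary, so that it can be taken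
measurable where that is known.\<close>

lemma batch_step_probability:
  fixes p q :: "nat \<Rightarrow> nat \<Rightarrow> real"
  assumes p: "direction_pair d p ka" and q: "direction_pair d q ka'"
    and \<sigma>: "0 \<le> \<sigma>" and sd: "10 ^ 30 * real d \<le> lam * real m" and noise_le: "\<sigma>\<^sup>2 * ln (real d) \<le> lam * real m"
    and al: "2 / 5 \<le> \<bar>al\<bar>" "\<bar>al\<bar> \<le> 17 / 10" and al': "2 / 5 \<le> \<bar>al'\<bar>" "\<bar>al'\<bar> \<le> 17 / 10"
    and E_le: "(al * al' - 1)\<^sup>2 + be\<^sup>2 + be'\<^sup>2 \<le> 1 / 10 ^ 4"
    and ka: "be = 0 \<or> ka = 1" "be' = 0 \<or> ka' = 1"
    and Bad: "\<And>\<omega> \<Delta>0 \<rho>0 \<Delta>e \<rho>e. batch_step d m lam \<sigma> (ln (real d)) (\<lambda>i j. \<omega> (ix i j)) (\<lambda>i j. \<omega> (iz i j))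
      (\<lambda>i. \<omega> (ie i)) p q al al' be be' ka ka' \<Delta>0 \<rho>0 \<Delta>e \<rho>e \<Longrightarrow> \<not> Bad \<omega>"
  shows "measure gauss {\<omega>. Bad \<omega>} \<le> 1 / real d ^ 18"
proof -
  interpret sw: arrays iz ix ie ia d m by (rule swapped)
  let ?s = "lam * real m"
  have d: "1000 \<le> d" "m \<le> d" using reg by (simp_all add: regime_def)
  have L: "1 \<le> ln (real d)" using d by (intro ln_ge_1)
  have m: "0 < m"
  proof (rule ccontr)
    assume "\<not> 0 < m"
    then show False using reg L by (simp add: regime_def power_le_zero_eq)
  qed
  have s: "0 < ?s"
  proof -
    have "0 < 10 ^ 30 * real d" using d by simp
    then show ?thesis using sd by linarith
  qed
  define xs where "xs \<omega> = (\<lambda>k i. rowf d ix (p k) \<omega> i)" for \<omega>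
  define zs where "zs \<omega> = (\<lambda>k i. rowf d iz (q k) \<omega> i)" for \<omega>
  have xsm[measurable]: "(\<lambda>\<omega>. xs \<omega> k i) \<in> borel_measurable gauss" for k i unfolding xs_def by measurable
  have zsm[measurable]: "(\<lambda>\<omega>. zs \<omega> k i) \<in> borel_measurable gauss" for k i unfolding zs_def by measurable
  define a where "a \<omega> = (\<lambda>i j. if j < d then (al' * zs \<omega> 0 i + be' * zs \<omega> 1 i) * \<omega> (ix i j)
        else (al * xs \<omega> 0 i + be * xs \<omega> 1 i) * \<omega> (iz i (j - d)))" for \<omega>
  have am: "(\<lambda>\<omega>. a \<omega> i j) \<in> borel_measurable gauss" for i j unfolding a_def by (cases "j < d") simp_all
  define q' where "q' = (\<lambda>j. al' / 2 * q 0 j + be' / 2 * q 1 j)"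
  define p' where "p' = (\<lambda>j. al / 2 * p 0 j + be / 2 * p 1 j)"
  have nsq2: "1 / 25 \<le> nsq d (\<lambda>j. u / 2 * r 0 j + v / 2 * r 1 j) \<and> nsq d (\<lambda>j. u / 2 * r 0 j + v / 2 * r 1 j) \<le> 3 / 4"
    if "direction_pair d r k" "2 / 5 \<le> \<bar>u\<bar>" "\<bar>u\<bar> \<le> 17 / 10" "v\<^sup>2 \<le> 1 / 10 ^ 4" for u v k :: real and r
  proof -
    have "nsq d (\<lambda>j. u / 2 * r 0 j + v / 2 * r 1 j) = (u / 2)\<^sup>2 * nsq d (r 0) + (v / 2)\<^sup>2 * nsq d (r 1)"
      using that(1) by (intro nsq_orthogonal_combination) (simp add: direction_pair_def)
    also have "\<dots> = u\<^sup>2 / 4 + v\<^sup>2 / 4 * k" using that(1) by (simp add: direction_pair_def power_divide)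
    finally have e: "nsq d (\<lambda>j. u / 2 * r 0 j + v / 2 * r 1 j) = u\<^sup>2 / 4 + v\<^sup>2 / 4 * k" .
    have "(2 / 5)\<^sup>2 \<le> u\<^sup>2" "u\<^sup>2 \<le> (17 / 10)\<^sup>2"
      using power_mono[OF that(2), of 2] power_mono[OF that(3), of 2] by simp_all
    then have "4 / 25 \<le> u\<^sup>2" "u\<^sup>2 \<le> 289 / 100" by (simp_all add: power2_eq_square)
    moreover have "0 \<le> v\<^sup>2 / 4 * k" "v\<^sup>2 / 4 * k \<le> v\<^sup>2 / 4"
      using that(1) by (auto simp: direction_pair_def)
    ultimately show ?thesis using that(4) unfolding e by simp
  qed
  have be2: "be\<^sup>2 \<le> 1 / 10 ^ 4" "be'\<^sup>2 \<le> 1 / 10 ^ 4"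
    using E_le zero_le_power2[of "al * al' - 1"] zero_le_power2[of be] zero_le_power2[of be'] by linarith+
  have q': "1 / 25 \<le> nsq d q'" "nsq d q' \<le> 3 / 4" "nsq d q' \<le> 1"
    using nsq2[OF q al' be2(2)] unfolding q'_def by linarith+
  have p': "1 / 25 \<le> nsq d p'" "nsq d p' \<le> 3 / 4" "nsq d p' \<le> 1"
    using nsq2[OF p al be2(1)] unfolding p'_def by linarith+
  define c where "c \<omega> i = rowf d iz q' \<omega> i * \<omega> (ie i)" for \<omega> i
  define c' where "c' \<omega> i = rowf d ix p' \<omega> i * \<omega> (ie i)" for \<omega> i
  have cm[measurable]: "(\<lambda>\<omega>. c \<omega> i) \<in> borel_measurable gauss" "(\<lambda>\<omega>. c' \<omega> i) \<in> borel_measurable gauss" for i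
    unfolding c_def c'_def by measurable
  have aq: "a \<omega> i j = 2 * rowf d iz q' \<omega> i * \<omega> (ix i j)" "a \<omega> i (d + j) = 2 * rowf d ix p' \<omega> i * \<omega> (iz i j)"
    if "j < d" for \<omega> i j
    unfolding a_def q'_def p'_def rowf_combination xs_def zs_def using that by (simp_all add: algebra_simps)
  have lin_e: "lin m (a \<omega>) (\<lambda>i. \<omega> (ie i)) j = 2 * colf m ix (c \<omega>) \<omega> j"
      "lin m (a \<omega>) (\<lambda>i. \<omega> (ie i)) (d + j) = 2 * colf m iz (c' \<omega>) \<omega> j" if "j < d" for \<omega> j
    using that by (simp_all add: lin_def colf_def c_def c'_def sum_distrib_left aq mult_ac)
  have nsq_lin: "nsq (2 * d) (lin m (a \<omega>) (\<lambda>i. \<omega> (ie i)))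
      = 4 * nsq d (colf m ix (c \<omega>) \<omega>) + 4 * nsq d (colf m iz (c' \<omega>) \<omega>)" for \<omega>
    unfolding nsq_split_2d unfolding nsq_def
    by (simp add: lin_e power_mult_distrib sum_distrib_left)
  define S where "S \<omega> i = rowf d iz q' \<omega> i * rowf d ix (colf m ix (c \<omega>) \<omega>) \<omega> i" for \<omega> i
  define S' where "S' \<omega> i = rowf d ix p' \<omega> i * rowf d iz (colf m iz (c' \<omega>) \<omega>) \<omega> i" for \<omega> i
  have app_lin: "app (2 * d) (a \<omega>) (lin m (a \<omega>) (\<lambda>i. \<omega> (ie i))) i = 4 * (S \<omega> i + S' \<omega> i)" for \<omega> i
    unfolding app_def sum_split_2d S_def S'_def rowf_def[of d ix "colf m ix (c \<omega>) \<omega>"] rowf_def[of d iz "colf m iz (c' \<omega>) \<omega>"]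
    by (simp add: aq lin_e sum_distrib_left distrib_left mult_ac)
  have nsq_app: "nsq m (app (2 * d) (a \<omega>) (lin m (a \<omega>) (\<lambda>i. \<omega> (ie i)))) \<le> 32 * nsq m (S \<omega>) + 32 * nsq m (S' \<omega>)" for \<omega>
  proof -
    have "nsq m (app (2 * d) (a \<omega>) (lin m (a \<omega>) (\<lambda>i. \<omega> (ie i)))) = 16 * nsq m (\<lambda>i. S \<omega> i + S' \<omega> i)"
      unfolding app_lin[abs_def] nsq_scale by simp
    then show ?thesis using nsq_add_le[of m "S \<omega>" "S' \<omega>"] by linarith
  qed
  define E1 where "E1 k k' l l' \<omega> \<longleftrightarrow> real m / 1000 \<le>
      \<bar>(\<Sum>i<m. xs \<omega> k i * xs \<omega> k' i * zs \<omega> l i * zs \<omega> l' i)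
        - real m * ((\<Sum>j<d. p k j * p k' j) * (\<Sum>j<d. q l j * q l' j))\<bar>" for k k' l l' \<omega>
  define E2x where "E2x k l l' \<omega> \<longleftrightarrow> 10 ^ 12 * real m * real d <
      nsq d (colf m ix (\<lambda>i. zs \<omega> l i * zs \<omega> l' i * xs \<omega> k i) \<omega>)" for k l l' \<omega>
  define E2z where "E2z l k k' \<omega> \<longleftrightarrow> 10 ^ 12 * real m * real d <
      nsq d (colf m iz (\<lambda>i. xs \<omega> k i * xs \<omega> k' i * zs \<omega> l i) \<omega>)" for k k' l \<omega>
  define G1 where "G1 \<omega> \<longleftrightarrow> \<not> (real m * real d / 30 \<le> nsq d (colf m ix (c \<omega>) \<omega>)
      \<and> nsq d (colf m ix (c \<omega>) \<omega>) \<le> real m * real d)" for \<omega>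
  define G2 where "G2 \<omega> \<longleftrightarrow> \<not> (real m * real d / 30 \<le> nsq d (colf m iz (c' \<omega>) \<omega>)
      \<and> nsq d (colf m iz (c' \<omega>) \<omega>) \<le> real m * real d)" for \<omega>
  define S1 where "S1 \<omega> \<longleftrightarrow> 10 ^ 16 * real m * (real d)\<^sup>2 < nsq m (S \<omega>)" for \<omega>
  define S2 where "S2 \<omega> \<longleftrightarrow> 10 ^ 16 * real m * (real d)\<^sup>2 < nsq m (S' \<omega>)" for \<omega>
  have "\<exists>E. {\<omega>. E \<omega>} \<in> sets gauss \<and> measure gauss {\<omega>. E \<omega>} \<le> 1 / real d ^ 22 \<and>
    (\<forall>\<omega>. \<not> E \<omega> \<longrightarrow> (\<exists>\<Delta>w \<rho>w. ridge (2 * d) m (a \<omega>) ?s (bil W (xs \<omega>) (zs \<omega>)) \<Delta>w \<rho>w \<and>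
      (\<Sum>i<m. \<rho>w i * \<omega> (ie i))\<^sup>2 \<le> 50 * ln (real d) * nsq m (bil W (xs \<omega>) (zs \<omega>))))" for W
  proof -
    have bm: "(\<lambda>\<omega>. bil W (xs \<omega>) (zs \<omega>) i) \<in> borel_measurable gauss" for i
      unfolding bil_def by measurable
    have dep: "a \<omega> = a \<omega>' \<and> bil W (xs \<omega>) (zs \<omega>) = bil W (xs \<omega>') (zs \<omega>')"
      if "\<And>\<kappa>. (\<forall>i. \<kappa> \<noteq> ie i) \<Longrightarrow> \<omega> \<kappa> = \<omega>' \<kappa>" for \<omega> \<omega>'
    proof -
      have w: "\<omega> (ix i j) = \<omega>' (ix i j)" "\<omega> (iz i j) = \<omega>' (iz i j)" for i j
        by (rule that, use disj in metis)+
      then have "xs \<omega> = xs \<omega>'" "zs \<omega> = zs \<omega>'" by (simp_all add: xs_def zs_def rowf_def)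
      moreover from this have "a \<omega> = a \<omega>'" using w by (auto simp: a_def fun_eq_iff)
      ultimately show ?thesis by simp
    qed
    show ?thesis by (rule ridge_noise_inner_bounded[OF s am bm dep, where N = "2 * d"]) blast+
  qed
  then have "\<forall>W. \<exists>E. {\<omega>. E \<omega>} \<in> sets gauss \<and> measure gauss {\<omega>. E \<omega>} \<le> 1 / real d ^ 22 \<and>
    (\<forall>\<omega>. \<not> E \<omega> \<longrightarrow> (\<exists>\<Delta>w \<rho>w. ridge (2 * d) m (a \<omega>) ?s (bil W (xs \<omega>) (zs \<omega>)) \<Delta>w \<rho>w \<and>
      (\<Sum>i<m. \<rho>w i * \<omega> (ie i))\<^sup>2 \<le> 50 * ln (real d) * nsq m (bil W (xs \<omega>) (zs \<omega>))))" ..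
  from choice[OF this] obtain N where N: "\<And>W. {\<omega>. N W \<omega>} \<in> sets gauss" "\<And>W. measure gauss {\<omega>. N W \<omega>} \<le> 1 / real d ^ 22"
    "\<And>W \<omega>. \<not> N W \<omega> \<Longrightarrow> (\<exists>\<Delta>w \<rho>w. ridge (2 * d) m (a \<omega>) ?s (bil W (xs \<omega>) (zs \<omega>)) \<Delta>w \<rho>w \<and>
      (\<Sum>i<m. \<rho>w i * \<omega> (ie i))\<^sup>2 \<le> 50 * ln (real d) * nsq m (bil W (xs \<omega>) (zs \<omega>)))"
    by blast
  define V where "V = mat2 ((al * al' - 1) * (al\<^sup>2 + al'\<^sup>2)) (be' * (al + (al * al' - 1) * al')) (be * (al' + (al * al' - 1) * al)) (2 * be * be')"
  define H where "H = mat2 al' be' 0 0"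
  define H' where "H' = mat2 al 0 be 0"
  define Es where "Es = [E1 k k' l l'. k \<leftarrow> [0..<2], k' \<leftarrow> [0..<2], l \<leftarrow> [0..<2], l' \<leftarrow> [0..<2]]
    @ [E2x k l l'. k \<leftarrow> [0..<2], l \<leftarrow> [0..<2], l' \<leftarrow> [0..<2]] @ [E2z l k k'. l \<leftarrow> [0..<2], k \<leftarrow> [0..<2], k' \<leftarrow> [0..<2]]
    @ [G1, G2, S1, S2, N V, N H, N H']"
  have Es_ball: "(\<forall>E\<in>set Es. P E) \<longleftrightarrow>
    (\<forall>k\<in>{0..<2}. \<forall>k'\<in>{0..<2}. \<forall>l\<in>{0..<2}. \<forall>l'\<in>{0..<2}. P (E1 k k' l l')) \<and>
    (\<forall>k\<in>{0..<2}. \<forall>l\<in>{0..<2}. \<forall>l'\<in>{0..<2}. P (E2x k l l')) \<and>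
    (\<forall>l\<in>{0..<2}. \<forall>k\<in>{0..<2}. \<forall>k'\<in>{0..<2}. P (E2z l k k')) \<and>
    P G1 \<and> P G2 \<and> P S1 \<and> P S2 \<and> P (N V) \<and> P (N H) \<and> P (N H')" for P
    unfolding Es_def set_append ball_Un by (simp add: set_upt)
  have len: "length Es = 39" by (simp add: Es_def upt_rec numeral_2_eq_2)
  note np = direction_pair_nsq[OF p] and nq = direction_pair_nsq[OF q]
  have d22: "0 < real d ^ 22" using d by simp
  then have up: "x \<le> 5 / real d ^ 22" if "x \<le> r / real d ^ 22" "r \<le> 5" for x r
    using that by (meson divide_right_mono less_imp_le order_trans)
  have P1: "measure gauss {\<omega>. E1 k k' l l' \<omega>} \<le> 5 / real d ^ 22" if "k < 2" "k' < 2" "l < 2" "l' < 2" for k k' l l'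
    unfolding E1_def xs_def zs_def by (rule up[OF moments_concentrate]) (use that np nq in auto)
  have P2: "measure gauss {\<omega>. E2x k l l' \<omega>} \<le> 5 / real d ^ 22" if "k < 2" "l < 2" "l' < 2" for k l l'
    unfolding E2x_def xs_def zs_def by (rule up[OF row_sums_bounded_direction[OF p]]) (use that nq in auto)
  have P3: "measure gauss {\<omega>. E2z l k k' \<omega>} \<le> 5 / real d ^ 22" if "l < 2" "k < 2" "k' < 2" for k k' l
    unfolding E2z_def xs_def zs_def by (rule up[OF sw.row_sums_bounded_direction[OF q]]) (use that np in auto)
  have P4: "measure gauss {\<omega>. G1 \<omega>} \<le> 5 / real d ^ 22"
    unfolding G1_def c_def by (rule up[OF gradient_noise_bounds]) (use q' in auto)
  have P5: "measure gauss {\<omega>. G2 \<omega>} \<le> 5 / real d ^ 22"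
    unfolding G2_def c'_def by (rule up[OF sw.gradient_noise_bounds]) (use p' in auto)
  have P6: "measure gauss {\<omega>. S1 \<omega>} \<le> 5 / real d ^ 22"
    unfolding S1_def S_def c_def by (rule noise_gram_square_bounded[OF q'(3)])
  have P7: "measure gauss {\<omega>. S2 \<omega>} \<le> 5 / real d ^ 22"
    unfolding S2_def S'_def c'_def by (rule sw.noise_gram_square_bounded[OF p'(3)])
  have P8: "measure gauss {\<omega>. N W \<omega>} \<le> 5 / real d ^ 22" for W by (rule up[OF N(2)]) simp
  have M1: "{\<omega>. E1 k k' l l' \<omega>} \<in> sets gauss" for k k' l l' unfolding E1_def by (rule gauss_setI) measurable
  have M2: "{\<omega>. E2x k l l' \<omega>} \<in> sets gauss" for k l l' unfolding E2x_def nsq_def colf_def by (rule gauss_setI) measurable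
  have M3: "{\<omega>. E2z l k k' \<omega>} \<in> sets gauss" for k l k' unfolding E2z_def nsq_def colf_def by (rule gauss_setI) measurable
  have M4: "{\<omega>. G1 \<omega>} \<in> sets gauss" unfolding G1_def nsq_def colf_def by (rule gauss_setI) measurable
  have M5: "{\<omega>. G2 \<omega>} \<in> sets gauss" unfolding G2_def nsq_def colf_def by (rule gauss_setI) measurable
  have M6: "{\<omega>. S1 \<omega>} \<in> sets gauss" unfolding S1_def S_def nsq_def colf_def rowf_def by (rule gauss_setI) measurable
  have M7: "{\<omega>. S2 \<omega>} \<in> sets gauss" unfolding S2_def S'_def nsq_def colf_def rowf_def by (rule gauss_setI) measurable
  define Good where "Good \<omega> \<longleftrightarrow> (\<exists>\<Delta>0 \<rho>0 \<Delta>e \<rho>e. batch_step d m lam \<sigma> (ln (real d))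
      (\<lambda>i j. \<omega> (ix i j)) (\<lambda>i j. \<omega> (iz i j)) (\<lambda>i. \<omega> (ie i)) p q al al' be be' ka ka' \<Delta>0 \<rho>0 \<Delta>e \<rho>e)" for \<omega>
  have good: "Good \<omega>" if no': "\<And>E. E \<in> set Es \<Longrightarrow> \<not> E \<omega>" for \<omega>
  proof -
    have no: "\<forall>E\<in>set Es. \<not> E \<omega>" using no' by blast
    note no = no[unfolded Es_ball]
    define R where "R = mat2 (al * al' - 1) (al * be') (al' * be) (be * be')"
    have H1: "\<bar>(\<Sum>i<m. xs \<omega> k i * xs \<omega> k' i * zs \<omega> l i * zs \<omega> l' i) - real m * (mat2 1 0 0 ka k k' * mat2 1 0 0 ka' l l')\<bar> \<le> real m / 1000"
      if "k < 2" "k' < 2" "l < 2" "l' < 2" for k k' l l'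
    proof -
      have "\<not> E1 k k' l l' \<omega>" using no that by simp
      then show ?thesis
        using direction_pair_inner[OF p that(1,2)] direction_pair_inner[OF q that(3,4)] by (simp add: E1_def)
    qed
    have H2x: "nsq d (\<lambda>j. \<Sum>i<m. zs \<omega> l i * zs \<omega> l' i * xs \<omega> k i * \<omega> (ix i j)) \<le> 10 ^ 12 * real m * real d"
      if "k < 2" "l < 2" "l' < 2" for k l l'
    proof -
      have "\<not> E2x k l l' \<omega>" using no that by simp
      then show ?thesis by (simp add: E2x_def colf_def[abs_def])
    qed
    have H2z: "nsq d (\<lambda>j. \<Sum>i<m. xs \<omega> k i * xs \<omega> k' i * zs \<omega> l i * \<omega> (iz i j)) \<le> 10 ^ 12 * real m * real d"
      if "l < 2" "k < 2" "k' < 2" for k k' l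
    proof -
      have "\<not> E2z l k k' \<omega>" using no that by simp
      then show ?thesis by (simp add: E2z_def colf_def[abs_def])
    qed
    have ng: "\<not> G1 \<omega>" "\<not> G2 \<omega>" "\<not> S1 \<omega>" "\<not> S2 \<omega>" "\<not> N V \<omega>" "\<not> N H \<omega>" "\<not> N H' \<omega>"
      using no by blast+
    have md: "0 \<le> real m * real d" by simp
    have H3: "(1 / 10) * real m * real d \<le> nsq (2 * d) (lin m (a \<omega>) (\<lambda>i. \<omega> (ie i)))"
      "nsq (2 * d) (lin m (a \<omega>) (\<lambda>i. \<omega> (ie i))) \<le> 10 * real m * real d"
      using ng(1,2) md unfolding nsq_lin G1_def G2_def not_not mult.assoc by - linarith+
    have H4: "nsq m (app (2 * d) (a \<omega>) (lin m (a \<omega>) (\<lambda>i. \<omega> (ie i)))) \<le> 10 ^ 18 * real m * (real d)\<^sup>2"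
    proof -
      define y where "y = real m * (real d)\<^sup>2"
      have "nsq m (S \<omega>) \<le> 10 ^ 16 * y" "nsq m (S' \<omega>) \<le> 10 ^ 16 * y"
        using ng(3,4) by (simp_all add: S1_def S2_def y_def mult.assoc not_less)
      moreover have "0 \<le> y" by (simp add: y_def)
      ultimately have "nsq m (app (2 * d) (a \<omega>) (lin m (a \<omega>) (\<lambda>i. \<omega> (ie i)))) \<le> 10 ^ 18 * y"
        using nsq_app[of \<omega>] by simp
      then show ?thesis by (simp add: y_def mult.assoc)
    qed
    have H5: "\<exists>\<Delta>w \<rho>w. ridge (2 * d) m (a \<omega>) ?s (bil W (xs \<omega>) (zs \<omega>)) \<Delta>w \<rho>w \<and>
        (\<Sum>i<m. \<rho>w i * \<omega> (ie i))\<^sup>2 \<le> 50 * ln (real d) * nsq m (bil W (xs \<omega>) (zs \<omega>))" if "W \<in> {V, H, H'}" for W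
      using that N(3) ng(5-7) by blast
    obtain \<Delta>0 \<rho>0 where r0: "ridge (2 * d) m (a \<omega>) ?s (\<lambda>i. - bil R (xs \<omega>) (zs \<omega>) i) \<Delta>0 \<rho>0"
      using ridge_by_inverse[OF s, of m "2 * d" "\<lambda>i. vec (2 * d) (a \<omega> i)" "a \<omega>"] by auto
    obtain \<Delta>e \<rho>e where re: "ridge (2 * d) m (a \<omega>) ?s (\<lambda>i. \<omega> (ie i)) \<Delta>e \<rho>e"
      using ridge_by_inverse[OF s, of m "2 * d" "\<lambda>i. vec (2 * d) (a \<omega> i)" "a \<omega>"] by auto
    have kas: "0 \<le> ka" "ka \<le> 1" "0 \<le> ka'" "ka' \<le> 1" using p q by (auto simp: direction_pair_def)
    have L0: "0 \<le> ln (real d)" and d0: "0 < d" using L d by auto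
    have "batch_step d m lam \<sigma> (ln (real d)) (\<lambda>i j. \<omega> (ix i j)) (\<lambda>i j. \<omega> (iz i j)) (\<lambda>i. \<omega> (ie i))
        p q al al' be be' ka ka' \<Delta>0 \<rho>0 \<Delta>e \<rho>e"
      unfolding batch_step_def
      apply (intro conjI allI impI)
      apply (fact m \<sigma> L0 sd d0 d(2) noise_le al al' E_le kas ka)+
      apply (rule H1[unfolded xs_def zs_def rowf_def]; assumption)
      apply (rule H2x[unfolded xs_def zs_def rowf_def]; assumption)
      apply (rule H2z[unfolded xs_def zs_def rowf_def]; assumption)
      apply (rule H3[unfolded a_def xs_def zs_def rowf_def])+
      apply (rule H4[unfolded a_def xs_def zs_def rowf_def])
      apply (rule H5[unfolded V_def H_def H'_def a_def xs_def zs_def rowf_def], assumption)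
      apply (rule r0[unfolded R_def a_def xs_def zs_def rowf_def])
      apply (rule re[unfolded a_def xs_def zs_def rowf_def])
      done
    then show ?thesis unfolding Good_def by blast
  qed
  have "measure gauss {\<omega>. Bad \<omega>} \<le> real (length Es) * (5 / real d ^ 22)"
  proof (rule gauss_prob_list)
    show "\<exists>E\<in>set Es. E \<omega>" if "Bad \<omega>" for \<omega> using good[of \<omega>] Bad[of \<omega>] that unfolding Good_def by blast
    have "\<forall>E\<in>set Es. {\<omega>. E \<omega>} \<in> sets gauss" unfolding Es_ball using M1 M2 M3 M4 M5 M6 M7 N(1) by blast
    then show "{\<omega>. E \<omega>} \<in> sets gauss" if "E \<in> set Es" for E using that by blast
    have "\<forall>E\<in>set Es. measure gauss {\<omega>. E \<omega>} \<le> 5 / real d ^ 22" unfolding Es_ball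
      using P1 P2 P3 P4 P5 P6 P7 P8 by simp
    then show "measure gauss {\<omega>. E \<omega>} \<le> 5 / real d ^ 22" if "E \<in> set Es" for E using that by blast
  qed
  also have "\<dots> \<le> 1 / real d ^ 18"
  proof -
    have "195 * 1 \<le> (1000 :: real) ^ 4" by simp
    also have "\<dots> \<le> real d ^ 4" using d by (intro power_mono) auto
    finally have "195 * real d ^ 18 \<le> real d ^ 4 * real d ^ 18" by (intro mult_right_mono) auto
    then have "195 * real d ^ 18 \<le> real d ^ 22" by (simp add: power_add[symmetric])
    then show ?thesis using d by (simp add: len divide_simps)
  qed
  finally show ?thesis .
qed

end

section \<open>One step of the iteration\<close>

text \<open>The region in which one step is controlled. A small error pins down only the product \<open>\<alpha> \<alpha>'\<close>, so the two factors are
constrained separately.\<close>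

definition near_truth :: "real vec \<Rightarrow> real vec \<Rightarrow> real vec \<times> real vec \<Rightarrow> bool" where
  "near_truth \<mu>s \<nu>s w \<longleftrightarrow> 2 / 5 \<le> \<bar>fst w \<bullet> \<mu>s\<bar> \<and> \<bar>fst w \<bullet> \<mu>s\<bar> \<le> 17 / 10 \<and>
    2 / 5 \<le> \<bar>snd w \<bullet> \<nu>s\<bar> \<and> \<bar>snd w \<bullet> \<nu>s\<bar> \<le> 17 / 10 \<and> Err \<mu>s \<nu>s w \<le> 1 / 10 ^ 4"

text \<open>What a good batch gives: the two-sided recursion for the error and the size of the movement of \<open>\<alpha>\<close> and \<open>\<alpha>'\<close>.\<close>

definition step_progress ::
  "nat \<Rightarrow> nat \<Rightarrow> real \<Rightarrow> real \<Rightarrow> real vec \<Rightarrow> real vec \<Rightarrow> real vec \<times> real vec \<Rightarrow> real vec \<times> real vec \<Rightarrow> bool" where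
  "step_progress d m lam \<sigma> \<mu>s \<nu>s w w' \<longleftrightarrow>
    Err \<mu>s \<nu>s w' \<le> (1 - (1 / 10) / lam) * Err \<mu>s \<nu>s w + 20 * \<sigma>\<^sup>2 * real d / (lam\<^sup>2 * real m)
        + 2 * 10 ^ 6 * (\<sigma>\<^sup>2 * ln (real d) / real m) / lam \<and>
    (1 - 14 / lam) * Err \<mu>s \<nu>s w + (1 / 80) * \<sigma>\<^sup>2 * real d / (lam\<^sup>2 * real m)
        - 2 * 10 ^ 6 * (\<sigma>\<^sup>2 * ln (real d) / real m) / lam \<le> Err \<mu>s \<nu>s w' \<and>
    lam\<^sup>2 * (fst w' \<bullet> \<mu>s - fst w \<bullet> \<mu>s)\<^sup>2 \<le> 1536 * Err \<mu>s \<nu>s w + 2400 * (\<sigma>\<^sup>2 * ln (real d) / real m) \<and>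
    lam\<^sup>2 * (snd w' \<bullet> \<nu>s - snd w \<bullet> \<nu>s)\<^sup>2 \<le> 1536 * Err \<mu>s \<nu>s w + 2400 * (\<sigma>\<^sup>2 * ln (real d) / real m)"

lemma ridge_cong:
  assumes "ridge N m a s r \<Delta> \<rho>"
    and "\<And>i j. i < m \<Longrightarrow> j < N \<Longrightarrow> a' i j = a i j" "\<And>i. i < m \<Longrightarrow> r' i = r i"
  shows "ridge N m a' s r' \<Delta> \<rho>"
  using assms by (auto simp: ridge_def lin_def app_def)

lemma orthogonal_decomposition:
  assumes v: "v \<in> carrier_vec d" and u: "u \<in> carrier_vec d" "l2norm u = 1"
  obtains p ka be where "direction_pair d p ka" "be = 0 \<or> ka = 1" "\<And>j. p 0 j = u $ j"
    "\<And>j. j < d \<Longrightarrow> v $ j = (v \<bullet> u) * p 0 j + be * p 1 j" "v \<bullet> v = (v \<bullet> u)\<^sup>2 + be\<^sup>2"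
proof -
  define al where "al = v \<bullet> u"
  define r where "r j = v $ j - al * u $ j" for j
  define be where "be = sqrt (nsq d r)"
  define p where "p k j = (if k = (0 :: nat) then u $ j else if be = 0 then 0 else r j / be)" for k j
  define ka where "ka = (if be = 0 then 0 else 1 :: real)"
  have be2: "be\<^sup>2 = nsq d r" by (simp add: be_def)
  have uu: "(\<Sum>j<d. (u $ j)\<^sup>2) = 1"
    using u scalar_prod_sum[OF u(1) u(1)] by (simp add: l2norm_def power2_eq_square)
  have vu: "(\<Sum>j<d. u $ j * v $ j) = al" unfolding al_def scalar_prod_sum[OF v u(1)] by (simp add: mult.commute)
  have ur: "(\<Sum>j<d. u $ j * r j) = 0"
  proof -
    have "(\<Sum>j<d. u $ j * r j) = (\<Sum>j<d. u $ j * v $ j - al * (u $ j)\<^sup>2)"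
      by (intro sum.cong refl) (simp add: r_def power2_eq_square algebra_simps)
    then show ?thesis by (simp add: sum_subtractf vu sum_distrib_left[symmetric] uu)
  qed
  have vv: "v \<bullet> v = al\<^sup>2 + be\<^sup>2"
  proof -
    have "v \<bullet> v = (\<Sum>j<d. (r j)\<^sup>2 + 2 * al * (u $ j * r j) + al\<^sup>2 * (u $ j)\<^sup>2)"
      unfolding scalar_prod_sum[OF v v] by (intro sum.cong refl) (simp add: r_def power2_eq_square algebra_simps)
    then show ?thesis by (simp add: sum.distrib sum_distrib_left[symmetric] ur uu be2 nsq_def)
  qed
  have r0: "r j = be * p 1 j" if "j < d" for j
    using nsq_eq_0[of d r j] that be2 by (cases "be = 0") (simp_all add: p_def)
  show ?thesis
  proof (rule that)
    have "nsq d (p 1) = ka"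
    proof (cases "be = 0")
      case False
      have "p 1 = (\<lambda>j. (1 / be) * r j)" using False by (simp add: p_def fun_eq_iff)
      then have "nsq d (p 1) = (1 / be)\<^sup>2 * be\<^sup>2" using nsq_scale[of d "1 / be" r] be2 by simp
      then show ?thesis using False by (simp add: ka_def power_divide)
    qed (simp add: p_def ka_def nsq_def)
    moreover have "(\<Sum>j<d. p 0 j * p 1 j) = 0"
    proof (cases "be = 0")
      case False
      have "(\<Sum>j<d. p 0 j * p 1 j) = (\<Sum>j<d. u $ j * r j) / be"
        unfolding sum_divide_distrib using False by (simp add: p_def)
      then show ?thesis using ur by simp
    qed (simp add: p_def)
    ultimately show "direction_pair d p ka" using uu by (simp add: direction_pair_def nsq_def p_def ka_def)
    show "be = 0 \<or> ka = 1" by (simp add: ka_def)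
    show "p 0 j = u $ j" for j by (simp add: p_def)
    show "v $ j = (v \<bullet> u) * p 0 j + be * p 1 j" if "j < d" for j
      using r0[OF that] by (simp add: r_def p_def al_def)
    show "v \<bullet> v = (v \<bullet> u)\<^sup>2 + be\<^sup>2" using vv by (simp add: al_def)
  qed
qed

lemma shifted_vector:
  assumes "\<mu> \<in> carrier_vec d" "\<mu>' \<in> carrier_vec d" "\<mu>s \<in> carrier_vec d"
    and step: "\<And>j. j < d \<Longrightarrow> \<mu>' $ j = \<mu> $ j + \<Delta> j" and ps: "\<And>j. p 0 j = \<mu>s $ j"
    and dec: "\<And>j. j < d \<Longrightarrow> \<mu> $ j = al * p 0 j + be * p 1 j" and sq: "\<mu> \<bullet> \<mu> = al\<^sup>2 + be\<^sup>2" and al: "al = \<mu> \<bullet> \<mu>s"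
  defines "D \<equiv> (\<lambda>k :: nat. \<Sum>j<d. p k j * \<Delta> j)"
  shows "\<mu>' \<bullet> \<mu>s = al + D 0" "\<mu>' \<bullet> \<mu>' - (\<mu>' \<bullet> \<mu>s)\<^sup>2 = be\<^sup>2 + 2 * be * D 1 + nsq d \<Delta> - (D 0)\<^sup>2"
proof -
  have "\<mu>' \<bullet> \<mu>s = (\<Sum>j<d. \<mu> $ j * \<mu>s $ j + p 0 j * \<Delta> j)"
    unfolding scalar_prod_sum[OF assms(2,3)] by (intro sum.cong refl) (simp add: step ps algebra_simps)
  then show 1: "\<mu>' \<bullet> \<mu>s = al + D 0" unfolding al scalar_prod_sum[OF assms(1,3)] D_def by (simp add: sum.distrib)
  have "\<mu>' \<bullet> \<mu>' = (\<Sum>j<d. \<mu> $ j * \<mu> $ j + (2 * al * (p 0 j * \<Delta> j) + 2 * be * (p 1 j * \<Delta> j)) + (\<Delta> j)\<^sup>2)"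
    unfolding scalar_prod_sum[OF assms(2,2)]
  proof (intro sum.cong refl)
    fix j assume "j \<in> {..<d}"
    then have j: "j < d" by simp
    have "\<mu>' $ j * \<mu>' $ j = \<mu> $ j * \<mu> $ j + 2 * (al * p 0 j + be * p 1 j) * \<Delta> j + (\<Delta> j)\<^sup>2"
      unfolding step[OF j] dec[OF j, symmetric] by (simp add: power2_eq_square algebra_simps)
    then show "\<mu>' $ j * \<mu>' $ j = \<mu> $ j * \<mu> $ j + (2 * al * (p 0 j * \<Delta> j) + 2 * be * (p 1 j * \<Delta> j)) + (\<Delta> j)\<^sup>2"
      by (simp add: algebra_simps)
  qed
  then have "\<mu>' \<bullet> \<mu>' = (al\<^sup>2 + be\<^sup>2) + (2 * al * D 0 + 2 * be * D 1) + nsq d \<Delta>"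
    unfolding sq[symmetric] scalar_prod_sum[OF assms(1,1)] D_def nsq_def by (simp add: sum.distrib sum_distrib_left)
  then show "\<mu>' \<bullet> \<mu>' - (\<mu>' \<bullet> \<mu>s)\<^sup>2 = be\<^sup>2 + 2 * be * D 1 + nsq d \<Delta> - (D 0)\<^sup>2"
    unfolding 1 by (simp add: power2_eq_square algebra_simps)
qed

lemma batch_step_progress:
  assumes bs: "batch_step d m lam \<sigma> (ln (real d)) xf zf e p q (\<mu> \<bullet> \<mu>s) (\<nu> \<bullet> \<nu>s) be be' ka ka' \<Delta>0 \<rho>0 \<Delta>e \<rho>e"
    and c: "\<mu> \<in> carrier_vec d" "\<nu> \<in> carrier_vec d" "\<mu>s \<in> carrier_vec d" "\<nu>s \<in> carrier_vec d"
    and unit: "l2norm \<mu>s = 1" "l2norm \<nu>s = 1"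
    and x: "\<And>i. x i \<in> carrier_vec d" "\<And>i j. j < d \<Longrightarrow> x i $ j = xf i j"
    and z: "\<And>i. z i \<in> carrier_vec d" "\<And>i j. j < d \<Longrightarrow> z i $ j = zf i j"
    and y: "\<And>i. y i = (x i \<bullet> \<mu>s) * (z i \<bullet> \<nu>s) + \<sigma> * e i"
    and p: "\<And>j. p 0 j = \<mu>s $ j" "\<And>j. j < d \<Longrightarrow> \<mu> $ j = (\<mu> \<bullet> \<mu>s) * p 0 j + be * p 1 j" "\<mu> \<bullet> \<mu> = (\<mu> \<bullet> \<mu>s)\<^sup>2 + be\<^sup>2"
    and q: "\<And>j. q 0 j = \<nu>s $ j" "\<And>j. j < d \<Longrightarrow> \<nu> $ j = (\<nu> \<bullet> \<nu>s) * q 0 j + be' * q 1 j" "\<nu> \<bullet> \<nu> = (\<nu> \<bullet> \<nu>s)\<^sup>2 + be'\<^sup>2"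
  shows "step_progress d m lam \<sigma> \<mu>s \<nu>s (\<mu>, \<nu>) (prox_linear_step d m lam x z y (\<mu>, \<nu>))"
proof -
  define al where "al = \<mu> \<bullet> \<mu>s"
  define al' where "al' = \<nu> \<bullet> \<nu>s"
  note bs = bs[folded al_def al'_def] and p = p[folded al_def] and q = q[folded al'_def]
  define \<Delta> where "\<Delta> = batch_step.\<Delta> \<sigma> \<Delta>0 \<Delta>e"
  define xs where "xs k i = (\<Sum>j<d. p k j * xf i j)" for k i
  define zs where "zs l i = (\<Sum>j<d. q l j * zf i j)" for l i
  have s: "0 < lam * real m" by (rule batch_step.s_pos[OF bs])
  have x0: "x i \<bullet> \<mu>s = xs 0 i" for i
    unfolding scalar_prod_sum[OF x(1) c(3)] xs_def by (intro sum.cong refl) (simp add: x(2) p(1) mult.commute)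
  have z0: "z i \<bullet> \<nu>s = zs 0 i" for i
    unfolding scalar_prod_sum[OF z(1) c(4)] zs_def by (intro sum.cong refl) (simp add: z(2) q(1) mult.commute)
  have xm: "x i \<bullet> \<mu> = al * xs 0 i + be * xs 1 i" for i
    unfolding scalar_prod_sum[OF x(1) c(1)] xs_def sum_distrib_left sum.distrib[symmetric]
    by (intro sum.cong refl) (simp add: x(2) p(2) algebra_simps)
  have zm: "z i \<bullet> \<nu> = al' * zs 0 i + be' * zs 1 i" for i
    unfolding scalar_prod_sum[OF z(1) c(2)] zs_def sum_distrib_left sum.distrib[symmetric]
    by (intro sum.cong refl) (simp add: z(2) q(2) algebra_simps)
  note T = batch_step.ridge_total[OF bs, folded xs_def zs_def, folded \<Delta>_def]
  have R: "ridge (2 * d) m (design d (\<lambda>i. z i \<bullet> \<nu>) (\<lambda>i. x i \<bullet> \<mu>) (\<lambda>i j. x i $ j) (\<lambda>i j. z i $ j)) (lam * real m)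
      (\<lambda>i. y i - (x i \<bullet> \<mu>) * (z i \<bullet> \<nu>)) \<Delta> (batch_step.\<rho> \<sigma> \<rho>0 \<rho>e)"
  proof (rule ridge_cong[OF T])
    fix i j assume "i < m" "j < 2 * d"
    then show "design d (\<lambda>i. z i \<bullet> \<nu>) (\<lambda>i. x i \<bullet> \<mu>) (\<lambda>i j. x i $ j) (\<lambda>i j. z i $ j) i j =
      (if j < d then (al' * zs 0 i + be' * zs 1 i) * xf i j else (al * xs 0 i + be * xs 1 i) * zf i (j - d))"
      by (simp add: design_def xm zm x(2) z(2))
  next
    fix i assume "i < m"
    show "y i - (x i \<bullet> \<mu>) * (z i \<bullet> \<nu>)
      = - bil (mat2 (al * al' - 1) (al * be') (al' * be) (be * be')) xs zs i + \<sigma> * e i"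
      unfolding y x0 z0 xm zm by (simp add: bil_def mat2_def numeral_2_eq_2 algebra_simps)
  qed
  obtain \<mu>' \<nu>' where st: "prox_linear_step d m lam x z y (\<mu>, \<nu>) = (\<mu>', \<nu>')"
    and c': "\<mu>' \<in> carrier_vec d" "\<nu>' \<in> carrier_vec d"
    and j': "\<And>j. j < d \<Longrightarrow> \<mu>' $ j = \<mu> $ j + \<Delta> j" "\<And>j. j < d \<Longrightarrow> \<nu>' $ j = \<nu> $ j + \<Delta> (d + j)"
    using prox_linear_step_ridge[OF x(1) z(1) c(1,2) s R] by blast
  define D where "D k = (\<Sum>j<d. p k j * \<Delta> j)" for k
  define D' where "D' k = (\<Sum>j<d. q k j * \<Delta> (d + j))" for k
  have X: "\<mu>' \<bullet> \<mu>s = al + D 0" "\<mu>' \<bullet> \<mu>' - (\<mu>' \<bullet> \<mu>s)\<^sup>2 = be\<^sup>2 + 2 * be * D 1 + nsq d \<Delta> - (D 0)\<^sup>2"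
    unfolding D_def by (rule shifted_vector[OF c(1) c'(1) c(3) j'(1) p(1,2,3) al_def]; assumption)+
  have Z: "\<nu>' \<bullet> \<nu>s = al' + D' 0"
    "\<nu>' \<bullet> \<nu>' - (\<nu>' \<bullet> \<nu>s)\<^sup>2 = be'\<^sup>2 + 2 * be' * D' 1 + nsq d (\<lambda>j. \<Delta> (d + j)) - (D' 0)\<^sup>2"
    unfolding D'_def by (rule shifted_vector[OF c(2) c'(2) c(4) j'(2) q(1,2,3) al'_def]; assumption)+
  have dx: "batch_step.dx d \<sigma> p \<Delta>0 \<Delta>e k = D k" for k by (simp add: batch_step.dx_def[OF bs] D_def \<Delta>_def)
  have dz: "batch_step.dz d \<sigma> q \<Delta>0 \<Delta>e k = D' k" for k by (simp add: batch_step.dz_def[OF bs] D'_def \<Delta>_def)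
  have E: "Err \<mu>s \<nu>s (\<mu>, \<nu>) = (al * al' - 1)\<^sup>2 + be\<^sup>2 + be'\<^sup>2"
    unfolding Err_formula[OF c unit] p(3) q(3) al_def[symmetric] al'_def[symmetric] by simp
  have E': "Err \<mu>s \<nu>s (\<mu>', \<nu>') = ((al + D 0) * (al' + D' 0) - 1)\<^sup>2 + (be\<^sup>2 + 2 * be * D 1 + nsq d \<Delta> - (D 0)\<^sup>2)
      + (be'\<^sup>2 + 2 * be' * D' 1 + nsq d (\<lambda>j. \<Delta> (d + j)) - (D' 0)\<^sup>2)"
    unfolding Err_formula[OF c' c(3,4) unit] X(2) Z(2) unfolding X(1) Z(1) ..
  have eta: "batch_step.\<eta> m \<sigma> (ln (real d)) = \<sigma>\<^sup>2 * ln (real d) / real m" by (rule batch_step.\<eta>_def[OF bs])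
  show ?thesis
    unfolding step_progress_def st fst_conv snd_conv
    using batch_step.err_step[OF bs, folded \<Delta>_def, unfolded dx dz eta, folded E E']
      batch_step.shift_small[OF bs, unfolded dx dz eta, folded E]
    unfolding X(1) Z(1) al_def[symmetric] al'_def[symmetric] by simp
qed

primrec scale_noise :: "real \<Rightarrow> (noise_index \<Rightarrow> real) \<Rightarrow> noise_index \<Rightarrow> real" where
  "scale_noise \<sigma> \<omega> (X t i j) = \<omega> (X t i j)"
| "scale_noise \<sigma> \<omega> (Z t i j) = \<omega> (Z t i j)"
| "scale_noise \<sigma> \<omega> (Eps t i) = \<sigma> * \<omega> (Eps t i)"

lemma step_progress_probability:
  assumes reg: "regime m d" and \<sigma>: "0 \<le> \<sigma>" and sd: "10 ^ 30 * real d \<le> lam * real m"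
    and noise_le: "\<sigma>\<^sup>2 * ln (real d) \<le> lam * real m"
    and w: "fst w \<in> carrier_vec d" "snd w \<in> carrier_vec d" and c: "\<mu>s \<in> carrier_vec d" "\<nu>s \<in> carrier_vec d"
    and unit: "l2norm \<mu>s = 1" "l2norm \<nu>s = 1" and near: "near_truth \<mu>s \<nu>s w"
  shows "measure gauss {\<omega>. \<not> step_progress d m lam \<sigma> \<mu>s \<nu>s w (prox_linear_step d m lam
      (batch_x d (scale_noise \<sigma> \<omega>) t) (batch_z d (scale_noise \<sigma> \<omega>) t) (batch_y d \<mu>s \<nu>s (scale_noise \<sigma> \<omega>) t) w)} \<le> 1 / real d ^ 18"
proof -
  interpret A: arrays "X t" "Z t" "Eps t" "Eps (Suc t)" d m
    using reg by unfold_locales auto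
  obtain \<mu> \<nu> where w_eq: "w = (\<mu>, \<nu>)" by (cases w)
  note c' = w[unfolded w_eq fst_conv snd_conv]
  obtain p ka be where p: "direction_pair d p ka" "be = 0 \<or> ka = 1" "\<And>j. p 0 j = \<mu>s $ j"
    "\<And>j. j < d \<Longrightarrow> \<mu> $ j = (\<mu> \<bullet> \<mu>s) * p 0 j + be * p 1 j" "\<mu> \<bullet> \<mu> = (\<mu> \<bullet> \<mu>s)\<^sup>2 + be\<^sup>2"
    using orthogonal_decomposition[OF c'(1) c(1) unit(1)] by blast
  obtain q ka' be' where q: "direction_pair d q ka'" "be' = 0 \<or> ka' = 1" "\<And>j. q 0 j = \<nu>s $ j"
    "\<And>j. j < d \<Longrightarrow> \<nu> $ j = (\<nu> \<bullet> \<nu>s) * q 0 j + be' * q 1 j" "\<nu> \<bullet> \<nu> = (\<nu> \<bullet> \<nu>s)\<^sup>2 + be'\<^sup>2"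
    using orthogonal_decomposition[OF c'(2) c(2) unit(2)] by blast
  have near': "2 / 5 \<le> \<bar>\<mu> \<bullet> \<mu>s\<bar>" "\<bar>\<mu> \<bullet> \<mu>s\<bar> \<le> 17 / 10" "2 / 5 \<le> \<bar>\<nu> \<bullet> \<nu>s\<bar>" "\<bar>\<nu> \<bullet> \<nu>s\<bar> \<le> 17 / 10"
    "Err \<mu>s \<nu>s (\<mu>, \<nu>) \<le> 1 / 10 ^ 4"
    using near by (simp_all add: near_truth_def w_eq)
  have E: "((\<mu> \<bullet> \<mu>s) * (\<nu> \<bullet> \<nu>s) - 1)\<^sup>2 + be\<^sup>2 + be'\<^sup>2 \<le> 1 / 10 ^ 4"
    using near'(5) unfolding Err_formula[OF c' c unit] p(5) q(5) by simp
  show ?thesis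
  proof (rule A.batch_step_probability[OF p(1) q(1) \<sigma> sd noise_le near'(1-4) E p(2) q(2)])
    fix \<omega> \<Delta>0 \<rho>0 \<Delta>e \<rho>e
    assume bs: "batch_step d m lam \<sigma> (ln (real d)) (\<lambda>i j. \<omega> (X t i j)) (\<lambda>i j. \<omega> (Z t i j))
      (\<lambda>i. \<omega> (Eps t i)) p q (\<mu> \<bullet> \<mu>s) (\<nu> \<bullet> \<nu>s) be be' ka ka' \<Delta>0 \<rho>0 \<Delta>e \<rho>e"
    have "step_progress d m lam \<sigma> \<mu>s \<nu>s (\<mu>, \<nu>) (prox_linear_step d m lam
      (batch_x d (scale_noise \<sigma> \<omega>) t) (batch_z d (scale_noise \<sigma> \<omega>) t) (batch_y d \<mu>s \<nu>s (scale_noise \<sigma> \<omega>) t) (\<mu>, \<nu>))"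
    proof (rule batch_step_progress[OF bs c' c unit])
      show "batch_x d (scale_noise \<sigma> \<omega>) t i \<in> carrier_vec d" "batch_z d (scale_noise \<sigma> \<omega>) t i \<in> carrier_vec d" for i
        by (rule batch_carrier)+
      show "batch_x d (scale_noise \<sigma> \<omega>) t i $ j = \<omega> (X t i j)" "batch_z d (scale_noise \<sigma> \<omega>) t i $ j = \<omega> (Z t i j)"
        if "j < d" for i j using that by (simp_all add: batch_x_def batch_z_def)
      show "batch_y d \<mu>s \<nu>s (scale_noise \<sigma> \<omega>) t i = (batch_x d (scale_noise \<sigma> \<omega>) t i \<bullet> \<mu>s)
          * (batch_z d (scale_noise \<sigma> \<omega>) t i \<bullet> \<nu>s) + \<sigma> * \<omega> (Eps t i)" for i
        by (simp add: batch_y_def)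
    qed (use p q in auto)
    then show "\<not> \<not> step_progress d m lam \<sigma> \<mu>s \<nu>s w (prox_linear_step d m lam
      (batch_x d (scale_noise \<sigma> \<omega>) t) (batch_z d (scale_noise \<sigma> \<omega>) t) (batch_y d \<mu>s \<nu>s (scale_noise \<sigma> \<omega>) t) w)"
      by (simp add: w_eq)
  qed
qed

section \<open>Iterates stay near the truth\<close>

text \<open>As long as the state is in the region, the error is at most \<open>q\<^sup>2\<^sup>t / 10\<^sup>1\<^sup>0 + 10 \<phi>\<close> with
\<open>q = 1 - 1 / (20 \<lambda>)\<close>, so that one step moves \<open>a\<close> and \<open>b\<close> by at most \<open>(4 q\<^sup>t / 10\<^sup>4 + 130 \<surd>\<phi>) / \<lambda>\<close>. Summing these up
gives the total drift \<open>g t\<close> below, which stays under \<open>1 / 100\<close>, so the region is not left.\<close>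

lemma stays_near:
  fixes E a b :: "nat \<Rightarrow> real" and lam \<phi> :: real
  assumes lam: "1 \<le> lam" and \<phi>: "0 \<le> \<phi>" "\<phi> \<le> 1 / 10 ^ 6" and T: "real T * sqrt \<phi> \<le> lam / 10 ^ 5"
    and E0: "E 0 \<le> 1 / 10 ^ 10"
    and a0: "49 / 100 \<le> \<bar>a 0\<bar>" "\<bar>a 0\<bar> \<le> 3 / 2" and b0: "49 / 100 \<le> \<bar>b 0\<bar>" "\<bar>b 0\<bar> \<le> 3 / 2"
    and step: "\<And>t. t < T \<Longrightarrow> 2 / 5 \<le> \<bar>a t\<bar> \<Longrightarrow> \<bar>a t\<bar> \<le> 17 / 10 \<Longrightarrow> 2 / 5 \<le> \<bar>b t\<bar> \<Longrightarrow> \<bar>b t\<bar> \<le> 17 / 10 \<Longrightarrow> E t \<le> 1 / 10 ^ 4 \<Longrightarrow>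
      E (Suc t) \<le> (1 - (1 / 10) / lam) * E t + \<phi> / lam \<and>
      lam\<^sup>2 * (a (Suc t) - a t)\<^sup>2 \<le> 1536 * E t + \<phi> \<and> lam\<^sup>2 * (b (Suc t) - b t)\<^sup>2 \<le> 1536 * E t + \<phi>"
    and t: "t \<le> T"
  shows "2 / 5 \<le> \<bar>a t\<bar> \<and> \<bar>a t\<bar> \<le> 17 / 10 \<and> 2 / 5 \<le> \<bar>b t\<bar> \<and> \<bar>b t\<bar> \<le> 17 / 10 \<and> E t \<le> 1 / 10 ^ 4"
proof -
  define q where "q = 1 - (1 / 20) / lam"
  have q: "0 \<le> q" "q \<le> 1" using lam by (simp_all add: q_def divide_simps)
  have q2: "1 - (1 / 10) / lam \<le> q\<^sup>2" using lam by (simp add: q_def power2_eq_square algebra_simps)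
  \<comment> \<open>The telescoping part: \<open>q\<^sup>t - q\<^sup>t\<^sup>+\<^sup>1 = q\<^sup>t / (20 \<lambda>)\<close>, and \<open>4 / 10\<^sup>4 \<cdot> 20 = 8 / 1000\<close>.\<close>
  define g where "g t = (8 / 1000) * (1 - q ^ t) + 130 * (real t * sqrt \<phi> / lam)" for t
  have g_small: "g t \<le> 1 / 100" if "t \<le> T" for t
  proof -
    have "real t * sqrt \<phi> \<le> real T * sqrt \<phi>" using that \<phi> by (intro mult_right_mono) auto
    then have "real t * sqrt \<phi> / lam \<le> 1 / 100000" using T lam by (simp add: divide_simps)
    moreover have "0 \<le> q ^ t" using q by simp
    ultimately show ?thesis unfolding g_def by (simp only: right_diff_distrib)
  qed
  have near: "2 / 5 \<le> \<bar>u\<bar> \<and> \<bar>u\<bar> \<le> 17 / 10" if "\<bar>u - u0\<bar> \<le> g t" "t \<le> T" "49 / 100 \<le> \<bar>u0\<bar>" "\<bar>u0\<bar> \<le> 3 / 2" for u u0 t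
    using that g_small[OF that(2)] by linarith
  have E_small: "e \<le> 1 / 10 ^ 4" if "e \<le> (q ^ t)\<^sup>2 / 10 ^ 10 + 10 * \<phi>" for e t
  proof -
    have "q ^ t \<le> 1" "0 \<le> q ^ t" using q by (simp_all add: power_le_one)
    then have "(q ^ t)\<^sup>2 \<le> 1" by (simp add: power_le_one)
    then show ?thesis using that \<phi> by simp
  qed
  have drift: "\<bar>u' - u0\<bar> \<le> g (Suc t)"
    if u: "\<bar>u - u0\<bar> \<le> g t" and e: "e \<le> (q ^ t)\<^sup>2 / 10 ^ 10 + 10 * \<phi>" and st: "lam\<^sup>2 * (u' - u)\<^sup>2 \<le> 1536 * e + \<phi>" for u u' u0 e t
  proof -
    define Y where "Y = (4 / 10 ^ 4) * q ^ t + 130 * sqrt \<phi>"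
    have Y0: "0 \<le> Y" using q \<phi> by (simp add: Y_def)
    have "0 \<le> 2 * ((4 / 10 ^ 4) * q ^ t) * (130 * sqrt \<phi>)" using q \<phi> by simp
    then have "(16 / 10 ^ 8) * (q ^ t)\<^sup>2 + 16900 * \<phi> \<le> Y\<^sup>2"
      using \<phi> by (simp add: Y_def power2_sum power_mult_distrib power_divide)
    moreover have "1536 * e + \<phi> \<le> (16 / 10 ^ 8) * (q ^ t)\<^sup>2 + 16900 * \<phi>"
    proof -
      define y where "y = (q ^ t)\<^sup>2"
      have "0 \<le> y" "e \<le> y / 10000000000 + 10 * \<phi>" using e by (simp_all add: y_def)
      then have "1536 * e + \<phi> \<le> 16 / 100000000 * y + 16900 * \<phi>" using \<phi>(1) by linarith
      then show ?thesis by (simp add: y_def)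
    qed
    ultimately have "(lam * \<bar>u' - u\<bar>)\<^sup>2 \<le> Y\<^sup>2" using st by (simp add: power_mult_distrib)
    then have "lam * \<bar>u' - u\<bar> \<le> Y" using Y0 by (rule power2_le_imp_le)
    then have "\<bar>u' - u\<bar> \<le> Y / lam" using lam by (simp add: pos_le_divide_eq mult.commute)
    moreover have "g t + Y / lam = g (Suc t)" using lam unfolding g_def Y_def q_def by (simp add: field_simps)
    ultimately show ?thesis using u by linarith
  qed
  have "E t \<le> (q ^ t)\<^sup>2 / 10 ^ 10 + 10 * \<phi> \<and> \<bar>a t - a 0\<bar> \<le> g t \<and> \<bar>b t - b 0\<bar> \<le> g t"
    using t
  proof (induction t)
    case 0
    then show ?case using E0 \<phi> by (simp add: g_def)
  next
    case (Suc t)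
    then have IH: "E t \<le> (q ^ t)\<^sup>2 / 10 ^ 10 + 10 * \<phi>" "\<bar>a t - a 0\<bar> \<le> g t" "\<bar>b t - b 0\<bar> \<le> g t" and tT: "t < T" "t \<le> T" by auto
    note A = near[OF IH(2) tT(2) a0] and B = near[OF IH(3) tT(2) b0]
    have st: "E (Suc t) \<le> (1 - (1 / 10) / lam) * E t + \<phi> / lam" "lam\<^sup>2 * (a (Suc t) - a t)\<^sup>2 \<le> 1536 * E t + \<phi>"
      "lam\<^sup>2 * (b (Suc t) - b t)\<^sup>2 \<le> 1536 * E t + \<phi>"
      using step[OF tT(1) A[THEN conjunct1] A[THEN conjunct2] B[THEN conjunct1] B[THEN conjunct2] E_small[OF IH(1)]] by blast+
    have r0: "0 \<le> 1 - (1 / 10) / lam" using lam by (simp add: divide_simps)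
    have "E (Suc t) \<le> (1 - (1 / 10) / lam) * ((q ^ t)\<^sup>2 / 10 ^ 10 + 10 * \<phi>) + \<phi> / lam"
      using st(1) mult_left_mono[OF IH(1) r0] by linarith
    also have "\<dots> = (1 - (1 / 10) / lam) * ((q ^ t)\<^sup>2 / 10 ^ 10) + 10 * \<phi>"
      using lam by (simp add: field_simps)
    also have "\<dots> \<le> q\<^sup>2 * ((q ^ t)\<^sup>2 / 10 ^ 10) + 10 * \<phi>" using mult_right_mono[OF q2, of "(q ^ t)\<^sup>2 / 10 ^ 10"] by simp
    also have "q\<^sup>2 * ((q ^ t)\<^sup>2 / 10 ^ 10) = (q ^ Suc t)\<^sup>2 / 10 ^ 10" by (simp add: power_mult_distrib)
    finally show ?case using drift[OF IH(2,1) st(2)] drift[OF IH(3,1) st(3)] by blast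
  qed
  then have inv: "E t \<le> (q ^ t)\<^sup>2 / 10 ^ 10 + 10 * \<phi>" "\<bar>a t - a 0\<bar> \<le> g t" "\<bar>b t - b 0\<bar> \<le> g t" by blast+
  show ?thesis using near[OF inv(2) t a0] near[OF inv(3) t b0] E_small[OF inv(1)] by blast
qed

section \<open>The law of the batches\<close>

lemma distr_scaled_gauss_coordinate:
  assumes "0 \<le> \<sigma>"
  shows "distr gauss borel (\<lambda>\<omega>. \<sigma> * \<omega> \<kappa>) = normal_law \<sigma>"
proof (cases "\<sigma> = 0")
  case True
  then show ?thesis by (simp add: normal_law_def gauss.distr_const)
next
  case False
  have "distributed gauss lborel (\<lambda>\<omega>. \<omega> \<kappa>) std_normal_density"
    unfolding distributed_def using distr_gauss_coordinate[of \<kappa>] by (auto simp: distr_cong[OF refl sets_lborel])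
  from gauss.normal_density_affine[OF this _ False, of 0] assms False
  have "distributed gauss lborel (\<lambda>\<omega>. \<sigma> * \<omega> \<kappa>) (normal_density 0 \<sigma>)" by simp
  then have "distr gauss lborel (\<lambda>\<omega>. \<sigma> * \<omega> \<kappa>) = density lborel (normal_density 0 \<sigma>)" by (simp add: distributed_def)
  then show ?thesis using False by (simp add: normal_law_def distr_cong[OF refl sets_lborel])
qed

lemma scale_noise_measurable [measurable]: "(\<lambda>\<omega>. scale_noise \<sigma> \<omega> \<kappa>) \<in> borel_measurable gauss"
  by (cases \<kappa>) simp_all

lemma noise_space_as_scaled_gauss:
  assumes \<sigma>: "0 \<le> \<sigma>" and E: "{\<omega> \<in> space (noise_space \<sigma>). P \<omega>} \<in> sets (noise_space \<sigma>)"
  shows "measure (noise_space \<sigma>) {\<omega> \<in> space (noise_space \<sigma>). P \<omega>} = measure gauss {\<omega>. P (scale_noise \<sigma> \<omega>)}"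
proof -
  define c where "c = rec_noise_index (\<lambda>_ _ _. 1) (\<lambda>_ _ _. 1) (\<lambda>_ _. \<sigma>)"
  have V: "scale_noise \<sigma> \<omega> \<kappa> = c \<kappa> * \<omega> \<kappa>" for \<omega> \<kappa> by (cases \<kappa>) (simp_all add: c_def)
  have "gauss.indep_vars (\<lambda>_. borel) (\<lambda>\<kappa> \<omega>. scale_noise \<sigma> \<omega> \<kappa>) UNIV"
    unfolding V using gauss.indep_vars_compose2[OF indep_gauss_coordinates, of "\<lambda>\<kappa> u. c \<kappa> * u" "\<lambda>_. borel"] by simp
  moreover have "distr gauss borel (\<lambda>\<omega>. scale_noise \<sigma> \<omega> \<kappa>) = noise_law \<sigma> \<kappa>" for \<kappa>
    using distr_scaled_gauss_coordinate[of 1 \<kappa>] distr_scaled_gauss_coordinate[OF \<sigma>, of \<kappa>] by (cases \<kappa>) simp_all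
  ultimately have "measure gauss {u \<in> space gauss. P (\<lambda>k. scale_noise \<sigma> u k)} =
    measure (noise_space \<sigma>) {\<omega> \<in> space (noise_space \<sigma>). P \<omega>}"
    by (rule prob_noise_space_transfer[OF prob_space_gauss _ _ E])
  then show ?thesis by simp
qed

lemma noise_space_coordinate_measurable: "(\<lambda>\<omega>. \<omega> \<kappa>) \<in> borel_measurable (noise_space \<sigma>)"
proof -
  have "(\<lambda>\<omega>. \<omega> \<kappa>) \<in> measurable (noise_space \<sigma>) (noise_law \<sigma> \<kappa>)"
    unfolding noise_space_def by (rule measurable_component_singleton) simp
  then show ?thesis by (simp add: measurable_cong_sets[OF refl sets_noise_law])
qed

section \<open>The recursion along the trajectory\<close>

lemma scale_noise_mix:
  "scale_noise \<sigma> (mix A \<omega>0 \<omega>) \<kappa> = (if \<kappa> \<in> A then scale_noise \<sigma> \<omega>0 \<kappa> else scale_noise \<sigma> \<omega> \<kappa>)"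
  by (cases \<kappa>) (simp_all add: mix_def)

text \<open>Freezing every coordinate outside batch \<open>t\<close> fixes the state \<open>W t\<close> and leaves the batch standard Gaussian, so the estimate for
one step from a fixed state applies.\<close>

lemma iteration_progress_probability:
  fixes w0 :: "real vec \<times> real vec"
  assumes reg: "regime m d" and \<sigma>: "0 \<le> \<sigma>" and sd: "10 ^ 30 * real d \<le> lam * real m"
    and noise_le: "\<sigma>\<^sup>2 * ln (real d) \<le> lam * real m"
    and w: "fst w0 \<in> carrier_vec d" "snd w0 \<in> carrier_vec d" and c: "\<mu>s \<in> carrier_vec d" "\<nu>s \<in> carrier_vec d"
    and unit: "l2norm \<mu>s = 1" "l2norm \<nu>s = 1"
  defines "W \<equiv> \<lambda>t \<omega>. prox_linear_iterates d m lam \<mu>s \<nu>s w0 (scale_noise \<sigma> \<omega>) t"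
  shows "{\<omega>. near_truth \<mu>s \<nu>s (W t \<omega>) \<and> \<not> step_progress d m lam \<sigma> \<mu>s \<nu>s (W t \<omega>) (W (Suc t) \<omega>)} \<in> sets gauss"
    and "measure gauss {\<omega>. near_truth \<mu>s \<nu>s (W t \<omega>) \<and> \<not> step_progress d m lam \<sigma> \<mu>s \<nu>s (W t \<omega>) (W (Suc t) \<omega>)} \<le> 1 / real d ^ 18"
proof -
  have s: "0 < lam * real m"
  proof -
    have "0 < 10 ^ 30 * real d" using reg by (simp add: regime_def)
    then show ?thesis using sd by linarith
  qed
  define e where "e t \<omega> = Err \<mu>s \<nu>s (W t \<omega>)" for t \<omega>
  define al where "al t \<omega> = fst (W t \<omega>) \<bullet> \<mu>s" for t \<omega>
  define al' where "al' t \<omega> = snd (W t \<omega>) \<bullet> \<nu>s" for t \<omega>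
  have m: "e t \<in> borel_measurable gauss" "al t \<in> borel_measurable gauss" "al' t \<in> borel_measurable gauss" for t
    unfolding e_def al_def al'_def W_def by (rule Err_measurable[OF s scale_noise_measurable w c unit])+
  have le: "Measurable.pred gauss (\<lambda>\<omega>. f \<omega> \<le> g \<omega>)"
    if "f \<in> borel_measurable gauss" "g \<in> borel_measurable gauss" for f g :: "_ \<Rightarrow> real"
    unfolding Measurable.pred_def by (rule borel_measurable_le[OF that])
  show B: "{\<omega>. near_truth \<mu>s \<nu>s (W t \<omega>) \<and> \<not> step_progress d m lam \<sigma> \<mu>s \<nu>s (W t \<omega>) (W (Suc t) \<omega>)} \<in> sets gauss"
    unfolding near_truth_def step_progress_def e_def[symmetric] al_def[symmetric] al'_def[symmetric]
    by (intro gauss_setI pred_intros_logic le borel_measurable_add borel_measurable_diff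
        borel_measurable_times borel_measurable_power borel_measurable_const borel_measurable_abs m)
  show "measure gauss {\<omega>. near_truth \<mu>s \<nu>s (W t \<omega>) \<and> \<not> step_progress d m lam \<sigma> \<mu>s \<nu>s (W t \<omega>) (W (Suc t) \<omega>)} \<le> 1 / real d ^ 18"
  proof (rule gauss_prob_le_by_resampling[where A = "{\<kappa>. batch_number \<kappa> \<noteq> t}", OF B])
    fix \<omega>0 :: "noise_index \<Rightarrow> real"
    let ?A = "{\<kappa>. batch_number \<kappa> \<noteq> t}"
    have W0: "W t (mix ?A \<omega>0 \<omega>) = W t \<omega>0" for \<omega>
      unfolding W_def by (rule prox_linear_iterates_cong) (simp add: scale_noise_mix)
    have b: "batch_x d (scale_noise \<sigma> (mix ?A \<omega>0 \<omega>)) t = batch_x d (scale_noise \<sigma> \<omega>) t"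
      "batch_z d (scale_noise \<sigma> (mix ?A \<omega>0 \<omega>)) t = batch_z d (scale_noise \<sigma> \<omega>) t"
      "batch_y d \<mu>s \<nu>s (scale_noise \<sigma> (mix ?A \<omega>0 \<omega>)) t = batch_y d \<mu>s \<nu>s (scale_noise \<sigma> \<omega>) t" for \<omega>
      by (simp_all add: batch_x_def[abs_def] batch_z_def[abs_def] batch_y_def[abs_def] scale_noise_mix mix_def)
    have W1: "W (Suc t) (mix ?A \<omega>0 \<omega>) = prox_linear_step d m lam
        (batch_x d (scale_noise \<sigma> \<omega>) t) (batch_z d (scale_noise \<sigma> \<omega>) t) (batch_y d \<mu>s \<nu>s (scale_noise \<sigma> \<omega>) t) (W t \<omega>0)" for \<omega>
    proof -
      have "W (Suc t) (mix ?A \<omega>0 \<omega>) = prox_linear_step d m lam (batch_x d (scale_noise \<sigma> (mix ?A \<omega>0 \<omega>)) t)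
        (batch_z d (scale_noise \<sigma> (mix ?A \<omega>0 \<omega>)) t) (batch_y d \<mu>s \<nu>s (scale_noise \<sigma> (mix ?A \<omega>0 \<omega>)) t) (W t (mix ?A \<omega>0 \<omega>))"
        by (simp add: W_def)
      then show ?thesis unfolding b W0 .
    qed
    show "measure gauss {\<omega>. near_truth \<mu>s \<nu>s (W t (mix ?A \<omega>0 \<omega>)) \<and>
        \<not> step_progress d m lam \<sigma> \<mu>s \<nu>s (W t (mix ?A \<omega>0 \<omega>)) (W (Suc t) (mix ?A \<omega>0 \<omega>))} \<le> 1 / real d ^ 18"
    proof (cases "near_truth \<mu>s \<nu>s (W t \<omega>0)")
      case True
      have "fst (W t \<omega>0) \<in> carrier_vec d" "snd (W t \<omega>0) \<in> carrier_vec d"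
        unfolding W_def by (rule prox_linear_iterates_carrier[OF w])+
      then show ?thesis unfolding W0 W1
        using step_progress_probability[OF reg \<sigma> sd noise_le _ _ c unit True, of t] True by simp
    next
      case False
      then show ?thesis unfolding W0 by simp
    qed
  qed
qed

text \<open>With \<open>M = u\<^sup>4\<close>, \<open>log M \<le> 4 u\<close> and \<open>\<surd>\<phi> \<le> 1450 / u\<^sup>2\<close>, so the product is at most a constant over \<open>u \<ge> 10\<^sup>1\<^sup>0\<close>.\<close>

lemma log_times_sqrt_small:
  fixes M \<phi> lam :: real
  assumes M: "10 ^ 40 \<le> M" and \<phi>: "0 \<le> \<phi>" "\<phi> \<le> 2100000 / M" and lam: "0 < lam"
    and T: "real T \<le> lam / (1 / 10) * ln M"
  shows "real T * sqrt \<phi> \<le> lam / 10 ^ 5" "\<phi> \<le> 1 / 10 ^ 6"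
proof -
  define u where "u = sqrt (sqrt M)"
  have M0: "0 < M" using M by (intro less_le_trans[OF _ M]) simp
  have "10 ^ 20 \<le> sqrt M" by (rule real_le_rsqrt) (use M in simp)
  moreover have "((10 :: real) ^ 10)\<^sup>2 = 10 ^ 20" by simp
  ultimately have "(10 ^ 10)\<^sup>2 \<le> sqrt M" by (simp only:)
  then have u: "10 ^ 10 \<le> u" unfolding u_def by (rule real_le_rsqrt)
  have u0: "0 < u" using u by (intro less_le_trans[OF _ u]) simp
  have Mu: "M = (u\<^sup>2)\<^sup>2" using M0 by (simp add: u_def)
  have "ln M = 4 * ln u" unfolding Mu using u0 by (simp add: ln_realpow)
  also have "\<dots> \<le> 4 * u" using ln_le_minus_one[OF u0] by simp
  finally have "lam / (1 / 10) * ln M \<le> lam / (1 / 10) * (4 * u)" using lam by (intro mult_left_mono) auto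
  then have T': "real T \<le> 40 * lam * u" using T by simp
  have "\<phi> \<le> (1450 / u\<^sup>2)\<^sup>2"
  proof -
    have "2100000 / M \<le> 2102500 / M" using M0 by (intro divide_right_mono) auto
    moreover have "(1450 / u\<^sup>2)\<^sup>2 = 2102500 / M" by (simp add: Mu power_divide)
    ultimately show ?thesis using \<phi>(2) by linarith
  qed
  then have "sqrt \<phi> \<le> 1450 / u\<^sup>2" by (rule real_le_lsqrt[rotated]) (use \<phi> in auto)
  then have "real T * sqrt \<phi> \<le> (40 * lam * u) * (1450 / u\<^sup>2)" using T' lam u0 \<phi> by (intro mult_mono) auto
  also have "\<dots> = 58000 * lam / u" using u0 by (simp add: power2_eq_square)
  also have "\<dots> \<le> 58000 * lam / 10 ^ 10" using u lam u0 by (intro divide_left_mono) auto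
  also have "\<dots> \<le> lam / 10 ^ 5" using lam by simp
  finally show "real T * sqrt \<phi> \<le> lam / 10 ^ 5" .
  have "\<phi> \<le> 2100000 / 10 ^ 40" using \<phi>(2) divide_left_mono[OF M, of 2100000] M0 by simp
  also have "\<dots> \<le> 1 / 10 ^ 6" by simp
  finally show "\<phi> \<le> 1 / 10 ^ 6" .
qed

lemma unit_inner_square_le:
  assumes "v \<in> carrier_vec d" "u \<in> carrier_vec d" "l2norm u = 1"
  shows "(v \<bullet> u)\<^sup>2 \<le> v \<bullet> v"
proof -
  obtain p ka be where "direction_pair d p ka" "be = 0 \<or> ka = 1" "\<And>j. p 0 j = u $ j"
    "\<And>j. j < d \<Longrightarrow> v $ j = (v \<bullet> u) * p 0 j + be * p 1 j" "v \<bullet> v = (v \<bullet> u)\<^sup>2 + be\<^sup>2"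
    using orthogonal_decomposition[OF assms] by blast
  then show ?thesis by simp
qed

lemma initial_alignment:
  assumes c: "\<mu> \<in> carrier_vec d" "\<nu> \<in> carrier_vec d" "\<mu>s \<in> carrier_vec d" "\<nu>s \<in> carrier_vec d"
    and unit: "l2norm \<mu>s = 1" "l2norm \<nu>s = 1" and E: "Err \<mu>s \<nu>s (\<mu>, \<nu>) \<le> 1 / 10 ^ 10"
    and n: "1 / 2 \<le> l2norm \<mu>" "l2norm \<mu> \<le> 3 / 2" "1 / 2 \<le> l2norm \<nu>" "l2norm \<nu> \<le> 3 / 2"
  shows "49 / 100 \<le> \<bar>\<mu> \<bullet> \<mu>s\<bar>" "\<bar>\<mu> \<bullet> \<mu>s\<bar> \<le> 3 / 2" "49 / 100 \<le> \<bar>\<nu> \<bullet> \<nu>s\<bar>" "\<bar>\<nu> \<bullet> \<nu>s\<bar> \<le> 3 / 2"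
proof -
  have key: "49 / 100 \<le> \<bar>v \<bullet> u\<bar> \<and> \<bar>v \<bullet> u\<bar> \<le> 3 / 2"
    if "0 \<le> v \<bullet> v - (v \<bullet> u)\<^sup>2" "v \<bullet> v - (v \<bullet> u)\<^sup>2 \<le> 1 / 10 ^ 10" "1 / 2 \<le> l2norm v" "l2norm v \<le> 3 / 2" for u v
  proof -
    have vv: "0 \<le> v \<bullet> v" by (auto simp: scalar_prod_def intro: sum_nonneg)
    have "(1 / 2)\<^sup>2 \<le> (l2norm v)\<^sup>2" "(l2norm v)\<^sup>2 \<le> (3 / 2)\<^sup>2" using that(3,4) vv by (intro power_mono; simp add: l2norm_def)+
    then have "1 / 4 \<le> v \<bullet> v" "v \<bullet> v \<le> 9 / 4" using vv by (simp_all add: l2norm_def power2_eq_square)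
    then have "(49 / 100)\<^sup>2 \<le> \<bar>v \<bullet> u\<bar>\<^sup>2" "\<bar>v \<bullet> u\<bar>\<^sup>2 \<le> (3 / 2)\<^sup>2" using that(1,2) by (simp_all add: power2_eq_square)
    then show ?thesis using power2_le_imp_le[of "49 / 100" "\<bar>v \<bullet> u\<bar>"] power2_le_imp_le[of "\<bar>v \<bullet> u\<bar>" "3 / 2"] by simp
  qed
  have be: "0 \<le> \<mu> \<bullet> \<mu> - (\<mu> \<bullet> \<mu>s)\<^sup>2" using unit_inner_square_le[OF c(1,3) unit(1)] by linarith
  have be': "0 \<le> \<nu> \<bullet> \<nu> - (\<nu> \<bullet> \<nu>s)\<^sup>2" using unit_inner_square_le[OF c(2,4) unit(2)] by linarith
  have s: "\<mu> \<bullet> \<mu> - (\<mu> \<bullet> \<mu>s)\<^sup>2 \<le> 1 / 10 ^ 10" "\<nu> \<bullet> \<nu> - (\<nu> \<bullet> \<nu>s)\<^sup>2 \<le> 1 / 10 ^ 10"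
    using E zero_le_power2[of "(\<mu> \<bullet> \<mu>s) * (\<nu> \<bullet> \<nu>s) - 1"] be be' unfolding Err_formula[OF c unit] by - linarith+
  show "49 / 100 \<le> \<bar>\<mu> \<bullet> \<mu>s\<bar>" "\<bar>\<mu> \<bullet> \<mu>s\<bar> \<le> 3 / 2"
    using key[OF be s(1) n(1,2)] by blast+
  show "49 / 100 \<le> \<bar>\<nu> \<bullet> \<nu>s\<bar>" "\<bar>\<nu> \<bullet> \<nu>s\<bar> \<le> 3 / 2"
    using key[OF be' s(2) n(3,4)] by blast+
qed

text \<open>The two noise levels \<open>\<sigma>\<^sup>2 d / (\<lambda> m)\<close> and \<open>\<sigma>\<^sup>2 L\<^sup>6 / \<surd>m\<close> are at most \<open>10\<^sup>-\<^sup>4\<^sup>0\<close>. The second one is why the batch size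
carries the constant \<open>10\<^sup>8\<^sup>0\<close> and the factor \<open>1 + \<sigma>\<^sup>4\<close>: it enters through \<open>\<surd>m\<close>.\<close>

lemma noise_scales:
  fixes \<sigma> lam L :: real
  assumes d: "1000 \<le> d" "m \<le> d" "1 \<le> m" and L: "1 \<le> L" "L \<le> real d"
    and lam: "10 ^ 80 * (1 + \<sigma>\<^sup>2) * real d / real m \<le> lam" and batch: "10 ^ 80 * (1 + \<sigma> ^ 4) * L ^ 12 \<le> real m"
  shows "10 ^ 80 * real d \<le> lam * real m" "\<sigma>\<^sup>2 * L \<le> lam * real m" "1 \<le> lam" "10 ^ 20 * L ^ 12 \<le> real m"
    and "\<sigma>\<^sup>2 * L / real m \<le> L ^ 6 * \<sigma>\<^sup>2 / sqrt (real m)"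
    and "\<sigma> \<noteq> 0 \<Longrightarrow> 10 ^ 40 \<le> min (lam * real m / (\<sigma>\<^sup>2 * real d)) (sqrt (real m) / (\<sigma>\<^sup>2 * L ^ 6))"
proof -
  have m: "0 < real m" and d0: "0 < real d" using d by simp_all
  have lm: "10 ^ 80 * (1 + \<sigma>\<^sup>2) * real d \<le> lam * real m" using lam m by (simp add: divide_le_eq)
  have e: "10 ^ 80 * (1 + \<sigma>\<^sup>2) * real d = 10 ^ 80 * real d + 10 ^ 80 * (\<sigma>\<^sup>2 * real d)" by (simp add: algebra_simps)
  have sd0: "0 \<le> \<sigma>\<^sup>2 * real d" by simp
  have split: "k * u \<le> w \<and> k * v \<le> w" if "k * u + k * v \<le> w" "0 \<le> k" "0 \<le> u" "0 \<le> v" for k u v w :: real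
    using that mult_nonneg_nonneg[of k u] mult_nonneg_nonneg[of k v] by linarith
  have "10 ^ 80 * real d \<le> lam * real m \<and> 10 ^ 80 * (\<sigma>\<^sup>2 * real d) \<le> lam * real m"
    using lm d0 sd0 unfolding e by (intro split) auto
  then have a: "10 ^ 80 * real d \<le> lam * real m" and b: "10 ^ 80 * (\<sigma>\<^sup>2 * real d) \<le> lam * real m" by blast+
  show "10 ^ 80 * real d \<le> lam * real m" by (rule a)
  have "\<sigma>\<^sup>2 * L \<le> \<sigma>\<^sup>2 * real d" using L by (intro mult_left_mono) auto
  also have "\<dots> \<le> 10 ^ 80 * (\<sigma>\<^sup>2 * real d)" using sd0 by simp
  finally show "\<sigma>\<^sup>2 * L \<le> lam * real m" using b by linarith
  have "1 * real m \<le> 10 ^ 80 * real d" using d by simp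
  then have "1 * real m \<le> lam * real m" using a by linarith
  then show "1 \<le> lam" using m by (simp only: mult_le_cancel_right_pos)
  have L12: "1 \<le> L ^ 12" using L by simp
  have e4: "10 ^ 80 * (1 + \<sigma> ^ 4) * L ^ 12 = 10 ^ 80 * L ^ 12 + 10 ^ 80 * (\<sigma> ^ 4 * L ^ 12)" by (simp add: algebra_simps)
  have s4: "0 \<le> \<sigma> ^ 4 * L ^ 12" using L by simp
  have "10 ^ 80 * L ^ 12 \<le> real m \<and> 10 ^ 80 * (\<sigma> ^ 4 * L ^ 12) \<le> real m" using batch L12 s4 unfolding e4 by (intro split) auto
  then have m1: "10 ^ 80 * L ^ 12 \<le> real m" and m2: "10 ^ 80 * (\<sigma> ^ 4 * L ^ 12) \<le> real m" by blast+
  show "10 ^ 20 * L ^ 12 \<le> real m" using m1 L12 by simp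
  have "sqrt (real m) * 1 \<le> sqrt (real m) * sqrt (real m)" using d by (intro mult_left_mono) auto
  then have "sqrt (real m) \<le> real m" using m by simp
  then have "1 / real m \<le> 1 / sqrt (real m)" using m by (intro divide_left_mono) auto
  moreover have "L \<le> L ^ 6" using power_increasing[of 1 6 L] L by simp
  ultimately have "\<sigma>\<^sup>2 * L * (1 / real m) \<le> \<sigma>\<^sup>2 * L ^ 6 * (1 / sqrt (real m))"
    using L m by (intro mult_mono) auto
  then show "\<sigma>\<^sup>2 * L / real m \<le> L ^ 6 * \<sigma>\<^sup>2 / sqrt (real m)" by (simp add: mult.commute)
  assume \<sigma>: "\<sigma> \<noteq> 0"
  have p1: "0 < \<sigma>\<^sup>2 * real d" using \<sigma> d0 by simp
  have p2: "0 < \<sigma>\<^sup>2 * L ^ 6" using \<sigma> L by simp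
  have "10 ^ 40 * (\<sigma>\<^sup>2 * real d) \<le> lam * real m" using b p1 by simp
  then have 1: "10 ^ 40 \<le> lam * real m / (\<sigma>\<^sup>2 * real d)" using p1 by (simp only: pos_le_divide_eq)
  have "(10 ^ 40 * (\<sigma>\<^sup>2 * L ^ 6))\<^sup>2 = 10 ^ 80 * (\<sigma> ^ 4 * L ^ 12)" by (simp add: power_mult_distrib power_mult[symmetric])
  then have "10 ^ 40 * (\<sigma>\<^sup>2 * L ^ 6) \<le> sqrt (real m)" using m2 by (intro real_le_rsqrt) (simp only:)
  then have 2: "10 ^ 40 \<le> sqrt (real m) / (\<sigma>\<^sup>2 * L ^ 6)" using p2 by (simp only: pos_le_divide_eq)
  show "10 ^ 40 \<le> min (lam * real m / (\<sigma>\<^sup>2 * real d)) (sqrt (real m) / (\<sigma>\<^sup>2 * L ^ 6))" using 1 2 by (simp only: min.bounded_iff)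
qed

text \<open>Outside the bad events the state never leaves the region, by \<open>stays_near\<close> with \<open>\<phi>\<close> combining both noise levels; hence the
recursion of \<open>step_progress\<close> holds at every step. The fluctuation \<open>\<eta> = \<sigma>\<^sup>2 L / m\<close> obtained there is smaller than the
\<open>L\<^sup>6 \<sigma>\<^sup>2 / \<surd>m\<close> of the statement.\<close>

lemma error_recursion_probability:
  fixes d m T :: nat and lam \<sigma> :: real
  assumes d: "1000 \<le> d" "m \<le> d" "1 \<le> m"
    and c: "\<mu>0 \<in> carrier_vec d" "\<nu>0 \<in> carrier_vec d" "\<mu>s \<in> carrier_vec d" "\<nu>s \<in> carrier_vec d"
    and unit: "l2norm \<mu>s = 1" "l2norm \<nu>s = 1" and \<sigma>: "0 \<le> \<sigma>"
    and init: "Err \<mu>s \<nu>s (\<mu>0, \<nu>0) \<le> 1 / 10 ^ 10"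
      "1 / 2 \<le> l2norm \<mu>0" "l2norm \<mu>0 \<le> 3 / 2" "1 / 2 \<le> l2norm \<nu>0" "l2norm \<nu>0 \<le> 3 / 2"
    and lam: "10 ^ 80 * (1 + \<sigma>\<^sup>2) * real d / real m \<le> lam"
    and batch: "10 ^ 80 * (1 + \<sigma> ^ 4) * ln (real d) ^ 12 \<le> real m"
    and T: "\<sigma> = 0 \<or> real T \<le> lam / (1 / 10) * ln (min (lam * real m / (\<sigma>\<^sup>2 * real d)) (sqrt (real m) / (\<sigma>\<^sup>2 * ln (real d) ^ 6)))"
  defines "E \<equiv> (\<lambda>\<omega> t. Err \<mu>s \<nu>s (prox_linear_iterates d m lam \<mu>s \<nu>s (\<mu>0, \<nu>0) \<omega> t))"
    and "bias \<equiv> \<sigma>\<^sup>2 * real d / (lam\<^sup>2 * real m)" and "fluct \<equiv> ln (real d) ^ 6 * \<sigma>\<^sup>2 / (lam * sqrt (real m))"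
  shows "1 - (real T + 1) / real d ^ 18 \<le> measure (noise_space \<sigma>) {\<omega> \<in> space (noise_space \<sigma>). \<forall>t\<le>T.
      (1 - 14 / lam) * E \<omega> t + 1 / 80 * bias - 2 * 10 ^ 6 * fluct \<le> E \<omega> (Suc t) \<and>
      E \<omega> (Suc t) \<le> (1 - (1 / 10) / lam) * E \<omega> t + 2 * 10 ^ 6 * bias + 2 * 10 ^ 6 * fluct}"
proof -
  define L where "L = ln (real d)"
  have L: "1 \<le> L" "L \<le> real d" using ln_ge_1[of d] ln_le_minus_one[of "real d"] d by (simp_all add: L_def)
  note N = noise_scales[OF d L lam batch[folded L_def]]
  have reg: "regime m d" using d N(4) by (simp add: regime_def L_def)
  have m: "0 < real m" and lam0: "0 < lam" using d N(3) by simp_all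
  have s: "0 < lam * real m" using m lam0 by simp
  have sd: "10 ^ 30 * real d \<le> lam * real m"
  proof -
    have "10 ^ 30 * real d \<le> 10 ^ 80 * real d" by (intro mult_right_mono) auto
    then show ?thesis using N(1) by linarith
  qed
  define \<eta> where "\<eta> = \<sigma>\<^sup>2 * L / real m"
  have \<eta>: "0 \<le> \<eta>" using L by (simp add: \<eta>_def)
  have \<eta>_fluct: "\<eta> / lam \<le> fluct"
  proof -
    have "\<eta> / lam \<le> (L ^ 6 * \<sigma>\<^sup>2 / sqrt (real m)) / lam" using N(5) lam0 unfolding \<eta>_def by (intro divide_right_mono) auto
    then show ?thesis by (simp add: fluct_def L_def mult.commute)
  qed
  have bias: "0 \<le> bias" by (simp add: bias_def)
  define \<phi> where "\<phi> = 20 * (\<sigma>\<^sup>2 * real d / (lam * real m)) + 2 * 10 ^ 6 * \<eta>"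
  have \<phi>_lam: "\<phi> / lam = 20 * bias + 2 * 10 ^ 6 * (\<eta> / lam)"
    by (simp add: \<phi>_def bias_def add_divide_distrib power2_eq_square)
  have \<phi>0: "0 \<le> \<phi>" using \<eta> s by (simp add: \<phi>_def)
  have \<phi>: "real T * sqrt \<phi> \<le> lam / 10 ^ 5 \<and> \<phi> \<le> 1 / 10 ^ 6"
  proof (cases "\<sigma> = 0")
    case True
    then have "\<phi> = 0" by (simp add: \<phi>_def \<eta>_def)
    then show ?thesis using lam0 by simp
  next
    case False
    define Q where "Q = min (lam * real m / (\<sigma>\<^sup>2 * real d)) (sqrt (real m) / (\<sigma>\<^sup>2 * L ^ 6))"
    have Q40: "10 ^ 40 \<le> Q" unfolding Q_def by (rule N(6)[OF False])
    have Q0: "0 < Q" by (rule less_le_trans[OF _ Q40]) simp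
    have "Q \<le> lam * real m / (\<sigma>\<^sup>2 * real d)" "Q \<le> sqrt (real m) / (\<sigma>\<^sup>2 * L ^ 6)" by (simp_all add: Q_def)
    moreover have "1 / x \<le> 1 / Q" if "Q \<le> x" for x using Q0 that by (simp add: frac_le)
    ultimately have "1 / (lam * real m / (\<sigma>\<^sup>2 * real d)) \<le> 1 / Q" "1 / (sqrt (real m) / (\<sigma>\<^sup>2 * L ^ 6)) \<le> 1 / Q"
      by blast+
    then have "\<sigma>\<^sup>2 * real d / (lam * real m) \<le> 1 / Q" "L ^ 6 * \<sigma>\<^sup>2 / sqrt (real m) \<le> 1 / Q" by (simp_all add: mult.commute)
    moreover have "\<eta> \<le> L ^ 6 * \<sigma>\<^sup>2 / sqrt (real m)" using N(5) by (simp add: \<eta>_def)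
    moreover have "0 < 1 / Q" using Q0 by simp
    ultimately have "20 * (\<sigma>\<^sup>2 * real d / (lam * real m)) + 2000000 * \<eta> \<le> 2100000 * (1 / Q)" by linarith
    then have "\<phi> \<le> 2100000 / Q" by (simp add: \<phi>_def)
    moreover have "real T \<le> lam / (1 / 10) * ln Q" using T False by (simp add: Q_def L_def)
    ultimately show ?thesis using log_times_sqrt_small[OF Q40 \<phi>0 _ lam0] by blast
  qed
  let ?w0 = "(\<mu>0, \<nu>0)"
  have w0: "fst ?w0 \<in> carrier_vec d" "snd ?w0 \<in> carrier_vec d" using c by simp_all
  define W where "W t \<omega> = prox_linear_iterates d m lam \<mu>s \<nu>s ?w0 (scale_noise \<sigma> \<omega>) t" for t \<omega>
  define Bad where "Bad t \<omega> \<longleftrightarrow> near_truth \<mu>s \<nu>s (W t \<omega>) \<and> \<not> step_progress d m lam \<sigma> \<mu>s \<nu>s (W t \<omega>) (W (Suc t) \<omega>)" for t \<omega>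
  note P = iteration_progress_probability[OF reg \<sigma> sd N(2)[unfolded L_def] w0 c(3,4) unit, folded W_def, folded Bad_def]
  define G where "G \<omega> \<longleftrightarrow> (\<forall>t\<in>{..T}. (1 - 14 / lam) * E \<omega> t + 1 / 80 * bias - 2 * 10 ^ 6 * fluct \<le> E \<omega> (Suc t) \<and>
      E \<omega> (Suc t) \<le> (1 - (1 / 10) / lam) * E \<omega> t + 2 * 10 ^ 6 * bias + 2 * 10 ^ 6 * fluct)" for \<omega>
  have good: "G (scale_noise \<sigma> \<omega>)" if nb: "\<And>t. t \<le> T \<Longrightarrow> \<not> Bad t \<omega>" for \<omega>
  proof -
    define e where "e t = Err \<mu>s \<nu>s (W t \<omega>)" for t
    define a where "a t = fst (W t \<omega>) \<bullet> \<mu>s" for t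
    define b where "b t = snd (W t \<omega>) \<bullet> \<nu>s" for t
    note I = initial_alignment[OF c unit init]
    have prog: "e (Suc t) \<le> (1 - (1 / 10) / lam) * e t + 20 * bias + 2 * 10 ^ 6 * (\<eta> / lam)"
      "(1 - 14 / lam) * e t + 1 / 80 * bias - 2 * 10 ^ 6 * (\<eta> / lam) \<le> e (Suc t)"
      "lam\<^sup>2 * (a (Suc t) - a t)\<^sup>2 \<le> 1536 * e t + 2400 * \<eta>" "lam\<^sup>2 * (b (Suc t) - b t)\<^sup>2 \<le> 1536 * e t + 2400 * \<eta>"
      if "t \<le> T" "2 / 5 \<le> \<bar>a t\<bar>" "\<bar>a t\<bar> \<le> 17 / 10" "2 / 5 \<le> \<bar>b t\<bar>" "\<bar>b t\<bar> \<le> 17 / 10" "e t \<le> 1 / 10 ^ 4" for t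
    proof -
      have "near_truth \<mu>s \<nu>s (W t \<omega>)" using that by (simp add: near_truth_def a_def b_def e_def)
      then have "step_progress d m lam \<sigma> \<mu>s \<nu>s (W t \<omega>) (W (Suc t) \<omega>)" using nb[OF that(1)] by (simp add: Bad_def)
      note S = this[unfolded step_progress_def, folded e_def a_def b_def L_def, folded \<eta>_def]
      show "e (Suc t) \<le> (1 - (1 / 10) / lam) * e t + 20 * bias + 2 * 10 ^ 6 * (\<eta> / lam)"
        "(1 - 14 / lam) * e t + 1 / 80 * bias - 2 * 10 ^ 6 * (\<eta> / lam) \<le> e (Suc t)"
        "lam\<^sup>2 * (a (Suc t) - a t)\<^sup>2 \<le> 1536 * e t + 2400 * \<eta>" "lam\<^sup>2 * (b (Suc t) - b t)\<^sup>2 \<le> 1536 * e t + 2400 * \<eta>"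
        using S by (simp_all add: bias_def mult.assoc)
    qed
    have near: "2 / 5 \<le> \<bar>a t\<bar> \<and> \<bar>a t\<bar> \<le> 17 / 10 \<and> 2 / 5 \<le> \<bar>b t\<bar> \<and> \<bar>b t\<bar> \<le> 17 / 10 \<and> e t \<le> 1 / 10 ^ 4" if "t \<le> T" for t
    proof (rule stays_near[OF N(3) \<phi>0 \<phi>[THEN conjunct2] \<phi>[THEN conjunct1] _ _ _ _ _ _ that])
      show "e 0 \<le> 1 / 10 ^ 10" using init by (simp add: e_def W_def)
      show "49 / 100 \<le> \<bar>a 0\<bar>" "\<bar>a 0\<bar> \<le> 3 / 2" "49 / 100 \<le> \<bar>b 0\<bar>" "\<bar>b 0\<bar> \<le> 3 / 2" using I by (simp_all add: a_def b_def W_def)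
      fix t assume t: "t < T" and n: "2 / 5 \<le> \<bar>a t\<bar>" "\<bar>a t\<bar> \<le> 17 / 10" "2 / 5 \<le> \<bar>b t\<bar>" "\<bar>b t\<bar> \<le> 17 / 10" "e t \<le> 1 / 10 ^ 4"
      have "2400 * \<eta> \<le> \<phi>"
      proof -
        have "0 \<le> \<sigma>\<^sup>2 * real d / (lam * real m)" using s by simp
        then show ?thesis using \<eta> unfolding \<phi>_def by simp
      qed
      then show "e (Suc t) \<le> (1 - (1 / 10) / lam) * e t + \<phi> / lam \<and>
        lam\<^sup>2 * (a (Suc t) - a t)\<^sup>2 \<le> 1536 * e t + \<phi> \<and> lam\<^sup>2 * (b (Suc t) - b t)\<^sup>2 \<le> 1536 * e t + \<phi>"
        using prog[OF less_imp_le[OF t] n] unfolding \<phi>_lam by (intro conjI) linarith+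
    qed
    have "(1 - 14 / lam) * e t + 1 / 80 * bias - 2 * 10 ^ 6 * fluct \<le> e (Suc t) \<and>
      e (Suc t) \<le> (1 - (1 / 10) / lam) * e t + 2 * 10 ^ 6 * bias + 2 * 10 ^ 6 * fluct" if "t \<le> T" for t
    proof -
      note n = near[OF that]
      note S = prog[OF that n[THEN conjunct1] n[THEN conjunct2, THEN conjunct1] n[THEN conjunct2, THEN conjunct2, THEN conjunct1]
        n[THEN conjunct2, THEN conjunct2, THEN conjunct2, THEN conjunct1] n[THEN conjunct2, THEN conjunct2, THEN conjunct2, THEN conjunct2]]
      have "2 * 10 ^ 6 * (\<eta> / lam) \<le> 2 * 10 ^ 6 * fluct" using \<eta>_fluct by simp
      moreover have "20 * bias \<le> 2 * 10 ^ 6 * bias" using bias by simp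
      ultimately show ?thesis using S(1,2) by (intro conjI) linarith+
    qed
    then show ?thesis by (simp add: G_def E_def e_def W_def)
  qed
  have Em: "(\<lambda>\<omega>. E \<omega> t) \<in> borel_measurable (noise_space \<sigma>)" for t
    unfolding E_def by (rule Err_measurable(1)[OF s noise_space_coordinate_measurable w0 c(3,4) unit])
  have le: "Measurable.pred (noise_space \<sigma>) (\<lambda>\<omega>. f \<omega> \<le> g \<omega>)"
    if "f \<in> borel_measurable (noise_space \<sigma>)" "g \<in> borel_measurable (noise_space \<sigma>)" for f g :: "_ \<Rightarrow> real"
    unfolding Measurable.pred_def by (rule borel_measurable_le[OF that])
  have "Measurable.pred (noise_space \<sigma>) G"
    unfolding G_def by (intro pred_intros_finite pred_intros_logic le borel_measurable_add borel_measurable_diff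
        borel_measurable_times borel_measurable_const Em finite_atMost)
  then have Gs: "{\<omega> \<in> space (noise_space \<sigma>). G \<omega>} \<in> sets (noise_space \<sigma>)" by (simp add: Measurable.pred_def)
  have Em': "(\<lambda>\<omega>. E (scale_noise \<sigma> \<omega>) t) \<in> borel_measurable gauss" for t
    unfolding E_def by (rule Err_measurable(1)[OF s scale_noise_measurable w0 c(3,4) unit])
  have le': "Measurable.pred gauss (\<lambda>\<omega>. f \<omega> \<le> g \<omega>)"
    if "f \<in> borel_measurable gauss" "g \<in> borel_measurable gauss" for f g :: "(noise_index \<Rightarrow> real) \<Rightarrow> real"
    unfolding Measurable.pred_def by (rule borel_measurable_le[OF that])
  have Gg: "{\<omega>. G (scale_noise \<sigma> \<omega>)} \<in> sets gauss"
    unfolding G_def by (intro gauss_setI pred_intros_finite pred_intros_logic le' borel_measurable_add borel_measurable_diff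
        borel_measurable_times borel_measurable_const Em' finite_atMost)
  have "measure gauss {\<omega>. \<not> G (scale_noise \<sigma> \<omega>)} \<le> real (length (map Bad [0..<Suc T])) * (1 / real d ^ 18)"
  proof (rule gauss_prob_list)
    show "\<exists>B\<in>set (map Bad [0..<Suc T]). B \<omega>" if "\<not> G (scale_noise \<sigma> \<omega>)" for \<omega>
    proof -
      have "\<exists>t\<le>T. Bad t \<omega>" using good[of \<omega>] that by blast
      then show ?thesis by (auto simp: less_Suc_eq_le simp del: upt_Suc)
    qed
    show "{\<omega>. B \<omega>} \<in> sets gauss" "measure gauss {\<omega>. B \<omega>} \<le> 1 / real d ^ 18" if "B \<in> set (map Bad [0..<Suc T])" for B
      using that P by (auto simp del: upt_Suc)
  qed
  moreover have "measure gauss {\<omega>. \<not> G (scale_noise \<sigma> \<omega>)} = 1 - measure gauss {\<omega>. G (scale_noise \<sigma> \<omega>)}"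
    using gauss.prob_compl[OF Gg] by (simp add: Compl_eq_Diff_UNIV[symmetric] Collect_neg_eq)
  ultimately have "1 - (real T + 1) / real d ^ 18 \<le> measure gauss {\<omega>. G (scale_noise \<sigma> \<omega>)}"
    by (simp add: add.commute)
  then show ?thesis
    unfolding noise_space_as_scaled_gauss[OF \<sigma> Gs, symmetric] by (simp add: G_def atMost_def)
qed

text \<open>\<open>K0\<close> is small enough for the geometric part of the drift of \<open>\<alpha>\<close> and \<open>\<alpha>'\<close>, and \<open>C\<close> is large enough to make the noise levels
negligible against it. The other constants are those of \<open>err_step\<close>, with one \<open>C1\<close> for both kinds of noise.\<close>

theorem theorem2:
  shows "\<exists>K0 d0 c1 c2 C C1 C2 :: real.
    0 < K0 \<and> 0 < d0 \<and> 0 < c1 \<and> 0 < c2 \<and> 0 < C \<and> 0 < C1 \<and> 0 < C2 \<and>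
    (\<forall>(d::nat) (m::nat) (T::nat) (lam::real) (\<sigma>::real)
       (\<mu>s::real vec) (\<nu>s::real vec) (\<mu>0::real vec) (\<nu>0::real vec).
      1 \<le> d \<longrightarrow> 1 \<le> m \<longrightarrow>
      \<mu>s \<in> carrier_vec d \<longrightarrow> \<nu>s \<in> carrier_vec d \<longrightarrow> l2norm \<mu>s = 1 \<longrightarrow> l2norm \<nu>s = 1 \<longrightarrow>
      0 \<le> \<sigma> \<longrightarrow>
      \<mu>0 \<in> carrier_vec d \<longrightarrow> \<nu>0 \<in> carrier_vec d \<longrightarrow>
      Err \<mu>s \<nu>s (\<mu>0, \<nu>0) \<le> K0 \<longrightarrow>
      0.5 \<le> l2norm \<mu>0 \<longrightarrow> l2norm \<mu>0 \<le> 1.5 \<longrightarrow> 0.5 \<le> l2norm \<nu>0 \<longrightarrow> l2norm \<nu>0 \<le> 1.5 \<longrightarrow>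
      lam \<ge> C * (1 + \<sigma>^2) * real d / real m \<longrightarrow>
      C * (1 + \<sigma>^4) * ln (real d) ^ 12 \<le> real m \<longrightarrow> m \<le> d \<longrightarrow>
      d0 \<le> real d \<longrightarrow>
      (\<sigma> = 0 \<or>
        real T \<le> lam / c1 * ln (min (lam * real m / (\<sigma>^2 * real d))
                                   (sqrt (real m) / (\<sigma>^2 * ln (real d) ^ 6)))) \<longrightarrow>
      measure (noise_space \<sigma>)
        {\<omega> \<in> space (noise_space \<sigma>). \<forall>t\<le>T.
           (let E = (\<lambda>s. Err \<mu>s \<nu>s (prox_linear_iterates d m lam \<mu>s \<nu>s (\<mu>0, \<nu>0) \<omega> s))
            in (1 - c2 / lam) * E t + C2 * \<sigma>^2 * real d / (lam^2 * real m)
                 - C1 * ln (real d) ^ 6 * \<sigma>^2 / (lam * sqrt (real m)) \<le> E (Suc t) \<and>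
               E (Suc t) \<le> (1 - c1 / lam) * E t + C1 * \<sigma>^2 * real d / (lam^2 * real m)
                 + C1 * ln (real d) ^ 6 * \<sigma>^2 / (lam * sqrt (real m)))}
      \<ge> 1 - (real T + 1) / real d ^ 18)"
  apply (rule exI[of _ "1 / 10 ^ 10"], rule exI[of _ 1000], rule exI[of _ "1 / 10"], rule exI[of _ 14],
      rule exI[of _ "10 ^ 80"], rule exI[of _ "2 * 10 ^ 6"], rule exI[of _ "1 / 80"])
proof (intro conjI allI impI)
  fix d m T :: nat and lam \<sigma> :: real and \<mu>s \<nu>s \<mu>0 \<nu>0 :: "real vec"
  assume m1: "1 \<le> m" and c: "\<mu>s \<in> carrier_vec d" "\<nu>s \<in> carrier_vec d" and u: "l2norm \<mu>s = 1" "l2norm \<nu>s = 1"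
    and \<sigma>: "0 \<le> \<sigma>" and c0: "\<mu>0 \<in> carrier_vec d" "\<nu>0 \<in> carrier_vec d" and E0: "Err \<mu>s \<nu>s (\<mu>0, \<nu>0) \<le> 1 / 10 ^ 10"
    and n: "0.5 \<le> l2norm \<mu>0" "l2norm \<mu>0 \<le> 1.5" "0.5 \<le> l2norm \<nu>0" "l2norm \<nu>0 \<le> 1.5"
    and lam: "10 ^ 80 * (1 + \<sigma>^2) * real d / real m \<le> lam"
    and batch: "10 ^ 80 * (1 + \<sigma>^4) * ln (real d) ^ 12 \<le> real m" and md: "m \<le> d" and d0: "1000 \<le> real d"
    and T: "\<sigma> = 0 \<or> real T \<le> lam / (1 / 10) * ln (min (lam * real m / (\<sigma>^2 * real d))
                                   (sqrt (real m) / (\<sigma>^2 * ln (real d) ^ 6)))"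
  have d: "1000 \<le> d" using d0 by simp
  have n': "1 / 2 \<le> l2norm \<mu>0" "l2norm \<mu>0 \<le> 3 / 2" "1 / 2 \<le> l2norm \<nu>0" "l2norm \<nu>0 \<le> 3 / 2" using n by simp_all
  show "1 - (real T + 1) / real d ^ 18 \<le> measure (noise_space \<sigma>)
        {\<omega> \<in> space (noise_space \<sigma>). \<forall>t\<le>T.
           (let E = (\<lambda>s. Err \<mu>s \<nu>s (prox_linear_iterates d m lam \<mu>s \<nu>s (\<mu>0, \<nu>0) \<omega> s))
            in (1 - 14 / lam) * E t + 1 / 80 * \<sigma>^2 * real d / (lam^2 * real m)
                 - 2 * 10 ^ 6 * ln (real d) ^ 6 * \<sigma>^2 / (lam * sqrt (real m)) \<le> E (Suc t) \<and>
               E (Suc t) \<le> (1 - 1 / 10 / lam) * E t + 2 * 10 ^ 6 * \<sigma>^2 * real d / (lam^2 * real m)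
                 + 2 * 10 ^ 6 * ln (real d) ^ 6 * \<sigma>^2 / (lam * sqrt (real m)))}"
    using error_recursion_probability[OF d md m1 c0 c u \<sigma> E0 n' lam batch T]
    by (simp only: Let_def times_divide_eq_right mult.assoc)
qed simp_all

end
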